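(* Let $n\ge1$, $A_{-1}\in\mathbb{R}^{n\times n}$, $b\in\mathbb{R}^{n\times 1}$ (one-dimensional control, $r=1$), and let $A_2,A_3$ be $n\times n$ matrix functions on $[-1,0]$ with entries in $L_2([-1,0],\mathbb{C})$. Consider the system $$\dot z(t)=A_{-1}\dot z(t-1)+\int_{-1}^0A_2(\theta)\dot z(t+\theta)\,d\theta+\int_{-1}^0A_3(\theta)z(t+\theta)\,d\theta+b\,u(t),\quad u(t)\in\mathbb{C},$$ with operator model $\dot x=\mathcal Ax+\mathcal Bu$ on $M_2$ as in the context. Let $\Delta_{\mathcal A}(\lambda)=\lambda I-\lambda e^{-\lambda}A_{-1}-\lambda\int_{-1}^0e^{\lambda s}A_2(s)\,ds-\int_{-1}^0e^{\lambda s}A_3(s)\,ds$. Assume (i) $\operatorname{rank}(\Delta_{\mathcal A}(\lambda)\ \ b)=n$ for all $\lambda\in\mathbb{C}$, and (ii) $\operatorname{rank}(b\ \ A_{-1}b\ \cdots\ A_{-1}^{n-1}b)=n$. Then: (1) the system is exactly controllable at every time $T>n$, i.e. $\mathcal R_T=\mathcal D(\mathcal A)$ for all $T>n$; (2) the system is not exactly controllable at any time $T\le n$, i.e. $\mathcal R_T\neq\mathcal D(\mathcal A)$ for all $T\le n$.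
   Context: The state space is $M_2=\mathbb{C}^n\times L_2(-1,0;\mathbb{C}^n)$. The operator $\mathcal A$ is defined by $\mathcal A(y,z(\cdot))=\big(Lz,\ \tfrac{d}{d\theta}z\big)$, where $Lz=\int_{-1}^0A_2(\theta)z'(\theta)\,d\theta+\int_{-1}^0A_3(\theta)z(\theta)\,d\theta$, on the domain $\mathcal D(\mathcal A)=\{(y,z(\cdot))\in M_2: z\in H^1(-1,0;\mathbb{C}^n),\ y=z(0)-A_{-1}z(-1)\}$; $\mathcal A$ generates a $C_0$-semigroup $e^{\mathcal At}$ on $M_2$. The control operator is $\mathcal Bu=(bu,0)$ for $u\in\mathbb{C}$. The reachability set from $0$ at time $T$ is $\mathcal R_T=\{\int_0^Te^{\mathcal At}\mathcal Bu(t)\,dt: u\in L_2(0,T;\mathbb{C})\}$. *)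

theory Defs
  imports "HOL-Analysis.Analysis"
begin

text \<open>Representatives of elements of M2 = C^n x L2(-1,0;C^n).
  Elements of M2 are equivalence classes modulo a.e. equality of the second
  component; all sets below are saturated with respect to this equivalence.\<close>

type_synonym 'n m2rep = "(complex^'n) \<times> (real \<Rightarrow> complex^'n)"

definition L2on :: "real set \<Rightarrow> (real \<Rightarrow> 'a::euclidean_space) \<Rightarrow> bool" where
  "L2on S f \<longleftrightarrow> (\<lambda>t. indicator S t *\<^sub>R f t) \<in> borel_measurable lborel
      \<and> integrable lborel (\<lambda>t. indicator S t * (norm (f t))^2)"

definition inM2 :: "'n::finite m2rep \<Rightarrow> bool" where
  "inM2 x \<longleftrightarrow> L2on {-1..0} (snd x)"

definition eqM2 :: "'n::finite m2rep \<Rightarrow> 'n m2rep \<Rightarrow> bool" where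
  "eqM2 x x' \<longleftrightarrow> fst x = fst x' \<and> (AE \<theta> in lborel. \<theta> \<in> {-1..0} \<longrightarrow> snd x \<theta> = snd x' \<theta>)"

definition addM2 :: "'n::finite m2rep \<Rightarrow> 'n m2rep \<Rightarrow> 'n m2rep" where
  "addM2 x x' = (fst x + fst x', \<lambda>\<theta>. snd x \<theta> + snd x' \<theta>)"

definition scaleM2 :: "complex \<Rightarrow> 'n::finite m2rep \<Rightarrow> 'n m2rep" where
  "scaleM2 c x = (c *s fst x, \<lambda>\<theta>. c *s snd x \<theta>)"

definition diffM2 :: "'n::finite m2rep \<Rightarrow> 'n m2rep \<Rightarrow> 'n m2rep" where
  "diffM2 x x' = (fst x - fst x', \<lambda>\<theta>. snd x \<theta> - snd x' \<theta>)"

definition normM2 :: "'n::finite m2rep \<Rightarrow> real" where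
  "normM2 x = sqrt ((norm (fst x))^2 + (LINT \<theta>:{-1..0}|lborel. (norm (snd x \<theta>))^2))"

definition innerM2 :: "'n::finite m2rep \<Rightarrow> 'n m2rep \<Rightarrow> complex" where
  "innerM2 x w = (\<Sum>i\<in>UNIV. fst x $ i * cnj (fst w $ i))
      + (LINT \<theta>:{-1..0}|lborel. (\<Sum>i\<in>UNIV. snd x \<theta> $ i * cnj (snd w \<theta> $ i)))"

definition H1_deriv :: "(real \<Rightarrow> complex^'n::finite) \<Rightarrow> (real \<Rightarrow> complex^'n) \<Rightarrow> bool" where
  "H1_deriv z g \<longleftrightarrow> L2on {-1..0} g
      \<and> (\<forall>\<theta>\<in>{-1..0}. z \<theta> = z (-1) + (LINT s:{-1..\<theta>}|lborel. g s))"

definition domA :: "complex^'n^'n \<Rightarrow> 'n::finite m2rep set" where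
  "domA A1 = {x. inM2 x \<and> (\<exists>z g. H1_deriv z g
      \<and> (AE \<theta> in lborel. \<theta> \<in> {-1..0} \<longrightarrow> snd x \<theta> = z \<theta>)
      \<and> fst x = z 0 - A1 *v z (-1))}"

definition Lop :: "(real \<Rightarrow> complex^'n^'n) \<Rightarrow> (real \<Rightarrow> complex^'n^'n)
    \<Rightarrow> (real \<Rightarrow> complex^'n::finite) \<Rightarrow> (real \<Rightarrow> complex^'n) \<Rightarrow> complex^'n" where
  "Lop A2 A3 z g = (LINT \<theta>:{-1..0}|lborel. A2 \<theta> *v g \<theta>) + (LINT \<theta>:{-1..0}|lborel. A3 \<theta> *v z \<theta>)"

definition opA :: "complex^'n^'n \<Rightarrow> (real \<Rightarrow> complex^'n^'n) \<Rightarrow> (real \<Rightarrow> complex^'n^'n)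
    \<Rightarrow> 'n::finite m2rep \<Rightarrow> 'n m2rep \<Rightarrow> bool" where
  "opA A1 A2 A3 x w \<longleftrightarrow> inM2 x \<and> inM2 w \<and> (\<exists>z g. H1_deriv z g
      \<and> (AE \<theta> in lborel. \<theta> \<in> {-1..0} \<longrightarrow> snd x \<theta> = z \<theta>)
      \<and> fst x = z 0 - A1 *v z (-1)
      \<and> eqM2 w (Lop A2 A3 z g, g))"

definition generates_C0 :: "complex^'n^'n \<Rightarrow> (real \<Rightarrow> complex^'n^'n) \<Rightarrow> (real \<Rightarrow> complex^'n^'n)
    \<Rightarrow> (real \<Rightarrow> 'n::finite m2rep \<Rightarrow> 'n m2rep) \<Rightarrow> bool" where
  "generates_C0 A1 A2 A3 S \<longleftrightarrow>
     (\<forall>t\<ge>0. \<forall>x. inM2 x \<longrightarrow> inM2 (S t x))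
   \<and> (\<forall>t\<ge>0. \<forall>x x'. inM2 x \<and> eqM2 x x' \<longrightarrow> eqM2 (S t x) (S t x'))
   \<and> (\<forall>t\<ge>0. \<forall>x y c. inM2 x \<and> inM2 y \<longrightarrow>
        eqM2 (S t (addM2 (scaleM2 c x) y)) (addM2 (scaleM2 c (S t x)) (S t y)))
   \<and> (\<forall>t\<ge>0. \<exists>C. \<forall>x. inM2 x \<longrightarrow> normM2 (S t x) \<le> C * normM2 x)
   \<and> (\<forall>x. inM2 x \<longrightarrow> eqM2 (S 0 x) x)
   \<and> (\<forall>t s x. t \<ge> 0 \<and> s \<ge> 0 \<and> inM2 x \<longrightarrow> eqM2 (S (t + s) x) (S t (S s x)))
   \<and> (\<forall>x. inM2 x \<longrightarrow> ((\<lambda>t. normM2 (diffM2 (S t x) x)) \<longlongrightarrow> 0) (at_right 0))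
   \<and> (\<forall>x w. inM2 x \<and> inM2 w \<longrightarrow>
        (((\<lambda>h. normM2 (diffM2 (scaleM2 (complex_of_real (1 / h)) (diffM2 (S h x) x)) w))
            \<longlongrightarrow> 0) (at_right 0)
         \<longleftrightarrow> opA A1 A2 A3 x w))"

definition Bop :: "complex^'n::finite \<Rightarrow> complex \<Rightarrow> 'n m2rep" where
  "Bop b c = (c *s b, \<lambda>\<theta>. 0)"

text \<open>Reachable set R_T = { int_0^T S(t) B u(t) dt : u in L2(0,T) }; the M2-valued
  integral is characterised weakly (through the M2 inner product).\<close>
definition reach :: "(real \<Rightarrow> 'n::finite m2rep \<Rightarrow> 'n m2rep) \<Rightarrow> complex^'n \<Rightarrow> real \<Rightarrow> 'n m2rep set" where
  "reach S b T = {x. inM2 x \<and> (\<exists>u::real \<Rightarrow> complex. L2on {0..T} u \<and>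
      (\<forall>w. inM2 w \<longrightarrow>
         innerM2 x w = (LINT t:{0..T}|lborel. innerM2 (S t (Bop b (u t))) w)))}"

definition DeltaA :: "complex^'n^'n \<Rightarrow> (real \<Rightarrow> complex^'n^'n) \<Rightarrow> (real \<Rightarrow> complex^'n^'n)
    \<Rightarrow> complex \<Rightarrow> complex^'n::finite^'n" where
  "DeltaA A1 A2 A3 lam = (\<chi> i j. (if i = j then lam else 0) - lam * exp (- lam) * A1 $ i $ j
      - lam * (LINT s:{-1..0}|lborel. exp (lam * complex_of_real s) * A2 s $ i $ j)
      - (LINT s:{-1..0}|lborel. exp (lam * complex_of_real s) * A3 s $ i $ j))"

definition augment :: "complex^'n^'m \<Rightarrow> complex^'m \<Rightarrow> complex^('n::finite option)^'m::finite" where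
  "augment M b = (\<chi> i j. case j of None \<Rightarrow> b $ i | Some k \<Rightarrow> M $ i $ k)"

definition matpow :: "complex^'n^'n \<Rightarrow> nat \<Rightarrow> complex^'n::finite^'n" where
  "matpow A k = ((\<lambda>M. A ** M) ^^ k) (mat 1)"

text \<open>A fixed enumeration of the index type by 0..n-1 (column order; rank does
  not depend on it).\<close>
definition idx :: "'n::finite \<Rightarrow> nat" where
  "idx = (SOME f. bij_betw f (UNIV::'n set) {..<CARD('n)})"

definition ctrb :: "complex^'n^'n \<Rightarrow> complex^'n \<Rightarrow> complex^'n::finite^'n" where
  "ctrb A b = (\<chi> i j. (matpow A (idx j) *v b) $ i)"

end

theory Submission
  imports Defs "HOL-Analysis.Analysis" "HOL-Computational_Algebra.Fundamental_Theorem_Algebra"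
begin

text \<open>
  Put \<open>w(t) = e\<^sup>-\<^sup>\<gamma>\<^sup>t z'(t)\<close>. The system becomes \<open>w = b u + K w\<close> on
  \<open>L\<^sub>2(\<real>)\<close>, where \<open>K\<close> is a causal, translation invariant operator of norm less than 1 when \<open>\<gamma>\<close>
  is large, so \<open>w = N (b u)\<close> with \<open>N = (I - K)\<^sup>-\<^sup>1\<close>, and reachability at time \<open>t\<close> asks which states at time 0
  arise from controls supported in \<open>[-t, 0]\<close>. Iterating \<open>w(t) = e\<^sup>-\<^sup>\<gamma> A\<^sub>-\<^sub>1 w(t - 1) + \<dots>\<close> \<open>n\<close> times and
  recombining the \<open>n\<close> unit pieces of a control on \<open>[-n, 0]\<close> by the Kalman matrix turns the derivative part
  of the control-to-state map into identity minus compact. At \<open>t = n\<close> the additional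
  component \<open>z(-1)\<close> is one constraint too many for the Fredholm alternative, so the map is not onto; its
  range has finite codimension, though.

  For \<open>t > n\<close> the reachable spaces increase, hence two of them at different times coincide if they are proper,
  and that space is invariant under the free evolution. A common eigenfunctional annihilating it
  is multiplied by \<open>e\<^sup>p\<^sup>h\<close> under the evolution by \<open>h\<close>; tested on exponential trajectories it annihilates the
  responses to controls with directions in the range of \<open>\<Delta>(p + \<gamma>)\<close> and along \<open>b\<close>, so by the rank
  condition all responses: it is zero.

  Duhamel's formula, applied to the response to a constant control, identifies the semigroup integral in the
  definition of the reachable set with \<open>N (b u)\<close>.
\<close>

text \<open>Everything is phrased for trajectories on the whole line, observed at time 0. Initial
  value problems then disappear: waiting is a translation, and time enters only through the length
  of the control interval to the left of 0. The threshold is a count: n unit pieces of a scalar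
  control against the n components of \<open>z'\<close> on \<open>[-1, 0]\<close>. Exactly at n this
  is a square problem, and \<open>z(-1)\<close> is left without a control of its own. Beyond n the
  surplus control is not computed; the proof argues by stationarity instead, since m functionals
  allow fewer than m strict increases among m + 1 proper spaces. Spectral theory of the generator is
  avoided as well: an eigenvalue is a root of a polynomial of least degree that annihilates a
  functional, and it is the evolution, not its generator, that is tested. Compact operators appear
  only as norm limits of operators of finite rank, so that after a Neumann inversion the Fredholm
  alternative is linear algebra in finite dimension.\<close>

definition sqi :: "(real \<Rightarrow> complex) \<Rightarrow> bool" where
  "sqi f \<longleftrightarrow> f \<in> borel_measurable lborel \<and> integrable lborel (\<lambda>t. (norm (f t))\<^sup>2)"

lemma sqi_meas [measurable_dest]: "sqi f \<Longrightarrow> f \<in> borel_measurable lborel"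
  by (simp add: sqi_def)

lemma sqi_meas' [measurable_dest]: "sqi f \<Longrightarrow> f \<in> borel_measurable borel"
  by (simp add: sqi_def)

lemma sqi_bound:
  assumes "sqi f" "g \<in> borel_measurable lborel" "AE t in lborel. norm (g t) \<le> C * norm (f t)"
  shows "sqi g"
  unfolding sqi_def
proof
  show [measurable]: "g \<in> borel_measurable lborel" by fact
  have 1: "integrable lborel (\<lambda>t. C\<^sup>2 * (norm (f t))\<^sup>2)"
    using assms(1) by (simp add: sqi_def)
  have 2: "AE t in lborel. norm ((norm (g t))\<^sup>2) \<le> norm (C\<^sup>2 * (norm (f t))\<^sup>2)"
    using assms(3)
  proof eventually_elim
    case (elim t)
    have "(norm (g t))\<^sup>2 \<le> (C * norm (f t))\<^sup>2"
      using elim by (intro power_mono) auto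
    then show ?case by (simp add: power_mult_distrib)
  qed
  show "integrable lborel (\<lambda>t. (norm (g t))\<^sup>2)"
    by (rule Bochner_Integration.integrable_bound[OF 1 _ 2]) measurable
qed

lemma sqi_zero [simp]: "sqi (\<lambda>_. 0)"
  by (simp add: sqi_def)

lemma sqi_add [intro]:
  assumes "sqi f" "sqi g" shows "sqi (\<lambda>t. f t + g t)"
  unfolding sqi_def
proof
  note [measurable] = sqi_meas[OF assms(1)] sqi_meas[OF assms(2)]
  show "(\<lambda>t. f t + g t) \<in> borel_measurable lborel" by measurable
  have "integrable lborel (\<lambda>t. 2 * (norm (f t))\<^sup>2 + 2 * (norm (g t))\<^sup>2)"
    using assms by (simp add: sqi_def)
  then show "integrable lborel (\<lambda>t. (norm (f t + g t))\<^sup>2)"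
  proof (rule Bochner_Integration.integrable_bound)
    show "AE t in lborel. norm ((norm (f t + g t))\<^sup>2) \<le> norm (2 * (norm (f t))\<^sup>2 + 2 * (norm (g t))\<^sup>2)"
    proof (rule AE_I2)
      fix t
      have "(norm (f t + g t))\<^sup>2 \<le> (norm (f t) + norm (g t))\<^sup>2"
        by (intro power_mono norm_triangle_ineq) auto
      also have "\<dots> \<le> 2 * (norm (f t))\<^sup>2 + 2 * (norm (g t))\<^sup>2"
        using zero_le_power2[of "norm (f t) - norm (g t)"]
        by (simp add: power2_eq_square algebra_simps)
      finally show "norm ((norm (f t + g t))\<^sup>2) \<le> norm (2 * (norm (f t))\<^sup>2 + 2 * (norm (g t))\<^sup>2)"
        by simp
    qed
  qed measurable
qed

lemma sqi_cmult [intro]: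
  assumes "sqi f" shows "sqi (\<lambda>t. c * f t)"
  using assms by (rule sqi_bound[where C="norm c"]) (use assms in \<open>auto simp: norm_mult intro!: borel_measurable_times sqi_meas\<close>)

lemma sqi_uminus [intro]: "sqi f \<Longrightarrow> sqi (\<lambda>t. - f t)"
  using sqi_cmult[of f "-1"] by simp

lemma sqi_diff [intro]: "sqi f \<Longrightarrow> sqi g \<Longrightarrow> sqi (\<lambda>t. f t - g t)"
  using sqi_add[of f "\<lambda>t. - g t"] by auto

lemma sqi_scaleR [intro]: "sqi f \<Longrightarrow> sqi (\<lambda>t. c *\<^sub>R f t)"
  using sqi_cmult[of f "of_real c"] by (simp add: scaleR_conv_of_real)

lemma sqi_cnj [intro]: "sqi f \<Longrightarrow> sqi (\<lambda>t. cnj (f t))"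
  unfolding sqi_def by (auto intro: borel_measurable_continuous_on[OF continuous_on_cnj[OF continuous_on_id]])

lemma integrable_sqi_mult:
  assumes "sqi f" "sqi g" shows "integrable lborel (\<lambda>t. f t * g t)"
proof -
  note [measurable] = sqi_meas[OF assms(1)] sqi_meas[OF assms(2)]
  have "integrable lborel (\<lambda>t. (norm (f t))\<^sup>2 + (norm (g t))\<^sup>2)"
    using assms by (simp add: sqi_def)
  then show ?thesis
  proof (rule Bochner_Integration.integrable_bound)
    show "AE t in lborel. norm (f t * g t) \<le> norm ((norm (f t))\<^sup>2 + (norm (g t))\<^sup>2)"
    proof (rule AE_I2)
      fix t
      have "0 \<le> norm (f t) * norm (g t)" by simp
      moreover have "2 * (norm (f t) * norm (g t)) \<le> (norm (f t))\<^sup>2 + (norm (g t))\<^sup>2"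
        using zero_le_power2[of "norm (f t) - norm (g t)"] by (simp add: power2_eq_square algebra_simps)
      ultimately have "norm (f t) * norm (g t) \<le> (norm (f t))\<^sup>2 + (norm (g t))\<^sup>2" by linarith
      then show "norm (f t * g t) \<le> norm ((norm (f t))\<^sup>2 + (norm (g t))\<^sup>2)" by (simp add: norm_mult)
    qed
  qed measurable
qed

text \<open>Complex-valued square integrable functions on the whole real line, modulo equality almost everywhere.\<close>

quotient_type L2 = "real \<Rightarrow> complex" /
  partial: "\<lambda>f g. sqi f \<and> sqi g \<and> (AE t in lborel. f t = g t)"
proof (rule part_equivpI)
  show "\<exists>x. sqi x \<and> sqi x \<and> (AE t in lborel. x t = x t)" by (rule exI[of _ "\<lambda>_. 0"]) simp
  show "symp (\<lambda>f g. sqi f \<and> sqi g \<and> (AE t in lborel. f t = g t))"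
    by (auto simp: symp_def elim: eventually_mono)
  show "transp (\<lambda>f g. sqi f \<and> sqi g \<and> (AE t in lborel. f t = g t))"
    unfolding transp_def by (auto elim: eventually_elim2)
qed

lemma sqi_rep [simp, intro]: "sqi (rep_L2 x)"
  using Quotient_rep_reflp[OF Quotient_L2] by auto

lemma abs_rep_L2 [simp]: "abs_L2 (rep_L2 x) = x"
  by (rule Quotient_abs_rep[OF Quotient_L2])

lemma rep_meas [measurable]: "rep_L2 x \<in> borel_measurable borel"
  using sqi_rep[of x] by (simp add: sqi_def)

lemma abs_L2_eq_iff: "sqi f \<Longrightarrow> sqi g \<Longrightarrow> abs_L2 f = abs_L2 g \<longleftrightarrow> (AE t in lborel. f t = g t)"
  using Quotient_rel_abs[OF Quotient_L2] Quotient_rel[OF Quotient_L2, of f g] by auto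

lemma rep_abs_L2: "sqi f \<Longrightarrow> AE t in lborel. rep_L2 (abs_L2 f) t = f t"
  using abs_L2_eq_iff[of "rep_L2 (abs_L2 f)" f] by simp

lemma L2_eqI: "(AE t in lborel. rep_L2 x t = rep_L2 y t) \<Longrightarrow> x = y"
  using abs_L2_eq_iff[of "rep_L2 x" "rep_L2 y"] by simp

text \<open>The real part of the Hermitian form is a real inner product with the same norm. Complex
  scalars act separately, through \<open>mulL\<close> with a constant function.\<close>

instantiation L2 :: real_inner
begin

lift_definition zero_L2 :: L2 is "\<lambda>_. 0" by simp
lift_definition plus_L2 :: "L2 \<Rightarrow> L2 \<Rightarrow> L2" is "\<lambda>f g t. f t + g t" by (auto elim: eventually_elim2)
lift_definition minus_L2 :: "L2 \<Rightarrow> L2 \<Rightarrow> L2" is "\<lambda>f g t. f t - g t" by (auto elim: eventually_elim2)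
lift_definition uminus_L2 :: "L2 \<Rightarrow> L2" is "\<lambda>f t. - f t" by (auto elim: eventually_mono)
lift_definition scaleR_L2 :: "real \<Rightarrow> L2 \<Rightarrow> L2" is "\<lambda>c f t. c *\<^sub>R f t" by (auto elim: eventually_mono)
lift_definition inner_L2 :: "L2 \<Rightarrow> L2 \<Rightarrow> real" is "\<lambda>f g. Re (LINT t|lborel. f t * cnj (g t))"
proof -
  fix f f' g g' :: "real \<Rightarrow> complex"
  assume 1: "sqi f \<and> sqi f' \<and> (AE t in lborel. f t = f' t)" and 2: "sqi g \<and> sqi g' \<and> (AE t in lborel. g t = g' t)"
  have "(LINT t|lborel. f t * cnj (g t)) = (LINT t|lborel. f' t * cnj (g' t))"
  proof (rule integral_cong_AE)
    show "AE x in lborel. f x * cnj (g x) = f' x * cnj (g' x)"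
      using 1 2 by (auto elim: eventually_elim2)
    show "(\<lambda>t. f t * cnj (g t)) \<in> borel_measurable lborel"
      using 1 2 by (intro borel_measurable_integrable integrable_sqi_mult) auto
    show "(\<lambda>t. f' t * cnj (g' t)) \<in> borel_measurable lborel"
      using 1 2 by (intro borel_measurable_integrable integrable_sqi_mult) auto
  qed
  then show "Re (LINT t|lborel. f t * cnj (g t)) = Re (LINT t|lborel. f' t * cnj (g' t))" by simp
qed

definition norm_L2 :: "L2 \<Rightarrow> real" where "norm_L2 x = sqrt (inner x x)"
definition sgn_L2 :: "L2 \<Rightarrow> L2" where "sgn_L2 x = inverse (norm x) *\<^sub>R x"
definition dist_L2 :: "L2 \<Rightarrow> L2 \<Rightarrow> real" where "dist_L2 x y = norm (x - y)"
definition uniformity_L2 :: "(L2 \<times> L2) filter" where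
  "uniformity_L2 = (INF e\<in>{0<..}. principal {(x, y). dist x y < e})"
definition open_L2 :: "L2 set \<Rightarrow> bool" where
  "open_L2 U = (\<forall>x\<in>U. \<forall>\<^sub>F (x', y) in uniformity. x' = x \<longrightarrow> y \<in> U)"

instance
proof
  fix x y z :: L2 and a b :: real
  show "x + y + z = x + (y + z)" by transfer (auto simp: add.assoc)
  show "x + y = y + x" by transfer (auto simp: add.commute)
  show "0 + x = x" by transfer auto
  show "- x + x = 0" by transfer auto
  show "x - y = x + - y" by transfer auto
  show "a *\<^sub>R (x + y) = a *\<^sub>R x + a *\<^sub>R y" by transfer (auto simp: scaleR_right_distrib)
  show "(a + b) *\<^sub>R x = a *\<^sub>R x + b *\<^sub>R x" by transfer (auto simp: scaleR_left_distrib)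
  show "a *\<^sub>R b *\<^sub>R x = (a * b) *\<^sub>R x" by transfer auto
  show "1 *\<^sub>R x = x" by transfer auto
  show "dist x y = norm (x - y)" by (rule dist_L2_def)
  show "sgn x = inverse (norm x) *\<^sub>R x" by (rule sgn_L2_def)
  show "uniformity = (INF e\<in>{0<..}. principal {(x, y :: L2). dist x y < e})" by (rule uniformity_L2_def)
  show "open U = (\<forall>x\<in>U. \<forall>\<^sub>F (x', y) in uniformity. x' = x \<longrightarrow> y \<in> U)" for U :: "L2 set" by (rule open_L2_def)
  show "norm x = sqrt (inner x x)" by (rule norm_L2_def)
  show "inner x y = inner y x"
  proof transfer
    fix f g :: "real \<Rightarrow> complex"
    have "(LINT t|lborel. f t * cnj (g t)) = cnj (LINT t|lborel. g t * cnj (f t))"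
      unfolding Bochner_Integration.integral_cnj[symmetric] by (intro Bochner_Integration.integral_cong refl) (simp add: mult.commute)
    then show "Re (LINT t|lborel. f t * cnj (g t)) = Re (LINT t|lborel. g t * cnj (f t))" by simp
  qed
  show "inner (x + y) z = inner x z + inner y z"
    by transfer (auto simp: ring_distribs integrable_sqi_mult sqi_cnj)
  show "inner (a *\<^sub>R x) y = a * inner x y"
    by transfer auto
  have nsq: "f t * cnj (f t) = of_real ((norm (f t))\<^sup>2)" for f :: "real \<Rightarrow> complex" and t
    by (rule complex_norm_square[symmetric])
  show "0 \<le> inner x x"
    by transfer (simp only: nsq integral_complex_of_real, simp)
  show "(inner x x = 0) = (x = 0)"
  proof transfer
    fix f :: "real \<Rightarrow> complex" assume f: "sqi f \<and> sqi f \<and> (AE t in lborel. f t = f t)"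
    have "(LINT t|lborel. (norm (f t))\<^sup>2) = 0 \<longleftrightarrow> (AE t in lborel. (norm (f t))\<^sup>2 = 0)"
      using f by (intro integral_nonneg_eq_0_iff_AE) (auto simp: sqi_def)
    then show "(Re (LINT t|lborel. f t * cnj (f t)) = 0) = (sqi f \<and> sqi (\<lambda>_. 0) \<and> (AE t in lborel. f t = 0))"
      using f by (simp only: nsq integral_complex_of_real, simp)
  qed
qed

end

lemma norm_L2_sq: "(norm x)\<^sup>2 = (LINT t|lborel. (norm (rep_L2 x t))\<^sup>2)"
proof -
  have nsq: "f t * cnj (f t) = of_real ((norm (f t))\<^sup>2)" for f :: "real \<Rightarrow> complex" and t
    by (rule complex_norm_square[symmetric])
  have "(norm x)\<^sup>2 = inner x x" by (simp add: power2_norm_eq_inner)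
  also have "\<dots> = Re (LINT t|lborel. rep_L2 x t * cnj (rep_L2 x t))"
    by (simp add: inner_L2.rep_eq)
  finally show ?thesis by (simp only: nsq integral_complex_of_real Re_complex_of_real)
qed

lemma norm_abs_L2_sq: "sqi f \<Longrightarrow> (norm (abs_L2 f))\<^sup>2 = (LINT t|lborel. (norm (f t))\<^sup>2)"
  unfolding norm_L2_sq
  by (intro integral_cong_AE) (use rep_abs_L2[of f] in \<open>auto elim: eventually_mono\<close>)

lemma nn_norm_L2_sq: "(\<integral>\<^sup>+t. ennreal ((norm (rep_L2 x t))\<^sup>2) \<partial>lborel) = ennreal ((norm x)\<^sup>2)"
  unfolding norm_L2_sq by (rule nn_integral_eq_integral) (use sqi_rep[of x] in \<open>auto simp: sqi_def\<close>)

lemma rep_add: "AE t in lborel. rep_L2 (x + y) t = rep_L2 x t + rep_L2 y t"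
  using rep_abs_L2[of "\<lambda>t. rep_L2 x t + rep_L2 y t"] by (auto simp: plus_L2.abs_eq[symmetric] sqi_add)

lemma rep_diff: "AE t in lborel. rep_L2 (x - y) t = rep_L2 x t - rep_L2 y t"
  using rep_abs_L2[of "\<lambda>t. rep_L2 x t - rep_L2 y t"] by (auto simp: minus_L2.abs_eq[symmetric] sqi_diff)

lemma rep_scaleR: "AE t in lborel. rep_L2 (c *\<^sub>R x) t = c *\<^sub>R rep_L2 x t"
  using rep_abs_L2[of "\<lambda>t. c *\<^sub>R rep_L2 x t"] by (auto simp: scaleR_L2.abs_eq[symmetric] sqi_scaleR)

lemma abs_L2_add: "sqi f \<Longrightarrow> sqi g \<Longrightarrow> abs_L2 (\<lambda>t. f t + g t) = abs_L2 f + abs_L2 g"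
  by (rule plus_L2.abs_eq[symmetric]) auto

lemma abs_L2_diff: "sqi f \<Longrightarrow> sqi g \<Longrightarrow> abs_L2 (\<lambda>t. f t - g t) = abs_L2 f - abs_L2 g"
  by (rule minus_L2.abs_eq[symmetric]) auto

lemma norm_L2_leI:
  assumes "sqi f" "(\<integral>\<^sup>+t. ennreal ((norm (f t))\<^sup>2) \<partial>lborel) \<le> ennreal (C\<^sup>2)" "0 \<le> C"
  shows "norm (abs_L2 f) \<le> C"
proof -
  have "ennreal ((norm (abs_L2 f))\<^sup>2) = (\<integral>\<^sup>+t. ennreal ((norm (f t))\<^sup>2) \<partial>lborel)"
    unfolding norm_abs_L2_sq[OF assms(1)]
    by (rule nn_integral_eq_integral[symmetric]) (use assms(1) in \<open>auto simp: sqi_def\<close>)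
  also have "\<dots> \<le> ennreal (C\<^sup>2)" by fact
  finally have "(norm (abs_L2 f))\<^sup>2 \<le> C\<^sup>2" by (simp add: ennreal_le_iff)
  then show ?thesis using assms(3) by (rule power2_le_imp_le)
qed

lemma sqiI_nn:
  assumes "f \<in> borel_measurable lborel" "(\<integral>\<^sup>+t. ennreal ((norm (f t))\<^sup>2) \<partial>lborel) < \<infinity>"
  shows "sqi f"
  unfolding sqi_def
proof
  show [measurable]: "f \<in> borel_measurable lborel" by fact
  show "integrable lborel (\<lambda>t. (norm (f t))\<^sup>2)"
    by (rule integrableI_bounded) (use assms in auto)
qed

text \<open>Riesz-Fischer: a rapidly converging subsequence converges almost everywhere, and Fatou's
  lemma carries the distance estimates over to the pointwise limit.\<close>

instance L2 :: complete_space
proof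
  fix X :: "nat \<Rightarrow> L2" assume X: "Cauchy X"
  obtain r :: "nat \<Rightarrow> nat" where r: "\<And>n i j. i \<ge> r n \<Longrightarrow> j \<ge> r n \<Longrightarrow> dist (X i) (X j) < (1/2) ^ n"
  proof -
    have "\<forall>n. \<exists>N. \<forall>i\<ge>N. \<forall>j\<ge>N. dist (X i) (X j) < (1/2) ^ n"
      using X unfolding Cauchy_def by auto
    then show ?thesis using that by (metis choice)
  qed
  \<comment> \<open>Partial sums of \<open>r\<close> make the indices monotone while keeping
    \<open>R n \<ge> r n\<close>.\<close>
  define R where "R n = (\<Sum>k\<le>n. r k)" for n
  have Rr: "R n \<ge> r n" "R (Suc n) \<ge> R n" for n
    by (auto simp: R_def intro: member_le_sum)
  have Rmono: "R m \<ge> R n" if "m \<ge> n" for m n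
    using that Rr(2) by (metis lift_Suc_mono_le)
  define h where "h n = rep_L2 (X (R n))" for n
  have hm [measurable]: "h n \<in> borel_measurable borel" for n by (simp add: h_def)
  have hsq: "sqi (h n)" for n by (simp add: h_def)
  have habs: "abs_L2 (h n) = X (R n)" for n by (simp add: h_def)
  have hd: "(\<integral>\<^sup>+t. ennreal ((norm (h m t - h n t))\<^sup>2) \<partial>lborel) \<le> ennreal (((1/2)^n)\<^sup>2)" if "m \<ge> n" for m n
  proof -
    have "norm (X (R m) - X (R n)) < (1/2)^n"
      using r[of n "R m" "R n"] Rr(1)[of n] Rmono[OF that] by (auto simp: dist_norm)
    then have 1: "(norm (X (R m) - X (R n)))\<^sup>2 \<le> ((1/2)^n)\<^sup>2"
      by (intro power_mono) auto
    have "(\<integral>\<^sup>+t. ennreal ((norm (h m t - h n t))\<^sup>2) \<partial>lborel) = ennreal (LINT t|lborel. (norm (h m t - h n t))\<^sup>2)"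
      by (rule nn_integral_eq_integral) (use sqi_diff[OF hsq hsq] in \<open>auto simp: sqi_def\<close>)
    also have "(LINT t|lborel. (norm (h m t - h n t))\<^sup>2) = (norm (X (R m) - X (R n)))\<^sup>2"
      using norm_abs_L2_sq[OF sqi_diff[OF hsq hsq]] by (simp add: abs_L2_diff hsq habs)
    finally show ?thesis using 1 by (auto intro: ennreal_leI)
  qed
  \<comment> \<open>The squared distance is at most 4^-n, so the factor 2^n still leaves a
    convergent series. Its finiteness at a point forces increments of order 2^(-n/2) there, and
    these are summable.\<close>
  have "(\<integral>\<^sup>+t. (\<Sum>n. ennreal (2^n * (norm (h (Suc n) t - h n t))\<^sup>2)) \<partial>lborel)
     = (\<Sum>n. \<integral>\<^sup>+t. ennreal (2^n * (norm (h (Suc n) t - h n t))\<^sup>2) \<partial>lborel)"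
    by (rule nn_integral_suminf) measurable
  also have "\<dots> \<le> (\<Sum>n. ennreal ((1/2)^n))"
  proof (rule suminf_le)
    fix n
    have "(\<integral>\<^sup>+t. ennreal (2^n * (norm (h (Suc n) t - h n t))\<^sup>2) \<partial>lborel)
      = ennreal (2^n) * (\<integral>\<^sup>+t. ennreal ((norm (h (Suc n) t - h n t))\<^sup>2) \<partial>lborel)"
      by (simp add: ennreal_mult nn_integral_cmult)
    also have "\<dots> \<le> ennreal (2^n) * ennreal (((1/2)^n)\<^sup>2)"
      by (intro mult_left_mono hd) auto
    also have "\<dots> = ennreal ((1/2)^n)"
      by (simp add: ennreal_mult[symmetric] power2_eq_square power_divide field_simps)
    finally show "(\<integral>\<^sup>+t. ennreal (2^n * (norm (h (Suc n) t - h n t))\<^sup>2) \<partial>lborel) \<le> ennreal ((1/2)^n)" .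
  qed auto
  also have "\<dots> < \<infinity>"
    by (subst suminf_ennreal2) (auto intro: summable_geometric)
  finally have "(\<integral>\<^sup>+t. (\<Sum>n. ennreal (2^n * (norm (h (Suc n) t - h n t))\<^sup>2)) \<partial>lborel) \<noteq> \<infinity>" by simp
  then have "AE t in lborel. (\<Sum>n. ennreal (2^n * (norm (h (Suc n) t - h n t))\<^sup>2)) \<noteq> \<infinity>"
    by (intro nn_integral_noteq_infinite) measurable
  then have conv: "AE t in lborel. convergent (\<lambda>n. h n t)"
  proof eventually_elim
    case (elim t)
    have "summable (\<lambda>n. 2^n * (norm (h (Suc n) t - h n t))\<^sup>2)"
      using elim by (intro summable_suminf_not_top) auto
    from summable_LIMSEQ_zero[OF this] have "Bseq (\<lambda>n. 2^n * (norm (h (Suc n) t - h n t))\<^sup>2)"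
      by (intro convergent_imp_Bseq convergentI)
    then obtain K where K: "K > 0" "\<And>n. norm (2^n * (norm (h (Suc n) t - h n t))\<^sup>2) \<le> K"
      by (auto elim: BseqE)
    have b: "norm (h (Suc n) t - h n t) \<le> sqrt K * (sqrt (1/2))^n" for n
    proof (rule power2_le_imp_le)
      have "(norm (h (Suc n) t - h n t))\<^sup>2 \<le> K * (1/2)^n"
        using K(2)[of n] by (simp add: power_divide field_simps)
      also have "\<dots> = (sqrt K * (sqrt (1/2))^n)\<^sup>2"
      proof -
        have "(sqrt (1/2) ^ n)\<^sup>2 = ((sqrt (1/2))\<^sup>2) ^ n" by (metis power_mult mult.commute)
        also have "\<dots> = (1/2)^n" by (subst real_sqrt_pow2) auto
        finally show ?thesis using K(1) by (simp only: power_mult_distrib) simp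
      qed
      finally show "(norm (h (Suc n) t - h n t))\<^sup>2 \<le> (sqrt K * (sqrt (1/2))^n)\<^sup>2" .
      show "0 \<le> sqrt K * sqrt (1 / 2) ^ n" using K(1) by simp
    qed
    have "summable (\<lambda>n. sqrt K * (sqrt (1/2))^n)"
      by (intro summable_mult summable_geometric) (simp add: real_sqrt_divide)
    then have "summable (\<lambda>n. h (Suc n) t - h n t)"
      by (rule summable_comparison_test') (use b in auto)
    then obtain l where "(\<lambda>n. \<Sum>i<n. h (Suc i) t - h i t) \<longlonglongrightarrow> l" by (auto simp: summable_def sums_def)
    moreover have "(\<Sum>i<n. h (Suc i) t - h i t) = h n t - h 0 t" for n by (rule sum_lessThan_telescope)
    ultimately have "(\<lambda>n. h n t - h 0 t) \<longlonglongrightarrow> l" by simp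
    then have "(\<lambda>n. (h n t - h 0 t) + h 0 t) \<longlonglongrightarrow> l + h 0 t" by (intro tendsto_intros)
    then show ?case by (auto simp: convergent_def)
  qed
  define H where "H t = lim (\<lambda>n. h n t)" for t
  have Hm [measurable]: "H \<in> borel_measurable borel"
    unfolding H_def by measurable
  have lim: "AE t in lborel. (\<lambda>n. h n t) \<longlonglongrightarrow> H t"
    using conv by eventually_elim (simp add: H_def convergent_LIMSEQ_iff)
  have Hd: "(\<integral>\<^sup>+t. ennreal ((norm (H t - h n t))\<^sup>2) \<partial>lborel) \<le> ennreal (((1/2)^n)\<^sup>2)" for n
  proof -
    have "(\<integral>\<^sup>+t. ennreal ((norm (H t - h n t))\<^sup>2) \<partial>lborel)
       = (\<integral>\<^sup>+t. liminf (\<lambda>m. ennreal ((norm (h m t - h n t))\<^sup>2)) \<partial>lborel)"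
    proof (rule nn_integral_cong_AE, use lim in eventually_elim)
      case (elim t)
      have "(\<lambda>m. ennreal ((norm (h m t - h n t))\<^sup>2)) \<longlonglongrightarrow> ennreal ((norm (H t - h n t))\<^sup>2)"
        by (intro tendsto_intros elim)
      from lim_imp_Liminf[OF _ this] show ?case by simp
    qed
    also have "\<dots> \<le> liminf (\<lambda>m. \<integral>\<^sup>+t. ennreal ((norm (h m t - h n t))\<^sup>2) \<partial>lborel)"
      by (rule nn_integral_liminf) measurable
    also have "\<dots> \<le> liminf (\<lambda>m. ennreal (((1/2)^n)\<^sup>2))"
      by (rule Liminf_mono) (use hd in \<open>auto intro: eventually_sequentiallyI[of n]\<close>)
    also have "\<dots> = ennreal (((1/2)^n)\<^sup>2)" by (simp add: Liminf_const)
    finally show ?thesis .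
  qed
  have Hsq: "sqi H"
  proof -
    have "sqi (\<lambda>t. H t - h 0 t)"
    proof (rule sqiI_nn)
      show "(\<integral>\<^sup>+t. ennreal ((norm (H t - h 0 t))\<^sup>2) \<partial>lborel) < \<infinity>"
        using Hd[of 0] by (rule le_less_trans) simp
    qed measurable
    from sqi_add[OF this hsq[of 0]] show ?thesis by simp
  qed
  have near: "norm (abs_L2 H - X (R n)) \<le> (1/2)^n" for n
    using norm_L2_leI[OF sqi_diff[OF Hsq hsq] Hd] by (simp add: abs_L2_diff Hsq hsq habs)
  have "X \<longlonglongrightarrow> abs_L2 H"
  proof (rule LIMSEQ_I)
    fix e :: real assume "e > 0"
    obtain n where n: "(1/2::real)^n < e/2"
      using real_arch_pow_inv[of "e/2" "1/2"] \<open>e > 0\<close> by auto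
    show "\<exists>no. \<forall>k\<ge>no. norm (X k - abs_L2 H) < e"
    proof (intro exI allI impI)
      fix k assume "k \<ge> r n"
      then have "dist (X k) (X (R n)) < (1/2)^n" using r Rr(1) by blast
      moreover have "dist (X (R n)) (abs_L2 H) \<le> (1/2)^n"
        using near[of n] by (simp add: dist_norm norm_minus_commute)
      ultimately have "dist (X k) (abs_L2 H) < e"
        using n dist_triangle[of "X k" "abs_L2 H" "X (R n)"] by linarith
      then show "norm (X k - abs_L2 H) < e" by (simp add: dist_norm)
    qed
  qed
  then show "convergent X" by (auto simp: convergent_def)
qed

instance L2 :: banach ..

subsection \<open>Multiplication operators\<close>

definition bmeas :: "(real \<Rightarrow> complex) \<Rightarrow> bool" where
  "bmeas m \<longleftrightarrow> m \<in> borel_measurable borel \<and> (\<exists>C. \<forall>t. norm (m t) \<le> C)"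

lemma bmeas_meas [measurable_dest]: "bmeas m \<Longrightarrow> m \<in> borel_measurable borel"
  by (simp add: bmeas_def)

lemma sqi_bmult:
  assumes "bmeas m" "sqi f" shows "sqi (\<lambda>t. m t * f t)"
proof -
  note [measurable] = bmeas_meas[OF assms(1)] sqi_meas[OF assms(2)]
  obtain C where C: "\<And>t. norm (m t) \<le> C" using assms by (auto simp: bmeas_def)
  show ?thesis
    by (rule sqi_bound[OF assms(2), where C=C]) (auto simp: norm_mult intro!: mult_right_mono C)
qed

text \<open>Multiplication by an unbounded or non-measurable function is the zero operator.\<close>

lift_definition mulL :: "(real \<Rightarrow> complex) \<Rightarrow> L2 \<Rightarrow> L2" is
  "\<lambda>m f t. if bmeas m then m t * f t else 0"
proof -
  fix m f g :: "real \<Rightarrow> complex"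
  assume "sqi f \<and> sqi g \<and> (AE t in lborel. f t = g t)"
  then show "sqi (\<lambda>t. if bmeas m then m t * f t else 0) \<and> sqi (\<lambda>t. if bmeas m then m t * g t else 0) \<and>
       (AE t in lborel. (if bmeas m then m t * f t else 0) = (if bmeas m then m t * g t else 0))"
    by (cases "bmeas m") (auto intro: sqi_bmult elim: eventually_mono)
qed

lemma bmeas_const [simp]: "bmeas (\<lambda>_. c)"
  by (auto simp: bmeas_def)

lemma bmeas_mult: "bmeas m \<Longrightarrow> bmeas m' \<Longrightarrow> bmeas (\<lambda>t. m t * m' t)"
  unfolding bmeas_def
proof safe
  fix C C' assume "\<forall>t. norm (m t) \<le> C" "\<forall>t. norm (m' t) \<le> C'"
  then show "\<exists>C. \<forall>t. norm (m t * m' t) \<le> C"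
    by (intro exI[of _ "C * C'"]) (auto simp: norm_mult intro!: mult_mono intro: order_trans[OF norm_ge_zero])
qed auto

lemma bmeas_add: "bmeas m \<Longrightarrow> bmeas m' \<Longrightarrow> bmeas (\<lambda>t. m t + m' t)"
  unfolding bmeas_def
proof safe
  fix C C' assume "\<forall>t. norm (m t) \<le> C" "\<forall>t. norm (m' t) \<le> C'"
  then show "\<exists>C. \<forall>t. norm (m t + m' t) \<le> C"
    by (intro exI[of _ "C + C'"]) (auto intro!: norm_triangle_le add_mono)
qed auto

lemma bmeas_indicator [simp]: "S \<in> sets borel \<Longrightarrow> bmeas (indicator S)"
  by (auto simp: bmeas_def indicator_def intro!: exI[of _ 1])

lemma bmeas_shift: "bmeas m \<Longrightarrow> bmeas (\<lambda>t. m (t + h))"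
  unfolding bmeas_def by auto

lemma bmeas_window:
  assumes "\<And>t. isCont m t" "compact K"
  shows "bmeas (\<lambda>t. indicator K t * m t)"
proof -
  have c: "continuous_on S m" for S using assms(1) by (simp add: continuous_at_imp_continuous_on)
  have "compact (m ` K)" by (intro compact_continuous_image c assms)
  then obtain C where C: "\<And>t. t \<in> K \<Longrightarrow> norm (m t) \<le> C" by (meson bounded_iff compact_imp_bounded imageI)
  have [measurable]: "m \<in> borel_measurable borel" by (rule borel_measurable_continuous_onI[OF c])
  have [measurable]: "K \<in> sets borel" using assms(2) by (simp add: borel_closed compact_imp_closed)
  have "norm (indicator K t * m t) \<le> max C 0" for t
    using C[of t] by (auto simp: indicator_def)
  then show ?thesis unfolding bmeas_def by auto
qed

lemma rep_mulL: "bmeas m \<Longrightarrow> AE t in lborel. rep_L2 (mulL m x) t = m t * rep_L2 x t"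
  using rep_abs_L2[OF sqi_bmult[of m "rep_L2 x"]] mulL.abs_eq[of "rep_L2 x" m] by simp

lemma mulL_abs: "bmeas m \<Longrightarrow> sqi f \<Longrightarrow> mulL m (abs_L2 f) = abs_L2 (\<lambda>t. m t * f t)"
  using mulL.abs_eq[of f m] by simp

lemma mulL_eq_0: "\<not> bmeas m \<Longrightarrow> mulL m x = 0"
  by transfer auto

lemma mulL_add: "mulL m (x + y) = mulL m x + mulL m y"
proof (cases "bmeas m")
  case True then show ?thesis by transfer (auto simp: distrib_left intro!: sqi_bmult sqi_add)
qed (simp add: mulL_eq_0)

lemma mulL_scaleR: "mulL m (c *\<^sub>R x) = c *\<^sub>R mulL m x"
proof (cases "bmeas m")
  case True then show ?thesis by transfer (auto intro!: sqi_bmult sqi_scaleR)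
qed (simp add: mulL_eq_0)

lemma norm_mulL_le:
  assumes "\<And>t. norm (m t) \<le> C" shows "norm (mulL m x) \<le> C * norm x"
proof (cases "bmeas m")
  case False
  have "0 \<le> C" using assms[of 0] norm_ge_zero order_trans by blast
  moreover have "mulL m x = 0" using False by transfer auto
  ultimately show ?thesis by simp
next
  case True
  have C: "0 \<le> C" using assms[of 0] norm_ge_zero order_trans by blast
  have "(norm (mulL m x))\<^sup>2 = (LINT t|lborel. (norm (m t * rep_L2 x t))\<^sup>2)"
    using norm_abs_L2_sq[OF sqi_bmult[OF True sqi_rep[of x]]] mulL_abs[OF True sqi_rep[of x]] by simp
  also have "\<dots> \<le> (LINT t|lborel. C\<^sup>2 * (norm (rep_L2 x t))\<^sup>2)"
  proof (rule integral_mono)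
    show "integrable lborel (\<lambda>t. (norm (m t * rep_L2 x t))\<^sup>2)" using sqi_bmult[OF True sqi_rep[of x]] by (simp add: sqi_def)
    show "integrable lborel (\<lambda>t. C\<^sup>2 * (norm (rep_L2 x t))\<^sup>2)" using sqi_rep[of x] by (simp add: sqi_def)
    fix t
    have "(norm (m t))\<^sup>2 \<le> C\<^sup>2" using assms[of t] by (intro power_mono) auto
    then show "(norm (m t * rep_L2 x t))\<^sup>2 \<le> C\<^sup>2 * (norm (rep_L2 x t))\<^sup>2"
      by (auto simp: norm_mult power_mult_distrib intro!: mult_right_mono)
  qed
  also have "\<dots> = (C * norm x)\<^sup>2" by (simp add: norm_L2_sq power_mult_distrib)
  finally show ?thesis using C by (auto intro: power2_le_imp_le)
qed

lemma bounded_linear_mulL: "bounded_linear (mulL m)"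
proof (cases "bmeas m")
  case True
  then obtain C where "\<And>t. norm (m t) \<le> C" by (auto simp: bmeas_def)
  from norm_mulL_le[OF this] show ?thesis
    by (intro bounded_linear_intro[where K=C]) (auto simp: mulL_add mulL_scaleR mult.commute)
next
  case False
  then have "mulL m = (\<lambda>x. 0)" by (intro ext, transfer) auto
  then show ?thesis by simp
qed

lemma mulL_mulL: "bmeas m \<Longrightarrow> bmeas m' \<Longrightarrow> mulL m (mulL m' x) = mulL (\<lambda>t. m t * m' t) x"
  by transfer (auto simp: bmeas_mult mult.assoc intro!: sqi_bmult)

lemma mulL_plus: "bmeas m \<Longrightarrow> bmeas m' \<Longrightarrow> mulL (\<lambda>t. m t + m' t) x = mulL m x + mulL m' x"
  by transfer (auto simp: bmeas_add distrib_right intro!: sqi_bmult sqi_add)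

lemma mulL_one [simp]: "mulL (\<lambda>_. 1) x = x"
  by transfer auto

lemma mulL_of_real: "mulL (\<lambda>_. of_real c) x = c *\<^sub>R x"
  by transfer (auto simp: scaleR_conv_of_real)

lemma mulL_const_zero [simp]: "mulL (\<lambda>_. 0) x = 0"
  by transfer auto

lemma mulL_cong_AE:
  assumes "bmeas m" "bmeas m'" "AE t in lborel. m t = m' t" shows "mulL m x = mulL m' x"
  by (rule L2_eqI) (use rep_mulL[OF assms(1), of x] rep_mulL[OF assms(2), of x] assms(3) in \<open>eventually_elim, simp\<close>)

text \<open>Unconditional, since an inadmissible symbol gives the zero operator and both sides are
  then 0.\<close>

lemma mulL_mulL_commute: "mulL m (mulL m' x) = mulL m' (mulL m x)"
proof (cases "bmeas m \<and> bmeas m'")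
  case True
  then show ?thesis by (simp add: mulL_mulL mult.commute)
next
  case False
  have "mulL k 0 = 0" for k by (rule linear_0[OF bounded_linear.linear[OF bounded_linear_mulL]])
  then show ?thesis using False by (auto simp: mulL_eq_0)
qed

subsection \<open>Translations\<close>

lemma sqi_shift: "sqi f \<Longrightarrow> sqi (\<lambda>t. f (t + h))"
  unfolding sqi_def
  using lborel_integrable_real_affine[of "\<lambda>t. (norm (f t))\<^sup>2" 1 h] by (auto simp: add.commute)

lemma sqi_reflect: "sqi f \<Longrightarrow> sqi (\<lambda>t. f (- t))"
  unfolding sqi_def
  using lborel_integrable_real_affine[of "\<lambda>t. (norm (f t))\<^sup>2" "-1" 0] by auto

lemma AE_shift:
  assumes "AE t in lborel. f t = g t" "f \<in> borel_measurable lborel" "g \<in> borel_measurable lborel"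
  shows "AE t in lborel. f (t + h :: real) = (g (t + h) :: complex)"
  using AE_borel_affine[of 1 "\<lambda>t. f t = g t" h] assms by (simp add: add.commute)

text \<open>Positive \<open>h\<close> moves the graph to the left: what happens at time
  \<open>h\<close> is brought to time 0, so the state at time \<open>h\<close> is the state at 0 of
  the shifted trajectory.\<close>

lift_definition shiftL :: "real \<Rightarrow> L2 \<Rightarrow> L2" is "\<lambda>h f t. f (t + h)"
proof -
  fix h :: real and f g :: "real \<Rightarrow> complex"
  assume "sqi f \<and> sqi g \<and> (AE t in lborel. f t = g t)"
  then show "sqi (\<lambda>t. f (t + h)) \<and> sqi (\<lambda>t. g (t + h)) \<and> (AE t in lborel. f (t + h) = g (t + h))"
    using AE_shift[of f g h] sqi_shift sqi_meas by blast
qed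

lemma rep_shiftL: "AE t in lborel. rep_L2 (shiftL h x) t = rep_L2 x (t + h)"
  using rep_abs_L2[OF sqi_shift[of "rep_L2 x" h]] shiftL.abs_eq[of "rep_L2 x" h] by simp

lemma shiftL_abs: "sqi f \<Longrightarrow> shiftL h (abs_L2 f) = abs_L2 (\<lambda>t. f (t + h))"
  using shiftL.abs_eq[of f h] by simp

lemma shiftL_add: "shiftL h (x + y) = shiftL h x + shiftL h y"
  by transfer (auto intro: sqi_shift)

lemma shiftL_scaleR: "shiftL h (c *\<^sub>R x) = c *\<^sub>R shiftL h x"
  by transfer (auto intro: sqi_shift)

lemma norm_shiftL [simp]: "norm (shiftL h x) = norm x"
proof -
  have "(norm (shiftL h x))\<^sup>2 = (LINT t|lborel. (norm (rep_L2 x (t + h)))\<^sup>2)"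
    using norm_abs_L2_sq[OF sqi_shift[OF sqi_rep[of x]]] shiftL_abs[OF sqi_rep[of x]] by simp
  also have "\<dots> = (norm x)\<^sup>2"
    unfolding norm_L2_sq using lborel_integral_real_affine[of 1 "\<lambda>t. (norm (rep_L2 x t))\<^sup>2" h]
    by (simp add: add.commute)
  finally show ?thesis by simp
qed

lemma bounded_linear_shiftL: "bounded_linear (shiftL h)"
  by (rule bounded_linear_intro[where K=1]) (auto simp: shiftL_add shiftL_scaleR)

lemma shiftL_shiftL: "shiftL h (shiftL k x) = shiftL (h + k) x"
proof transfer
  fix h k f assume f: "sqi f \<and> sqi f \<and> (AE t in lborel. f t = f t)"
  have "f (t + h + k) = f (t + (h + k))" for t by (simp add: algebra_simps)
  moreover have "sqi (\<lambda>t. f (t + (h + k)))" using f by (auto intro: sqi_shift)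
  ultimately show "sqi (\<lambda>t. f (t + h + k)) \<and> sqi (\<lambda>t. f (t + (h + k))) \<and> (AE t in lborel. f (t + h + k) = f (t + (h + k)))"
    by simp
qed

lemma shiftL_0 [simp]: "shiftL 0 x = x"
  by transfer auto

lemma shiftL_mulL:
  assumes "bmeas m" shows "shiftL h (mulL m x) = mulL (\<lambda>t. m (t + h)) (shiftL h x)"
  using assms by transfer (auto simp: bmeas_shift intro!: sqi_shift sqi_bmult)

subsection \<open>The bilinear pairing\<close>

text \<open>Bilinear instead of Hermitian, so that pairing with a fixed class is complex linear, as
  convolution at a point has to be.\<close>

definition pairL :: "L2 \<Rightarrow> L2 \<Rightarrow> complex" where
  "pairL x y = (LINT t|lborel. rep_L2 x t * rep_L2 y t)"

lemma pairL_abs: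
  assumes "sqi f" "sqi g" shows "pairL (abs_L2 f) (abs_L2 g) = (LINT t|lborel. f t * g t)"
  unfolding pairL_def
proof (rule integral_cong_AE)
  show "AE t in lborel. rep_L2 (abs_L2 f) t * rep_L2 (abs_L2 g) t = f t * g t"
    using rep_abs_L2[OF assms(1)] rep_abs_L2[OF assms(2)] by eventually_elim simp
  show "(\<lambda>t. f t * g t) \<in> borel_measurable lborel"
    by (rule borel_measurable_integrable[OF integrable_sqi_mult[OF assms]])
qed simp

lemma pairL_abs_left: "sqi f \<Longrightarrow> pairL (abs_L2 f) y = (LINT t|lborel. f t * rep_L2 y t)"
  using pairL_abs[of f "rep_L2 y"] by simp

lemma pairL_commute: "pairL x y = pairL y x"
  by (simp add: pairL_def mult.commute)

lemma pairL_cong_AE: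
  assumes "AE t in lborel. rep_L2 x t * rep_L2 y t = rep_L2 x' t * rep_L2 y' t"
  shows "pairL x y = pairL x' y'"
  unfolding pairL_def by (rule integral_cong_AE) (use assms in auto)

lemma norm_pairL_le: "norm (pairL x y) \<le> norm x * norm y"
proof -
  let ?f = "\<lambda>t. norm (rep_L2 x t)" and ?g = "\<lambda>t. norm (rep_L2 y t)"
  have int: "integrable lborel (\<lambda>t. rep_L2 x t * rep_L2 y t)" by (intro integrable_sqi_mult) auto
  have "norm (pairL x y) \<le> (LINT t|lborel. ?f t * ?g t)"
    unfolding pairL_def using integral_norm_bound[of lborel "\<lambda>t. rep_L2 x t * rep_L2 y t"] by (simp add: norm_mult)
  moreover have "(LINT t|lborel. ?f t * ?g t) \<le> norm x * norm y"
  proof (rule power2_le_imp_le)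
    have "ennreal (LINT t|lborel. ?f t * ?g t) = (\<integral>\<^sup>+t. ennreal (?f t) * ennreal (?g t) \<partial>lborel)"
      using int by (subst nn_integral_eq_integral[symmetric]) (auto simp: norm_mult ennreal_mult dest: integrable_norm)
    then have "ennreal ((LINT t|lborel. ?f t * ?g t)\<^sup>2) = (\<integral>\<^sup>+t. ennreal (?f t) * ennreal (?g t) \<partial>lborel)\<^sup>2"
      by (simp add: ennreal_power[symmetric])
    also have "\<dots> \<le> (\<integral>\<^sup>+t. ennreal (?f t) ^ 2 \<partial>lborel) * (\<integral>\<^sup>+t. ennreal (?g t) ^ 2 \<partial>lborel)"
      by (rule Cauchy_Schwarz_nn_integral) measurable
    also have "\<dots> = ennreal ((norm x * norm y)\<^sup>2)"
      by (simp add: ennreal_power nn_norm_L2_sq ennreal_mult power_mult_distrib)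
    finally show "(LINT t|lborel. ?f t * ?g t)\<^sup>2 \<le> (norm x * norm y)\<^sup>2" by (simp add: ennreal_le_iff)
  qed simp
  ultimately show ?thesis by linarith
qed

lemma pairL_add_left: "pairL (x + y) z = pairL x z + pairL y z"
proof -
  have "pairL (x + y) z = (LINT t|lborel. rep_L2 x t * rep_L2 z t + rep_L2 y t * rep_L2 z t)"
    unfolding pairL_def
    by (rule integral_cong_AE) (use rep_add[of x y] in \<open>auto elim!: eventually_mono simp: distrib_right\<close>)
  then show ?thesis by (simp add: pairL_def integrable_sqi_mult)
qed

lemma pairL_add_right: "pairL z (x + y) = pairL z x + pairL z y"
  by (simp add: pairL_commute[of z] pairL_add_left)

lemma pairL_scaleR_left: "pairL (c *\<^sub>R x) z = c *\<^sub>R pairL x z"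
proof -
  have "pairL (c *\<^sub>R x) z = (LINT t|lborel. c *\<^sub>R (rep_L2 x t * rep_L2 z t))"
    unfolding pairL_def
    by (rule integral_cong_AE) (use rep_scaleR[of c x] in \<open>auto elim!: eventually_mono\<close>)
  then show ?thesis by (simp add: pairL_def)
qed

lemma pairL_scaleR_right: "pairL z (c *\<^sub>R x) = c *\<^sub>R pairL z x"
  by (simp add: pairL_commute[of z] pairL_scaleR_left)

lemma bounded_bilinear_pairL: "bounded_bilinear pairL"
  by unfold_locales (auto simp: pairL_add_left pairL_add_right pairL_scaleR_left pairL_scaleR_right
      intro!: exI[of _ 1] norm_pairL_le)

lemma pairL_mulL: "pairL (mulL m x) y = pairL x (mulL m y)"
proof (cases "bmeas m")
  case True
  show ?thesis
    by (rule pairL_cong_AE) (use rep_mulL[OF True, of x] rep_mulL[OF True, of y] in \<open>eventually_elim, simp\<close>)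
next
  case False
  have "pairL 0 z = 0" "pairL z 0 = 0" for z
    using bounded_bilinear.zero_left[OF bounded_bilinear_pairL] bounded_bilinear.zero_right[OF bounded_bilinear_pairL] by auto
  then show ?thesis using False by (simp add: mulL_eq_0)
qed

lemma pairL_const: "pairL x (mulL (\<lambda>_. c) y) = c * pairL x y"
proof -
  have "pairL x (mulL (\<lambda>_. c) y) = (LINT t|lborel. c * (rep_L2 x t * rep_L2 y t))"
    unfolding pairL_def
    by (rule integral_cong_AE) (use rep_mulL[OF bmeas_const, of c y] in \<open>auto elim!: eventually_mono\<close>)
  then show ?thesis by (simp add: pairL_def)
qed

lemma pairL_shiftL: "pairL (shiftL h x) (shiftL h y) = pairL x y"
proof -
  have "pairL (shiftL h x) (shiftL h y) = (LINT t|lborel. rep_L2 x (t + h) * rep_L2 y (t + h))"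
    unfolding pairL_def
    by (rule integral_cong_AE) (use rep_shiftL[of h x] rep_shiftL[of h y] in \<open>auto elim!: eventually_elim2\<close>)
  also have "\<dots> = pairL x y"
    unfolding pairL_def using lborel_integral_real_affine[of 1 "\<lambda>t. rep_L2 x t * rep_L2 y t" h]
    by (simp add: add.commute)
  finally show ?thesis .
qed

subsection \<open>Density of interval indicators\<close>

lemma abs_L2_tendsto_dominated:
  assumes "\<And>n. sqi (f n)" "sqi F" "sqi g"
    and "\<And>n. AE t in lborel. norm (f n t) \<le> norm (g t)"
    and lim: "AE t in lborel. (\<lambda>n. f n t) \<longlonglongrightarrow> F t"
  shows "(\<lambda>n. abs_L2 (f n)) \<longlonglongrightarrow> abs_L2 F"
proof -
  note [measurable] = sqi_meas[OF assms(1)] sqi_meas[OF assms(2)] sqi_meas[OF assms(3)]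
  have bd: "AE t in lborel. \<forall>n. norm (f n t) \<le> norm (g t)" using assms(4) by (simp add: AE_all_countable)
  have "(\<lambda>n. LINT t|lborel. (norm (f n t - F t))\<^sup>2) \<longlonglongrightarrow> (LINT t::real|lborel. (0::real))"
  proof (rule Bochner_Integration.integral_dominated_convergence[where w="\<lambda>t. 4 * (norm (g t))\<^sup>2"
        and s="\<lambda>n t. (norm (f n t - F t))\<^sup>2" and f="\<lambda>_. 0"])
    show "integrable lborel (\<lambda>t. 4 * (norm (g t))\<^sup>2)" using assms(3) by (simp add: sqi_def)
    show "AE t in lborel. (\<lambda>n. (norm (f n t - F t))\<^sup>2) \<longlonglongrightarrow> 0"
      using lim
    proof eventually_elim
      case (elim t)
      have "(\<lambda>n. (norm (f n t - F t))\<^sup>2) \<longlonglongrightarrow> (norm (F t - F t))\<^sup>2"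
        by (intro tendsto_intros elim)
      then show ?case by simp
    qed
    show "AE t in lborel. norm ((norm (f n t - F t))\<^sup>2) \<le> 4 * (norm (g t))\<^sup>2" for n
      using bd lim
    proof eventually_elim
      case (elim t)
      have "norm (F t) \<le> norm (g t)"
        by (rule LIMSEQ_le_const2[OF tendsto_norm[OF elim(2)]]) (use elim(1) in auto)
      with elim(1) have "norm (f n t - F t) \<le> 2 * norm (g t)"
        using norm_triangle_ineq4[of "f n t" "F t"] by (smt (verit))
      then have "(norm (f n t - F t))\<^sup>2 \<le> (2 * norm (g t))\<^sup>2" by (intro power_mono) auto
      then show ?case by (simp add: power_mult_distrib)
    qed
  qed measurable
  moreover have "(LINT t|lborel. (norm (f n t - F t))\<^sup>2) = (norm (abs_L2 (f n) - abs_L2 F))\<^sup>2" for n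
    using norm_abs_L2_sq[OF sqi_diff[OF assms(1) assms(2)], of n] by (simp add: abs_L2_diff assms)
  ultimately have "(\<lambda>n. (norm (abs_L2 (f n) - abs_L2 F))\<^sup>2) \<longlonglongrightarrow> 0" by simp
  then have "(\<lambda>n. norm (abs_L2 (f n) - abs_L2 F)) \<longlonglongrightarrow> 0"
    using tendsto_real_sqrt[of "\<lambda>n. (norm (abs_L2 (f n) - abs_L2 F))\<^sup>2" 0] by simp
  then show ?thesis using LIM_zero_iff tendsto_norm_zero_iff by blast
qed

lemma sqi_indicator:
  assumes "S \<in> sets borel" "emeasure lborel S < \<infinity>" shows "sqi (indicator S)"
  unfolding sqi_def
proof
  have "(\<lambda>t. (norm (indicator S t :: complex))\<^sup>2) = indicator S" by (auto simp: indicator_def fun_eq_iff)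
  then show "integrable lborel (\<lambda>t. (norm (indicator S t :: complex))\<^sup>2)" using assms by simp
qed (use assms in simp)

lemma sqi_indicator_bounded:
  assumes "S \<in> sets borel" "S \<subseteq> {a..b::real}" shows "sqi (indicator S)"
proof (rule sqi_indicator[OF assms(1)])
  have "emeasure lborel S \<le> emeasure lborel {a..b}" using assms by (intro emeasure_mono) auto
  also have "\<dots> < \<infinity>" by (simp add: emeasure_lborel_Icc_eq)
  finally show "emeasure lborel S < \<infinity>" .
qed

definition indL :: "real set \<Rightarrow> L2" where "indL S = abs_L2 (indicator S)"

lemma indL_empty [simp]: "indL {} = 0"
proof -
  have "indicator {} = (\<lambda>_::real. 0::complex)" by auto
  then show ?thesis by (simp add: indL_def zero_L2_def)
qed

text \<open>The Borel sets whose indicator, cut to a bounded window, lies in \<open>M\<close> form a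
  Dynkin system containing the intervals, hence all Borel sets are among them. Simple functions cut
  to bounded windows then approximate \<open>x\<close> under a common bound.\<close>

lemma L2_dense_intervals:
  assumes "closed M"
    and add: "\<And>x y. x \<in> M \<Longrightarrow> y \<in> M \<Longrightarrow> x + y \<in> M"
    and scale: "\<And>c x. x \<in> M \<Longrightarrow> mulL (\<lambda>_. c) x \<in> M"
    and ind: "\<And>a b. a \<le> b \<Longrightarrow> indL {a..b} \<in> M"
  shows "x \<in> M"
proof -
  have zero: "0 \<in> M" using scale[OF ind[of 0 0], of 0] by simp
  have diff: "x - y \<in> M" if "x \<in> M" "y \<in> M" for x y
  proof -
    have "mulL (\<lambda>_. -1) y = - y" using mulL_of_real[of "-1" y] by simp
    then show ?thesis using add[OF that(1) scale[OF that(2), of "-1"]] by simp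
  qed
  \<comment> \<open>The window \<open>{-N..N}\<close> keeps indicators of complements square
    integrable.\<close>
  have sets: "indL (A \<inter> {-N..N}) \<in> M" if "A \<in> sets borel" for A and N :: real
  proof -
    define G where "G = range (\<lambda>(a::real, b). {a..b})"
    have 1: "A \<in> sigma_sets UNIV G"
      using that unfolding G_def borel_eq_atLeastAtMost by simp
    have 2: "Int_stable G"
      unfolding Int_stable_def G_def by (auto simp: image_iff)
    have 3: "G \<subseteq> Pow UNIV" by simp
    from 2 3 1 show ?thesis
    proof (induction rule: sigma_sets_induct_disjoint)
      case (basic A)
      then obtain a b where A: "A = {a..b}" by (auto simp: G_def)
      have "A \<inter> {-N..N} = {max a (-N)..min b N}" unfolding A by auto
      then show ?case using ind[of "max a (-N)" "min b N"] zero
        by (cases "max a (-N) \<le> min b N") auto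
    next
      case empty
      then show ?case using zero by simp
    next
      case (compl A)
      have A: "A \<in> sets borel" using compl(1) unfolding G_def borel_eq_atLeastAtMost by simp
      have "indL ((UNIV - A) \<inter> {-N..N}) = indL (UNIV \<inter> {-N..N}) - indL (A \<inter> {-N..N})"
        unfolding indL_def
        by (subst abs_L2_diff[symmetric]) (use A in \<open>auto intro!: sqi_indicator_bounded[of _ "-N" N] arg_cong[where f=abs_L2] simp: indicator_def fun_eq_iff\<close>)
      moreover have "indL (UNIV \<inter> {-N..N}) \<in> M"
        using ind[of "-N" N] zero by (cases "-N \<le> N") auto
      ultimately show ?case using diff compl by simp
    next
      case (union A)
      have A: "A i \<in> sets borel" for i using union(2) unfolding G_def borel_eq_atLeastAtMost by auto
      have part: "indL ((\<Union>i<n. A i) \<inter> {-N..N}) \<in> M" for n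
      proof (induction n)
        case 0 then show ?case using zero by simp
      next
        case (Suc n)
        have "A n \<inter> (\<Union>i<n. A i) = {}" 
        proof -
          have "A n \<inter> A i = {}" if "i < n" for i
            using union(1) that disjoint_family_onD[of A UNIV n i] by auto
          then show ?thesis by blast
        qed
        moreover define B where "B = (\<Union>i<n. A i)"
        ultimately have "indicator ((B \<union> A n) \<inter> {-N..N}) = (\<lambda>t. indicator (B \<inter> {-N..N}) t + indicator (A n \<inter> {-N..N}) t :: complex)"
          by (auto simp: indicator_def fun_eq_iff)
        moreover have "B \<in> sets borel" using A by (auto simp: B_def)
        ultimately have "indL ((B \<union> A n) \<inter> {-N..N}) = indL (B \<inter> {-N..N}) + indL (A n \<inter> {-N..N})"
          unfolding indL_def
          by (subst abs_L2_add[symmetric]) (use A in \<open>auto intro!: sqi_indicator_bounded[of _ "-N" N]\<close>)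
        moreover have "(\<Union>i<Suc n. A i) = B \<union> A n" by (auto simp: B_def less_Suc_eq)
        ultimately have "indL ((\<Union>i<Suc n. A i) \<inter> {-N..N}) = indL ((\<Union>i<n. A i) \<inter> {-N..N}) + indL (A n \<inter> {-N..N})"
          by (simp add: B_def)
        then show ?case using add Suc union(3) by simp
      qed
      have "(\<lambda>n. indL ((\<Union>i<n. A i) \<inter> {-N..N})) \<longlonglongrightarrow> indL ((\<Union>i. A i) \<inter> {-N..N})"
        unfolding indL_def
      proof (rule abs_L2_tendsto_dominated[where g="indicator {-N..N}"])
        show "AE t in lborel. (\<lambda>n. indicator ((\<Union>i<n. A i) \<inter> {-N..N}) t :: complex) \<longlonglongrightarrow> indicator ((\<Union>i. A i) \<inter> {-N..N}) t"
        proof (rule AE_I2)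
          fix t :: real
          show "(\<lambda>n. indicator ((\<Union>i<n. A i) \<inter> {-N..N}) t :: complex) \<longlonglongrightarrow> indicator ((\<Union>i. A i) \<inter> {-N..N}) t"
          proof (cases "t \<in> (\<Union>i. A i) \<inter> {-N..N}")
            case True
            then obtain i where "t \<in> A i" by auto
            then show ?thesis using True by (intro tendsto_eventually eventually_sequentiallyI[of "Suc i"]) (auto simp: indicator_def)
          next
            case False then show ?thesis by (intro tendsto_eventually) (auto simp: indicator_def)
          qed
        qed
      qed (use A in \<open>auto intro!: sqi_indicator_bounded[of _ "-N" N] simp: indicator_def\<close>)
      from closed_sequentially[OF \<open>closed M\<close> part this] show ?case .
    qed
  qed
  have sumM: "(\<Sum>y\<in>Y. z y) \<in> M" if "\<And>y. y \<in> Y \<Longrightarrow> z y \<in> M" "finite Y" for Y :: "complex set" and z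
    using that(2,1) by (induction rule: finite_induct) (auto intro: add zero)
  obtain F where F: "\<And>i. simple_function lborel (F i)" "\<And>t. (\<lambda>i. F i t) \<longlonglongrightarrow> rep_L2 x t"
      "\<And>i t. norm (F i t) \<le> 2 * norm (rep_L2 x t)"
    using borel_measurable_implies_sequence_metric[of "rep_L2 x" lborel 0] by (auto simp: dist_norm)
  define f where "f i t = indicator {- real i..real i} t * F i t" for i t
  have Fm [measurable]: "F i \<in> borel_measurable lborel" for i by (rule borel_measurable_simple_function[OF F(1)])
  have fb: "norm (f i t) \<le> 2 * norm (rep_L2 x t)" for i t
    using F(3)[of i t] by (auto simp: f_def indicator_def)
  have fs: "sqi (f i)" for i
    by (rule sqi_bound[OF sqi_rep[of x], where C=2]) (use fb in \<open>auto simp: f_def[abs_def]\<close>)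
  have fM: "abs_L2 (f i) \<in> M" for i
  proof -
    define Y where "Y = F i ` UNIV"
    have fin: "finite Y" using F(1)[of i] by (simp add: simple_function_def Y_def)
    have meas: "F i -` {y} \<in> sets borel" for y
      using measurable_sets[OF Fm[of i], of "{y}"] by simp
    define g where "g Z t = (\<Sum>y\<in>Z. y * indicator (F i -` {y} \<inter> {- real i..real i}) t)" for Z t
    have si: "sqi (indicator (F i -` {y} \<inter> {- real i..real i}))" for y
      by (rule sqi_indicator_bounded[of _ "- real i" "real i"]) (use meas in auto)
    have "sqi (g Z) \<and> abs_L2 (g Z) \<in> M" if "finite Z" for Z
      using that
    proof (induction rule: finite_induct)
      case empty then show ?case using zero by (simp add: g_def[abs_def] zero_L2_def)
    next
      case (insert y Z)
      have "g (insert y Z) = (\<lambda>t. y * indicator (F i -` {y} \<inter> {- real i..real i}) t + g Z t)"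
        unfolding g_def by (rule ext, rule sum.insert) (use insert in auto)
      moreover have "abs_L2 (\<lambda>t. y * indicator (F i -` {y} \<inter> {- real i..real i}) t) \<in> M"
        using scale[OF sets[OF meas[of y], of "real i"], of y] mulL_abs[OF bmeas_const si, of y] by (simp add: indL_def)
      ultimately show ?case using insert si sqi_cmult[OF si] by (auto simp: abs_L2_add intro!: add sqi_add)
    qed
    moreover have "f i = g Y"
    proof
      fix t
      have "g Y t = (\<Sum>y\<in>{F i t}. y * indicator (F i -` {y} \<inter> {- real i..real i}) t)"
        unfolding g_def by (rule sum.mono_neutral_right[OF fin]) (auto simp: Y_def indicator_def)
      then show "f i t = g Y t" by (auto simp: f_def indicator_def)
    qed
    ultimately show ?thesis using fin by simp
  qed
  have "(\<lambda>i. abs_L2 (f i)) \<longlonglongrightarrow> abs_L2 (rep_L2 x)"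
  proof (rule abs_L2_tendsto_dominated[where g="\<lambda>t. 2 * rep_L2 x t"])
    show "AE t in lborel. (\<lambda>i. f i t) \<longlonglongrightarrow> rep_L2 x t"
    proof (rule AE_I2)
      fix t
      obtain N where N: "\<bar>t\<bar> \<le> real N" using real_arch_simple by blast
      show "(\<lambda>i. f i t) \<longlonglongrightarrow> rep_L2 x t"
      proof (rule Lim_transform_eventually[OF F(2)])
        show "\<forall>\<^sub>F i in sequentially. F i t = f i t"
          using N by (intro eventually_sequentiallyI[of N]) (auto simp: f_def indicator_def abs_le_iff)
      qed
    qed
  qed (use fb fs in \<open>auto simp: norm_mult intro: sqi_cmult\<close>)
  then show ?thesis using closed_sequentially[OF \<open>closed M\<close>, of "\<lambda>i. abs_L2 (f i)"] fM by simp
qed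

text \<open>A uniform bound on the operators makes the set of good \<open>x\<close> closed, so
  convergence to the identity need only be tested on interval indicators.\<close>

lemma L2_closed_dense:
  assumes lin: "\<And>n. bounded_linear (F n)" and bd: "\<And>n x. norm (F n x) \<le> C * norm x"
    and comm: "\<And>n c x. F n (mulL (\<lambda>_. c) x) = mulL (\<lambda>_. c) (F n x)"
    and ind: "\<And>a b. a \<le> b \<Longrightarrow> (\<lambda>n. F n (indL {a..b})) \<longlonglongrightarrow> indL {a..b}"
  shows "(\<lambda>n::nat. F n x) \<longlonglongrightarrow> x"
proof -
  define M where "M = {x. (\<lambda>n. F n x) \<longlonglongrightarrow> x}"
  note l = bounded_linear.linear[OF lin]
  have "closed M"
    unfolding closed_sequential_limits
  proof (intro allI impI, elim conjE)
    fix y x assume y: "\<forall>k. y k \<in> M" and lim: "y \<longlonglongrightarrow> x"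
    \<comment> \<open>The shares of the three terms in the estimate below: 1 + 1 +
      \<open>max C 0\<close>.\<close>
    define C' where "C' = max C 0 + 2"
    have "C' > 0" by (auto simp: C'_def)
    show "x \<in> M"
      unfolding M_def mem_Collect_eq
    proof (rule LIMSEQ_I)
      fix e :: real assume "e > 0"
      obtain k where k: "norm (y k - x) < e / C'"
        using LIMSEQ_D[OF lim, of "e / C'"] \<open>e > 0\<close> \<open>C' > 0\<close> by auto
      obtain N where N: "\<And>n. n \<ge> N \<Longrightarrow> norm (F n (y k) - y k) < e / C'"
        using y LIMSEQ_D[of "\<lambda>n. F n (y k)" "y k" "e / C'"] \<open>e > 0\<close> \<open>C' > 0\<close> by (auto simp: M_def)
      show "\<exists>N. \<forall>n\<ge>N. norm (F n x - x) < e"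
      proof (intro exI allI impI)
        fix n assume n: "n \<ge> N"
        have "norm (F n x - x) = norm ((F n (y k) - y k) + (y k - x) - F n (y k - x))"
          by (simp add: linear_diff[OF l])
        also have "\<dots> \<le> norm (F n (y k) - y k) + norm (y k - x) + norm (F n (y k - x))"
          by (meson add_mono norm_triangle_ineq norm_triangle_ineq4 order_trans order_refl)
        also have "\<dots> < e / C' + e / C' + max C 0 * (e / C')"
        proof -
          have "norm (F n (y k - x)) \<le> max C 0 * norm (y k - x)"
            using bd[of n "y k - x"] by (smt (verit, best) mult_right_mono norm_ge_zero)
          also have "\<dots> \<le> max C 0 * (e / C')" using k by (intro mult_left_mono) auto
          finally show ?thesis using N[OF n] k by linarith
        qed
        also have "\<dots> = C' * (e / C')" unfolding C'_def by (simp only: distrib_right)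
        also have "\<dots> = e" using \<open>C' > 0\<close> by simp
        finally show "norm (F n x - x) < e" .
      qed
    qed
  qed
  then have "x \<in> M"
  proof (rule L2_dense_intervals)
    show "x + y \<in> M" if "x \<in> M" "y \<in> M" for x y
      using that unfolding M_def by (auto simp: linear_add[OF l] intro: tendsto_add)
    show "mulL (\<lambda>_. c) x \<in> M" if "x \<in> M" for c x
      using that unfolding M_def by (auto simp: comm intro: bounded_linear.tendsto[OF bounded_linear_mulL])
  qed (use ind in \<open>auto simp: M_def\<close>)
  then show ?thesis by (simp add: M_def)
qed

text \<open>Translations are isometries, so convergence at 0 need only be checked on interval
  indicators, where it is pointwise off the two end points. Continuity elsewhere follows from the
  group law.\<close>

lemma shiftL_continuous: "isCont (\<lambda>h. shiftL h x) h0"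
proof -
  have 0: "(\<lambda>n. shiftL (s n) x) \<longlonglongrightarrow> x" if s: "s \<longlonglongrightarrow> 0" "\<And>n. norm (s n) \<le> 1" for s :: "nat \<Rightarrow> real" and x
  proof (rule L2_closed_dense[where C=1])
    fix a b :: real assume "a \<le> b"
    have ib: "sqi (indicator {a..b})" by (rule sqi_indicator_bounded) auto
    show "(\<lambda>n. shiftL (s n) (indL {a..b})) \<longlonglongrightarrow> indL {a..b}"
      unfolding indL_def shiftL_abs[OF ib]
    proof (rule abs_L2_tendsto_dominated[where g="indicator {a-1..b+1}"])
      have "AE t in lborel. t \<noteq> a \<and> t \<noteq> b"
        using AE_lborel_singleton[of a] AE_lborel_singleton[of b] by eventually_elim auto
      then show "AE t in lborel. (\<lambda>n. indicator {a..b} (t + s n) :: complex) \<longlonglongrightarrow> indicator {a..b} t"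
      proof eventually_elim
        case (elim t)
        have lim: "(\<lambda>n. t + s n) \<longlonglongrightarrow> t + 0" by (intro tendsto_intros s)
        consider "t < a" | "a < t \<and> t < b" | "b < t" using elim by linarith
        then show ?case
        proof cases
          case 1
          then have "\<forall>\<^sub>F n in sequentially. t + s n < a" using order_tendstoD(2)[OF lim] by simp
          then show ?thesis using 1 by (intro tendsto_eventually) (auto elim: eventually_mono simp: indicator_def)
        next
          case 2
          then have "\<forall>\<^sub>F n in sequentially. a < t + s n" "\<forall>\<^sub>F n in sequentially. t + s n < b"
            using order_tendstoD[OF lim] by simp_all
          then show ?thesis using 2 by (intro tendsto_eventually) (auto elim: eventually_elim2 simp: indicator_def)
        next
          case 3
          then have "\<forall>\<^sub>F n in sequentially. b < t + s n" using order_tendstoD(1)[OF lim] by simp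
          then show ?thesis using 3 by (intro tendsto_eventually) (auto elim: eventually_mono simp: indicator_def)
        qed
      qed
      show "AE t in lborel. norm (indicator {a..b} (t + s n) :: complex) \<le> norm (indicator {a-1..b+1} t :: complex)" for n
        using s(2)[of n] by (auto simp: indicator_def abs_le_iff)
      show "sqi (indicator {a-1..b+1})" by (rule sqi_indicator_bounded) auto
    qed (use ib in \<open>auto intro: sqi_shift\<close>)
  qed (auto simp: bounded_linear_shiftL shiftL_mulL)
  have lim0: "((\<lambda>h. shiftL h y) \<longlongrightarrow> y) (at 0)" for y
    unfolding tendsto_at_iff_sequentially
  proof (intro allI impI)
    fix s :: "nat \<Rightarrow> real" assume "\<forall>i. s i \<in> UNIV - {0}" and s: "s \<longlonglongrightarrow> 0"
    \<comment> \<open>Increments clipped to [-1, 1] admit one dominating indicator for the whole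
      sequence; a null sequence is eventually unaffected by the clipping.\<close>
    define s' where "s' n = max (-1) (min 1 (s n))" for n
    have "(\<lambda>n. max (-1) (min 1 (s n))) \<longlonglongrightarrow> max (-1) (min 1 0)" by (intro tendsto_intros s)
    then have "s' \<longlonglongrightarrow> 0" by (simp add: s'_def[abs_def])
    then have "(\<lambda>n. shiftL (s' n) y) \<longlonglongrightarrow> y" by (rule 0) (auto simp: s'_def)
    moreover have "\<forall>\<^sub>F n in sequentially. shiftL (s' n) y = shiftL (s n) y"
    proof -
      have "\<forall>\<^sub>F n in sequentially. -1 < s n" "\<forall>\<^sub>F n in sequentially. s n < 1" using order_tendstoD[OF s] by auto
      then show ?thesis by eventually_elim (auto simp: s'_def)
    qed
    ultimately show "((\<lambda>h. shiftL h y) \<circ> s) \<longlonglongrightarrow> y" unfolding o_def by (rule Lim_transform_eventually)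
  qed
  have "((\<lambda>h. shiftL h (shiftL h0 x)) \<longlongrightarrow> shiftL h0 x) (at 0)" by (rule lim0)
  then show ?thesis unfolding isCont_def by (subst LIM_offset_zero_iff[of h0]) (auto simp: shiftL_shiftL add.commute)
qed

subsection \<open>Convolution\<close>

text \<open>Square integrability gives values of the convolution at single points and their
  continuity; integrability gives its boundedness as an operator on \<open>L2\<close>.\<close>

definition kern :: "(real \<Rightarrow> complex) \<Rightarrow> bool" where
  "kern k \<longleftrightarrow> sqi k \<and> integrable lborel k"

definition kref :: "(real \<Rightarrow> complex) \<Rightarrow> L2" where "kref k = abs_L2 (\<lambda>s. k (- s))"

text \<open>Convolution with a square integrable kernel is defined at every point, not only almost everywhere.\<close>

definition conv :: "(real \<Rightarrow> complex) \<Rightarrow> L2 \<Rightarrow> real \<Rightarrow> complex" where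
  "conv k x t = pairL (shiftL (- t) (kref k)) x"

lemma conv_eq: "sqi k \<Longrightarrow> conv k x t = (LINT s|lborel. k (t - s) * rep_L2 x s)"
  unfolding conv_def kref_def
  by (simp add: shiftL_abs sqi_reflect pairL_abs_left sqi_shift[OF sqi_reflect, of k "-t", simplified])

lemma conv_add: "conv k (x + y) t = conv k x t + conv k y t"
  by (simp add: conv_def pairL_add_right)

lemma conv_scaleR: "conv k (c *\<^sub>R x) t = c *\<^sub>R conv k x t"
  by (simp add: conv_def pairL_scaleR_right)

lemma conv_const: "conv k (mulL (\<lambda>_. c) x) t = c * conv k x t"
  by (simp add: conv_def pairL_const)

lemma conv_shiftL: "conv k (shiftL h x) t = conv k x (t + h)"
  using pairL_shiftL[of h "shiftL (- t - h) (kref k)" x] by (simp add: conv_def shiftL_shiftL)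

lemma bounded_linear_conv: "bounded_linear (\<lambda>x. conv k x t)"
  unfolding conv_def by (rule bounded_bilinear.bounded_linear_right[OF bounded_bilinear_pairL])

text \<open>The modulus of continuity depends on \<open>x\<close> only through its norm. This
  equicontinuity is what makes convolutions, seen through a bounded window, compact.\<close>

lemma norm_conv_diff_le: "norm (conv k x t - conv k x t') \<le> norm (shiftL (t' - t) (kref k) - kref k) * norm x"
proof -
  have "conv k x t - conv k x t' = pairL (shiftL (- t') (shiftL (t' - t) (kref k) - kref k)) x"
    by (simp add: conv_def shiftL_shiftL linear_diff[OF bounded_linear.linear[OF bounded_linear_shiftL]]
        bounded_bilinear.diff_left[OF bounded_bilinear_pairL])
  then show ?thesis using norm_pairL_le[of "shiftL (- t') (shiftL (t' - t) (kref k) - kref k)" x] by simp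
qed

lemma conv_continuous: "continuous_on S (conv k x)"
proof -
  have "isCont (\<lambda>t. shiftL (- t) (kref k)) t" for t
    by (rule isCont_o2[OF _ shiftL_continuous]) (intro continuous_intros)
  then have "isCont (\<lambda>t. pairL (shiftL (- t) (kref k)) x) t" for t
    by (rule bounded_linear.isCont[OF bounded_bilinear.bounded_linear_left[OF bounded_bilinear_pairL]])
  then show ?thesis unfolding conv_def[abs_def] by (simp add: continuous_at_imp_continuous_on)
qed

lemma conv_measurable [measurable]: "conv k x \<in> borel_measurable borel"
  by (rule borel_measurable_continuous_onI[OF conv_continuous])

lemma nn_integral_reflect:
  fixes g :: "real \<Rightarrow> ennreal"
  assumes [measurable]: "g \<in> borel_measurable borel"
  shows "(\<integral>\<^sup>+s. g (t - s) \<partial>lborel) = (\<integral>\<^sup>+s. g s \<partial>lborel)"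
  using nn_integral_real_affine[of g "-1" t] by simp

text \<open>Young's inequality: write \<open>|k| |x|\<close> as \<open>sqrt |k|\<close> times
  \<open>sqrt |k| |x|\<close>, apply Cauchy-Schwarz for each \<open>t\<close> and integrate by
  Fubini's theorem.\<close>

lemma nn_conv_le:
  assumes k: "kern k"
  shows "(\<integral>\<^sup>+t. ennreal ((norm (conv k x t))\<^sup>2) \<partial>lborel) \<le> ennreal (((LINT s|lborel. norm (k s)) * norm x)\<^sup>2)"
proof -
  have [measurable]: "k \<in> borel_measurable borel" using k by (simp add: kern_def sqi_def)
  have sk: "sqi k" and ik: "integrable lborel k" using k by (auto simp: kern_def)
  define K where "K = (LINT s|lborel. norm (k s))"
  have nK: "(\<integral>\<^sup>+s. ennreal (norm (k s)) \<partial>lborel) = ennreal K"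
    unfolding K_def by (rule nn_integral_eq_integral) (use ik in \<open>auto dest: integrable_norm\<close>)
  have K0: "K \<ge> 0" by (simp add: K_def)
  define x' where "x' s = norm (rep_L2 x s)" for s
  have [measurable]: "x' \<in> borel_measurable borel" unfolding x'_def[abs_def] by measurable
  have pt: "ennreal ((norm (conv k x t))\<^sup>2) \<le> ennreal K * (\<integral>\<^sup>+s. ennreal (norm (k (t - s))) * ennreal ((x' s)\<^sup>2) \<partial>lborel)" for t
  proof -
    have int: "integrable lborel (\<lambda>s. k (t - s) * rep_L2 x s)"
      by (rule integrable_sqi_mult) (use sqi_shift[OF sqi_reflect[OF sk], of "-t"] in simp_all)
    have "norm (conv k x t) \<le> (LINT s|lborel. norm (k (t - s)) * x' s)"
      unfolding conv_eq[OF sk] x'_def using integral_norm_bound[of lborel "\<lambda>s. k (t - s) * rep_L2 x s"] by (simp add: norm_mult)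
    then have "ennreal (norm (conv k x t)) \<le> ennreal (LINT s|lborel. norm (k (t - s)) * x' s)" by (rule ennreal_leI)
    also have "\<dots> = (\<integral>\<^sup>+s. ennreal (norm (k (t - s)) * x' s) \<partial>lborel)"
      by (rule nn_integral_eq_integral[symmetric]) (use integrable_norm[OF int] in \<open>auto simp: norm_mult x'_def\<close>)
    also have "\<dots> = (\<integral>\<^sup>+s. ennreal (sqrt (norm (k (t - s)))) * ennreal (sqrt (norm (k (t - s))) * x' s) \<partial>lborel)"
      by (intro nn_integral_cong) (simp add: ennreal_mult[symmetric] x'_def mult.assoc[symmetric])
    finally have "ennreal (norm (conv k x t)) ^ 2 \<le> (\<integral>\<^sup>+s. ennreal (sqrt (norm (k (t - s)))) * ennreal (sqrt (norm (k (t - s))) * x' s) \<partial>lborel)^2"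
      by (rule power_mono_ennreal)
    also have "\<dots> \<le> (\<integral>\<^sup>+s. ennreal (sqrt (norm (k (t - s))))^2 \<partial>lborel) * (\<integral>\<^sup>+s. ennreal (sqrt (norm (k (t - s))) * x' s)^2 \<partial>lborel)"
      by (rule Cauchy_Schwarz_nn_integral) measurable
    also have "(\<integral>\<^sup>+s. ennreal (sqrt (norm (k (t - s))))^2 \<partial>lborel) = ennreal K"
      using nn_integral_reflect[of "\<lambda>s. ennreal (norm (k s))" t] by (simp add: ennreal_power nK)
    also have "(\<integral>\<^sup>+s. ennreal (sqrt (norm (k (t - s))) * x' s)^2 \<partial>lborel) = (\<integral>\<^sup>+s. ennreal (norm (k (t - s))) * ennreal ((x' s)\<^sup>2) \<partial>lborel)"
      by (intro nn_integral_cong) (simp add: ennreal_power x'_def power_mult_distrib ennreal_mult[symmetric])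
    finally show ?thesis by (simp add: ennreal_power)
  qed
  have "(\<integral>\<^sup>+t. ennreal ((norm (conv k x t))\<^sup>2) \<partial>lborel)
     \<le> (\<integral>\<^sup>+t. ennreal K * (\<integral>\<^sup>+s. ennreal (norm (k (t - s))) * ennreal ((x' s)\<^sup>2) \<partial>lborel) \<partial>lborel)"
    by (intro nn_integral_mono pt)
  also have "\<dots> = ennreal K * (\<integral>\<^sup>+t. (\<integral>\<^sup>+s. ennreal (norm (k (t - s))) * ennreal ((x' s)\<^sup>2) \<partial>lborel) \<partial>lborel)"
    by (rule nn_integral_cmult) measurable
  also have "(\<integral>\<^sup>+t. (\<integral>\<^sup>+s. ennreal (norm (k (t - s))) * ennreal ((x' s)\<^sup>2) \<partial>lborel) \<partial>lborel)
    = (\<integral>\<^sup>+s. (\<integral>\<^sup>+t. ennreal (norm (k (t - s))) * ennreal ((x' s)\<^sup>2) \<partial>lborel) \<partial>lborel)"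
    by (rule lborel_pair.Fubini'[symmetric]) measurable
  also have "\<dots> = (\<integral>\<^sup>+s. ennreal K * ennreal ((x' s)\<^sup>2) \<partial>lborel)"
  proof (rule nn_integral_cong)
    fix s
    have "(\<integral>\<^sup>+t. ennreal (norm (k (t - s))) * ennreal ((x' s)\<^sup>2) \<partial>lborel) = (\<integral>\<^sup>+t. ennreal (norm (k (t - s))) \<partial>lborel) * ennreal ((x' s)\<^sup>2)"
      by (rule nn_integral_multc) measurable
    also have "(\<integral>\<^sup>+t. ennreal (norm (k (t - s))) \<partial>lborel) = ennreal K"
      using nn_integral_real_affine[of "\<lambda>t. ennreal (norm (k t))" 1 "-s"] nK by (simp add: )
    finally show "(\<integral>\<^sup>+t. ennreal (norm (k (t - s))) * ennreal ((x' s)\<^sup>2) \<partial>lborel) = ennreal K * ennreal ((x' s)\<^sup>2)" .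
  qed
  also have "\<dots> = ennreal K * ennreal ((norm x)\<^sup>2)"
    by (subst nn_integral_cmult) (auto simp: x'_def nn_norm_L2_sq)
  also have "ennreal K * (ennreal K * ennreal ((norm x)\<^sup>2)) = ennreal ((K * norm x)\<^sup>2)"
    using K0 by (simp add: ennreal_mult[symmetric] power2_eq_square mult_ac)
  finally show ?thesis by (simp add: K_def)
qed

lemma sqi_conv: "kern k \<Longrightarrow> sqi (conv k x)"
  by (rule sqiI_nn) (auto intro: le_less_trans[OF nn_conv_le])

definition convL :: "(real \<Rightarrow> complex) \<Rightarrow> L2 \<Rightarrow> L2" where
  "convL k x = abs_L2 (conv k x)"

lemma norm_convL_le: "kern k \<Longrightarrow> norm (convL k x) \<le> (LINT s|lborel. norm (k s)) * norm x"
  unfolding convL_def by (rule norm_L2_leI[OF sqi_conv nn_conv_le]) auto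

lemma rep_convL: "kern k \<Longrightarrow> AE t in lborel. rep_L2 (convL k x) t = conv k x t"
  unfolding convL_def by (rule rep_abs_L2[OF sqi_conv])

lemma bounded_linear_convL:
  assumes "kern k" shows "bounded_linear (convL k)"
proof (rule bounded_linear_intro[where K="LINT s|lborel. norm (k s)"])
  fix x y r
  have "conv k (x + y) = (\<lambda>t. conv k x t + conv k y t)" by (simp add: conv_add fun_eq_iff)
  then show "convL k (x + y) = convL k x + convL k y"
    unfolding convL_def by (simp add: abs_L2_add sqi_conv assms)
  have "conv k (r *\<^sub>R x) = (\<lambda>t. r *\<^sub>R conv k x t)" by (simp add: conv_scaleR fun_eq_iff)
  then show "convL k (r *\<^sub>R x) = r *\<^sub>R convL k x"
    unfolding convL_def by (simp add: scaleR_L2.abs_eq sqi_conv assms)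
  show "norm (convL k x) \<le> norm x * (LINT s|lborel. norm (k s))"
    using norm_convL_le[OF assms, of x] by (simp add: mult.commute)
qed

lemma convL_const: "kern k \<Longrightarrow> convL k (mulL (\<lambda>_. c) x) = mulL (\<lambda>_. c) (convL k x)"
  unfolding convL_def by (simp add: mulL_abs sqi_conv) (rule arg_cong[where f=abs_L2], simp add: conv_const fun_eq_iff)

lemma convL_shiftL: "kern k \<Longrightarrow> convL k (shiftL h x) = shiftL h (convL k x)"
  unfolding convL_def by (simp add: shiftL_abs sqi_conv) (rule arg_cong[where f=abs_L2], simp add: conv_shiftL fun_eq_iff)

subsection \<open>Operators that are finite rank up to small norm\<close>

definition finrank :: "('a::real_normed_vector \<Rightarrow> 'b::real_normed_vector) \<Rightarrow> bool" where
  "finrank K \<longleftrightarrow> (\<exists>m l a. (\<forall>i<(m::nat). bounded_linear (l i :: 'a \<Rightarrow> real)) \<and> (\<forall>x. K x = (\<Sum>i<m. l i x *\<^sub>R a i)))"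

text \<open>Stands in for compactness. In this form stability under sums and compositions is
  immediate, and an approximation with error 1/2 is all that the Fredholm alternative asks
  for.\<close>

definition approximable :: "('a::real_normed_vector \<Rightarrow> 'b::real_normed_vector) \<Rightarrow> bool" where
  "approximable K \<longleftrightarrow> bounded_linear K \<and> (\<forall>e>0. \<exists>K'. finrank K' \<and> (\<forall>x. norm (K x - K' x) \<le> e * norm x))"

lemma bounded_linear_sum_scaleR:
  assumes "\<And>i. i < (m::nat) \<Longrightarrow> bounded_linear (l i)"
  shows "bounded_linear (\<lambda>x. \<Sum>i<m. l i x *\<^sub>R a i)"
  by (rule bounded_linear_sum) (use assms bounded_linear_scaleR_const in auto)

lemma finrank_bounded_linear: "finrank K \<Longrightarrow> bounded_linear K"
proof -
  assume "finrank K"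
  then obtain m l a where l: "\<And>i. i < m \<Longrightarrow> bounded_linear (l i :: 'a \<Rightarrow> real)" and K: "\<And>x. K x = (\<Sum>i<(m::nat). l i x *\<^sub>R a i)"
    unfolding finrank_def by blast
  have "K = (\<lambda>x. \<Sum>i<m. l i x *\<^sub>R a i)" using K by auto
  then show ?thesis using bounded_linear_sum_scaleR[of m l a, OF l] by simp
qed

lemma finrank_add:
  assumes "finrank K" "finrank K'" shows "finrank (\<lambda>x. K x + K' x)"
proof -
  obtain m l a where l: "\<And>i. i < m \<Longrightarrow> bounded_linear (l i :: 'a \<Rightarrow> real)" and K: "\<And>x. K x = (\<Sum>i<(m::nat). l i x *\<^sub>R a i)"
    using assms(1) unfolding finrank_def by blast
  obtain m' l' a' where l': "\<And>i. i < m' \<Longrightarrow> bounded_linear (l' i :: 'a \<Rightarrow> real)" and K': "\<And>x. K' x = (\<Sum>i<(m'::nat). l' i x *\<^sub>R a' i)"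
    using assms(2) unfolding finrank_def by blast
  define L where "L i = (if i < m then l i else l' (i - m))" for i
  define A where "A i = (if i < m then a i else a' (i - m))" for i
  have s: "(\<Sum>i<m + m'. f i) = (\<Sum>i<m. f i) + (\<Sum>i<m'. f (m + i))" for f :: "nat \<Rightarrow> 'b"
    by (induction m') (auto simp: add.assoc)
  have "K x + K' x = (\<Sum>i<m + m'. L i x *\<^sub>R A i)" for x
    unfolding s by (simp add: K K' L_def A_def)
  moreover have "bounded_linear (L i)" if "i < m + m'" for i using that l l' by (auto simp: L_def)
  ultimately show ?thesis unfolding finrank_def by blast
qed

lemma finrank_zero: "finrank (\<lambda>x. 0)"
  unfolding finrank_def by (rule exI[of _ 0]) auto

lemma finrank_sum: "finite I \<Longrightarrow> (\<And>i. i \<in> I \<Longrightarrow> finrank (K i)) \<Longrightarrow> finrank (\<lambda>x. \<Sum>i\<in>I. K i x)"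
  by (induction rule: finite_induct) (auto intro: finrank_zero finrank_add)

lemma finrank_rank1: "bounded_linear (l :: 'a::real_normed_vector \<Rightarrow> real) \<Longrightarrow> finrank (\<lambda>x. l x *\<^sub>R a)"
  unfolding finrank_def by (intro exI[of _ 1] exI[of _ "\<lambda>_. l"] exI[of _ "\<lambda>_. a"]) auto

lemma finrank_compose_left:
  assumes "finrank K" "bounded_linear B" shows "finrank (\<lambda>x. B (K x))"
proof -
  obtain m l a where l: "\<And>i. i < m \<Longrightarrow> bounded_linear (l i :: 'a \<Rightarrow> real)" and K: "\<And>x. K x = (\<Sum>i<(m::nat). l i x *\<^sub>R a i)"
    using assms(1) unfolding finrank_def by blast
  have "B (K x) = (\<Sum>i<m. l i x *\<^sub>R B (a i))" for x
    using bounded_linear.linear[OF assms(2)] by (simp add: K linear_sum linear_scale)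
  then show ?thesis using l unfolding finrank_def by (intro exI[of _ m] exI[of _ l] exI[of _ "\<lambda>i. B (a i)"]) auto
qed

lemma finrank_compose_right:
  assumes "finrank K" "bounded_linear B" shows "finrank (\<lambda>x. K (B x))"
proof -
  obtain m l a where l: "\<And>i. i < m \<Longrightarrow> bounded_linear (l i)" and K: "\<And>x. K x = (\<Sum>i<(m::nat). l i x *\<^sub>R a i)"
    using assms(1) unfolding finrank_def by blast
  have "bounded_linear (\<lambda>x. l i (B x))" if "i < m" for i using bounded_linear_compose[OF l[OF that] assms(2)] .
  then show ?thesis unfolding finrank_def K by (intro exI[of _ m] exI[of _ "\<lambda>i x. l i (B x)"] exI[of _ a]) auto
qed

lemma approximable_bounded_linear: "approximable K \<Longrightarrow> bounded_linear K"
  by (simp add: approximable_def)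

lemma approximable_add:
  assumes "approximable K" "approximable L" shows "approximable (\<lambda>x. K x + L x)"
  unfolding approximable_def
proof (intro conjI allI impI)
  show "bounded_linear (\<lambda>x. K x + L x)" using assms by (intro bounded_linear_add) (auto simp: approximable_def)
  fix e :: real assume "e > 0"
  then obtain K' L' where "finrank K'" "finrank L'" and b: "\<And>x. norm (K x - K' x) \<le> e/2 * norm x" "\<And>x. norm (L x - L' x) \<le> e/2 * norm x"
    using assms unfolding approximable_def by (metis half_gt_zero)
  then show "\<exists>K'. finrank K' \<and> (\<forall>x. norm (K x + L x - K' x) \<le> e * norm x)"
  proof (intro exI conjI allI)
    fix x
    have "K x + L x - (K' x + L' x) = (K x - K' x) + (L x - L' x)" by simp
    then have "norm (K x + L x - (K' x + L' x)) \<le> norm (K x - K' x) + norm (L x - L' x)" using norm_triangle_ineq by metis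
    also have "\<dots> \<le> e/2 * norm x + e/2 * norm x" by (intro add_mono b)
    finally show "norm (K x + L x - (K' x + L' x)) \<le> e * norm x" by simp
  qed (rule finrank_add)
qed

lemma approximable_zero: "approximable (\<lambda>x. 0)"
  unfolding approximable_def using finrank_zero by fastforce

lemma approximable_sum: "finite I \<Longrightarrow> (\<And>i. i \<in> I \<Longrightarrow> approximable (K i)) \<Longrightarrow> approximable (\<lambda>x. \<Sum>i\<in>I. K i x)"
  by (induction rule: finite_induct) (auto intro: approximable_zero approximable_add)

lemma approximable_compose_left:
  assumes "approximable K" "bounded_linear B" shows "approximable (\<lambda>x. B (K x))"
  unfolding approximable_def
proof (intro conjI allI impI)
  show "bounded_linear (\<lambda>x. B (K x))" using bounded_linear_compose[OF assms(2) approximable_bounded_linear[OF assms(1)]] .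
  fix e :: real assume "e > 0"
  obtain C where C: "C > 0" "\<And>x. norm (B x) \<le> norm x * C" using bounded_linear.pos_bounded[OF assms(2)] by blast
  from \<open>e > 0\<close> C(1) obtain K' where K': "finrank K'" "\<And>x. norm (K x - K' x) \<le> e / C * norm x"
    using assms(1) unfolding approximable_def by (metis divide_pos_pos)
  show "\<exists>K'. finrank K' \<and> (\<forall>x. norm (B (K x) - K' x) \<le> e * norm x)"
  proof (intro exI conjI allI)
    fix x
    have "norm (B (K x) - B (K' x)) = norm (B (K x - K' x))" using bounded_linear.linear[OF assms(2)] by (simp add: linear_diff)
    also have "\<dots> \<le> norm (K x - K' x) * C" by (rule C)
    also have "\<dots> \<le> e / C * norm x * C" using C(1) by (intro mult_right_mono K') auto
    finally show "norm (B (K x) - B (K' x)) \<le> e * norm x" using C(1) by simp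
  qed (rule finrank_compose_left[OF K'(1) assms(2)])
qed

lemma approximable_compose_right:
  assumes "approximable K" "bounded_linear B" shows "approximable (\<lambda>x. K (B x))"
  unfolding approximable_def
proof (intro conjI allI impI)
  show "bounded_linear (\<lambda>x. K (B x))" using bounded_linear_compose[OF approximable_bounded_linear[OF assms(1)] assms(2)] .
  fix e :: real assume "e > 0"
  obtain C where C: "C > 0" "\<And>x. norm (B x) \<le> norm x * C" using bounded_linear.pos_bounded[OF assms(2)] by blast
  from \<open>e > 0\<close> C(1) obtain K' where K': "finrank K'" "\<And>x. norm (K x - K' x) \<le> e / C * norm x"
    using assms(1) unfolding approximable_def by (metis divide_pos_pos)
  show "\<exists>K'. finrank K' \<and> (\<forall>x. norm (K (B x) - K' x) \<le> e * norm x)"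
  proof (intro exI conjI allI)
    fix x
    have "norm (K (B x) - K' (B x)) \<le> e / C * norm (B x)" by (rule K')
    also have "\<dots> \<le> e / C * (norm x * C)" using C \<open>e > 0\<close> by (intro mult_left_mono) auto
    finally show "norm (K (B x) - K' (B x)) \<le> e * norm x" using C(1) by simp
  qed (rule finrank_compose_right[OF K'(1) assms(2)])
qed

subsection \<open>Neumann inversion\<close>

text \<open>\<open>N y\<close> is the fixed point of the contraction
  \<open>x \<mapsto> y + K x\<close>; uniqueness of fixed points yields the linearity of
  \<open>N\<close>.\<close>

lemma neumann_inverse:
  fixes K :: "'a::banach \<Rightarrow> 'a"
  assumes K: "bounded_linear K" and q: "q < 1" "\<And>x. norm (K x) \<le> q * norm x"
  obtains N where "bounded_linear N" "\<And>y. N y = y + K (N y)" "\<And>x y. x = y + K x \<Longrightarrow> x = N y"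
proof -
  note l = bounded_linear.linear[OF K]
  \<comment> \<open>A negative \<open>q\<close> forces the space to be trivial; the fixed point
    theorem wants a nonnegative constant in any case.\<close>
  define q' where "q' = max q 0"
  have q': "0 \<le> q'" "q' < 1" "norm (K x) \<le> q' * norm x" for x
    using q(1) order_trans[OF q(2)[of x] mult_right_mono[of q "max q 0" "norm x"]] by (auto simp: q'_def)
  have uniq: "\<exists>!x. y + K x = x" for y
    by (rule banach_fix_type[OF q'(1,2)]) (use q'(3) in \<open>simp add: dist_norm linear_diff[OF l, symmetric]\<close>)
  define N where "N y = (THE x. y + K x = x)" for y
  have N: "N y = y + K (N y)" for y
    using theI'[of "\<lambda>x. y + K x = x"] uniq[of y] by (simp add: N_def)
  have U: "x = N y" if "x = y + K x" for x y
    using uniq[of y] that N[of y] by metis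
  have "bounded_linear N"
  proof (rule bounded_linear_intro[where K="1 / (1 - q')"])
    fix x y r
    show "N (x + y) = N x + N y"
    proof (rule U[symmetric])
      have "N x + N y = (x + K (N x)) + (y + K (N y))" using N by metis
      then show "N x + N y = x + y + K (N x + N y)" by (rule trans) (simp add: linear_add[OF l])
    qed
    show "N (r *\<^sub>R x) = r *\<^sub>R N x"
    proof (rule U[symmetric])
      have "r *\<^sub>R N x = r *\<^sub>R (x + K (N x))" using N by metis
      then show "r *\<^sub>R N x = r *\<^sub>R x + K (r *\<^sub>R N x)" by (rule trans) (simp add: linear_scale[OF l] scaleR_add_right)
    qed
    have "norm (N x) \<le> norm x + norm (K (N x))" using N[of x] norm_triangle_ineq by metis
    also have "\<dots> \<le> norm x + q' * norm (N x)" using q' by simp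
    finally have "(1 - q') * norm (N x) \<le> norm x" by (simp add: algebra_simps)
    then show "norm (N x) \<le> norm x * (1 / (1 - q'))" using q' by (simp add: pos_le_divide_eq mult.commute)
  qed
  then show thesis using that N U by blast
qed

subsection \<open>The Fredholm alternative\<close>

text \<open>For a finite rank \<open>K'\<close> with \<open>K - K'\<close> of norm at most 1/2, the
  operator \<open>I - (K - K')\<close> has an inverse \<open>N\<close>, and composing with
  \<open>N\<close> turns \<open>I - K\<close> into the identity minus finite rank. If the
  functionals of \<open>K'\<close> vanish at \<open>N y\<close>, then \<open>N y\<close> is even a
  preimage of \<open>y\<close> under \<open>I - K\<close>.\<close>

lemma approximable_split:
  fixes K :: "'a::banach \<Rightarrow> 'a"
  assumes "approximable K"
  obtains N m l a where "bounded_linear N" "\<And>i. i < (m::nat) \<Longrightarrow> bounded_linear (l i :: 'a \<Rightarrow> real)"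
    "\<And>x. N (x - K x) = x - (\<Sum>i<m. l i x *\<^sub>R a i)"
    "\<And>y. (\<forall>i<m. l i (N y) = 0) \<Longrightarrow> y = N y - K (N y)"
    "surj N"
proof -
  have "\<exists>K'. finrank K' \<and> (\<forall>x. norm (K x - K' x) \<le> (1/2) * norm x)"
    using assms unfolding approximable_def by (meson half_gt_zero zero_less_one)
  then obtain K' where K': "finrank K'" "\<And>x. norm (K x - K' x) \<le> (1/2) * norm x" by blast
  obtain m l a where l: "\<And>i. i < m \<Longrightarrow> bounded_linear (l i)" and Ka: "\<And>x. K' x = (\<Sum>i<(m::nat). l i x *\<^sub>R a i)"
    using K'(1) unfolding finrank_def by blast
  have bl: "bounded_linear (\<lambda>x. K x - K' x)"
    by (intro bounded_linear_sub approximable_bounded_linear assms finrank_bounded_linear K')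
  obtain N where N: "bounded_linear N" "\<And>y. N y = y + (K (N y) - K' (N y))" "\<And>x y. x = y + (K x - K' x) \<Longrightarrow> x = N y"
    using neumann_inverse[OF bl, of "1/2"] K'(2) by auto
  note lin = bounded_linear.linear[OF N(1)]
  show thesis
  proof (rule that[of N m l "\<lambda>i. N (a i)"])
    show "N (x - K x) = x - (\<Sum>i<m. l i x *\<^sub>R N (a i))" for x
    proof -
      have "x = N (x - K x + K' x)" by (rule N(3)) simp
      also have "\<dots> = N (x - K x) + N (K' x)" by (rule linear_add[OF lin])
      also have "N (K' x) = (\<Sum>i<m. l i x *\<^sub>R N (a i))" by (simp add: Ka linear_sum[OF lin] linear_scale[OF lin])
      finally show ?thesis by (simp add: algebra_simps)
    qed
    show "y = N y - K (N y)" if "\<forall>i<m. l i (N y) = 0" for y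
      using N(2)[of y] that by (simp add: Ka algebra_simps)
    show "surj N"
    proof (rule surjI)
      fix x show "N (x - (K x - K' x)) = x" by (rule N(3)[symmetric]) simp
    qed
  qed (use N l in auto)
qed

text \<open>Everything happens in the span \<open>V\<close> of the \<open>a i\<close>:
  \<open>F x\<close> and \<open>x\<close> differ by an element of \<open>V\<close>, so a surjective
  \<open>F\<close> maps \<open>V\<close> onto itself and its kernel lies in \<open>V\<close>. There
  dimension counting decides.\<close>

lemma finite_rank_surj_imp_inj:
  fixes F :: "'a::real_vector \<Rightarrow> 'a"
  assumes lin: "\<And>i. i < (m::nat) \<Longrightarrow> linear (l i :: 'a \<Rightarrow> real)"
    and F: "\<And>x. F x = x - (\<Sum>i<m. l i x *\<^sub>R a i)"
    and surj: "surj F" and ker: "F x = 0"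
  shows "x = 0"
proof -
  define V where "V = span (a ` {..<m})"
  have linF: "linear F"
  proof -
    have "linear (\<lambda>x. x - (\<Sum>i<m. l i x *\<^sub>R a i))"
      by (intro linear_compose_sub linear_id[unfolded id_def] linear_compose_sum ballI)
        (use lin in \<open>auto intro!: linearI simp: linear_add linear_scale scaleR_left_distrib\<close>)
    moreover have "F = (\<lambda>x. x - (\<Sum>i<m. l i x *\<^sub>R a i))" using F by auto
    ultimately show ?thesis by simp
  qed
  have RV: "(\<Sum>i<m. l i y *\<^sub>R a i) \<in> V" for y
    unfolding V_def by (intro span_sum span_scale span_base) auto
  have VF: "F y \<in> V \<longleftrightarrow> y \<in> V" for y
  proof
    assume "F y \<in> V"
    then have "F y + (\<Sum>i<m. l i y *\<^sub>R a i) \<in> V" using RV unfolding V_def by (intro span_add)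
    then show "y \<in> V" by (simp add: F)
  next
    assume "y \<in> V" then show "F y \<in> V" unfolding F using RV unfolding V_def by (intro span_diff)
  qed
  obtain B where B: "B \<subseteq> a ` {..<m}" "independent B" "a ` {..<m} \<subseteq> span B"
    using maximal_independent_subset[of "a ` {..<m}"] by blast
  have fB: "finite B" using B(1) finite_subset by blast
  have VB: "V = span B" unfolding V_def using B(1,3) by (metis span_mono span_span subset_antisym span_minimal subspace_span)
  have "F ` V = V"
  proof safe
    fix v assume "v \<in> V"
    obtain y where "F y = v" using surj by (metis surjD)
    with \<open>v \<in> V\<close> VF show "v \<in> F ` V" by blast
  qed (use VF in auto)
  then have sp: "span (F ` B) = span B" using VB linear_span_image[OF linF, of B] by simp
  have "card B \<le> card (F ` B)"
    using independent_span_bound[of "F ` B" B] fB B(2) sp span_superset by fastforce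
  then have inj: "inj_on F B" using fB card_image_le[OF fB, of F] by (intro eq_card_imp_inj_on) auto
  \<comment> \<open>A dependent image would contain a smaller set that still spans
    \<open>span B\<close>, against the independence of \<open>B\<close>.\<close>
  have ind: "independent (F ` B)"
  proof
    assume "dependent (F ` B)"
    obtain C where C: "C \<subseteq> F ` B" "independent C" "F ` B \<subseteq> span C"
      using maximal_independent_subset[of "F ` B"] by blast
    have "C \<noteq> F ` B" using \<open>dependent (F ` B)\<close> C(2) by auto
    then have "card C < card (F ` B)" using C(1) fB by (intro psubset_card_mono) auto
    moreover have "span C = span B" using C sp by (metis span_mono span_span subset_antisym span_minimal subspace_span)
    moreover have "finite C" using C(1) fB finite_subset by blast
    ultimately have "card B \<le> card C" using independent_span_bound[of C B] B(2) span_superset by fastforce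
    with \<open>card C < card (F ` B)\<close> card_image_le[OF fB, of F] show False by simp
  qed
  have "x \<in> span B" using VF[of x] ker VB by (metis span_zero)
  moreover have "inj_on F (span B)"
    using linear_inj_on_span_iff_independent_image[OF linF ind] inj by (simp add: linear_independent_injective_image)
  moreover have "F 0 = 0" by (rule linear_0[OF linF])
  ultimately show ?thesis using ker inj_onD[of F "span B" x 0] span_zero by auto
qed

text \<open>The \<open>N\<close> of the splitting is onto, so surjectivity passes from
  \<open>I - K\<close> to the finite rank perturbation \<open>x \<mapsto> N (x - K x)\<close> of the
  identity, and its kernel contains that of \<open>I - K\<close>.\<close>

lemma fredholm_surj_imp_inj:
  fixes K :: "'a::banach \<Rightarrow> 'a"
  assumes "approximable K" and surj: "\<And>y. \<exists>x. x - K x = y" and ker: "K x = x"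
  shows "x = 0"
proof -
  obtain N m l a where N: "bounded_linear N" "\<And>i. i < (m::nat) \<Longrightarrow> bounded_linear (l i :: 'a \<Rightarrow> real)"
    "\<And>x. N (x - K x) = x - (\<Sum>i<m. l i x *\<^sub>R a i)"
    "\<And>y. (\<forall>i<m. l i (N y) = 0) \<Longrightarrow> y = N y - K (N y)" "surj N"
    by (rule approximable_split[OF assms(1)]) blast
  show ?thesis
  proof (rule finite_rank_surj_imp_inj[of m l "\<lambda>x. N (x - K x)" a])
    show "surj (\<lambda>x. N (x - K x))"
      using N(5) surj by (metis surjD surjI surj_def)
    show "N (x - K x) = 0" using ker linear_0[OF bounded_linear.linear[OF N(1)]] by simp
    show "linear (l i)" if "i < m" for i using bounded_linear.linear[OF N(2)[OF that]] .
  qed (use N(3) in auto)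
qed

subsection \<open>Strongly continuous semigroups\<close>

lemma uniform_boundedness:
  fixes F :: "'i \<Rightarrow> 'a::banach \<Rightarrow> 'b::real_normed_vector"
  assumes lin: "\<And>i. bounded_linear (F i)" and pt: "\<And>x. \<exists>C. \<forall>i. norm (F i x) \<le> C"
  shows "\<exists>C. \<forall>i x. norm (F i x) \<le> C * norm x"
proof -
  define T where "T m = {x. \<forall>i. norm (F i x) \<le> real m}" for m :: nat
  have cl: "closed (T m)" for m
  proof -
    have "T m = (\<Inter>i. {x. norm (F i x) \<le> real m})" by (auto simp: T_def)
    moreover have "closed {x. norm (F i x) \<le> real m}" for i
      by (intro closed_Collect_le continuous_intros bounded_linear.continuous_on[OF lin])
    ultimately show ?thesis by auto
  qed
  have cover: "(\<Union>m. T m) = UNIV"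
  proof -
    have "\<exists>m. x \<in> T m" for x
    proof -
      obtain C where "\<And>i. norm (F i x) \<le> C" using pt by blast
      moreover obtain m where "C \<le> real m" using real_arch_simple by blast
      ultimately show ?thesis unfolding T_def by (auto intro: order_trans)
    qed
    then show ?thesis by auto
  qed
  have "\<exists>m. interior (T m) \<noteq> {}"
  proof (rule ccontr)
    assume "\<not> ?thesis"
    then have "\<And>m. interior (T m) = {}" by auto
    then have "(euclidean :: 'a topology) interior_of (\<Union>(range T)) = {}"
      using Met_TC.metric_Baire_category_alt[of "range T"] cl
      by (auto simp: mcomplete_iff_complete complete_UNIV)
    then show False by (simp add: cover)
  qed
  then obtain m x r where r: "r > 0" "ball x r \<subseteq> T m"
    by (meson ex_in_conv mem_interior)
  have "norm (F i y) \<le> (4 * real m / r) * norm y" for i y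
  proof (cases "y = 0")
    case True then show ?thesis using linear_0[OF bounded_linear.linear[OF lin]] by simp
  next
    case False
    \<comment> \<open>Half the radius: \<open>x + c *\<^sub>R y\<close> stays in the ball on which
      all \<open>F i\<close> are bounded by \<open>m\<close>.\<close>
    define c where "c = r / (2 * norm y)"
    have c: "c > 0" using r False by (simp add: c_def)
    have "x + c *\<^sub>R y \<in> ball x r" "x \<in> ball x r" using r False by (auto simp: dist_norm c_def)
    then have "x + c *\<^sub>R y \<in> T m" "x \<in> T m" using r(2) by blast+
    then have *: "norm (F i (x + c *\<^sub>R y)) \<le> real m" "norm (F i x) \<le> real m" by (auto simp: T_def)
    have "c *\<^sub>R F i y = F i (x + c *\<^sub>R y) - F i x"
      using bounded_linear.linear[OF lin[of i]] by (simp add: linear_add linear_scale)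
    then have "norm (c *\<^sub>R F i y) \<le> real m + real m" using * norm_triangle_ineq4 by (metis add_mono order_trans)
    then have "norm (F i y) \<le> 2 * real m / c" using c by (simp add: field_simps)
    then show ?thesis using False r by (simp add: c_def field_simps)
  qed
  then show ?thesis by blast
qed

lemma has_vector_derivative_quotientI:
  fixes f :: "real \<Rightarrow> 'a::real_normed_vector"
  assumes "((\<lambda>y. (f y - f t) /\<^sub>R (y - t)) \<longlongrightarrow> d) (at t within A)"
  shows "(f has_vector_derivative d) (at t within A)"
  unfolding has_vector_derivative_def has_derivative_within
proof
  show "bounded_linear (\<lambda>h. h *\<^sub>R d)" by (rule bounded_linear_scaleR_left)
  show "((\<lambda>y. (1 / norm (y - t)) *\<^sub>R (f y - (f t + (y - t) *\<^sub>R d))) \<longlongrightarrow> 0) (at t within A)"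
  proof (rule Lim_null_comparison)
    show "\<forall>\<^sub>F y in at t within A. norm ((1 / norm (y - t)) *\<^sub>R (f y - (f t + (y - t) *\<^sub>R d))) \<le> norm ((f y - f t) /\<^sub>R (y - t) - d)"
      unfolding eventually_at_filter
    proof (rule always_eventually, intro allI impI)
      fix y :: real assume y: "y \<noteq> t"
      have "(f y - f t) /\<^sub>R (y - t) - d = (f y - (f t + (y - t) *\<^sub>R d)) /\<^sub>R (y - t)"
        using y by (simp add: scaleR_diff_right scaleR_add_right)
      then show "norm ((1 / norm (y - t)) *\<^sub>R (f y - (f t + (y - t) *\<^sub>R d))) \<le> norm ((f y - f t) /\<^sub>R (y - t) - d)"
        by (simp add: divide_inverse)
    qed
    show "((\<lambda>y. norm ((f y - f t) /\<^sub>R (y - t) - d)) \<longlongrightarrow> 0) (at t within A)"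
      using tendsto_norm[OF tendsto_diff[OF assms tendsto_const[of d]]] by simp
  qed
qed

locale c0_semigroup =
  fixes S :: "real \<Rightarrow> 'a::banach \<Rightarrow> 'a"
  assumes bl: "\<And>t. t \<ge> 0 \<Longrightarrow> bounded_linear (S t)"
    and zero: "S 0 x = x"
    and add: "\<And>t s. t \<ge> 0 \<Longrightarrow> s \<ge> 0 \<Longrightarrow> S (t + s) x = S t (S s x)"
    and strong: "((\<lambda>t. S t x) \<longlongrightarrow> x) (at_right 0)"
begin

text \<open>Otherwise the operator norms are unbounded along some null sequence of times, although
  every orbit is bounded along it; this contradicts uniform boundedness.\<close>

lemma bounded_near_0: "\<exists>d>0. \<exists>C. \<forall>t x. 0 \<le> t \<and> t \<le> d \<longrightarrow> norm (S t x) \<le> C * norm x"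
proof (rule ccontr)
  assume neg: "\<not> ?thesis"
  have "\<forall>n. \<exists>t x. 0 \<le> t \<and> t \<le> inverse (real (Suc n)) \<and> \<not> norm (S t x) \<le> real n * norm x"
  proof
    fix n
    have "inverse (real (Suc n)) > 0" by simp
    with neg have "\<not> (\<forall>t x. 0 \<le> t \<and> t \<le> inverse (real (Suc n)) \<longrightarrow> norm (S t x) \<le> real n * norm x)" by blast
    then show "\<exists>t x. 0 \<le> t \<and> t \<le> inverse (real (Suc n)) \<and> \<not> norm (S t x) \<le> real n * norm x" by blast
  qed
  then obtain t x where t: "\<And>n. 0 \<le> t n" "\<And>n. t n \<le> inverse (real (Suc n))" and x: "\<And>n. \<not> norm (S (t n) (x n)) \<le> real n * norm (x n)"
    by metis
  have t0: "t \<longlonglongrightarrow> 0"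
    by (rule tendsto_sandwich[OF _ _ tendsto_const LIMSEQ_inverse_real_of_nat]) (use t in auto)
  have "\<exists>C. \<forall>n. norm (S (t n) y) \<le> C" for y
  proof -
    have "continuous (at 0 within {0..}) (\<lambda>t. S t y)"
      using strong[of y] by (simp add: continuous_within zero at_within_Ici_at_right)
    then have "(\<lambda>n. S (t n) y) \<longlonglongrightarrow> S 0 y"
      using t0 t(1) unfolding continuous_within_sequentially by (auto simp: o_def)
    then have "Bseq (\<lambda>n. S (t n) y)" by (intro convergent_imp_Bseq convergentI)
    then show ?thesis unfolding Bseq_def by blast
  qed
  then obtain C where C: "\<And>n y. norm (S (t n) y) \<le> C * norm y"
    using uniform_boundedness[of "\<lambda>n. S (t n)"] bl t(1) by blast
  obtain n where "C \<le> real n" using real_arch_simple by blast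
  then have "norm (S (t n) (x n)) \<le> real n * norm (x n)"
    using C[of n "x n"] mult_right_mono[of C "real n" "norm (x n)"] by simp
  with x show False by blast
qed

lemma bounded_on: "\<exists>C. \<forall>t x. 0 \<le> t \<and> t \<le> T \<longrightarrow> norm (S t x) \<le> C * norm x"
proof -
  obtain d C where d: "d > 0" "\<And>t x. 0 \<le> t \<Longrightarrow> t \<le> d \<Longrightarrow> norm (S t x) \<le> C * norm x"
    using bounded_near_0 by blast
  have "\<exists>C'. \<forall>t x. 0 \<le> t \<and> t \<le> real n * d \<longrightarrow> norm (S t x) \<le> C' * norm x" for n
  proof (induction n)
    case 0
    then show ?case by (intro exI[of _ 1]) (auto simp: zero)
  next
    case (Suc n)
    then obtain C' where C': "\<And>t x. 0 \<le> t \<Longrightarrow> t \<le> real n * d \<Longrightarrow> norm (S t x) \<le> C' * norm x" by blast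
    show ?case
    proof (intro exI allI impI, elim conjE)
      fix t x assume t: "0 \<le> t" "t \<le> real (Suc n) * d"
      show "norm (S t x) \<le> (max C 0 * max C' 0 + max C' 0) * norm x"
      proof (cases "t \<le> real n * d")
        case True
        have "norm (S t x) \<le> max C' 0 * norm x"
          using C'[OF t(1) True] by (rule order_trans) (intro mult_right_mono, auto)
        then show ?thesis by (simp add: distrib_right add_increasing)
      next
        case False
        have nd: "0 \<le> real n * d" using d(1) by simp
        have t': "0 \<le> t - real n * d" "t - real n * d \<le> d" using t False by (auto simp: algebra_simps)
        have "S t x = S (t - real n * d) (S (real n * d) x)"
          using add[OF t'(1) nd] by simp
        also have "norm \<dots> \<le> C * norm (S (real n * d) x)" by (rule d(2)[OF t'])
        also have "\<dots> \<le> max C 0 * norm (S (real n * d) x)" by (intro mult_right_mono) auto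
        also have "\<dots> \<le> max C 0 * (max C' 0 * norm x)"
          using C'[OF nd order_refl, of x] mult_right_mono[of C' "max C' 0" "norm x"] by (intro mult_left_mono) auto
        finally show ?thesis by (simp add: distrib_right add_increasing2 mult.assoc)
      qed
    qed
  qed
  moreover obtain n where "T \<le> real n * d" using reals_Archimedean3[OF d(1)] by (metis less_imp_le)
  ultimately show ?thesis by (meson order_trans)
qed

lemma continuous_orbit: "continuous_on {0..} (\<lambda>t. S t x)"
  unfolding continuous_on_iff
proof (intro ballI allI impI)
  fix t e :: real assume t: "t \<in> {0..}" and e: "e > 0"
  obtain C where C: "\<And>s x. 0 \<le> s \<Longrightarrow> s \<le> t + 1 \<Longrightarrow> norm (S s x) \<le> C * norm x"
    using bounded_on[of "t + 1"] by blast
  define C' where "C' = max C 0 + 1"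
  have C': "C' > 0" "\<And>s x. 0 \<le> s \<Longrightarrow> s \<le> t + 1 \<Longrightarrow> norm (S s x) \<le> C' * norm x"
    by (auto simp: C'_def intro!: order_trans[OF C] mult_right_mono)
  have "\<forall>\<^sub>F h in at_right 0. dist (S h x) x < e / C'"
    using tendstoD[OF strong[of x]] e C' by auto
  then obtain d where d: "d > 0" "\<And>h. 0 < h \<Longrightarrow> h < d \<Longrightarrow> dist (S h x) x < e / C'"
    unfolding eventually_at_right_field by auto
  have main: "dist (S b x) (S a x) < e" if "0 \<le> a" "a \<le> b" "b - a < d" "a \<le> t + 1" for a b
  proof (cases "a = b")
    case False
    have "S b x - S a x = S a (S (b - a) x - x)"
      using add[of a "b - a" x] that bounded_linear.linear[OF bl[OF that(1)]] by (simp add: linear_diff)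
    then have "norm (S b x - S a x) \<le> C' * norm (S (b - a) x - x)" using C'(2)[OF that(1,4)] by simp
    also have "\<dots> < C' * (e / C')"
      using d(2)[of "b - a"] that False C' by (intro mult_strict_left_mono) (auto simp: dist_norm)
    also have "\<dots> = e" using C' by simp
    finally show ?thesis by (simp add: dist_norm)
  qed (use e in auto)
  show "\<exists>d>0. \<forall>t'\<in>{0..}. dist t' t < d \<longrightarrow> dist (S t' x) (S t x) < e"
  proof (intro exI[of _ "min d 1"] conjI ballI impI)
    fix t' :: real assume t': "t' \<in> {0..}" "dist t' t < min d 1"
    show "dist (S t' x) (S t x) < e"
    proof (cases "t \<le> t'")
      case True then show ?thesis using main[of t t'] t t' by (auto simp: dist_real_def)
    next
      case False then show ?thesis using main[of t' t] t t' by (auto simp: dist_real_def dist_commute)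
    qed
  qed (use d in auto)
qed

text \<open>The local norm bound allows the limits in time and in the vector to be taken at
  once.\<close>

lemma tendsto_joint:
  assumes "(\<tau> \<longlongrightarrow> t) F" "\<forall>\<^sub>F h in F. \<tau> h \<ge> 0" "t \<ge> 0" "(f \<longlongrightarrow> y) F"
  shows "((\<lambda>h. S (\<tau> h) (f h)) \<longlongrightarrow> S t y) F"
proof -
  obtain C where C: "\<And>s x. 0 \<le> s \<Longrightarrow> s \<le> t + 1 \<Longrightarrow> norm (S s x) \<le> C * norm x"
    using bounded_on[of "t + 1"] by blast
  have ev: "\<forall>\<^sub>F h in F. \<tau> h < t + 1" using order_tendstoD(2)[OF assms(1)] by simp
  have 1: "((\<lambda>h. S (\<tau> h) y) \<longlongrightarrow> S t y) F"
    by (rule continuous_on_tendsto_compose[OF continuous_orbit assms(1)]) (use assms in auto)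
  have 2: "((\<lambda>h. S (\<tau> h) (f h) - S (\<tau> h) y) \<longlongrightarrow> 0) F"
  proof (rule Lim_null_comparison)
    show "\<forall>\<^sub>F h in F. norm (S (\<tau> h) (f h) - S (\<tau> h) y) \<le> C * norm (f h - y)"
      using assms(2) ev
    proof eventually_elim
      case (elim h)
      then show ?case using C[of "\<tau> h" "f h - y"] bounded_linear.linear[OF bl[OF elim(1)]] by (simp add: linear_diff)
    qed
    have "((\<lambda>h. C * norm (f h - y)) \<longlongrightarrow> C * norm (y - y)) F" by (intro tendsto_intros assms)
    then show "((\<lambda>h. C * norm (f h - y)) \<longlongrightarrow> 0) F" by simp
  qed
  show ?thesis using tendsto_add[OF 2 1] by simp
qed

definition gen :: "'a \<Rightarrow> 'a \<Rightarrow> bool" where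
  "gen x w \<longleftrightarrow> ((\<lambda>h. (S h x - x) /\<^sub>R h) \<longlongrightarrow> w) (at_right 0)"

text \<open>On either side of \<open>t\<close> the quotient equals \<open>S (min y t)\<close>
  applied to the forward quotient of \<open>x\<close> with step \<open>\<bar>y - t\<bar>\<close>, so
  the right derivative at 0 suffices for the two-sided one.\<close>

lemma orbit_derivative:
  assumes "gen x w" "t \<ge> 0"
  shows "((\<lambda>y. (S y x - S t x) /\<^sub>R (y - t)) \<longlongrightarrow> S t w) (at t within {0..})"
proof -
  have ab: "filterlim (\<lambda>y. \<bar>y - t\<bar>) (at_right 0) (at t within {0..})"
    unfolding filterlim_at
  proof
    have "((\<lambda>y. \<bar>y - t\<bar>) \<longlongrightarrow> \<bar>t - t\<bar>) (at t within {0..})" by (intro tendsto_intros)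
    then show "((\<lambda>y. \<bar>y - t\<bar>) \<longlongrightarrow> 0) (at t within {0..})" by simp
    show "\<forall>\<^sub>F y in at t within {0..}. \<bar>y - t\<bar> \<in> {0<..} \<and> \<bar>y - t\<bar> \<noteq> 0"
      unfolding eventually_at_filter by simp
  qed
  have mn: "((\<lambda>y. min y t) \<longlongrightarrow> min t t) (at t within {0..})" by (intro tendsto_intros)
  have "((\<lambda>y. S (min y t) ((S \<bar>y - t\<bar> x - x) /\<^sub>R \<bar>y - t\<bar>)) \<longlongrightarrow> S t w) (at t within {0..})"
  proof (rule tendsto_joint)
    show "((\<lambda>y. min y t) \<longlongrightarrow> t) (at t within {0..})" using mn by simp
    show "\<forall>\<^sub>F y in at t within {0..}. 0 \<le> min y t" unfolding eventually_at_filter using assms(2) by simp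
    show "((\<lambda>y. (S \<bar>y - t\<bar> x - x) /\<^sub>R \<bar>y - t\<bar>) \<longlongrightarrow> w) (at t within {0..})"
      using filterlim_compose[OF assms(1)[unfolded gen_def] ab] by simp
  qed (rule assms)
  moreover have "\<forall>\<^sub>F y in at t within {0..}. S (min y t) ((S \<bar>y - t\<bar> x - x) /\<^sub>R \<bar>y - t\<bar>) = (S y x - S t x) /\<^sub>R (y - t)"
    unfolding eventually_at_filter
  proof (rule always_eventually, intro allI impI)
    fix y :: real assume y: "y \<noteq> t" "y \<in> {0..}"
    have lin: "linear (S (min y t))" using bl[of "min y t"] y assms(2) by (simp add: bounded_linear.linear)
    have a: "S (min y t) (S \<bar>y - t\<bar> x) = S (min y t + \<bar>y - t\<bar>) x" using add[of "min y t" "\<bar>y - t\<bar>" x] y assms(2) by simp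
    have e: "S (min y t) ((S \<bar>y - t\<bar> x - x) /\<^sub>R \<bar>y - t\<bar>) = (S (min y t + \<bar>y - t\<bar>) x - S (min y t) x) /\<^sub>R \<bar>y - t\<bar>"
      by (simp add: linear_scale[OF lin] linear_diff[OF lin] a)
    show "S (min y t) ((S \<bar>y - t\<bar> x - x) /\<^sub>R \<bar>y - t\<bar>) = (S y x - S t x) /\<^sub>R (y - t)"
    proof (cases "y < t")
      case True
      then have i: "inverse (y - t) = - inverse (t - y)" by (metis inverse_minus_eq minus_diff_eq)
      from True have "min y t + \<bar>y - t\<bar> = t" "min y t = y" "\<bar>y - t\<bar> = t - y" by auto
      with e i show ?thesis by (simp add: scaleR_diff_right)
    next
      case False
      with e show ?thesis by (simp add: min_def)
    qed
  qed
  ultimately show ?thesis by (rule Lim_transform_eventually)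
qed

text \<open>\<open>W\<close> is a classical solution of \<open>W' = A W + x0\<close> with
  \<open>W 0 = 0\<close>. In the derivative of \<open>S (T - s) (W s)\<close> the two generator
  terms cancel and \<open>S (T - s) x0\<close> remains, which is then integrated by the fundamental
  theorem.\<close>

theorem duhamel:
  assumes T: "T \<ge> 0"
    and W: "\<And>s. s \<in> {0..T} \<Longrightarrow> ((\<lambda>y. (W y - W s) /\<^sub>R (y - s)) \<longlongrightarrow> w s + x0) (at s within {0..T})"
    and g: "\<And>s. s \<in> {0..T} \<Longrightarrow> gen (W s) (w s)" and W0: "W 0 = 0"
  shows "((\<lambda>s. S (T - s) x0) has_integral W T) {0..T}"
proof -
  define q where "q s = S (T - s) (W s)" for s
  have "(q has_vector_derivative S (T - s) x0) (at s within {0..T})" if s: "s \<in> {0..T}" for s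
  proof (rule has_vector_derivative_quotientI)
    have refl: "filterlim (\<lambda>y. T - y) (at (T - s) within {0..}) (at s within {0..T})"
      unfolding filterlim_at
    proof
      show "((\<lambda>y. T - y) \<longlongrightarrow> T - s) (at s within {0..T})" by (intro tendsto_intros)
      show "\<forall>\<^sub>F y in at s within {0..T}. T - y \<in> {0..} \<and> T - y \<noteq> T - s"
        unfolding eventually_at_filter by simp
    qed
    have 1: "((\<lambda>y. S (T - y) ((W y - W s) /\<^sub>R (y - s))) \<longlongrightarrow> S (T - s) (w s + x0)) (at s within {0..T})"
      by (rule tendsto_joint[OF _ _ _ W[OF s]])
        (use s in \<open>auto simp: eventually_at_filter intro!: tendsto_intros\<close>)
    have 2: "((\<lambda>y. (S (T - y) (W s) - S (T - s) (W s)) /\<^sub>R ((T - y) - (T - s))) \<longlongrightarrow> S (T - s) (w s)) (at s within {0..T})"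
      using filterlim_compose[OF orbit_derivative[OF g[OF s], of "T - s"] refl] s by simp
    have lin: "linear (S (T - s))" using s bl by (simp add: bounded_linear.linear)
    have "((\<lambda>y. S (T - y) ((W y - W s) /\<^sub>R (y - s)) - (S (T - y) (W s) - S (T - s) (W s)) /\<^sub>R ((T - y) - (T - s)))
       \<longlongrightarrow> S (T - s) (w s + x0) - S (T - s) (w s)) (at s within {0..T})"
      by (rule tendsto_diff[OF 1 2])
    moreover have "S (T - s) (w s + x0) - S (T - s) (w s) = S (T - s) x0" by (simp add: linear_add[OF lin])
    moreover have "\<forall>\<^sub>F y in at s within {0..T}. S (T - y) ((W y - W s) /\<^sub>R (y - s)) - (S (T - y) (W s) - S (T - s) (W s)) /\<^sub>R ((T - y) - (T - s))
       = (q y - q s) /\<^sub>R (y - s)"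
      unfolding eventually_at_filter
    proof (rule always_eventually, intro allI impI)
      fix y :: real assume y: "y \<noteq> s" "y \<in> {0..T}"
      have lin: "linear (S (T - y))" using y bl by (simp add: bounded_linear.linear)
      have i: "inverse ((T - y) - (T - s)) = - inverse (y - s)" by (metis diff_diff_cancel inverse_minus_eq minus_diff_eq add_diff_cancel_left diff_diff_eq2 diff_add_cancel uminus_add_conv_diff add.commute)
      show "S (T - y) ((W y - W s) /\<^sub>R (y - s)) - (S (T - y) (W s) - S (T - s) (W s)) /\<^sub>R ((T - y) - (T - s)) = (q y - q s) /\<^sub>R (y - s)"
        unfolding i q_def by (simp add: linear_scale[OF lin] linear_diff[OF lin] scaleR_diff_right)
    qed
    ultimately show "((\<lambda>y. (q y - q s) /\<^sub>R (y - s)) \<longlongrightarrow> S (T - s) x0) (at s within {0..T})"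
      using Lim_transform_eventually by force
  qed
  then have "((\<lambda>s. S (T - s) x0) has_integral q T - q 0) {0..T}"
    by (rule fundamental_theorem_of_calculus[OF T])
  moreover have "q 0 = 0" using bl[OF T] by (simp add: q_def W0 bounded_linear.linear linear_0)
  moreover have "q T = W T" by (simp add: q_def zero)
  ultimately show ?thesis by simp
qed

end

subsection \<open>Complex functionals and invariant subspaces of finite codimension\<close>

lemma homogeneous_system_nontrivial:
  fixes \<alpha> :: "'k \<Rightarrow> nat \<Rightarrow> complex"
  assumes "finite K" "card K > m"
  shows "\<exists>c. (\<exists>k\<in>K. c k \<noteq> 0) \<and> (\<forall>i<m. (\<Sum>k\<in>K. c k * \<alpha> k i) = 0)"
  using assms
proof (induction m arbitrary: K \<alpha>)
  case 0
  then obtain k where "k \<in> K" by (metis card.empty ex_in_conv less_irrefl)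
  then show ?case by (intro exI[of _ "\<lambda>_. 1"]) auto
next
  case (Suc m)
  show ?case
  proof (cases "\<forall>k\<in>K. \<alpha> k m = 0")
    case True
    obtain c where "\<exists>k\<in>K. c k \<noteq> 0" "\<forall>i<m. (\<Sum>k\<in>K. c k * \<alpha> k i) = 0"
      using Suc.IH[of K \<alpha>] Suc.prems by auto
    then show ?thesis using True by (intro exI[of _ c]) (auto simp: less_Suc_eq)
  next
    case False
    then obtain j where j: "j \<in> K" "\<alpha> j m \<noteq> 0" by auto
    define K' where "K' = K - {j}"
    define \<beta> where "\<beta> k i = \<alpha> k i - \<alpha> k m / \<alpha> j m * \<alpha> j i" for k i
    have K': "finite K'" "card K' > m" "K = insert j K'" "j \<notin> K'" using Suc.prems j by (auto simp: K'_def)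
    obtain c where c: "\<exists>k\<in>K'. c k \<noteq> 0" "\<forall>i<m. (\<Sum>k\<in>K'. c k * \<beta> k i) = 0"
      using Suc.IH[of K' \<beta>] K' by auto
    define d where "d k = (if k = j then - (\<Sum>k\<in>K'. c k * (\<alpha> k m / \<alpha> j m)) else c k)" for k
    have "(\<Sum>k\<in>K. d k * \<alpha> k i) = (\<Sum>k\<in>K'. c k * \<beta> k i)" for i
    proof -
      have "(\<Sum>k\<in>K. d k * \<alpha> k i) = d j * \<alpha> j i + (\<Sum>k\<in>K'. d k * \<alpha> k i)" using K' by simp
      also have "(\<Sum>k\<in>K'. d k * \<alpha> k i) = (\<Sum>k\<in>K'. c k * \<alpha> k i)"
        by (rule sum.cong) (use K' in \<open>auto simp: d_def\<close>)
      also have "d j * \<alpha> j i = - (\<Sum>k\<in>K'. c k * (\<alpha> k m / \<alpha> j m) * \<alpha> j i)" by (simp add: d_def sum_distrib_right)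
      finally show ?thesis by (simp add: \<beta>_def sum_subtractf right_diff_distrib mult.assoc)
    qed
    moreover have "(\<Sum>k\<in>K'. c k * \<beta> k m) = 0" using j by (simp add: \<beta>_def)
    moreover have "\<exists>k\<in>K. d k \<noteq> 0" using c(1) K' by (metis d_def insertI2)
    ultimately show ?thesis using c(2) by (intro exI[of _ d]) (auto simp: less_Suc_eq)
  qed
qed

text \<open>Complex scalars are an additional structure on a real normed space. Agreement with the
  real scalars is demanded only where real functionals are made complex, in
  \<open>complexify_functionals\<close>.\<close>

locale complex_space =
  fixes sc :: "complex \<Rightarrow> 'x::real_normed_vector \<Rightarrow> 'x"
  assumes sc_add_right: "sc c (x + y) = sc c x + sc c y"
    and sc_add_left: "sc (c + d) x = sc c x + sc d x"
    and sc_sc: "sc c (sc d x) = sc (c * d) x"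
    and sc_one: "sc 1 x = x"
begin

definition clin :: "('x \<Rightarrow> complex) \<Rightarrow> bool" where
  "clin f \<longleftrightarrow> bounded_linear f \<and> (\<forall>c x. f (sc c x) = c * f x)"

definition csub :: "'x set \<Rightarrow> bool" where
  "csub R \<longleftrightarrow> 0 \<in> R \<and> (\<forall>x\<in>R. \<forall>y\<in>R. x + y \<in> R) \<and> (\<forall>c. \<forall>x\<in>R. sc c x \<in> R)"

text \<open>That such a common kernel is contained in a subspace expresses finite codimension
  without quotient spaces.\<close>

definition kers :: "nat \<Rightarrow> (nat \<Rightarrow> 'x \<Rightarrow> complex) \<Rightarrow> 'x set" where
  "kers m l = {x. \<forall>i<m. l i x = 0}"

lemma sc_zero_left [simp]: "sc 0 x = 0"
  using sc_add_left[of 0 0 x] by simp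

lemma sc_minus: "sc (- c) x = - sc c x"
  using sc_add_left[of c "-c" x] by (simp add: eq_neg_iff_add_eq_0 add.commute)

lemma csub_diff: "csub R \<Longrightarrow> x \<in> R \<Longrightarrow> y \<in> R \<Longrightarrow> x - y \<in> R"
  using sc_minus[of 1 y] unfolding csub_def by (metis sc_one uminus_add_conv_diff add.commute)

lemma clin_add: "clin f \<Longrightarrow> f (x + y) = f x + f y"
  unfolding clin_def using bounded_linear.linear linear_add by blast

lemma clin_diff: "clin f \<Longrightarrow> f (x - y) = f x - f y"
  unfolding clin_def using bounded_linear.linear linear_diff by blast

lemma clin_sc: "clin f \<Longrightarrow> f (sc c x) = c * f x"
  by (simp add: clin_def)

lemma clin_0: "clin f \<Longrightarrow> f 0 = 0"
  using clin_add[of f 0 0] by simp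

lemma clin_plus: "clin f \<Longrightarrow> clin g \<Longrightarrow> clin (\<lambda>x. f x + g x)"
  by (auto simp: clin_def bounded_linear_add distrib_left)

lemma clin_cmult: "clin f \<Longrightarrow> clin (\<lambda>x. c * f x)"
  by (auto simp: clin_def intro: bounded_linear_const_mult)

lemma clin_minus: "clin f \<Longrightarrow> clin g \<Longrightarrow> clin (\<lambda>x. f x - g x)"
  using clin_plus[of f "\<lambda>x. -1 * g x"] clin_cmult[of g "-1"] by simp

lemma clin_sum: "(\<And>i. i < (m::nat) \<Longrightarrow> clin (l i)) \<Longrightarrow> clin (\<lambda>x. \<Sum>i<m. a i * l i x)"
proof (induction m)
  case 0 then show ?case by (simp add: clin_def)
next
  case (Suc m)
  have "clin (\<lambda>x. \<Sum>i<m. a i * l i x)" "clin (\<lambda>x. a m * l m x)" using Suc by (auto intro: clin_cmult)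
  then show ?case using clin_plus by simp
qed

text \<open>Induction on the number of functionals: on the kernel of \<open>l m\<close> the
  remaining ones suffice, and one vector with \<open>l m e \<noteq> 0\<close> fixes the last
  coefficient. \<open>\<phi>\<close> need not be continuous; the combination shows that it
  is.\<close>

lemma functional_combination:
  assumes "csub V" "\<And>i. i < m \<Longrightarrow> clin (l i)"
    and "\<And>x y. x \<in> V \<Longrightarrow> y \<in> V \<Longrightarrow> \<phi> (x + y) = \<phi> x + \<phi> y" "\<And>c x. x \<in> V \<Longrightarrow> \<phi> (sc c x) = c * \<phi> x"
    and "\<And>x. x \<in> V \<Longrightarrow> x \<in> kers m l \<Longrightarrow> \<phi> x = 0"
  shows "\<exists>a. \<forall>x\<in>V. \<phi> x = (\<Sum>i<m. a i * l i x)"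
  using assms
proof (induction m arbitrary: V \<phi>)
  case 0
  then show ?case by (auto simp: kers_def)
next
  case (Suc m)
  define V' where "V' = {x\<in>V. l m x = 0}"
  have lm: "clin (l m)" using Suc.prems(2) by simp
  have V': "csub V'" using Suc.prems(1) by (auto simp: csub_def V'_def clin_add[OF lm] clin_sc[OF lm] clin_0[OF lm])
  have "\<exists>a. \<forall>x\<in>V'. \<phi> x = (\<Sum>i<m. a i * l i x)"
  proof (rule Suc.IH[OF V'])
    show "\<phi> x = 0" if "x \<in> V'" "x \<in> kers m l" for x
      using Suc.prems(5)[of x] that by (auto simp: V'_def kers_def less_Suc_eq)
  qed (use Suc.prems in \<open>auto simp: V'_def\<close>)
  then obtain a where a: "\<And>x. x \<in> V' \<Longrightarrow> \<phi> x = (\<Sum>i<m. a i * l i x)" by blast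
  show ?case
  proof (cases "\<forall>x\<in>V. l m x = 0")
    case True
    then show ?thesis using a by (intro exI[of _ "a(m := 0)"]) (auto simp: V'_def)
  next
    case False
    then obtain e where e: "e \<in> V" "l m e \<noteq> 0" by auto
    \<comment> \<open>What is left of \<open>\<phi>\<close> vanishes on the kernel of
      \<open>l m\<close> in \<open>V\<close>, hence is a multiple of \<open>l m\<close>
      there.\<close>
    define \<psi> where "\<psi> x = \<phi> x - (\<Sum>i<m. a i * l i x)" for x
    define b where "b = \<psi> e / l m e"
    have S: "clin (\<lambda>x. \<Sum>i<m. a i * l i x)" using Suc.prems(2) by (intro clin_sum) auto
    have "\<phi> x = (\<Sum>i<Suc m. (a(m := b)) i * l i x)" if x: "x \<in> V" for x
    proof -
      define y where "y = x - sc (l m x / l m e) e"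
      have scV: "sc c e \<in> V" for c using e Suc.prems(1) by (auto simp: csub_def)
      have "y \<in> V'" using csub_diff[OF Suc.prems(1) x scV] e(2) by (simp add: V'_def y_def clin_diff[OF lm] clin_sc[OF lm])
      then have \<psi>y: "\<psi> y = 0" and yV: "y \<in> V" using a by (auto simp: \<psi>_def V'_def)
      have x': "x = y + sc (l m x / l m e) e" by (simp add: y_def)
      have "\<phi> (y + sc (l m x / l m e) e) = \<phi> y + l m x / l m e * \<phi> e"
        using Suc.prems(3)[OF yV scV] Suc.prems(4)[OF e(1)] by simp
      moreover have "(\<Sum>i<m. a i * l i (y + sc (l m x / l m e) e)) = (\<Sum>i<m. a i * l i y) + l m x / l m e * (\<Sum>i<m. a i * l i e)"
        by (simp only: clin_add[OF S] clin_sc[OF S])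
      ultimately have "\<psi> (y + sc (l m x / l m e) e) = \<psi> y + l m x / l m e * \<psi> e"
        unfolding \<psi>_def by (simp add: algebra_simps)
      then have "\<psi> x = b * l m x" using x' \<psi>y by (simp add: b_def)
      moreover have "(\<Sum>i<m. (a(m := b)) i * l i x) = (\<Sum>i<m. a i * l i x)" by (rule sum.cong) auto
      ultimately show ?thesis by (simp add: \<psi>_def algebra_simps)
    qed
    then show ?thesis by blast
  qed
qed

text \<open>On the space spanned by \<open>R\<close> and \<open>x\<close>, the coordinate of
  \<open>x\<close> vanishes on \<open>R\<close> and therefore on the common kernel, so it is a
  combination of the \<open>l i\<close>. Such a combination is defined and continuous everywhere,
  which replaces an extension theorem.\<close>

lemma separating_functional:
  assumes R: "csub R" and l: "\<And>i. i < m \<Longrightarrow> clin (l i)" "kers m l \<subseteq> R" and x: "x \<notin> R"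
  obtains a where "\<And>y. y \<in> R \<Longrightarrow> (\<Sum>i<m. a i * l i y) = 0" "(\<Sum>i<m. a i * l i x) = 1"
proof -
  define V where "V = {r + sc c x | r c. r \<in> R}"
  have uniq: "c = c'" if "r + sc c x = r' + sc c' x" "r \<in> R" "r' \<in> R" for r r' c c'
  proof (rule ccontr)
    assume ne: "c \<noteq> c'"
    have "sc (c - c') x = r' - r" using that(1) sc_add_left[of "c - c'" c' x] by (simp add: algebra_simps)
    then have "sc (c - c') x \<in> R" using csub_diff[OF R that(3,2)] by simp
    then have "sc (1 / (c - c')) (sc (c - c') x) \<in> R" using R unfolding csub_def by blast
    then show False using x ne by (simp add: sc_sc sc_one)
  qed
  define \<phi> where "\<phi> y = (THE c. \<exists>r\<in>R. y = r + sc c x)" for y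
  have \<phi>: "\<phi> (r + sc c x) = c" if "r \<in> R" for r c
    unfolding \<phi>_def by (rule the_equality) (use that uniq in blast)+
  have V: "csub V"
    unfolding csub_def
  proof (intro conjI ballI allI)
    show "0 \<in> V" unfolding V_def using R by (auto simp: csub_def intro!: exI[of _ 0])
    fix y assume "y \<in> V"
    then obtain r c where y: "y = r + sc c x" "r \<in> R" by (auto simp: V_def)
    show "sc d y \<in> V" for d
      unfolding V_def y by (auto simp: sc_add_right sc_sc intro!: exI[of _ "sc d r"] exI[of _ "d * c"]) (use R y in \<open>auto simp: csub_def\<close>)
    fix z assume "z \<in> V"
    then obtain r' c' where z: "z = r' + sc c' x" "r' \<in> R" by (auto simp: V_def)
    have "y + z = (r + r') + sc (c + c') x" by (simp add: y z sc_add_left algebra_simps)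
    moreover have "r + r' \<in> R" using R y z by (auto simp: csub_def)
    ultimately show "y + z \<in> V" unfolding V_def by blast
  qed
  have "\<exists>a. \<forall>x\<in>V. \<phi> x = (\<Sum>i<m. a i * l i x)"
  proof (rule functional_combination[OF V l(1)])
    fix y z assume "y \<in> V" "z \<in> V"
    then obtain r c r' c' where y: "y = r + sc c x" "r \<in> R" and z: "z = r' + sc c' x" "r' \<in> R" by (auto simp: V_def)
    have "y + z = (r + r') + sc (c + c') x" by (simp add: y z sc_add_left algebra_simps)
    moreover have "r + r' \<in> R" using R y z by (auto simp: csub_def)
    ultimately have "\<phi> (y + z) = c + c'" by (simp only: \<phi>)
    then show "\<phi> (y + z) = \<phi> y + \<phi> z" using \<phi>[OF y(2), of c] \<phi>[OF z(2), of c'] y(1) z(1) by simp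
  next
    fix d y assume "y \<in> V"
    then obtain r c where y: "y = r + sc c x" "r \<in> R" by (auto simp: V_def)
    have "sc d y = sc d r + sc (d * c) x" by (simp add: y sc_add_right sc_sc)
    moreover have "sc d r \<in> R" using R y by (auto simp: csub_def)
    ultimately have "\<phi> (sc d y) = d * c" by (simp only: \<phi>)
    then show "\<phi> (sc d y) = d * \<phi> y" using \<phi>[OF y(2), of c] y(1) by simp
  next
    fix y assume "y \<in> kers m l"
    then show "\<phi> y = 0" using \<phi>[of y 0] l(2) by auto
  qed auto
  then obtain a where a: "\<And>y. y \<in> V \<Longrightarrow> \<phi> y = (\<Sum>i<m. a i * l i y)" by blast
  show thesis
  proof (rule that[of a])
    fix y assume y: "y \<in> R"
    have "y = y + sc 0 x" by simp
    then have "y \<in> V" unfolding V_def using y by blast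
    then show "(\<Sum>i<m. a i * l i y) = 0" using a[of y] \<phi>[OF y, of 0] by simp
  next
    have 0: "0 \<in> R" using R by (simp add: csub_def)
    moreover have "x = 0 + sc 1 x" by (simp add: sc_one)
    ultimately have "x \<in> V" unfolding V_def by blast
    then show "(\<Sum>i<m. a i * l i x) = 1" using a[of x] \<phi>[OF 0, of 1] by (simp add: sc_one)
  qed
qed

text \<open>The new vector \<open>x\<close> pays for one functional: subtracting multiples of
  \<open>l j\<close>, where \<open>l j x \<noteq> 0\<close>, makes the others vanish at
  \<open>x\<close>. On their common kernel, subtracting a multiple of \<open>x\<close> then makes
  \<open>l j\<close> vanish too.\<close>

lemma drop_functional:
  assumes l: "\<And>i. i < m \<Longrightarrow> clin (l i)" "kers m l \<subseteq> R" and R': "csub R'" "R \<subseteq> R'" "x \<in> R'" "x \<notin> R"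
  obtains l' where "m > 0" "\<And>i. i < m - 1 \<Longrightarrow> clin (l' i)" "kers (m - 1) l' \<subseteq> R'"
proof -
  from l(2) R'(4) obtain j where j: "j < m" "l j x \<noteq> 0" by (auto simp: kers_def)
  \<comment> \<open>Enumerates the indices other than \<open>j\<close>.\<close>
  define \<sigma> where "\<sigma> i = (if i < j then i else Suc i)" for i
  define l' where "l' i y = l (\<sigma> i) y - l (\<sigma> i) x / l j x * l j y" for i y
  have \<sigma>: "\<sigma> i < m" if "i < m - 1" for i using that j by (auto simp: \<sigma>_def)
  have \<sigma>_surj: "\<exists>i'<m-1. \<sigma> i' = i" if "i < m" "i \<noteq> j" for i
    by (rule exI[of _ "if i < j then i else i - 1"]) (use that j in \<open>auto simp: \<sigma>_def\<close>)
  show thesis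
  proof (rule that[of l'])
    show "clin (l' i)" if "i < m - 1" for i
      unfolding l'_def[abs_def] by (intro clin_minus clin_cmult l \<sigma> that j)
    show "kers (m - 1) l' \<subseteq> R'"
    proof
      fix y assume y: "y \<in> kers (m - 1) l'"
      define z where "z = y - sc (l j y / l j x) x"
      have "l i z = 0" if "i < m" for i
      proof (cases "i = j")
        case True then show ?thesis using j by (simp add: z_def clin_diff[OF l(1)] clin_sc[OF l(1)])
      next
        case False
        obtain i' where "i' < m - 1" "\<sigma> i' = i" using \<sigma>_surj[of i] \<open>i < m\<close> False by blast
        then have "l i y - l i x / l j x * l j y = 0" using y by (auto simp: kers_def l'_def)
        then show ?thesis using \<open>i < m\<close> j by (simp add: z_def clin_diff[OF l(1)] clin_sc[OF l(1)] mult.commute)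
      qed
      then have "z \<in> R'" using l(2) R'(2) by (auto simp: kers_def)
      moreover have "sc (l j y / l j x) x \<in> R'" using R' by (auto simp: csub_def)
      ultimately show "y \<in> R'" using R'(1) unfolding csub_def z_def by (metis (no_types) diff_add_cancel)
    qed
  qed (use j in auto)
qed

text \<open>Every strict inclusion costs one functional; after \<open>m\<close> of them none is left
  and \<open>R m\<close> would be the whole space.\<close>

lemma chain_stationary:
  assumes l: "\<And>i. i < m \<Longrightarrow> clin (l i)" "kers m l \<subseteq> R 0"
    and R: "\<And>k. csub (R k)" "\<And>k. R k \<subseteq> R (Suc k)" and ne: "R m \<noteq> UNIV"
  shows "\<exists>k<m. R k = R (Suc k)"
proof (rule ccontr)
  assume neg: "\<not> ?thesis"
  have "\<exists>l. (\<forall>i<m-k. clin (l i)) \<and> kers (m - k) l \<subseteq> R k" if "k \<le> m" for k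
    using that
  proof (induction k)
    case 0 then show ?case using l by auto
  next
    case (Suc k)
    then obtain l' where l': "\<And>i. i < m - k \<Longrightarrow> clin (l' i)" "kers (m - k) l' \<subseteq> R k" by auto
    obtain x where "x \<in> R (Suc k)" "x \<notin> R k" using neg Suc.prems R(2)[of k] by (metis Suc_le_lessD subsetI subset_antisym)
    from drop_functional[OF l' R(1) R(2) this] obtain l'' where "\<And>i. i < m - k - 1 \<Longrightarrow> clin (l'' i)" "kers (m - k - 1) l'' \<subseteq> R (Suc k)" by blast
    then show ?case by auto
  qed
  from this[of m] have "UNIV \<subseteq> R m" by (auto simp: kers_def)
  then show False using ne by auto
qed

definition clinop :: "('x \<Rightarrow> 'x) \<Rightarrow> bool" where
  "clinop S \<longleftrightarrow> (\<forall>x y. S (x + y) = S x + S y) \<and> (\<forall>c x. S (sc c x) = sc c (S x))"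

text \<open>By invariance all functionals \<open>f \<circ> S ^^ k\<close> vanish on
  \<open>R\<close>, so they lie in the span of the \<open>m\<close> functionals \<open>l i\<close>,
  and some nonzero polynomial \<open>p\<close> of degree at most \<open>m\<close> annihilates
  \<open>f\<close> when evaluated at \<open>S\<close>. For \<open>p\<close> of least degree and a
  root \<open>\<mu>\<close>, the quotient of \<open>p\<close> by the linear factor gives a nonzero
  functional, which is an eigenfunctional for \<open>\<mu>\<close>.\<close>

lemma eigenfunctional_single:
  assumes S: "clinop S" and R: "csub R" "\<And>x. x \<in> R \<Longrightarrow> S x \<in> R" "R \<noteq> UNIV"
    and l: "\<And>i. i < m \<Longrightarrow> clin (l i)" "kers m l \<subseteq> R"
  obtains \<mu> g x0 where "\<And>x. x \<in> R \<Longrightarrow> g x = 0" "\<And>x. g (S x) = \<mu> * g x" "g x0 \<noteq> 0"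
    "\<And>x y. g (x + y) = g x + g y" "\<And>c x. g (sc c x) = c * g x"
proof -
  obtain x0 where x0: "x0 \<notin> R" using R(3) by auto
  obtain a where a: "\<And>y. y \<in> R \<Longrightarrow> (\<Sum>i<m. a i * l i y) = 0" "(\<Sum>i<m. a i * l i x0) = 1"
    using separating_functional[OF R(1) l x0] by blast
  define f where "f x = (\<Sum>i<m. a i * l i x)" for x
  have f: "clin f" unfolding f_def[abs_def] by (rule clin_sum[OF l(1)])
  have Spow: "clinop (S ^^ k)" "\<And>x. x \<in> R \<Longrightarrow> (S ^^ k) x \<in> R" for k
    using S R(2) by (induction k) (auto simp: clinop_def)
  have "\<exists>\<alpha>. \<forall>x\<in>UNIV. f ((S ^^ k) x) = (\<Sum>i<m. \<alpha> i * l i x)" for k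
  proof (rule functional_combination[of UNIV m l "\<lambda>x. f ((S ^^ k) x)"])
    show "f ((S ^^ k) x) = 0" if "x \<in> kers m l" for x
      using that Spow(2)[of x k] a(1) l(2) by (auto simp: f_def)
  qed (use Spow(1)[of k] l f in \<open>auto simp: clinop_def csub_def clin_add clin_sc\<close>)
  then obtain \<alpha> where \<alpha>: "\<And>k x. f ((S ^^ k) x) = (\<Sum>i<m. \<alpha> k i * l i x)" by (metis UNIV_I)
  \<comment> \<open>The functional obtained from \<open>f\<close> by evaluating \<open>p\<close> at
    \<open>S\<close>. The range covers every coefficient up to degree \<open>m\<close>, and leaves
    room for the index shift under multiplication by the indeterminate.\<close>
  define \<Phi> where "\<Phi> p x = (\<Sum>k<m+2. coeff p k * f ((S ^^ k) x))" for p x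
  obtain c where c: "\<exists>k\<in>{..m}. c k \<noteq> 0" "\<forall>i<m. (\<Sum>k\<in>{..m}. c k * \<alpha> k i) = 0"
    using homogeneous_system_nontrivial[of "{..m}" m \<alpha>] by auto
  define P where "P p \<longleftrightarrow> p \<noteq> 0 \<and> degree p \<le> m \<and> (\<forall>x. \<Phi> p x = 0)" for p
  define p0 where "p0 = (\<Sum>k\<le>m. monom (c k) k)"
  have cp: "coeff p0 k = (if k \<le> m then c k else 0)" for k
    unfolding p0_def by (simp add: coeff_sum)
  have "P p0"
    unfolding P_def
  proof (intro conjI allI)
    show "p0 \<noteq> 0" using c(1) cp by (metis atMost_iff coeff_0)
    show "degree p0 \<le> m" by (rule degree_le) (simp add: cp)
    fix x
    have "\<Phi> p0 x = (\<Sum>k\<le>m. c k * f ((S ^^ k) x))"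
      unfolding \<Phi>_def by (rule sum.mono_neutral_cong_right) (auto simp: cp)
    also have "\<dots> = (\<Sum>k\<le>m. \<Sum>i<m. c k * \<alpha> k i * l i x)" by (simp add: \<alpha> sum_distrib_left mult.assoc)
    also have "\<dots> = (\<Sum>i<m. (\<Sum>k\<le>m. c k * \<alpha> k i) * l i x)" by (subst sum.swap) (simp add: sum_distrib_right)
    also have "\<dots> = 0" using c(2) by simp
    finally show "\<Phi> p0 x = 0" .
  qed
  then obtain p where p: "P p" "\<And>q. P q \<Longrightarrow> degree p \<le> degree q"
    using exists_least_iff[of "\<lambda>d. \<exists>p. P p \<and> degree p = d"] by (metis linorder_not_le)
  have "degree p \<noteq> 0"
  proof
    assume "degree p = 0"
    then obtain c0 where "p = [:c0:]" by (metis degree_eq_zeroE)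
    then have "\<Phi> p x0 = c0 * f x0" unfolding \<Phi>_def by (subst sum.mono_neutral_right[of _ "{0}"]) (auto simp: coeff_pCons split: nat.splits)
    moreover have "c0 \<noteq> 0" using p(1) \<open>p = [:c0:]\<close> by (auto simp: P_def)
    ultimately show False using p(1) a(2) by (auto simp: P_def f_def)
  qed
  then obtain \<mu> where "poly p \<mu> = 0" using fundamental_theorem_of_algebra[of p] by (metis constant_degree)
  then obtain q where q: "p = [:-\<mu>, 1:] * q" by (auto simp: poly_eq_0_iff_dvd dvd_def)
  have q0: "q \<noteq> 0" using q p(1) by (auto simp: P_def)
  have dq: "degree p = Suc (degree q)" unfolding q by (subst degree_mult_eq) (use q0 in auto)
  then have dqm: "degree q \<le> m" "degree q < m + 1" using p(1) by (auto simp: P_def)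
  \<comment> \<open>By minimality of the degree of \<open>p\<close>, the shorter \<open>q\<close>
    cannot annihilate \<open>f\<close>.\<close>
  obtain x1 where x1: "\<Phi> q x1 \<noteq> 0" using p(2)[of q] dq q0 dqm by (auto simp: P_def)
  have "\<Phi> p x = \<Phi> q (S x) - \<mu> * \<Phi> q x" for x
  proof -
    have "coeff p k = coeff (pCons 0 q) k - \<mu> * coeff q k" for k unfolding q by simp
    then have "\<Phi> p x = (\<Sum>k<m+2. coeff (pCons 0 q) k * f ((S ^^ k) x)) - \<mu> * \<Phi> q x"
      unfolding \<Phi>_def by (simp only: left_diff_distrib sum_subtractf sum_distrib_left mult.assoc)
    also have "(\<Sum>k<m+2. coeff (pCons 0 q) k * f ((S ^^ k) x)) = (\<Sum>k<m+1. coeff q k * f ((S ^^ k) (S x)))"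
    proof -
      have "m + 2 = Suc (m + 1)" by simp
      then show ?thesis by (simp only: sum.lessThan_Suc_shift) (simp add: funpow_swap1)
    qed
    also have "\<dots> = \<Phi> q (S x)"
      unfolding \<Phi>_def by (rule sum.mono_neutral_left) (use dqm in \<open>auto intro!: coeff_eq_0\<close>)
    finally show ?thesis .
  qed
  then have eig: "\<Phi> q (S x) = \<mu> * \<Phi> q x" for x using p(1) unfolding P_def by (metis eq_iff_diff_eq_0)
  show thesis
  proof (rule that[of "\<Phi> q" \<mu> x1])
    show "\<Phi> q x = 0" if "x \<in> R" for x
      using Spow(2)[OF that] a(1) by (simp add: \<Phi>_def f_def)
    show "\<Phi> q (x + y) = \<Phi> q x + \<Phi> q y" for x y
    proof -
      have "f ((S ^^ k) (x + y)) = f ((S ^^ k) x) + f ((S ^^ k) y)" for k using Spow(1)[of k] by (simp add: clinop_def clin_add[OF f])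
      then show ?thesis unfolding \<Phi>_def by (simp only: distrib_left sum.distrib)
    qed
    show "\<Phi> q (sc c x) = c * \<Phi> q x" for c x
    proof -
      have "f ((S ^^ k) (sc c x)) = c * f ((S ^^ k) x)" for k using Spow(1)[of k] by (simp add: clinop_def clin_sc[OF f])
      then show ?thesis unfolding \<Phi>_def by (simp only: sum_distrib_left mult.left_commute)
    qed
  qed (use eig x1 in auto)
qed

text \<open>Among the proper invariant spaces above \<open>R\<close> choose \<open>R0\<close> with
  the fewest defining functionals. Then each \<open>S h\<close> acts on the quotient by
  \<open>R0\<close> as a scalar, so every functional vanishing on \<open>R0\<close> is an
  eigenfunctional of all \<open>S h\<close> simultaneously.\<close>

theorem common_eigenfunctional:
  assumes S: "\<And>h. h \<in> H \<Longrightarrow> clinop (S h)" "\<And>h k x. h \<in> H \<Longrightarrow> k \<in> H \<Longrightarrow> S h (S k x) = S k (S h x)"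
    and R: "csub R" "\<And>h x. h \<in> H \<Longrightarrow> x \<in> R \<Longrightarrow> S h x \<in> R" "R \<noteq> UNIV"
    and l: "\<And>i. i < m \<Longrightarrow> clin (l i)" "kers m l \<subseteq> R"
  obtains f x0 where "clin f" "f x0 \<noteq> 0" "\<And>x. x \<in> R \<Longrightarrow> f x = 0" "\<And>h. h \<in> H \<Longrightarrow> \<exists>\<mu>. \<forall>x. f (S h x) = \<mu> * f x"
proof -
  define Q where "Q m \<longleftrightarrow> (\<exists>l R'. (\<forall>i<m. clin (l i)) \<and> kers m l \<subseteq> R' \<and> csub R' \<and> R \<subseteq> R' \<and> R' \<noteq> UNIV \<and> (\<forall>h\<in>H. \<forall>x\<in>R'. S h x \<in> R'))" for m
  have "Q m" unfolding Q_def using R l by blast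
  define m0 where "m0 = (LEAST m. Q m)"
  have "Q m0" unfolding m0_def by (rule LeastI[of Q, OF \<open>Q m\<close>])
  then obtain l0 R0 where l0: "\<And>i. i < m0 \<Longrightarrow> clin (l0 i)" "kers m0 l0 \<subseteq> R0" and R0: "csub R0" "R \<subseteq> R0" "R0 \<noteq> UNIV" "\<And>h x. h \<in> H \<Longrightarrow> x \<in> R0 \<Longrightarrow> S h x \<in> R0"
    unfolding Q_def by blast
  have min: "\<not> Q k" if "k < m0" for k using not_less_Least[of k Q] that by (simp add: m0_def)
  have scal: "\<exists>\<mu>. \<forall>x. S h x - sc \<mu> x \<in> R0" if h: "h \<in> H" for h
  proof -
    obtain \<mu> g x1 where g: "\<And>x. x \<in> R0 \<Longrightarrow> g x = 0" "\<And>x. g (S h x) = \<mu> * g x" "g x1 \<noteq> 0"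
        "\<And>x y. g (x + y) = g x + g y" "\<And>c x. g (sc c x) = c * g x"
      by (rule eigenfunctional_single[OF S(1)[OF h] R0(1) R0(4)[OF h] R0(3) l0]) blast+
    define D where "D x = S h x - sc \<mu> x" for x
    have Sh: "S h (x + y) = S h x + S h y" "S h (sc c x) = sc c (S h x)" for x y c using S(1)[OF h] by (auto simp: clinop_def)
    have sd: "sc c (x - y) = sc c x - sc c y" for c x y
      using sc_add_right[of c "x - y" y] by (simp add: eq_diff_eq)
    \<comment> \<open>\<open>R0\<close> enlarged by the range of \<open>S h - \<mu>\<close>: still
      proper, because \<open>g\<close> annihilates it, and still invariant, because the operators
      commute.\<close>
    define R1 where "R1 = {r + D x | r x. r \<in> R0}"
    have "g (D x) = 0" for x
    proof -
      have "g (S h x) = g (D x) + g (sc \<mu> x)" using g(4)[of "D x" "sc \<mu> x"] by (simp add: D_def)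
      then show ?thesis using g(2,5) by simp
    qed
    then have "x1 \<notin> R1" using g by (auto simp: R1_def)
    have D_add: "D x + D y = D (x + y)" and D_sc: "sc c (D x) = D (sc c x)" for x y c
      by (auto simp: D_def Sh sd sc_add_right sc_sc mult.commute algebra_simps)
    have "csub R1"
      unfolding csub_def
    proof (intro conjI ballI allI)
      show "0 \<in> R1" unfolding R1_def using R0(1) D_sc[of 0 0] by (auto simp: csub_def intro!: exI[of _ 0])
      fix x assume "x \<in> R1"
      then obtain r y where x: "x = r + D y" "r \<in> R0" by (auto simp: R1_def)
      have "sc c x = sc c r + D (sc c y)" for c by (simp add: x sc_add_right D_sc)
      then show "sc c x \<in> R1" for c unfolding R1_def using R0(1) x by (auto simp: csub_def)
      fix x' assume "x' \<in> R1"
      then obtain r' y' where x': "x' = r' + D y'" "r' \<in> R0" by (auto simp: R1_def)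
      have "x + x' = (r + r') + D (y + y')" by (simp add: x x' D_add[symmetric] algebra_simps)
      moreover have "r + r' \<in> R0" using R0(1) x x' by (auto simp: csub_def)
      ultimately show "x + x' \<in> R1" unfolding R1_def by blast
    qed
    moreover have R01: "R0 \<subseteq> R1"
    proof
      fix r assume "r \<in> R0"
      moreover have "r = r + D 0" using D_sc[of 0 0] by simp
      ultimately show "r \<in> R1" unfolding R1_def by blast
    qed
    moreover have "S k x \<in> R1" if "k \<in> H" "x \<in> R1" for k x
    proof -
      obtain r y where x: "x = r + D y" "r \<in> R0" using \<open>x \<in> R1\<close> by (auto simp: R1_def)
      have Sk: "S k (x + y) = S k x + S k y" "S k (sc c x) = sc c (S k x)" for x y c using S(1)[OF that(1)] by (auto simp: clinop_def)
      have "S k (D y) = D (S k y)"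
        using Sk(1)[of "D y" "sc \<mu> y"] S(2)[OF that(1) h, of y] by (simp add: D_def Sk(2) eq_diff_eq)
      then have "S k x = S k r + D (S k y)" by (simp add: x Sk)
      then show ?thesis unfolding R1_def using R0(4)[OF that(1) x(2)] by auto
    qed
    moreover have "R1 \<noteq> UNIV" using \<open>x1 \<notin> R1\<close> by auto
    ultimately have "R1 \<subseteq> R0"
    proof -
      assume A: "csub R1" "R0 \<subseteq> R1" "\<And>k x. k \<in> H \<Longrightarrow> x \<in> R1 \<Longrightarrow> S k x \<in> R1" "R1 \<noteq> UNIV"
      show ?thesis
      proof
        fix x assume "x \<in> R1"
        show "x \<in> R0"
        proof (rule ccontr)
          assume "x \<notin> R0"
          \<comment> \<open>A strictly larger proper invariant space would get by with one
            functional less.\<close>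
          from drop_functional[OF l0 A(1,2) \<open>x \<in> R1\<close> this] obtain l' where l': "m0 > 0" "\<And>i. i < m0 - 1 \<Longrightarrow> clin (l' i)" "kers (m0 - 1) l' \<subseteq> R1" by blast
          then have "Q (m0 - 1)" unfolding Q_def using A R0(2) by blast
          then show False using min[of "m0 - 1"] l'(1) by simp
        qed
      qed
    qed
    moreover have "D x \<in> R1" for x
    proof -
      have "D x = 0 + D x" "0 \<in> R0" using R0(1) by (auto simp: csub_def)
      then show ?thesis unfolding R1_def by blast
    qed
    ultimately show ?thesis by (auto simp: D_def)
  qed
  obtain x0 where "x0 \<notin> R0" using R0(3) by auto
  from separating_functional[OF R0(1) l0 this] obtain a
    where a: "\<And>y. y \<in> R0 \<Longrightarrow> (\<Sum>i<m0. a i * l0 i y) = 0" "(\<Sum>i<m0. a i * l0 i x0) = 1" by blast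
  define f where "f x = (\<Sum>i<m0. a i * l0 i x)" for x
  have f: "clin f" unfolding f_def[abs_def] by (rule clin_sum[OF l0(1)])
  show thesis
  proof (rule that[of f x0])
    fix h assume "h \<in> H"
    from scal[OF this] obtain \<mu> where "\<And>x. S h x - sc \<mu> x \<in> R0" by blast
    then have "f (S h x - sc \<mu> x) = 0" for x using a(1) by (simp add: f_def)
    then have "f (S h x) = \<mu> * f x" for x by (simp add: clin_diff[OF f] clin_sc[OF f])
    then show "\<exists>\<mu>. \<forall>x. f (S h x) = \<mu> * f x" by blast
  qed (use f a R0(2) in \<open>auto simp: f_def\<close>)
qed

end

subsection \<open>Window compactness and averages\<close>

lemma abs_L2_sum:
  assumes "finite I" "\<And>i. i \<in> I \<Longrightarrow> sqi (f i)"
  shows "sqi (\<lambda>t. \<Sum>i\<in>I. f i t) \<and> abs_L2 (\<lambda>t. \<Sum>i\<in>I. f i t) = (\<Sum>i\<in>I. abs_L2 (f i))"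
  using assms by (induction rule: finite_induct) (auto simp: abs_L2_add sqi_add zero_L2_def)

lemma mulL_const_decomp: "mulL (\<lambda>_. c) v = Re c *\<^sub>R v + Im c *\<^sub>R mulL (\<lambda>_. \<i>) v"
proof -
  have "mulL (\<lambda>_. c) v = mulL (\<lambda>_. of_real (Re c) + of_real (Im c) * \<i>) v"
    by (rule arg_cong[where f="\<lambda>c. mulL (\<lambda>_. c) v"]) (metis complex_eq mult.commute)
  also have "\<dots> = mulL (\<lambda>_. of_real (Re c)) v + mulL (\<lambda>_. of_real (Im c) * \<i>) v" by (rule mulL_plus) auto
  also have "mulL (\<lambda>_. of_real (Im c) * \<i>) v = mulL (\<lambda>_. of_real (Im c)) (mulL (\<lambda>_. \<i>) v)" by (simp add: mulL_mulL)
  finally show ?thesis by (simp only: mulL_of_real)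
qed

lemma mulL_null_interval: "b \<le> a \<Longrightarrow> mulL (indicator {a..b}) x = 0"
proof -
  assume "b \<le> a"
  have "mulL (indicator {a..b}) x = mulL (\<lambda>_. 0) x"
    by (rule mulL_cong_AE) (use AE_lborel_singleton[of a] \<open>b \<le> a\<close> in \<open>auto elim!: eventually_mono simp: indicator_def\<close>)
  then show ?thesis by simp
qed

text \<open>Replacing the convolution by its values at the left ends of a fine subdivision is an
  operator of finite rank, and the equicontinuity of convolutions controls the error uniformly on
  the unit ball.\<close>

lemma conv_window_approximable:
  assumes k: "kern k" shows "approximable (\<lambda>x. mulL (indicator {a..b}) (convL k x))"
proof (cases "a < b")
  case False
  then show ?thesis by (simp add: mulL_null_interval approximable_zero)
next
  case ab: True
  have bl: "bounded_linear (\<lambda>x. mulL (indicator {a..b}) (convL k x))"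
    by (rule bounded_linear_compose[OF bounded_linear_mulL bounded_linear_convL[OF k]])
  have "\<exists>K'. finrank K' \<and> (\<forall>x. norm (mulL (indicator {a..b}) (convL k x) - K' x) \<le> e * norm x)" if e: "e > 0" for e
  proof -
    \<comment> \<open>A pointwise error \<open>w * norm x\<close> on an interval of length
      \<open>b - a\<close> has norm \<open>w * sqrt (b - a) * norm x\<close>, which is to be
      \<open>e * norm x\<close>.\<close>
    define w where "w = e / sqrt (b - a)"
    have w: "w > 0" using e ab by (simp add: w_def)
    have "((\<lambda>h. shiftL h (kref k)) \<longlongrightarrow> shiftL 0 (kref k)) (at 0)" using shiftL_continuous[of 0 "kref k"] by (simp only: isCont_def)
    then obtain d where d: "d > 0" "\<And>h. h \<noteq> 0 \<Longrightarrow> \<bar>h\<bar> < d \<Longrightarrow> norm (shiftL h (kref k) - kref k) < w"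
      using LIM_D[of "\<lambda>h. shiftL h (kref k)" "shiftL 0 (kref k)" 0 w] w by auto
    have d': "norm (shiftL h (kref k) - kref k) \<le> w" if "\<bar>h\<bar> < d" for h
      using d(2)[of h] that w by (cases "h = 0") auto
    obtain m where m1: "real m > (b - a) / d" using reals_Archimedean2 by blast
    have "(b - a) / d > 0" using ab d(1) by simp
    with m1 have "real m > 0" by linarith
    with m1 have m: "real m > (b - a) / d" "m > 0" by simp_all
    define \<delta> where "\<delta> = (b - a) / real m"
    have \<delta>: "\<delta> > 0" "\<delta> < d" using ab m d(1) by (auto simp: \<delta>_def field_simps)
    define p where "p i = a + real i * \<delta>" for i
    have pm: "p m = b" "p 0 = a" using m(2) by (auto simp: p_def \<delta>_def)
    define I where "I i = {p i..<p (Suc i)}" for i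
    have sI: "sqi (indicator (I i))" for i by (rule sqi_indicator_bounded[of _ "p i" "p (Suc i)"]) (auto simp: I_def)
    define K' where "K' x = (\<Sum>i<m. mulL (\<lambda>_. conv k x (p i)) (indL (I i)))" for x
    have "finrank (\<lambda>x. mulL (\<lambda>_. conv k x t) v)" for t v
      by (subst mulL_const_decomp[abs_def]) (intro finrank_add finrank_rank1 bounded_linear_compose[OF bounded_linear_Re bounded_linear_conv] bounded_linear_compose[OF bounded_linear_Im bounded_linear_conv])
    then have "finrank K'" unfolding K'_def[abs_def] by (intro finrank_sum) auto
    moreover have "norm (mulL (indicator {a..b}) (convL k x) - K' x) \<le> e * norm x" for x
    proof -
      define G where "G t = indicator {a..b} t * conv k x t - (\<Sum>i<m. conv k x (p i) * indicator (I i) t)" for t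
      have s1: "sqi (\<lambda>t. indicator {a..b} t * conv k x t)" by (rule sqi_bmult[OF _ sqi_conv[OF k]]) simp
      have s2: "sqi (\<lambda>t. conv k x (p i) * indicator (I i) t)" for i by (rule sqi_cmult[OF sI])
      note sums = abs_L2_sum[of "{..<m}" "\<lambda>i t. conv k x (p i) * indicator (I i) t", OF finite_lessThan s2]
      note s2' = sums[THEN conjunct1]
      have "abs_L2 G = mulL (indicator {a..b}) (convL k x) - K' x"
        unfolding G_def[abs_def] abs_L2_diff[OF s1 s2'] K'_def convL_def indL_def
        using sums sI by (simp add: mulL_abs sqi_conv[OF k])
      moreover have "norm (abs_L2 G) \<le> e * norm x"
      proof (rule norm_L2_leI)
        show "sqi G" unfolding G_def[abs_def] by (rule sqi_diff[OF s1 s2'])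
        \<comment> \<open>The half-open pieces do not cover \<open>b\<close>.\<close>
        have "AE t in lborel. t \<noteq> b" by (rule AE_lborel_singleton)
        then have "AE t in lborel. ennreal ((norm (G t))\<^sup>2) \<le> ennreal ((w * norm x)\<^sup>2) * indicator {a..b} t"
        proof eventually_elim
          case (elim t)
          show ?case
          proof (cases "t \<in> {a..b}")
            case False
            have "p i \<ge> a" "p (Suc i) \<le> b" if "i < m" for i
            proof -
              show "p i \<ge> a" using \<delta> by (simp add: p_def)
              have "real (Suc i) * \<delta> \<le> real m * \<delta>" using \<delta> that by (intro mult_right_mono) auto
              then show "p (Suc i) \<le> b" using pm(1) by (simp add: p_def)
            qed
            then have "indicator (I i) t = (0::complex)" if "i < m" for i
              using False that by (force simp: I_def indicator_def)
            then show ?thesis using False by (simp add: G_def)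
          next
            case True
            then have t: "a \<le> t" "t < b" using elim by auto
            define i where "i = nat \<lfloor>(t - a) / \<delta>\<rfloor>"
            have i1: "real i \<le> (t - a) / \<delta>" "(t - a) / \<delta> < real i + 1" using t \<delta> unfolding i_def by (auto simp: of_nat_nat)
            then have ti: "t \<in> I i" using \<delta> by (simp add: I_def p_def field_simps)
            have "i < m"
            proof -
              have "(t - a) / \<delta> < real m" using t \<delta> pm by (simp add: p_def field_simps)
              then show ?thesis using i1 by linarith
            qed
            have uniq: "indicator (I j) t = (0::complex)" if "j \<noteq> i" for j
            proof -
              have "t \<notin> I j"
              proof
                assume "t \<in> I j"
                then have "real j \<le> (t - a) / \<delta>" "(t - a) / \<delta> < real j + 1" using \<delta> by (auto simp: I_def p_def field_simps)
                then show False using i1 that by linarith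
              qed
              then show ?thesis by simp
            qed
            have "(\<Sum>j<m. conv k x (p j) * indicator (I j) t) = (\<Sum>j\<in>{i}. conv k x (p j) * indicator (I j) t)"
              by (rule sum.mono_neutral_right) (use \<open>i < m\<close> uniq in auto)
            then have "G t = conv k x t - conv k x (p i)" using True ti by (simp add: G_def)
            then have "norm (G t) \<le> norm (shiftL (p i - t) (kref k) - kref k) * norm x" using norm_conv_diff_le by simp
            also have "\<dots> \<le> w * norm x"
              by (intro mult_right_mono d') (use ti \<delta> in \<open>auto simp: I_def p_def field_simps\<close>)
            finally have "(norm (G t))\<^sup>2 \<le> (w * norm x)\<^sup>2" by (intro power_mono) auto
            then show ?thesis using True by (simp add: ennreal_leI)
          qed
        qed
        then have "(\<integral>\<^sup>+t. ennreal ((norm (G t))\<^sup>2) \<partial>lborel) \<le> (\<integral>\<^sup>+t. ennreal ((w * norm x)\<^sup>2) * indicator {a..b} t \<partial>lborel)"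
          by (rule nn_integral_mono_AE)
        also have "\<dots> = ennreal ((w * norm x)\<^sup>2) * ennreal (b - a)"
          using ab by (subst nn_integral_cmult_indicator) (auto simp: emeasure_lborel_Icc)
        also have "\<dots> = ennreal ((e * norm x)\<^sup>2)"
          using ab by (simp add: ennreal_mult[symmetric] w_def power_mult_distrib power_divide)
        finally show "(\<integral>\<^sup>+t. ennreal ((norm (G t))\<^sup>2) \<partial>lborel) \<le> ennreal ((e * norm x)\<^sup>2)" .
      qed (use e in auto)
      ultimately show ?thesis by simp
    qed
    ultimately show ?thesis by blast
  qed
  then show ?thesis unfolding approximable_def using bl by blast
qed

section \<open>Vanishing on sets of times\<close>

definition vanish :: "real set \<Rightarrow> L2 \<Rightarrow> bool" where
  "vanish A x \<longleftrightarrow> (AE t in lborel. t \<in> A \<longrightarrow> rep_L2 x t = 0)"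

lemma vanish_iff: "A \<in> sets borel \<Longrightarrow> vanish A x \<longleftrightarrow> mulL (indicator A) x = 0"
proof
  assume A: "A \<in> sets borel" and v: "vanish A x"
  have "AE t in lborel. rep_L2 (mulL (indicator A) x) t = rep_L2 0 t"
    using rep_mulL[of "indicator A" x] v[unfolded vanish_def] rep_abs_L2[OF sqi_zero] A
    unfolding zero_L2_def by (auto elim!: eventually_elim2 simp: indicator_def)
  then show "mulL (indicator A) x = 0" by (rule L2_eqI)
next
  assume A: "A \<in> sets borel" and v: "mulL (indicator A) x = 0"
  have "AE t in lborel. rep_L2 (0::L2) t = 0" using rep_abs_L2[OF sqi_zero] unfolding zero_L2_def .
  moreover have "AE t in lborel. rep_L2 0 t = indicator A t * rep_L2 x t" using rep_mulL[of "indicator A" x] A v by simp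
  ultimately show "vanish A x" unfolding vanish_def by eventually_elim (auto simp: indicator_def)
qed

lemma vanish_mono: "vanish A x \<Longrightarrow> B \<subseteq> A \<Longrightarrow> vanish B x"
  unfolding vanish_def by (auto elim: eventually_mono)

lemma vanish_Un: "vanish A x \<Longrightarrow> vanish B x \<Longrightarrow> vanish (A \<union> B) x"
  unfolding vanish_def by (auto elim: eventually_elim2)

text \<open>A single point is null; this is how open ends of intervals are closed and adjacent
  intervals joined throughout.\<close>

lemma vanish_null: "vanish A x \<Longrightarrow> B \<subseteq> A \<union> {c} \<Longrightarrow> vanish B x"
  unfolding vanish_def using AE_lborel_singleton[of c] by (auto elim: eventually_elim2)

lemma vanish_UNIV: "vanish UNIV x \<longleftrightarrow> x = 0"
  using vanish_iff[of UNIV x] by (simp add: indicator_def[abs_def])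

lemma vanish_zero [simp]: "vanish A 0"
  using rep_abs_L2[OF sqi_zero] unfolding zero_L2_def vanish_def by (auto elim: eventually_mono)

lemma vanish_add:
  assumes "vanish A x" "vanish A y" shows "vanish A (x + y)"
  using assms rep_add[of x y] unfolding vanish_def by eventually_elim auto

lemma vanish_diff:
  assumes "vanish A x" "vanish A y" shows "vanish A (x - y)"
  using assms rep_diff[of x y] unfolding vanish_def by eventually_elim auto

lemma vanish_sum: "(\<And>i. i \<in> I \<Longrightarrow> vanish A (x i)) \<Longrightarrow> vanish A (\<Sum>i\<in>I. x i)"
  by (induction I rule: infinite_finite_induct) (auto intro: vanish_add)

lemma vanish_mulL: "vanish A x \<Longrightarrow> vanish A (mulL m x)"
proof (cases "bmeas m")
  case True
  assume "vanish A x"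
  then show ?thesis using rep_mulL[OF True, of x] unfolding vanish_def by eventually_elim auto
qed (simp add: mulL_eq_0)

lemma vanish_mulL_zero: "bmeas m \<Longrightarrow> (\<And>t. t \<in> A \<Longrightarrow> m t = 0) \<Longrightarrow> vanish A (mulL m x)"
  using rep_mulL[of m x] unfolding vanish_def by (auto elim: eventually_mono)

lemma vanish_shiftL: "vanish A x \<Longrightarrow> (\<And>t. t \<in> B \<Longrightarrow> t + h \<in> A) \<Longrightarrow> A \<in> sets borel \<Longrightarrow> vanish B (shiftL h x)"
proof -
  assume v: "vanish A x" and B: "\<And>t. t \<in> B \<Longrightarrow> t + h \<in> A" and A [measurable]: "A \<in> sets borel"
  have "AE t in lborel. t + h \<in> A \<longrightarrow> rep_L2 x (t + h) = 0"
    using AE_borel_affine[of 1 "\<lambda>t. t \<in> A \<longrightarrow> rep_L2 x t = 0" h] v by (simp add: vanish_def add.commute)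
  then show ?thesis using rep_shiftL[of h x] B unfolding vanish_def by (auto elim: eventually_elim2)
qed

lemma conv_vanish:
  assumes "sqi k" "vanish A x" "\<And>s. s \<notin> A \<Longrightarrow> k (t - s) = 0"
  shows "conv k x t = 0"
  unfolding conv_eq[OF assms(1)]
  by (rule integral_eq_zero_AE) (use assms(2,3) in \<open>auto simp: vanish_def elim!: eventually_mono\<close>)

lemma vanish_convL:
  assumes "kern k" "vanish A x" "\<And>t s. t \<in> B \<Longrightarrow> s \<notin> A \<Longrightarrow> k (t - s) = 0"
  shows "vanish B (convL k x)"
  using rep_convL[OF assms(1), of x] conv_vanish[OF _ assms(2)] assms(1,3)
  unfolding vanish_def by (auto elim!: eventually_mono simp: kern_def)

lemma integral_indicator_complex:
  assumes "S \<in> sets borel" "emeasure lborel S < \<infinity>"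
  shows "integrable lborel (indicator S :: real \<Rightarrow> complex)" "(LINT t|lborel. (indicator S t :: complex)) = of_real (measure lborel S)"
proof -
  have e: "(indicator S :: real \<Rightarrow> complex) = (\<lambda>t. of_real (indicator S t))" by (auto simp: indicator_def)
  have i: "integrable lborel (indicator S :: real \<Rightarrow> real)" using assms by simp
  show "integrable lborel (indicator S :: real \<Rightarrow> complex)" unfolding e by (rule integrable_of_real[OF i])
  show "(LINT t|lborel. (indicator S t :: complex)) = of_real (measure lborel S)"
    unfolding e by (simp only: integral_complex_of_real) (use assms in simp)
qed

text \<open>Convolving with \<open>avk h\<close> averages over the interval between \<open>t\<close> and \<open>t + h\<close>; \<open>h\<close> may be negative.\<close>

definition avk :: "real \<Rightarrow> real \<Rightarrow> complex" where
  "avk h u = indicator {min 0 (-h)..max 0 (-h)} u / of_real \<bar>h\<bar>"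

lemma kern_avk: "h \<noteq> 0 \<Longrightarrow> kern (avk h)"
proof -
  have "sqi (indicator {min 0 (-h)..max 0 (-h)})" by (rule sqi_indicator_bounded[of _ "min 0 (-h)" "max 0 (-h)"]) auto
  from sqi_cmult[OF this, of "1 / of_real \<bar>h\<bar>"] have "sqi (avk h)" by (simp add: avk_def[abs_def])
  moreover have "integrable lborel (indicator {min 0 (-h)..max 0 (-h)} :: real \<Rightarrow> complex)"
    by (rule integral_indicator_complex(1)) (auto simp: emeasure_lborel_Icc_eq)
  then have "integrable lborel (avk h)" unfolding avk_def[abs_def] by simp
  ultimately show ?thesis by (simp add: kern_def)
qed

lemma integral_avk: assumes "h \<noteq> 0" shows "(LINT s|lborel. norm (avk h s)) = 1" "(LINT s|lborel. avk h (t - s)) = 1"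
proof -
  have m: "measure lborel {min 0 (-h)..max 0 (-h)} = \<bar>h\<bar>" by (auto simp: measure_lborel_Icc)
  have "(\<lambda>s. norm (avk h s)) = (\<lambda>s. indicator {min 0 (-h)..max 0 (-h)} s / \<bar>h\<bar>)"
    by (auto simp: avk_def indicator_def norm_divide)
  then have "(LINT s|lborel. norm (avk h s)) = (LINT s|lborel. indicator {min 0 (-h)..max 0 (-h)} s / \<bar>h\<bar>)" by simp
  also have "\<dots> = 1" using assms m by simp
  finally show "(LINT s|lborel. norm (avk h s)) = 1" .
  have "(LINT s|lborel. avk h (t - s)) = (LINT s|lborel. avk h s)"
    using lborel_integral_real_affine[of "-1" "avk h" t] by simp
  also have "\<dots> = of_real (measure lborel {min 0 (-h)..max 0 (-h)}) / of_real \<bar>h\<bar>"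
    unfolding avk_def by (subst integral_divide_zero, subst integral_indicator_complex) (auto simp: emeasure_lborel_Icc_eq)
  also have "\<dots> = 1" using assms unfolding m by simp
  finally show "(LINT s|lborel. avk h (t - s)) = 1" .
qed

lemma conv_indL: "sqi k \<Longrightarrow> conv k (indL {a..b}) t = (LINT s|lborel. k (t - s) * indicator {a..b} s)"
proof -
  assume k: "sqi k"
  have sk: "sqi (\<lambda>s. k (t - s))" using sqi_shift[OF sqi_reflect[OF k], of "-t"] by simp
  have si: "sqi (indicator {a..b})" by (rule sqi_indicator_bounded) auto
  show ?thesis using pairL_abs[OF sk si] pairL_abs_left[OF sk, of "indL {a..b}"] conv_eq[OF k, of "indL {a..b}" t]
    by (simp add: indL_def)
qed

text \<open>Lebesgue differentiation in norm. The averages have operator norm at most 1, so interval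
  indicators suffice, and these are reproduced exactly at every point farther than
  \<open>\<bar>s n\<bar>\<close> from both ends.\<close>

lemma average_tendsto:
  assumes s: "s \<longlonglongrightarrow> 0" "\<And>n. s n \<noteq> 0" "\<And>n. \<bar>s n\<bar> \<le> 1"
  shows "(\<lambda>n. convL (avk (s n)) x) \<longlonglongrightarrow> x"
proof (rule L2_closed_dense[where C=1])
  fix a b :: real assume "a \<le> b"
  have k: "kern (avk (s n))" for n by (rule kern_avk[OF s(2)])
  have sk: "sqi (avk (s n))" for n using k[of n] by (simp add: kern_def)
  have av0: "avk (s n) (t - u) = 0" if "\<bar>t - u\<bar> > \<bar>s n\<bar>" for n t u
    using that by (auto simp: avk_def indicator_def)
  \<comment> \<open>The kernel has integral 1 and reaches no farther than
    \<open>\<bar>s n\<bar>\<close>.\<close>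
  have const: "conv (avk (s n)) (indL {a..b}) t = c" if "\<And>u. \<bar>t - u\<bar> \<le> \<bar>s n\<bar> \<Longrightarrow> indicator {a..b} u = c" for n t c
  proof -
    have "avk (s n) (t - u) * indicator {a..b} u = avk (s n) (t - u) * c" for u
      using that[of u] av0[of n t u] by (cases "\<bar>t - u\<bar> \<le> \<bar>s n\<bar>") auto
    then have "conv (avk (s n)) (indL {a..b}) t = (LINT u|lborel. avk (s n) (t - u) * c)"
      unfolding conv_indL[OF sk] by (intro Bochner_Integration.integral_cong refl)
    then show ?thesis using integral_avk(2)[OF s(2), of n t] by simp
  qed
  show "(\<lambda>n. convL (avk (s n)) (indL {a..b})) \<longlonglongrightarrow> indL {a..b}"
    unfolding convL_def indL_def[of "{a..b}", symmetric]
    unfolding indL_def[of "{a..b}"]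
  proof (rule abs_L2_tendsto_dominated[where g="indicator {a-1..b+1}"], fold indL_def)
    have "AE t in lborel. t \<noteq> a \<and> t \<noteq> b"
      using AE_lborel_singleton[of a] AE_lborel_singleton[of b] by eventually_elim auto
    then show "AE t in lborel. (\<lambda>n. conv (avk (s n)) (indL {a..b}) t) \<longlonglongrightarrow> indicator {a..b} t"
    proof eventually_elim
      case (elim t)
      define r where "r = min \<bar>t - a\<bar> \<bar>t - b\<bar>"
      have r: "r > 0" using elim by (auto simp: r_def)
      have "\<forall>\<^sub>F n in sequentially. \<bar>s n\<bar> < r" using order_tendstoD(2)[OF tendsto_rabs[OF s(1)], of r] r by simp
      then show ?case
      proof (rule tendsto_eventually[OF eventually_mono])
        fix n assume n: "\<bar>s n\<bar> < r"
        show "conv (avk (s n)) (indL {a..b}) t = indicator {a..b} t"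
          by (rule const) (use n in \<open>auto simp: r_def indicator_def split: if_splits\<close>)
      qed
    qed
    show "AE t in lborel. norm (conv (avk (s n)) (indL {a..b}) t) \<le> norm (indicator {a-1..b+1} t :: complex)" for n
    proof (rule AE_I2)
      fix t
      show "norm (conv (avk (s n)) (indL {a..b}) t) \<le> norm (indicator {a-1..b+1} t :: complex)"
      proof (cases "t \<in> {a-1..b+1}")
        case False
        have "conv (avk (s n)) (indL {a..b}) t = 0"
          by (rule const) (use False s(3)[of n] in \<open>auto simp: indicator_def\<close>)
        then show ?thesis by simp
      next
        case True
        have "integrable lborel (\<lambda>u. avk (s n) (t - u))"
          using k[of n] lborel_integrable_real_affine[of "avk (s n)" "-1" t] by (simp add: kern_def)
        then have i: "integrable lborel (\<lambda>u. norm (avk (s n) (t - u)))" by (rule integrable_norm)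
        have "norm (conv (avk (s n)) (indL {a..b}) t) \<le> (LINT u|lborel. norm (avk (s n) (t - u) * indicator {a..b} u))"
          unfolding conv_indL[OF sk] by (rule integral_norm_bound)
        also have "\<dots> \<le> (LINT u|lborel. norm (avk (s n) (t - u)))"
        proof (rule integral_mono[OF _ i])
          show "integrable lborel (\<lambda>u. norm (avk (s n) (t - u) * indicator {a..b} u))"
            by (rule Bochner_Integration.integrable_bound[OF i]) (use sk[of n] in \<open>auto simp: norm_mult indicator_def sqi_def\<close>)
        qed (auto simp: norm_mult indicator_def)
        also have "\<dots> = (LINT u|lborel. norm (avk (s n) u))"
          using lborel_integral_real_affine[of "-1" "\<lambda>u. norm (avk (s n) u)" t] by simp
        also have "\<dots> = 1" by (rule integral_avk[OF s(2)])
        finally show ?thesis using True by simp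
      qed
    qed
    show "sqi (indicator {a-1..b+1})" "sqi (indicator {a..b})" by (rule sqi_indicator_bounded; auto)+
  qed (rule sqi_conv[OF k])
next
  show "norm (convL (avk (s n)) x) \<le> 1 * norm x" for n x
    using norm_convL_le[OF kern_avk[OF s(2)], of n x] integral_avk(1)[OF s(2), of n] by simp
qed (use s(2) in \<open>auto simp: bounded_linear_convL kern_avk convL_const\<close>)

subsection \<open>Operator matrices\<close>

definition mop :: "('m \<Rightarrow> 'n \<Rightarrow> L2 \<Rightarrow> L2) \<Rightarrow> L2^'n::finite \<Rightarrow> L2^'m::finite" where
  "mop T x = (\<chi> i. \<Sum>j\<in>UNIV. T i j (x $ j))"

lemma mop_nth [simp]: "mop T x $ i = (\<Sum>j\<in>UNIV. T i j (x $ j))"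
  by (simp add: mop_def)

lemma norm_vec_le_sum: "norm (x :: 'a::real_normed_vector^'n::finite) \<le> (\<Sum>i\<in>UNIV. norm (x $ i))"
  unfolding norm_vec_def by (rule L2_set_le_sum) auto

lemma bounded_linear_vecI:
  assumes "\<And>i. bounded_linear (\<lambda>x. f x $ i)"
  shows "bounded_linear (f :: 'a::real_normed_vector \<Rightarrow> 'b::real_normed_vector^'n::finite)"
proof -
  have "\<exists>K. \<forall>i x. norm (f x $ i) \<le> norm x * K i"
    using bounded_linear.bounded[OF assms] by metis
  then obtain K where K: "\<And>i x. norm (f x $ i) \<le> norm x * K i" by blast
  show ?thesis
  proof (rule bounded_linear_intro[where K="\<Sum>i\<in>UNIV. K i"])
    fix x y r
    show "f (x + y) = f x + f y" using linear_add[OF bounded_linear.linear[OF assms]] by (simp add: vec_eq_iff)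
    show "f (r *\<^sub>R x) = r *\<^sub>R f x" using linear_scale[OF bounded_linear.linear[OF assms]] by (simp add: vec_eq_iff)
    have "norm (f x) \<le> (\<Sum>i\<in>UNIV. norm x * K i)" by (rule order_trans[OF norm_vec_le_sum]) (intro sum_mono K)
    then show "norm (f x) \<le> norm x * (\<Sum>i\<in>UNIV. K i)" by (simp add: sum_distrib_left)
  qed
qed

lemma bounded_linear_mop: "(\<And>i j. bounded_linear (T i j)) \<Longrightarrow> bounded_linear (mop T)"
  unfolding mop_def
  by (rule bounded_linear_vecI) (auto intro!: bounded_linear_sum bounded_linear_compose[OF _ bounded_linear_vec_nth])

lemma norm_mop_le:
  assumes "\<And>i j x. norm (T i j x) \<le> c i j * norm x" "\<And>i j. c i j \<ge> 0"
  shows "norm (mop T x) \<le> (\<Sum>i\<in>UNIV. \<Sum>j\<in>UNIV. c i j) * norm x"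
proof -
  have "norm (mop T x) \<le> (\<Sum>i\<in>UNIV. norm (\<Sum>j\<in>UNIV. T i j (x $ j)))" using norm_vec_le_sum[of "mop T x"] by simp
  also have "\<dots> \<le> (\<Sum>i\<in>UNIV. \<Sum>j\<in>UNIV. c i j * norm x)"
  proof (rule sum_mono)
    fix i
    have "norm (\<Sum>j\<in>UNIV. T i j (x $ j)) \<le> (\<Sum>j\<in>UNIV. norm (T i j (x $ j)))" by (rule norm_sum)
    also have "\<dots> \<le> (\<Sum>j\<in>UNIV. c i j * norm x)"
    proof (rule sum_mono)
      fix j
      have "norm (T i j (x $ j)) \<le> c i j * norm (x $ j)" by (rule assms)
      also have "\<dots> \<le> c i j * norm x" by (intro mult_left_mono assms Finite_Cartesian_Product.norm_nth_le)
      finally show "norm (T i j (x $ j)) \<le> c i j * norm x" .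
    qed
    finally show "norm (\<Sum>j\<in>UNIV. T i j (x $ j)) \<le> (\<Sum>j\<in>UNIV. c i j * norm x)" .
  qed
  finally show ?thesis by (simp add: sum_distrib_right)
qed

lemma bounded_linear_axis: "bounded_linear (\<lambda>x. axis i x :: 'a::real_normed_vector^'n::finite)"
proof (rule bounded_linear_vecI)
  fix j show "bounded_linear (\<lambda>x. axis i x $ j :: 'a)" by (cases "j = i") (auto simp: axis_def)
qed

lemma approximable_mop:
  assumes "\<And>i j. approximable (T i j)" shows "approximable (mop T)"
proof -
  have "mop T = (\<lambda>x. \<Sum>i\<in>UNIV. \<Sum>j\<in>UNIV. axis i (T i j (x $ j)))"
  proof
    fix x
    have "(\<Sum>k\<in>UNIV. \<Sum>j\<in>UNIV. axis k (T k j (x $ j))) $ i = (\<Sum>k\<in>UNIV. if k = i then \<Sum>j\<in>UNIV. T k j (x $ j) else 0)" for i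
      unfolding sum_component by (rule sum.cong) (auto simp: axis_def)
    then show "mop T x = (\<Sum>i\<in>UNIV. \<Sum>j\<in>UNIV. axis i (T i j (x $ j)))" by (simp add: vec_eq_iff)
  qed
  moreover have "approximable (\<lambda>x. \<Sum>i\<in>UNIV. \<Sum>j\<in>UNIV. axis i (T i j (x $ j)))"
    by (intro approximable_sum approximable_compose_left[OF _ bounded_linear_axis] approximable_compose_right[OF assms bounded_linear_vec_nth]) auto
  ultimately show ?thesis by simp
qed

subsection \<open>The neutral equation in exponentially weighted coordinates\<close>

lemma L2on_complex_iff: "L2on A (f :: real \<Rightarrow> complex) \<longleftrightarrow> sqi (\<lambda>t. indicator A t *\<^sub>R f t)"
proof -
  have "(norm (indicator A t *\<^sub>R f t))\<^sup>2 = indicator A t * (norm (f t))\<^sup>2" for t by (simp add: indicator_def)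
  then show ?thesis unfolding L2on_def sqi_def by simp
qed

text \<open>For \<open>w(t) = e\<^sup>-\<^sup>\<gamma>\<^sup>t z'(t)\<close> the convolution with \<open>hker \<gamma>\<close> is \<open>e\<^sup>-\<^sup>\<gamma>\<^sup>t z(t)\<close>, and that with \<open>kA \<gamma> M\<close> is
  the weighted distributed delay \<open>e\<^sup>-\<^sup>\<gamma>\<^sup>t \<integral> M(\<theta>) z'(t + \<theta>) d\<theta>\<close>.\<close>

definition hker :: "real \<Rightarrow> real \<Rightarrow> complex" where
  "hker \<gamma> s = indicator {0..} s * of_real (exp (- (\<gamma> * s)))"

definition kA :: "real \<Rightarrow> (real \<Rightarrow> complex^'n^'n) \<Rightarrow> 'n::finite \<Rightarrow> 'n \<Rightarrow> real \<Rightarrow> complex" where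
  "kA \<gamma> M i j s = indicator {0..1} s * of_real (exp (- (\<gamma> * s))) * (indicator {-1..0} (-s) *\<^sub>R M (-s) $ i $ j)"

lemma integrable_exp_decay: "\<gamma> > 0 \<Longrightarrow> integrable lborel (\<lambda>s::real. indicator {0..} s * exp (- (\<gamma> * s)))"
proof -
  assume g: "\<gamma> > 0"
  have "((\<lambda>s. exp (- \<gamma> * s)) has_integral exp (- \<gamma> * 0) / \<gamma>) {0..}"
    by (rule has_integral_exp_minus_to_infinity[OF g])
  then have "(\<lambda>s. exp (- \<gamma> * s)) absolutely_integrable_on {0..}"
    by (intro nonnegative_absolutely_integrable_1) auto
  then have "integrable lebesgue (\<lambda>s. indicator {0..} s * exp (- (\<gamma> * s)))" by (simp add: set_integrable_def)
  then show ?thesis by (subst (asm) integrable_completion) auto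
qed

lemma kern_hker: assumes "\<gamma> > 0" shows "kern (hker \<gamma>)"
proof -
  have m: "hker \<gamma> \<in> borel_measurable borel" unfolding hker_def[abs_def] by measurable
  have "(norm (hker \<gamma> s))\<^sup>2 = indicator {0..} s * exp (- ((2 * \<gamma>) * s))" for s
    by (auto simp: hker_def indicator_def norm_mult exp_double[symmetric] algebra_simps)
  then have "sqi (hker \<gamma>)" using integrable_exp_decay[of "2 * \<gamma>"] assms m by (simp add: sqi_def)
  moreover have "integrable lborel (hker \<gamma>)"
  proof -
    have "hker \<gamma> = (\<lambda>s. of_real (indicator {0..} s * exp (- (\<gamma> * s))))" by (auto simp: hker_def indicator_def)
    then show ?thesis using integrable_of_real[OF integrable_exp_decay[OF assms]] by simp
  qed
  ultimately show ?thesis by (simp add: kern_def)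
qed

lemma norm_hker_mono: "1 \<le> \<gamma> \<Longrightarrow> norm (hker \<gamma> s) \<le> norm (hker 1 s)"
  by (auto simp: hker_def indicator_def norm_mult intro: mult_right_mono[of 1 \<gamma> s, simplified])

lemma kern_kA:
  assumes "L2on {-1..0} (\<lambda>\<theta>. M \<theta> $ i $ j)" shows "kern (kA \<gamma> M i j)"
proof -
  have s: "sqi (\<lambda>s. indicator {-1..0} (-s) *\<^sub>R M (-s) $ i $ j)"
    using sqi_reflect[OF iffD1[OF L2on_complex_iff assms]] by simp
  have b: "bmeas (\<lambda>s. indicator {0..1} s * of_real (exp (- (\<gamma> * s))))"
    by (rule bmeas_window) auto
  have i: "sqi (indicator {0..1})" by (rule sqi_indicator_bounded) auto
  have e: "indicator {0..1} s * (of_real (exp (- (\<gamma> * s))) * x) = indicator {0..1} s * of_real (exp (- (\<gamma> * s))) * (indicator {0..1} s * x)" for s and x :: complex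
    by (auto simp: indicator_def)
  have "sqi (kA \<gamma> M i j)" using sqi_bmult[OF b s] by (simp add: kA_def[abs_def])
  moreover have "integrable lborel (kA \<gamma> M i j)"
  proof -
    have "sqi (\<lambda>s. indicator {0..1} s * of_real (exp (- (\<gamma> * s))) * indicator {0..1} s)" by (rule sqi_bmult[OF b i])
    then have "integrable lborel (\<lambda>s. (indicator {0..1} s * of_real (exp (- (\<gamma> * s))) * indicator {0..1} s) * (indicator {-1..0} (-s) *\<^sub>R M (-s) $ i $ j))"
      by (rule integrable_sqi_mult[OF _ s])
    moreover have "(\<lambda>s. (indicator {0..1} s * of_real (exp (- (\<gamma> * s))) * indicator {0..1} s) * (indicator {-1..0} (-s) *\<^sub>R M (-s) $ i $ j)) = kA \<gamma> M i j"
      by (auto simp: kA_def fun_eq_iff indicator_def)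
    ultimately show ?thesis by simp
  qed
  ultimately show ?thesis by (simp add: kern_def)
qed

text \<open>For \<open>s > 0\<close> the weight tends to 0, and the unweighted kernel dominates.
  Thus a large weight makes the distributed delays small.\<close>

lemma kA_tendsto:
  assumes M: "L2on {-1..0} (\<lambda>\<theta>. M \<theta> $ i $ j)"
  shows "(\<lambda>n. LINT s|lborel. norm (kA (real (Suc n)) M i j s)) \<longlonglongrightarrow> 0"
proof -
  have i: "integrable lborel (kA \<gamma> M i j)" for \<gamma> using kern_kA[OF M] by (simp add: kern_def)
  have "(\<lambda>n. LINT s|lborel. norm (kA (real (Suc n)) M i j s)) \<longlonglongrightarrow> (LINT s::real|lborel. (0::real))"
  proof (rule Bochner_Integration.integral_dominated_convergence[where w="\<lambda>s. norm (kA 0 M i j s)"])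
    show "AE s in lborel. (\<lambda>n. norm (kA (real (Suc n)) M i j s)) \<longlonglongrightarrow> 0"
      using AE_lborel_singleton[of 0]
    proof eventually_elim
      case (elim s)
      show ?case
      proof (cases "s > 0")
        case True
        have "(\<lambda>n. exp (- s) ^ Suc n) \<longlonglongrightarrow> 0" using True by (intro LIMSEQ_Suc LIMSEQ_power_zero) auto
        then have "(\<lambda>n. exp (- (real (Suc n) * s))) \<longlonglongrightarrow> 0" by (simp only: exp_of_nat_mult[symmetric]) simp
        then have "(\<lambda>n. exp (- (real (Suc n) * s)) * norm (indicator {0..1} s * (indicator {-1..0} (-s) *\<^sub>R M (-s) $ i $ j) :: complex)) \<longlonglongrightarrow> 0 * norm (indicator {0..1} s * (indicator {-1..0} (-s) *\<^sub>R M (-s) $ i $ j) :: complex)"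
          by (intro tendsto_mult tendsto_const)
        then show ?thesis by (simp add: kA_def norm_mult mult_ac)
      next
        case False
        then show ?thesis using elim by (simp add: kA_def)
      qed
    qed
    show "AE s in lborel. norm (norm (kA (real (Suc n)) M i j s)) \<le> norm (kA 0 M i j s)" for n
      by (rule AE_I2) (auto simp: kA_def norm_mult indicator_def intro!: mult_left_le_one_le)
  qed (use i in \<open>auto intro: borel_measurable_integrable integrable_norm\<close>)
  then show ?thesis by simp
qed

text \<open>The distributed delays: \<open>A2\<close> acts on the derivative, \<open>A3\<close> on
  its weighted primitive \<open>convL (hker \<gamma>) u\<close>. This is the part that is compact on
  bounded windows.\<close>

definition cop :: "real \<Rightarrow> (real \<Rightarrow> complex^'n^'n) \<Rightarrow> (real \<Rightarrow> complex^'n^'n) \<Rightarrow> 'n::finite \<Rightarrow> 'n \<Rightarrow> L2 \<Rightarrow> L2" where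
  "cop \<gamma> A2 A3 i j u = convL (kA \<gamma> A2 i j) u + convL (kA \<gamma> A3 i j) (convL (hker \<gamma>) u)"

text \<open>Adds the pointwise delay; the factor \<open>exp (- \<gamma>)\<close> is what a shift by
  one unit of time does to the weight.\<close>

definition nop :: "real \<Rightarrow> complex^'n^'n \<Rightarrow> (real \<Rightarrow> complex^'n^'n) \<Rightarrow> (real \<Rightarrow> complex^'n^'n) \<Rightarrow> 'n::finite \<Rightarrow> 'n \<Rightarrow> L2 \<Rightarrow> L2" where
  "nop \<gamma> A1 A2 A3 i j u = mulL (\<lambda>_. of_real (exp (- \<gamma>)) * A1 $ i $ j) (shiftL (-1) u) + cop \<gamma> A2 A3 i j u"

text \<open>As \<open>\<gamma>\<close> grows, \<open>exp (- \<gamma>)\<close> and the norms of the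
  weighted kernels tend to 0, while the norm of \<open>hker \<gamma>\<close> stays below its value
  \<open>H\<close> at weight 1. Finitely many entries then sum to less than 1.\<close>

lemma exists_weight:
  assumes A2: "\<forall>i j. L2on {-1..0} (\<lambda>\<theta>. A2 \<theta> $ i $ j)" and A3: "\<forall>i j. L2on {-1..0} (\<lambda>\<theta>. A3 \<theta> $ i $ j)"
  shows "\<exists>\<gamma>>0. \<exists>q<1. \<forall>x. norm (mop (nop \<gamma> A1 A2 A3) x) \<le> q * norm (x :: L2^'n::finite)"
proof -
  define H where "H = (LINT s|lborel. norm (hker 1 s))"
  define I where "I M i j n = (LINT s|lborel. norm (kA (real (Suc n)) M i j s))" for M :: "real \<Rightarrow> complex^'n^'n" and i j n
  define c where "c n i j = exp (- 1) ^ Suc n * norm (A1 $ i $ j) + I A2 i j n + I A3 i j n * H" for n i j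
  have i2: "integrable lborel (kA \<gamma> A2 i j)" and i3: "integrable lborel (kA \<gamma> A3 i j)" for \<gamma> i j
    using kern_kA[OF A2[rule_format]] kern_kA[OF A3[rule_format]] by (auto simp: kern_def)
  note k2 = kern_kA[OF A2[rule_format]] and k3 = kern_kA[OF A3[rule_format]]
  have H0: "H \<ge> 0" and I0: "I M i j n \<ge> 0" for M i j n by (auto simp: H_def I_def)
  have "(\<lambda>n. \<Sum>i\<in>UNIV. \<Sum>j\<in>UNIV. c n i j) \<longlonglongrightarrow> (\<Sum>i\<in>(UNIV::'n set). \<Sum>j\<in>(UNIV::'n set). 0 * norm (A1 $ i $ j) + 0 + 0 * H)"
    unfolding c_def I_def
    by (intro tendsto_sum tendsto_add tendsto_mult tendsto_const kA_tendsto LIMSEQ_Suc LIMSEQ_power_zero) (use A2 A3 in auto)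
  then have "\<forall>\<^sub>F n in sequentially. (\<Sum>i\<in>UNIV. \<Sum>j\<in>UNIV. c n i j) < 1" by (intro order_tendstoD(2)) auto
  then obtain n where n: "(\<Sum>i\<in>UNIV. \<Sum>j\<in>UNIV. c n i j) < 1" by (auto simp: eventually_sequentially)
  \<comment> \<open>Convergence along integer weights is enough; the successor ensures
    \<open>\<gamma> \<ge> 1\<close>, where the bound \<open>H\<close> applies.\<close>
  define \<gamma> where "\<gamma> = real (Suc n)"
  have g: "\<gamma> > 0" "\<gamma> \<ge> 1" by (auto simp: \<gamma>_def)
  have ih: "integrable lborel (hker \<gamma>)" "integrable lborel (hker 1)" using kern_hker g by (auto simp: kern_def)
  have hle: "(LINT s|lborel. norm (hker \<gamma> s)) \<le> H" unfolding H_def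
    by (rule integral_mono) (use ih g in \<open>auto intro: integrable_norm norm_hker_mono\<close>)
  have e: "exp (- \<gamma>) = exp (- 1) ^ Suc n" unfolding \<gamma>_def by (simp only: exp_of_nat_mult[symmetric]) simp
  have "norm (nop \<gamma> A1 A2 A3 i j u) \<le> c n i j * norm u" for i j u
  proof -
    have 1: "norm (mulL (\<lambda>_. of_real (exp (- \<gamma>)) * A1 $ i $ j) (shiftL (-1) u)) \<le> exp (- 1) ^ Suc n * norm (A1 $ i $ j) * norm u"
      using norm_mulL_le[of "\<lambda>_. of_real (exp (- \<gamma>)) * A1 $ i $ j" "exp (- \<gamma>) * norm (A1 $ i $ j)" "shiftL (-1) u"]
      by (simp only: e norm_shiftL) (simp add: norm_mult norm_power)
    have 2: "norm (convL (kA \<gamma> A2 i j) u) \<le> I A2 i j n * norm u"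
      using norm_convL_le[OF k2[of \<gamma> i j], of u] by (simp add: I_def \<gamma>_def)
    have "norm (convL (kA \<gamma> A3 i j) (convL (hker \<gamma>) u)) \<le> I A3 i j n * norm (convL (hker \<gamma>) u)"
      using norm_convL_le[OF k3[of \<gamma> i j], of "convL (hker \<gamma>) u"] by (simp add: I_def \<gamma>_def)
    also have "\<dots> \<le> I A3 i j n * (H * norm u)"
      using norm_convL_le[OF kern_hker[OF g(1)], of u] mult_right_mono[OF hle, of "norm u"] by (intro mult_left_mono I0) auto
    finally have 3: "norm (convL (kA \<gamma> A3 i j) (convL (hker \<gamma>) u)) \<le> I A3 i j n * H * norm u" by (simp add: mult.assoc)
    have "norm (nop \<gamma> A1 A2 A3 i j u) \<le> norm (mulL (\<lambda>_. of_real (exp (- \<gamma>)) * A1 $ i $ j) (shiftL (-1) u)) + (norm (convL (kA \<gamma> A2 i j) u) + norm (convL (kA \<gamma> A3 i j) (convL (hker \<gamma>) u)))"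
      unfolding nop_def cop_def by (intro norm_triangle_le add_mono order_refl norm_triangle_ineq)
    also have "\<dots> \<le> c n i j * norm u" using 1 2 3 by (simp add: c_def distrib_right)
    finally show ?thesis .
  qed
  then have "\<forall>x. norm (mop (nop \<gamma> A1 A2 A3) x) \<le> (\<Sum>i\<in>UNIV. \<Sum>j\<in>UNIV. c n i j) * norm (x :: L2^'n)"
    by (intro allI norm_mop_le) (auto simp: c_def H0 I0)
  then show ?thesis using n g(1) by blast
qed

section \<open>Componentwise operations on vectors of classes\<close>

definition scV :: "complex \<Rightarrow> L2^'n::finite \<Rightarrow> L2^'n" where "scV c x = (\<chi> i. mulL (\<lambda>_. c) (x $ i))"
definition mV :: "(real \<Rightarrow> complex) \<Rightarrow> L2^'n::finite \<Rightarrow> L2^'n" where "mV m x = (\<chi> i. mulL m (x $ i))"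
definition shV :: "real \<Rightarrow> L2^'n::finite \<Rightarrow> L2^'n" where "shV h x = (\<chi> i. shiftL h (x $ i))"
definition vanV :: "real set \<Rightarrow> L2^'n::finite \<Rightarrow> bool" where "vanV A x \<longleftrightarrow> (\<forall>i. vanish A (x $ i))"
definition cutV :: "real set \<Rightarrow> L2^'n::finite \<Rightarrow> L2^'n" where "cutV A = mV (indicator A)"

lemma vec_ops_nth [simp]: "scV c x $ i = mulL (\<lambda>_. c) (x $ i)" "mV m x $ i = mulL m (x $ i)"
   "shV h x $ i = shiftL h (x $ i)" "cutV A x $ i = mulL (indicator A) (x $ i)"
  by (auto simp: scV_def mV_def shV_def cutV_def)

lemma scV_mV: "scV c = mV (\<lambda>_. c)" by (auto simp: fun_eq_iff vec_eq_iff)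

lemma bounded_linear_mV: "bounded_linear (mV m)"
  by (rule bounded_linear_vecI) (auto intro: bounded_linear_compose[OF bounded_linear_mulL bounded_linear_vec_nth])

lemma bounded_linear_shV: "bounded_linear (shV h)"
  by (rule bounded_linear_vecI) (auto intro: bounded_linear_compose[OF bounded_linear_shiftL bounded_linear_vec_nth])

lemmas linear_mV = bounded_linear.linear[OF bounded_linear_mV]
lemmas linear_shV = bounded_linear.linear[OF bounded_linear_shV]

lemma norm_mV_le: assumes "\<And>t. norm (m t) \<le> 1" shows "norm (mV m x) \<le> norm x"
  unfolding norm_vec_def by (rule L2_set_mono) (use norm_mulL_le[of m 1] assms in auto)

lemma norm_shV [simp]: "norm (shV h x) = norm x"
  by (simp add: norm_vec_def)

lemma scV_add: "scV c (x + y) = scV c x + scV c y" by (simp add: vec_eq_iff mulL_add)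
lemma shV_shV: "shV h (shV k x) = shV (h + k) x" by (simp add: vec_eq_iff shiftL_shiftL)
lemma shV_0 [simp]: "shV 0 x = x" by (simp add: vec_eq_iff)
lemma shV_scV: "shV h (scV c x) = scV c (shV h x)" by (simp add: vec_eq_iff shiftL_mulL)
lemma scV_mV_commute: "mV m (scV c x) = scV c (mV m x)" by (simp add: vec_eq_iff mulL_mulL_commute)

lemma vanV_cutV: "A \<in> sets borel \<Longrightarrow> vanV A x \<longleftrightarrow> cutV A x = 0"
  by (simp add: vanV_def vec_eq_iff vanish_iff)

lemma mulL_indicator_idem: "A \<in> sets borel \<Longrightarrow> B \<in> sets borel \<Longrightarrow> mulL (indicator A) (mulL (indicator B) x) = mulL (indicator (A \<inter> B)) x"
  by (simp add: mulL_mulL) (rule arg_cong[where f="\<lambda>m. mulL m x"], auto simp: indicator_def)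

lemma cutV_cutV: "A \<in> sets borel \<Longrightarrow> B \<in> sets borel \<Longrightarrow> cutV A (cutV B x) = cutV (A \<inter> B) x"
  by (simp add: vec_eq_iff mulL_indicator_idem)

lemma mulL_compl: "A \<in> sets borel \<Longrightarrow> x = mulL (indicator A) x + mulL (indicator (- A)) x"
proof -
  assume A: "A \<in> sets borel"
  have "mulL (\<lambda>t. indicator A t + indicator (- A) t) x = mulL (\<lambda>_. 1) x"
    by (rule arg_cong[where f="\<lambda>m. mulL m x"]) (auto simp: indicator_def)
  then show ?thesis using mulL_plus[of "indicator A" "indicator (- A)" x] A by simp
qed

lemma cutV_compl: "A \<in> sets borel \<Longrightarrow> x = cutV A x + cutV (- A) x"
  by (simp add: vec_eq_iff mulL_compl[symmetric])

lemma vanish_cut: "A \<in> sets borel \<Longrightarrow> A \<inter> B = {} \<Longrightarrow> vanish A (mulL (indicator B) x)"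
proof (cases "bmeas (indicator B)")
  case True
  assume "A \<inter> B = {}"
  then show ?thesis by (intro vanish_mulL_zero True) (auto simp: indicator_def)
qed (simp add: mulL_eq_0)

lemma cut_eq_self: "A \<in> sets borel \<Longrightarrow> vanish (- A) x \<Longrightarrow> mulL (indicator A) x = x"
  using mulL_compl[of A x] vanish_iff[of "- A" x] by auto

lemma vanV_add: "vanV A x \<Longrightarrow> vanV A y \<Longrightarrow> vanV A (x + y)" by (auto simp: vanV_def vanish_add)
lemma vanV_diff: "vanV A x \<Longrightarrow> vanV A y \<Longrightarrow> vanV A (x - y)" by (auto simp: vanV_def vanish_diff)
lemma vanV_cut: "A \<in> sets borel \<Longrightarrow> A \<inter> B = {} \<Longrightarrow> vanV A (cutV B x)" by (auto simp: vanV_def vanish_cut)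
lemma vanV_shV: "vanV A x \<Longrightarrow> (\<And>t. t \<in> B \<Longrightarrow> t + h \<in> A) \<Longrightarrow> A \<in> sets borel \<Longrightarrow> vanV B (shV h x)"
  by (auto simp: vanV_def intro: vanish_shiftL)

lemma conv_cong:
  assumes "sqi k" "vanish A (x - y)" "\<And>s. s \<notin> A \<Longrightarrow> k (t - s) = 0" shows "conv k x t = conv k y t"
  using conv_vanish[OF assms] linear_diff[OF bounded_linear.linear[OF bounded_linear_conv[of k t]], of x y] by simp

text \<open>Without weights: \<open>z\<close> is constant as long as its derivative vanishes. The
  exponential factor is the weight alone.\<close>

lemma conv_hker_decay:
  assumes g: "\<gamma> > 0" and st: "s \<le> t" and v: "vanish {s<..t} x"
  shows "conv (hker \<gamma>) x t = of_real (exp (- (\<gamma> * (t - s)))) * conv (hker \<gamma>) x s"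
proof -
  have sq: "sqi (hker \<gamma>)" using kern_hker[OF g] by (simp add: kern_def)
  have "(LINT u|lborel. hker \<gamma> (t - u) * rep_L2 x u) = (LINT u|lborel. of_real (exp (- (\<gamma> * (t - s)))) * (hker \<gamma> (s - u) * rep_L2 x u))"
  proof (rule integral_cong_AE)
    have [measurable]: "hker \<gamma> \<in> borel_measurable borel" using sq by (simp add: sqi_def)
    show "(\<lambda>u. hker \<gamma> (t - u) * rep_L2 x u) \<in> borel_measurable lborel" by measurable
    show "(\<lambda>u. of_real (exp (- (\<gamma> * (t - s)))) * (hker \<gamma> (s - u) * rep_L2 x u)) \<in> borel_measurable lborel" by measurable
    show "AE u in lborel. hker \<gamma> (t - u) * rep_L2 x u = of_real (exp (- (\<gamma> * (t - s)))) * (hker \<gamma> (s - u) * rep_L2 x u)"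
      using v unfolding vanish_def
    proof eventually_elim
      case (elim u)
      consider "u \<le> s" | "s < u" "u \<le> t" | "u > t" by linarith
      then show ?case
      proof cases
        case 1
        have "exp (- (\<gamma> * (t - u))) = exp (- (\<gamma> * (t - s))) * exp (- (\<gamma> * (s - u)))"
          by (simp add: exp_add[symmetric] algebra_simps)
        then show ?thesis using 1 st by (simp add: hker_def)
      qed (use elim st in \<open>auto simp: hker_def\<close>)
    qed
  qed
  then show ?thesis by (simp add: conv_eq[OF sq])
qed

section \<open>Contraction, causality and the state of a trajectory\<close>

locale neutral =
  fixes A1 :: "complex^'n::finite^'n" and b :: "complex^'n" and A2 A3 :: "real \<Rightarrow> complex^'n^'n" and \<gamma> q :: real
  assumes A2: "\<And>i j. L2on {-1..0} (\<lambda>\<theta>. A2 \<theta> $ i $ j)" and A3: "\<And>i j. L2on {-1..0} (\<lambda>\<theta>. A3 \<theta> $ i $ j)"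
    and \<gamma>: "\<gamma> > 0" and q: "q < 1" and contr: "\<And>x. norm (mop (nop \<gamma> A1 A2 A3) x) \<le> q * norm x"
begin

abbreviation "h0 \<equiv> hker \<gamma>"
abbreviation "T \<equiv> nop \<gamma> A1 A2 A3"
abbreviation "K \<equiv> mop T"

lemmas kern_h = kern_hker[OF \<gamma>]
lemmas kern2 = kern_kA[OF A2]
lemmas kern3 = kern_kA[OF A3]

lemma sqi_h: "sqi h0" using kern_h by (simp add: kern_def)

lemma bounded_linear_cop: "bounded_linear (cop \<gamma> A2 A3 i j)"
  unfolding cop_def[abs_def]
  by (intro bounded_linear_add bounded_linear_convL kern2 bounded_linear_compose[OF bounded_linear_convL[OF kern3] bounded_linear_convL[OF kern_h]])

lemma bounded_linear_T: "bounded_linear (T i j)"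
  unfolding nop_def[abs_def]
  by (intro bounded_linear_add bounded_linear_cop bounded_linear_compose[OF bounded_linear_mulL bounded_linear_shiftL])

lemma bounded_linear_K: "bounded_linear K" by (rule bounded_linear_mop[OF bounded_linear_T])
lemmas linear_K = bounded_linear.linear[OF bounded_linear_K]
lemma T_shiftL: "T i j (shiftL h u) = shiftL h (T i j u)"
  by (simp add: nop_def cop_def shiftL_add shiftL_mulL shiftL_shiftL convL_shiftL kern2 kern3 kern_h add.commute)

lemma T_const: "T i j (mulL (\<lambda>_. c) u) = mulL (\<lambda>_. c) (T i j u)"
  by (simp add: nop_def cop_def mulL_add shiftL_mulL convL_const kern2 kern3 kern_h mulL_mulL_commute[of "\<lambda>_. c"])

lemma K_shV: "K (shV h x) = shV h (K x)"
  by (simp add: vec_eq_iff T_shiftL linear_sum[OF bounded_linear.linear[OF bounded_linear_shiftL]])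

lemma K_scV: "K (scV c x) = scV c (K x)"
  by (simp add: vec_eq_iff T_const linear_sum[OF bounded_linear.linear[OF bounded_linear_mulL]])

text \<open>The choice is justified by the Neumann series: \<open>N\<close> is the inverse of \<open>I - K\<close>.\<close>

definition N :: "L2^'n \<Rightarrow> L2^'n" where
  "N = (SOME N. bounded_linear N \<and> (\<forall>y. N y = y + K (N y)) \<and> (\<forall>x y. x = y + K x \<longrightarrow> x = N y))"

lemma N_props: "bounded_linear N \<and> (\<forall>y. N y = y + K (N y)) \<and> (\<forall>x y. x = y + K x \<longrightarrow> x = N y)"
proof -
  obtain N' where "bounded_linear N'" "\<And>y. N' y = y + K (N' y)" "\<And>x y. x = y + K x \<Longrightarrow> x = N' y"
    using neumann_inverse[OF bounded_linear_K q contr] by blast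
  then show ?thesis unfolding N_def by (intro someI_ex[of "\<lambda>N. bounded_linear N \<and> (\<forall>y. N y = y + K (N y)) \<and> (\<forall>x y. x = y + K x \<longrightarrow> x = N y)"]) blast
qed

lemma bounded_linear_N: "bounded_linear N" using N_props by blast
lemma N_eq: "N y = y + K (N y)" using N_props by blast
lemma N_unique: "x = y + K x \<Longrightarrow> x = N y" using N_props by blast
lemmas linear_N = bounded_linear.linear[OF bounded_linear_N]

lemma N_diffK: "N (x - K x) = x" by (rule N_unique[symmetric]) simp

lemma N_shV: "N (shV h y) = shV h (N y)"
proof (rule N_unique[symmetric])
  have "shV h (N y) = shV h (y + K (N y))" using N_eq[of y] by simp
  then show "shV h (N y) = shV h y + K (shV h (N y))" by (rule trans) (simp add: linear_add[OF linear_shV] K_shV)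
qed

lemma N_scV: "N (scV c y) = scV c (N y)"
proof (rule N_unique[symmetric])
  have "scV c (N y) = scV c (y + K (N y))" using N_eq[of y] by simp
  then show "scV c (N y) = scV c y + K (scV c (N y))"
    by (rule trans) (simp add: K_scV scV_add)
qed

text \<open>Cutting does not increase norms, so the contraction property survives on any set of
  times and leaves only the zero solution of the homogeneous equation there.\<close>

lemma cut_absorb:
  assumes "cutV B w = cutV B (K (cutV B w))" shows "cutV B w = 0"
proof -
  have "norm (cutV B w) \<le> norm (K (cutV B w))"
    using norm_mV_le[of "indicator B" "K (cutV B w)"] assms by (simp add: cutV_def indicator_def)
  also have "\<dots> \<le> q * norm (cutV B w)" by (rule contr)
  finally have "(1 - q) * norm (cutV B w) \<le> 0" by (simp add: algebra_simps)
  then show ?thesis using q by (simp add: mult_le_0_iff)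
qed

lemma kA_zero: "s < 0 \<or> s > 1 \<Longrightarrow> kA \<gamma> M i j s = 0" by (auto simp: kA_def)
lemma h0_zero: "s < 0 \<Longrightarrow> h0 s = 0" by (auto simp: hker_def)

lemma T_vanish: 
  assumes "vanish {..<a} u" shows "vanish {..<a} (T i j u)"
proof -
  have h: "vanish {..<a} (convL h0 u)" by (rule vanish_convL[OF kern_h assms]) (auto intro: h0_zero)
  have "vanish {..<a} (convL (kA \<gamma> A2 i j) u)" by (rule vanish_convL[OF kern2 assms]) (auto intro: kA_zero)
  moreover have "vanish {..<a} (convL (kA \<gamma> A3 i j) (convL h0 u))" by (rule vanish_convL[OF kern3 h]) (auto intro: kA_zero)
  moreover have "vanish {..<a} (shiftL (-1) u)" by (rule vanish_shiftL[OF assms]) auto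
  ultimately show ?thesis unfolding nop_def cop_def by (intro vanish_add vanish_mulL)
qed

lemma K_causal: "vanV {..<a} x \<Longrightarrow> vanV {..<a} (K x)"
  by (auto simp: vanV_def intro!: vanish_sum T_vanish)

text \<open>Before \<open>a\<close> the forcing is zero and \<open>K\<close> looks only into the
  past, so the part of \<open>N y\<close> before \<open>a\<close> solves the homogeneous equation
  and \<open>cut_absorb\<close> applies.\<close>

lemma N_causal: assumes "vanV {..<a} y" shows "vanV {..<a} (N y)"
proof -
  define w where "w = N y"
  let ?Q = "cutV {..<a}"
  have lin: "linear ?Q" unfolding cutV_def by (rule linear_mV)
  have "vanV {..<a} (w - ?Q w)"
  proof -
    have "w = ?Q w + cutV (- {..<a}) w" by (rule cutV_compl) simp
    then have "w - ?Q w = cutV (- {..<a}) w" by (metis add_diff_cancel_left')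
    moreover have "vanV {..<a} (cutV (- {..<a}) w)" by (rule vanV_cut) auto
    ultimately show ?thesis by simp
  qed
  from K_causal[OF this] have "?Q (K (w - ?Q w)) = 0" by (subst (asm) vanV_cutV) auto
  then have 1: "?Q (K w) = ?Q (K (?Q w))" by (simp add: linear_diff[OF linear_K] linear_diff[OF lin])
  have "?Q w = ?Q (y + K w)" using N_eq[of y] by (simp add: w_def)
  also have "\<dots> = ?Q (K w)" using assms by (simp add: linear_add[OF lin] vanV_cutV)
  finally have "?Q w = 0" using 1 by (intro cut_absorb) simp
  then show ?thesis by (simp add: vanV_cutV w_def)
qed

text \<open>The state at time 0: up to the factor \<open>e\<^sup>\<gamma>\<close>, \<open>cst\<close> is \<open>z(-1)\<close>, and \<open>P\<close> retains \<open>z'\<close> on \<open>[-1, 0]\<close>. Together they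
  determine the future of an uncontrolled trajectory.\<close>

definition cst :: "L2^'n \<Rightarrow> complex^'n" where "cst x = (\<chi> i. conv h0 (x $ i) (-1))"
abbreviation "P \<equiv> cutV {-1..0::real}"
definition st :: "L2^'n \<Rightarrow> (complex^'n) \<times> (L2^'n)" where "st x = (cst x, P x)"

lemma bounded_linear_st: "bounded_linear st"
proof -
  have "bounded_linear cst" unfolding cst_def[abs_def]
    by (rule bounded_linear_vecI) (auto intro: bounded_linear_compose[OF bounded_linear_conv bounded_linear_vec_nth])
  then show ?thesis unfolding st_def[abs_def] cutV_def by (intro bounded_linear_Pair bounded_linear_mV)
qed

lemmas linear_st = bounded_linear.linear[OF bounded_linear_st]

text \<open>If the state at 0 is zero, then the past before -1 has no effect after 0: the pointwise
  and distributed delays reach back only one unit, and the primitive, zero at -1, stays zero. The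
  future therefore solves the homogeneous equation by itself.\<close>

lemma st_zero_future:
  assumes st: "st w = 0" and y: "vanV {0<..} (w - K w)" and h: "h \<ge> 0"
  shows "vanV {-1..} w" "st (shV h w) = 0"
proof -
  have c0: "conv h0 (w $ i) (-1) = 0" for i using st by (simp add: st_def cst_def vec_eq_iff zero_prod_def)
  have P0: "vanV {-1..0} w" using st by (simp add: st_def vanV_cutV zero_prod_def)
  \<comment> \<open>Past and future parts; what lies between them is zero by the hypothesis on the
    state.\<close>
  define wm where "wm = cutV {..-1} w"
  define wp where "wp = cutV {0<..} w"
  have split: "w = wm + wp"
  proof -
    have "w = cutV {-1..} w + cutV (- {-1..}) w" by (rule cutV_compl) simp
    moreover have "cutV {-1..} w = wp"
    proof -
      have "cutV {-1..} w = cutV {0<..} (cutV {-1..} w) + cutV (- {0<..}) (cutV {-1..} w)" by (rule cutV_compl) simp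
      moreover have "{0<..} \<inter> {-1..} = {(0::real)<..}" "- {0<..} \<inter> {-1..} = {-1..(0::real)}" by auto
      ultimately show ?thesis using P0 by (simp add: cutV_cutV wp_def vanV_cutV)
    qed
    moreover have "cutV (- {-1..}) w = wm"
    proof -
      have "mulL (indicator (- {-1..})) (w $ i) = mulL (indicator {..-1}) (w $ i)" for i
        by (rule mulL_cong_AE) (use AE_lborel_singleton[of "-1"] in \<open>auto elim!: eventually_mono simp: indicator_def\<close>)
      then show ?thesis by (simp add: wm_def vec_eq_iff)
    qed
    ultimately show ?thesis by (simp add: add.commute)
  qed
  have wmv: "vanish {-1<..} (wm $ i)" for i unfolding wm_def by (auto intro!: vanish_cut)
  have wpv: "vanish {..0} (wp $ i)" for i unfolding wp_def by (auto intro!: vanish_cut)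
  have cm: "conv h0 (wm $ i) (-1) = 0" for i
  proof -
    have "conv h0 (w $ i) (-1) = conv h0 (wm $ i) (-1)"
      by (rule conv_cong[OF sqi_h, of "{..0}"]) (use wpv[of i] split in \<open>auto intro!: h0_zero simp: vec_eq_iff\<close>)
    then show ?thesis using c0 by simp
  qed
  have hm: "vanish {-1<..} (convL h0 (wm $ i))" for i
    unfolding vanish_def using rep_convL[OF kern_h, of "wm $ i"]
  proof eventually_elim
    case (elim t)
    have "vanish {-1<..t} (wm $ i)" by (rule vanish_mono[OF wmv]) auto
    then show ?case using conv_hker_decay[OF \<gamma>, of "-1" t "wm $ i"] cm elim by auto
  qed
  have "vanish {0<..} (T i j (wm $ j))" for i j
  proof -
    have "vanish {0<..} (convL (kA \<gamma> A2 i j) (wm $ j))" by (rule vanish_convL[OF kern2 wmv]) (auto intro: kA_zero)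
    moreover have "vanish {0<..} (convL (kA \<gamma> A3 i j) (convL h0 (wm $ j)))" by (rule vanish_convL[OF kern3 hm]) (auto intro: kA_zero)
    moreover have "vanish {0<..} (shiftL (-1) (wm $ j))" by (rule vanish_shiftL[OF wmv]) auto
    ultimately show ?thesis unfolding nop_def cop_def by (intro vanish_add vanish_mulL)
  qed
  then have Kwm: "cutV {0<..} (K wm) = 0" by (subst vanV_cutV[symmetric]) (auto simp: vanV_def intro!: vanish_sum)
  let ?Q = "cutV {0<..}"
  have lin: "linear ?Q" unfolding cutV_def by (rule linear_mV)
  have "?Q w = ?Q (K w)" using y by (simp add: vanV_cutV linear_diff[OF lin])
  also have "\<dots> = ?Q (K wp)" by (subst split) (simp add: linear_add[OF linear_K] linear_add[OF lin] Kwm)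
  finally have "wp = 0" unfolding wp_def by (intro cut_absorb)
  then have w: "w = wm" using split by simp
  have "vanish {-1..} (w $ i)" for i unfolding w by (rule vanish_null[OF wmv, of _ "-1"]) auto
  then show "vanV {-1..} w" by (simp add: vanV_def)
  have "vanV {-1..0} (shV h w)" by (rule vanV_shV[OF \<open>vanV {-1..} w\<close>]) (use h in auto)
  then have "P (shV h w) = 0" by (simp add: vanV_cutV)
  moreover have "conv h0 (shV h w $ i) (-1) = 0" for i
  proof -
    have "vanish {-1<..-1+h} (w $ i)" unfolding w by (rule vanish_mono[OF wmv]) auto
    then have "conv h0 (w $ i) (-1 + h) = 0"
      using conv_hker_decay[OF \<gamma>, of "-1" "-1 + h" "w $ i"] h c0[of i] by simp
    then show ?thesis by (simp add: conv_shiftL)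
  qed
  ultimately show "st (shV h w) = 0" by (simp add: st_def cst_def vec_eq_iff zero_prod_def)
qed

end

subsection \<open>Linear algebra of the rank conditions\<close>

text \<open>Row rank equal to the number of rows means that the rows are pairwise distinct and form
  an independent set.\<close>

lemma full_row_rank_right_inverse:
  fixes A :: "'a::field^'m::finite^'n::finite"
  assumes "rank A = CARD('n)" shows "\<exists>B. A ** B = mat 1"
proof -
  have rows: "rows A = range (\<lambda>i. row i A)" by (auto simp: rows_def)
  obtain B where B: "B \<subseteq> rows A" "vec.independent B" "rows A \<subseteq> vec.span B" "card B = vec.dim (rows A)"
    using vec.basis_exists by blast
  have cB: "card B = CARD('n)" using B(4) assms by (simp add: row_rank_def_gen)
  have "card (rows A) \<le> CARD('n)" unfolding rows by (rule card_image_le) simp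
  moreover have "finite (rows A)" unfolding rows by simp
  ultimately have BR: "B = rows A" using B(1) cB by (metis card_seteq)
  have inj: "inj (\<lambda>i. row i A)"
    by (rule eq_card_imp_inj_on) (use cB BR rows in auto)
  show ?thesis
    unfolding matrix_right_invertible_independent_rows
  proof (intro allI impI)
    fix c :: "'n \<Rightarrow> 'a" and i assume c: "(\<Sum>i\<in>UNIV. c i *s row i A) = 0"
    have inv: "inv (\<lambda>i. row i A) (row i A) = i" for i using inv_f_f[OF inj, of i] by simp
    define d where "d v = c (inv (\<lambda>i. row i A) v)" for v
    have "(\<Sum>v\<in>rows A. d v *s v) = (\<Sum>i\<in>UNIV. d (row i A) *s row i A)"
      unfolding rows by (subst sum.reindex[OF inj]) simp
    also have "\<dots> = 0" using c by (simp add: d_def inv)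
    finally have "d (row i A) = 0"
      using vec.independentD[OF B(2), of "rows A" d "row i A"] BR by (auto simp: rows)
    then show "c i = 0" by (simp add: d_def inv)
  qed
qed

text \<open>The rank condition on \<open>\<Delta>\<close> enters the argument in this form, with the
  extra column \<open>None\<close> contributing the multiple of \<open>b\<close>.\<close>

lemma augment_surj:
  fixes M :: "complex^'n::finite^'n"
  assumes "rank (augment M b) = CARD('n)"
  shows "\<exists>\<zeta> c. \<xi> = M *v \<zeta> + c *s b"
proof -
  obtain B where B: "augment M b ** B = mat 1" using full_row_rank_right_inverse[OF assms] by blast
  define x where "x = B *v \<xi>"
  have ax: "augment M b *v x = \<xi>" by (simp add: x_def matrix_vector_mul_assoc B)
  have "(augment M b *v x) $ i = (M *v (\<chi> k. x $ Some k) + x $ None *s b) $ i" for i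
  proof -
    have "(augment M b *v x) $ i = (\<Sum>j\<in>UNIV. (case j of None \<Rightarrow> b $ i | Some k \<Rightarrow> M $ i $ k) * x $ j)"
      by (simp add: matrix_vector_mult_def augment_def)
    also have "\<dots> = b $ i * x $ None + (\<Sum>j\<in>range Some. (case j of None \<Rightarrow> b $ i | Some k \<Rightarrow> M $ i $ k) * x $ j)"
      unfolding UNIV_option_conv by (subst sum.insert) auto
    also have "(\<Sum>j\<in>range Some. (case j of None \<Rightarrow> b $ i | Some k \<Rightarrow> M $ i $ k) * x $ j) = (\<Sum>k\<in>UNIV. M $ i $ k * x $ Some k)"
      by (subst sum.reindex) auto
    finally show ?thesis by (simp add: matrix_vector_mult_def mult.commute)
  qed
  then have "augment M b *v x = M *v (\<chi> k. x $ Some k) + x $ None *s b" by (simp add: vec_eq_iff)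
  then show ?thesis using ax by metis
qed

lemma idx_bij: "bij_betw (idx :: 'n::finite \<Rightarrow> nat) UNIV {..<CARD('n)}"
proof -
  obtain f :: "'n \<Rightarrow> nat" where "bij_betw f UNIV {..<CARD('n)}"
    using ex_bij_betw_finite_nat[of "UNIV :: 'n set"] by (auto simp: atLeast0LessThan)
  then show ?thesis unfolding idx_def by (rule someI[of "\<lambda>f :: 'n \<Rightarrow> nat. bij_betw f UNIV {..<CARD('n)}"])
qed

lemma sum_idx: "(\<Sum>k<CARD('n::finite). f k) = (\<Sum>j\<in>(UNIV::'n set). f (idx j))"
  using sum.reindex_bij_betw[OF idx_bij[where 'n='n], of f] by simp

lemma idx_less: "idx (j :: 'n::finite) < CARD('n)"
  using bij_betwE[OF idx_bij[where 'n='n]] by auto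

lemma idx_eq: "idx (i :: 'n::finite) = idx j \<longleftrightarrow> i = j"
  using idx_bij[where 'n='n] unfolding bij_betw_def inj_on_def by auto

section \<open>Constant vectors and matrices acting on classes\<close>

definition colV :: "complex^'n \<Rightarrow> L2 \<Rightarrow> L2^'n::finite" where "colV c u = (\<chi> i. mulL (\<lambda>_. c $ i) u)"
definition matop :: "complex^'n^'m \<Rightarrow> L2^'n::finite \<Rightarrow> L2^'m::finite" where "matop M = mop (\<lambda>i j. mulL (\<lambda>_. M $ i $ j))"

lemma colV_nth [simp]: "colV c u $ i = mulL (\<lambda>_. c $ i) u" by (simp add: colV_def)
lemma matop_nth [simp]: "matop M x $ i = (\<Sum>j\<in>UNIV. mulL (\<lambda>_. M $ i $ j) (x $ j))" by (simp add: matop_def)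

lemma mulL_sum: "mulL m (\<Sum>i\<in>I. x i) = (\<Sum>i\<in>I. mulL m (x i))"
  by (rule linear_sum[OF bounded_linear.linear[OF bounded_linear_mulL]])

lemma mulL_const_sum: "finite I \<Longrightarrow> mulL (\<lambda>_. \<Sum>i\<in>I. c i) x = (\<Sum>i\<in>I. mulL (\<lambda>_. c i) x)"
  by (induction rule: finite_induct) (auto simp: mulL_plus)

lemma shiftL_sum: "shiftL h (\<Sum>i\<in>I. x i) = (\<Sum>i\<in>I. shiftL h (x i))"
  by (rule linear_sum[OF bounded_linear.linear[OF bounded_linear_shiftL]])

lemma matop_matop: "matop M (matop M' x) = matop (M ** M') x"
proof -
  have "(\<Sum>j\<in>UNIV. mulL (\<lambda>_. M $ i $ j) (\<Sum>k\<in>UNIV. mulL (\<lambda>_. M' $ j $ k) (x $ k))) = (\<Sum>k\<in>UNIV. mulL (\<lambda>_. \<Sum>j\<in>UNIV. M $ i $ j * M' $ j $ k) (x $ k))" for i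
    by (simp add: mulL_sum mulL_mulL mulL_const_sum) (rule sum.swap)
  then show ?thesis by (simp add: vec_eq_iff matrix_matrix_mult_def)
qed

lemma matop_1 [simp]: "matop (mat 1) x = x"
proof -
  have "(\<Sum>j\<in>UNIV. mulL (\<lambda>_. mat 1 $ i $ j) (x $ j)) = (\<Sum>j\<in>UNIV. if i = j then x $ j else 0)" for i
    by (rule sum.cong) (auto simp: mat_def)
  then show ?thesis by (simp add: vec_eq_iff)
qed

lemma matop_colV: "matop M (colV c u) = colV (M *v c) u"
  by (simp add: vec_eq_iff mulL_mulL mulL_const_sum[symmetric] matrix_vector_mult_def)

lemma matop_mV: "matop M (mV m x) = mV m (matop M x)"
  by (simp add: vec_eq_iff mulL_sum mulL_mulL_commute[of m])

lemma matop_shV: "matop M (shV h x) = shV h (matop M x)"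
  by (simp add: vec_eq_iff shiftL_sum shiftL_mulL)

lemma colV_mulL: "colV c (mulL m u) = mV m (colV c u)" by (simp add: vec_eq_iff mulL_mulL_commute[of m])
lemma colV_shiftL: "colV c (shiftL h u) = shV h (colV c u)" by (simp add: vec_eq_iff shiftL_mulL)

lemma bounded_linear_colV: "bounded_linear (colV c)"
  by (rule bounded_linear_vecI) (simp add: bounded_linear_mulL)

lemmas linear_colV = bounded_linear.linear[OF bounded_linear_colV]

lemma bounded_linear_matop: "bounded_linear (matop M)"
  unfolding matop_def by (rule bounded_linear_mop[OF bounded_linear_mulL])

lemma vanV_colV: "vanish A u \<Longrightarrow> vanV A (colV c u)" by (auto simp: vanV_def intro: vanish_mulL)

lemma cut_interval_split: "a \<le> b \<Longrightarrow> b \<le> c \<Longrightarrow> mulL (indicator {a..c}) u = mulL (indicator {a..b}) u + mulL (indicator {b..c}) u" for a b c :: real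
proof -
  assume *: "a \<le> b" "b \<le> c"
  have "mulL (indicator {a..c}) u = mulL (\<lambda>t. indicator {a..b} t + indicator {b..c} t) u"
  proof (rule mulL_cong_AE)
    show "bmeas (\<lambda>t. indicator {a..b} t + indicator {b..c} t)" by (rule bmeas_add) auto
    show "AE t in lborel. indicator {a..c} t = (indicator {a..b} t + indicator {b..c} t :: complex)"
      using AE_lborel_singleton[of b] by eventually_elim (use * in \<open>auto simp: indicator_def\<close>)
  qed simp
  then show ?thesis by (simp add: mulL_plus)
qed

lemma cut_sum_intervals: "(\<Sum>k<m. mulL (indicator {- 1 - real k..- real k}) u) = mulL (indicator {- real m..0}) u"
proof (induction m)
  case 0 show ?case using mulL_null_interval[of 0 0 u] by simp
next
  case (Suc m)
  have "mulL (indicator {- real (Suc m)..0}) u = mulL (indicator {- real (Suc m)..- real m}) u + mulL (indicator {- real m..0}) u"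
    by (rule cut_interval_split) auto
  then show ?case using Suc by (simp add: add.commute)
qed

text \<open>Different integer translates of the unit window meet at most in an end point, so the
  unit pieces of a control do not interfere.\<close>

lemma cut_shift_cut:
  "mulL (indicator {-1..0}) (shiftL (real l - real k) (mulL (indicator {-1..0}) x)) = (if l = k then mulL (indicator {-1..0}) x else 0)"
proof (cases "l = k")
  case True then show ?thesis by (simp add: mulL_indicator_idem)
next
  case False
  define d where "d = real l - real k"
  have d: "\<bar>d\<bar> \<ge> 1" using False unfolding d_def by (cases "l < k") auto
  have "mulL (indicator {-1..0}) (shiftL d (mulL (indicator {-1..0}) x)) = mulL (\<lambda>t. indicator {-1..0} t * indicator {-1..0} (t + d)) (shiftL d x)"
    by (simp add: shiftL_mulL mulL_mulL bmeas_shift)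
  also have "\<dots> = mulL (\<lambda>_. 0) (shiftL d x)"
  proof (rule mulL_cong_AE)
    show "AE t in lborel. indicator {-1..0} t * indicator {-1..0} (t + d) = (0::complex)"
      using AE_lborel_singleton[of 0] AE_lborel_singleton[of "-1"]
      by eventually_elim (use d in \<open>auto simp: indicator_def\<close>)
  qed (auto intro!: bmeas_mult bmeas_shift)
  finally show ?thesis using False by (simp add: d_def)
qed

text \<open>The splitting of \<open>approximable_split\<close>, arranged for finite codimension:
  \<open>F y = 0\<close> puts \<open>y\<close> into the range of \<open>I - K\<close>, with the
  preimage \<open>N y\<close> depending linearly on \<open>y\<close>.\<close>

lemma approximable_finrank_split:
  fixes K :: "'a::banach \<Rightarrow> 'a"
  assumes "approximable K"
  obtains N F where "bounded_linear N" "finrank (F :: 'a \<Rightarrow> 'a)" "\<And>y. F y = 0 \<Longrightarrow> y = N y - K (N y)"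
proof -
  have "\<exists>K'. finrank K' \<and> (\<forall>x. norm (K x - K' x) \<le> (1/2) * norm x)"
    using assms unfolding approximable_def by (meson half_gt_zero zero_less_one)
  then obtain K' where K': "finrank K'" "\<And>x. norm (K x - K' x) \<le> (1/2) * norm x" by blast
  have bl: "bounded_linear (\<lambda>x. K x - K' x)"
    by (intro bounded_linear_sub approximable_bounded_linear assms finrank_bounded_linear K')
  obtain N where N: "bounded_linear N" "\<And>y. N y = y + (K (N y) - K' (N y))" "\<And>x y. x = y + (K x - K' x) \<Longrightarrow> x = N y"
    using neumann_inverse[OF bl, of "1/2"] K'(2) by auto
  show thesis
  proof (rule that[OF N(1) finrank_compose_right[OF K'(1) N(1)]])
    show "y = N y - K (N y)" if "K' (N y) = 0" for y using N(2)[of y] that by (simp add: algebra_simps)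
  qed
qed

lemma finrank_euclidean: "bounded_linear (f :: 'a::real_normed_vector \<Rightarrow> 'b::euclidean_space) \<Longrightarrow> finrank f"
proof -
  assume f: "bounded_linear f"
  have "finrank (\<lambda>x. \<Sum>b\<in>Basis. (f x \<bullet> b) *\<^sub>R b)"
    by (intro finrank_sum finite_Basis finrank_rank1 bounded_linear_compose[OF bounded_linear_inner_left f])
  then show ?thesis by (simp add: euclidean_representation)
qed

context complex_space
begin

text \<open>For a real functional \<open>l\<close>, the expression \<open>l x - i l (i x)\<close> is
  complex linear with real part \<open>l x\<close>, so its kernel is contained in that of
  \<open>l\<close>.\<close>

lemma complexify_functionals:
  assumes sc: "bounded_linear (sc \<i>)" "\<And>r x. sc (of_real r) x = r *\<^sub>R x"
    and l: "\<And>i. i < m \<Longrightarrow> bounded_linear (l i :: 'x \<Rightarrow> real)" "\<And>x. (\<And>i. i < m \<Longrightarrow> l i x = 0) \<Longrightarrow> x \<in> R"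
  shows "\<exists>l'. (\<forall>i<m. clin (l' i)) \<and> kers m l' \<subseteq> R"
proof (intro exI conjI allI impI)
  define l' where "l' i x = of_real (l i x) - \<i> * of_real (l i (sc \<i> x))" for i x
  fix i assume i: "i < m"
  note lin = bounded_linear.linear[OF l(1)[OF i]]
  show "clin (l' i)"
    unfolding clin_def
  proof (intro conjI allI)
    show "bounded_linear (l' i)" unfolding l'_def[abs_def]
      by (intro bounded_linear_sub bounded_linear_compose[OF bounded_linear_of_real] bounded_linear_const_mult
          l(1)[OF i] bounded_linear_compose[OF l(1)[OF i] sc(1)])
    fix c x
    have c: "c = of_real (Re c) + of_real (Im c) * \<i>" by (metis complex_eq mult.commute)
    have "sc c x = Re c *\<^sub>R x + Im c *\<^sub>R sc \<i> x"
      by (subst c) (simp only: sc_add_left sc_sc[symmetric] sc(2))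
    then have 1: "l i (sc c x) = Re c * l i x + Im c * l i (sc \<i> x)" by (simp add: linear_add[OF lin] linear_scale[OF lin])
    have "sc \<i> (sc c x) = sc (\<i> * c) x" by (rule sc_sc)
    also have "\<i> * c = of_real (- Im c) + of_real (Re c) * \<i>" by (simp add: complex_eq_iff)
    also have "sc \<dots> x = (- Im c) *\<^sub>R x + Re c *\<^sub>R sc \<i> x" by (simp only: sc_add_left sc_sc[symmetric] sc(2))
    finally have 2: "l i (sc \<i> (sc c x)) = - Im c * l i x + Re c * l i (sc \<i> x)"
      by (simp add: linear_add[OF lin] linear_diff[OF lin] linear_scale[OF lin])
    show "l' i (sc c x) = c * l' i x"
      unfolding l'_def 1 2 by (simp add: complex_eq_iff algebra_simps)
  qed
next
  define l' where "l' i x = of_real (l i x) - \<i> * of_real (l i (sc \<i> x))" for i x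
  show "kers m (\<lambda>i x. of_real (l i x) - \<i> * of_real (l i (sc \<i> x))) \<subseteq> R"
  proof
    fix x assume x: "x \<in> kers m (\<lambda>i x. of_real (l i x) - \<i> * of_real (l i (sc \<i> x)))"
    show "x \<in> R"
    proof (rule l(2))
      fix i assume "i < m"
      then have "of_real (l i x) - \<i> * of_real (l i (sc \<i> x)) = 0" using x by (simp add: kers_def)
      then have "Re (of_real (l i x) - \<i> * of_real (l i (sc \<i> x))) = 0" by simp
      then show "l i x = 0" by simp
    qed
  qed
qed

end

subsection \<open>The controllability operator at time n\<close>

definition scE :: "complex \<Rightarrow> (complex^'n) \<times> (L2^'n::finite) \<Rightarrow> (complex^'n) \<times> (L2^'n)" where
  "scE c e = (c *s fst e, scV c (snd e))"

lemma scE_of_real: "scE (of_real r) e = r *\<^sub>R e"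
  by (simp add: scE_def vec_eq_iff prod_eq_iff mulL_of_real scaleR_conv_of_real[where 'a=complex])

lemma scE_add: "scE c (x + y) = scE c x + scE c y"
  by (simp add: scE_def prod_eq_iff vec_eq_iff mulL_add distrib_left)

lemma scE_one: "scE 1 e = e"
  by (simp add: scE_def prod_eq_iff vec_eq_iff)

locale neutral_kalman = neutral A1 b A2 A3 \<gamma> q
  for A1 :: "complex^'n::finite^'n" and b :: "complex^'n" and A2 A3 :: "real \<Rightarrow> complex^'n^'n" and \<gamma> q :: real +
  assumes kalman: "rank (ctrb A1 b) = CARD('n)"
begin

definition Ag :: "complex^'n^'n" where "Ag = (\<chi> i j. of_real (exp (- \<gamma>)) * A1 $ i $ j)"
definition C :: "L2^'n \<Rightarrow> L2^'n" where "C = mop (cop \<gamma> A2 A3)"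
definition Dm :: "complex^'n^'n" where "Dm = (\<chi> i j. (matpow Ag (idx j) *v b) $ i)"

lemma K_split: "K x = matop Ag (shV (-1) x) + C x"
  by (simp add: vec_eq_iff C_def nop_def Ag_def sum.distrib)

lemma C_shV: "C (shV h x) = shV h (C x)"
proof -
  have "cop \<gamma> A2 A3 i j (shiftL h u) = shiftL h (cop \<gamma> A2 A3 i j u)" for i j u
    by (simp add: cop_def shiftL_add convL_shiftL kern2 kern3 kern_h)
  then show ?thesis by (simp add: C_def vec_eq_iff shiftL_sum)
qed

lemma approximable_PC: "approximable (\<lambda>x. P (C x))"
proof -
  have "approximable (\<lambda>u. mulL (indicator {-1..0}) (cop \<gamma> A2 A3 i j u))" for i j
  proof -
    have "approximable (\<lambda>u. mulL (indicator {-1..0}) (convL (kA \<gamma> A2 i j) u) + mulL (indicator {-1..0}) (convL (kA \<gamma> A3 i j) (convL h0 u)))"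
      by (intro approximable_add conv_window_approximable kern2
          approximable_compose_right[OF conv_window_approximable[OF kern3] bounded_linear_convL[OF kern_h]])
    then show ?thesis by (simp add: cop_def mulL_add)
  qed
  then have "approximable (mop (\<lambda>i j u. mulL (indicator {-1..0}) (cop \<gamma> A2 A3 i j u)))" by (rule approximable_mop)
  moreover have "mop (\<lambda>i j u. mulL (indicator {-1..0}) (cop \<gamma> A2 A3 i j u)) = (\<lambda>x. P (C x))"
    by (simp add: fun_eq_iff vec_eq_iff C_def mulL_sum)
  ultimately show ?thesis by simp
qed

text \<open>The weight multiplies column \<open>k\<close> of the Kalman matrix by
  \<open>exp (- \<gamma>) ^ k\<close>; dividing the rows of the inverse of \<open>ctrb A1 b\<close>
  accordingly compensates for this.\<close>

lemma Dm_inverse: "\<exists>E. Dm ** E = mat 1 \<and> E ** Dm = mat 1"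
proof -
  obtain B where B: "ctrb A1 b ** B = mat 1" using full_row_rank_right_inverse[OF kalman] by blast
  have mp: "matpow Ag k *v v = of_real (exp (- \<gamma>)) ^ k *s (matpow A1 k *v v)" for k v
  proof (induction k)
    case 0 then show ?case by (simp add: matpow_def)
  next
    case (Suc k)
    have "matpow Ag (Suc k) *v v = Ag *v (matpow Ag k *v v)" by (simp add: matpow_def matrix_vector_mul_assoc)
    also have "\<dots> = of_real (exp (- \<gamma>)) ^ Suc k *s (A1 *v (matpow A1 k *v v))"
      unfolding Suc by (simp add: vec_eq_iff matrix_vector_mult_def Ag_def sum_distrib_left mult_ac)
    also have "A1 *v (matpow A1 k *v v) = matpow A1 (Suc k) *v v" by (simp add: matpow_def matrix_vector_mul_assoc)
    finally show ?case .
  qed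
  define E where "E = (\<chi> i j. B $ i $ j / of_real (exp (- \<gamma>)) ^ idx i)"
  have "Dm ** E = ctrb A1 b ** B"
    by (simp add: vec_eq_iff matrix_matrix_mult_def Dm_def E_def ctrb_def mp)
  then have "Dm ** E = mat 1" using B by simp
  then show ?thesis using matrix_left_right_inverse by blast
qed

definition Em :: "complex^'n^'n" where "Em = (SOME E. Dm ** E = mat 1 \<and> E ** Dm = mat 1)"

lemma Em: "Dm ** Em = mat 1" "Em ** Dm = mat 1"
  using someI_ex[OF Dm_inverse] unfolding Em_def by auto

text \<open>\<open>G g\<close> is the scalar control on \<open>[-n, 0]\<close> whose unit pieces are the components of \<open>Em g\<close>, so
  that the undistributed part of the system answers with \<open>g\<close> on \<open>[-1, 0]\<close>; \<open>Kc\<close> collects the contribution of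
  the distributed delays.\<close>

definition G :: "L2^'n \<Rightarrow> L2" where
  "G g = (\<Sum>j\<in>UNIV. shiftL (real (idx j)) (mulL (indicator {-1..0}) (matop Em g $ j)))"

lemma bounded_linear_G: "bounded_linear G"
  unfolding G_def[abs_def]
  by (intro bounded_linear_sum bounded_linear_compose[OF bounded_linear_shiftL] bounded_linear_compose[OF bounded_linear_mulL]
      bounded_linear_compose[OF bounded_linear_vec_nth bounded_linear_matop])

lemma G_P: "G (P g) = G g"
  by (simp add: G_def cutV_def matop_mV del: matop_nth) (simp add: mulL_indicator_idem)

lemma G_vanish: "vanish (- {- real CARD('n)..0}) (G g)"
  unfolding G_def
proof (rule vanish_sum)
  fix j :: 'n
  have "vanish (- {-1..0}) (mulL (indicator {-1..0}) (matop Em g $ j))" by (rule vanish_cut) auto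
  then show "vanish (- {- real CARD('n)..0}) (shiftL (real (idx j)) (mulL (indicator {-1..0}) (matop Em g $ j)))"
    by (rule vanish_shiftL) (use idx_less[of j] in auto)
qed

text \<open>The unit pieces of \<open>u\<close>, translated to \<open>[-1, 0]\<close>, form a vector
  \<open>a\<close>; \<open>Em\<close> recovers it from \<open>matop Dm a\<close>, and the translates
  reassemble \<open>u\<close>.\<close>

lemma G_surj:
  assumes "vanish (- {- real CARD('n)..0}) u" shows "\<exists>g. u = G g"
proof -
  define a :: "L2^'n" where "a = (\<chi> j. shiftL (- real (idx j)) u)"
  have "shiftL (real k) (mulL (indicator {-1..0}) (shiftL (- real k) u)) = mulL (indicator {-1 - real k..- real k}) u" for k
  proof -
    have "shiftL (real k) (mulL (indicator {-1..0}) (shiftL (- real k) u)) = mulL (\<lambda>t. indicator {-1..0} (t + real k)) u"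
      by (simp add: shiftL_mulL shiftL_shiftL)
    also have "(\<lambda>t. indicator {-1..0} (t + real k)) = (indicator {-1 - real k..- real k} :: real \<Rightarrow> complex)"
      by (auto simp: indicator_def fun_eq_iff)
    finally show ?thesis .
  qed
  then have "G (matop Dm a) = (\<Sum>j\<in>(UNIV::'n set). mulL (indicator {-1 - real (idx j)..- real (idx j)}) u)"
    by (simp add: G_def matop_matop Em a_def del: matop_nth)
  also have "\<dots> = (\<Sum>k<CARD('n). mulL (indicator {-1 - real k..- real k}) u)" by (rule sum_idx[symmetric])
  also have "\<dots> = u" unfolding cut_sum_intervals by (rule cut_eq_self) (use assms in auto)
  finally show ?thesis by metis
qed

lemma bounded_linear_matop_pow: "bounded_linear (matop Ag ^^ k)"
proof (induction k)
  case 0 show ?case using bounded_linear_ident by (simp add: id_def)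
next
  case (Suc k)
  have "matop Ag ^^ Suc k = (\<lambda>x. matop Ag ((matop Ag ^^ k) x))" by (simp add: fun_eq_iff)
  then show ?case using bounded_linear_compose[OF bounded_linear_matop Suc] by simp
qed

text \<open>Repeated substitution of \<open>w = matop Ag (shV (-1) w) + (y + C w)\<close> into
  itself. For \<open>m\<close> equal to the dimension the remainder looks only at times before -n
  when seen through the window, where a control on \<open>[-n, 0]\<close> has not yet acted.\<close>

lemma N_iterate: "w = y + K w \<Longrightarrow> w = (\<Sum>k<m. (matop Ag ^^ k) (shV (- real k) (y + C w))) + (matop Ag ^^ m) (shV (- real m) w)"
proof (induction m)
  case (Suc m)
  note lin = bounded_linear.linear[OF bounded_linear_matop_pow, of m]
  have "shV (- real m) w = shV (- real m) (y + C w) + shV (- real m) (matop Ag (shV (-1) w))"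
    using Suc.prems by (simp add: K_split linear_add[OF linear_shV, symmetric] algebra_simps)
  also have "shV (- real m) (matop Ag (shV (-1) w)) = matop Ag (shV (- real (Suc m)) w)"
    by (simp add: matop_shV[symmetric] shV_shV algebra_simps)
  finally have s: "shV (- real m) w = shV (- real m) (y + C w) + matop Ag (shV (- real (Suc m)) w)" .
  have "(matop Ag ^^ m) (shV (- real m) w) = (matop Ag ^^ m) (shV (- real m) (y + C w)) + (matop Ag ^^ Suc m) (shV (- real (Suc m)) w)"
    by (subst s) (simp only: linear_add[OF lin] funpow_Suc_right o_apply)
  then show ?case using Suc.IH[OF Suc.prems] by (simp add: add.assoc)
qed simp

definition Kc :: "L2^'n \<Rightarrow> L2^'n" where
  "Kc g = - (\<Sum>k<CARD('n). P ((matop Ag ^^ k) (shV (- real k) (C (N (colV b (G g)))))))"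

lemma matop_pow_P: "P ((matop Ag ^^ k) x) = (matop Ag ^^ k) (P x)"
  by (induction k) (auto simp: cutV_def matop_mV[symmetric])

lemma bounded_linear_NbG: "bounded_linear (\<lambda>g. N (colV b (G g)))"
  by (rule bounded_linear_compose[OF bounded_linear_N bounded_linear_compose[OF bounded_linear_colV bounded_linear_G]])

lemma approximable_Kc: "approximable Kc"
proof -
  have "approximable (\<lambda>g. (matop Ag ^^ k) (P (C (shV (- real k) (N (colV b (G g)))))))" for k
    by (rule approximable_compose_left[OF approximable_compose_right[OF approximable_PC bounded_linear_compose[OF bounded_linear_shV bounded_linear_NbG]] bounded_linear_matop_pow])
  then have "approximable (\<lambda>g. \<Sum>k<CARD('n). (matop Ag ^^ k) (P (C (shV (- real k) (N (colV b (G g)))))))"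
    by (intro approximable_sum) auto
  then have "approximable (\<lambda>g. - (\<Sum>k<CARD('n). (matop Ag ^^ k) (P (C (shV (- real k) (N (colV b (G g))))))))"
    by (rule approximable_compose_left[OF _ bounded_linear_minus[OF bounded_linear_ident]])
  then show ?thesis by (simp add: Kc_def[abs_def] matop_pow_P C_shV)
qed

lemma Kc_P: "Kc (P g) = Kc g" by (simp add: Kc_def G_P)

lemma linear_P: "linear P" unfolding cutV_def by (rule linear_mV)

lemma P_P: "P (P x) = P x" by (simp add: cutV_cutV)

lemma P_Kc: "P (Kc g) = Kc g"
  by (simp add: Kc_def linear_neg[OF linear_P] linear_sum[OF linear_P] P_P)

text \<open>Three contributions on \<open>[-1, 0]\<close>: the remainder of the iteration vanishes
  by causality, the terms with \<open>C\<close> are \<open>- Kc g\<close> by definition, and the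
  direct action of the control is the Kalman matrix applied to its unit pieces, which
  \<open>Em\<close> has prepared to give \<open>g\<close>.\<close>

lemma window_response: "P (N (colV b (G g))) = P g - Kc g"
proof -
  let ?n = "CARD('n)"
  define w where "w = N (colV b (G g))"
  have "w = (\<Sum>k<?n. (matop Ag ^^ k) (shV (- real k) (colV b (G g) + C w))) + (matop Ag ^^ ?n) (shV (- real ?n) w)"
    by (rule N_iterate) (use N_eq in \<open>simp add: w_def\<close>)
  from arg_cong[OF this, of P] have "P w = (\<Sum>k<?n. P ((matop Ag ^^ k) (shV (- real k) (colV b (G g) + C w)))) + P ((matop Ag ^^ ?n) (shV (- real ?n) w))"
    by (simp only: linear_add[OF linear_P] linear_sum[OF linear_P])
  also have "P ((matop Ag ^^ ?n) (shV (- real ?n) w)) = 0"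
  proof -
    have "vanish {..<- real ?n} (G g)" by (rule vanish_mono[OF G_vanish]) auto
    then have "vanV {..<- real ?n} w" unfolding w_def by (intro N_causal vanV_colV)
    then have "vanV {..<0} (shV (- real ?n) w)" by (rule vanV_shV) auto
    then have "vanV {-1..0} (shV (- real ?n) w)" unfolding vanV_def using vanish_null[of "{..<0}" _ "{-1..0}" 0] by fastforce
    then have "P (shV (- real ?n) w) = 0" by (simp add: vanV_cutV)
    then show ?thesis by (simp add: matop_pow_P linear_0[OF bounded_linear.linear[OF bounded_linear_matop_pow]])
  qed
  also have "(\<Sum>k<?n. P ((matop Ag ^^ k) (shV (- real k) (colV b (G g) + C w)))) = (\<Sum>k<?n. P ((matop Ag ^^ k) (shV (- real k) (colV b (G g))))) - Kc g"
    by (simp add: Kc_def w_def[symmetric] linear_add[OF linear_shV] linear_add[OF bounded_linear.linear[OF bounded_linear_matop_pow]] linear_add[OF linear_P] sum.distrib)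
  also have "(\<Sum>k<?n. P ((matop Ag ^^ k) (shV (- real k) (colV b (G g))))) = P g"
  proof -
    have mc: "(matop Ag ^^ k) (colV c u) = colV (matpow Ag k *v c) u" for k c u
      by (induction k) (auto simp: matpow_def matop_colV matrix_vector_mul_assoc)
    define a where "a = matop Em g"
    \<comment> \<open>Delayed by \<open>k\<close>, only the piece with number \<open>k\<close> is
      visible in the window.\<close>
    have PG: "mulL (indicator {-1..0}) (shiftL (- real k) (G g)) = (\<Sum>j\<in>UNIV. if idx j = k then mulL (indicator {-1..0}) (a $ j) else 0)" for k
      by (simp add: G_def a_def[symmetric] shiftL_sum mulL_sum shiftL_shiftL cut_shift_cut add.commute[of "- real k"] del: matop_nth)
    have "P ((matop Ag ^^ k) (shV (- real k) (colV b (G g)))) = colV (matpow Ag k *v b) (mulL (indicator {-1..0}) (shiftL (- real k) (G g)))" for k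
      by (simp add: colV_shiftL[symmetric] mc colV_mulL cutV_def)
    then have "(\<Sum>k<?n. P ((matop Ag ^^ k) (shV (- real k) (colV b (G g))))) = (\<Sum>j\<in>(UNIV::'n set). colV (matpow Ag (idx j) *v b) (mulL (indicator {-1..0}) (shiftL (- real (idx j)) (G g))))"
      by (simp only: sum_idx)
    also have "\<dots> = (\<Sum>j\<in>(UNIV::'n set). colV (matpow Ag (idx j) *v b) (mulL (indicator {-1..0}) (a $ j)))"
      unfolding PG by (simp add: idx_eq)
    also have "\<dots> = P (matop Dm a)"
      by (simp add: vec_eq_iff sum_component Dm_def mulL_sum mulL_mulL_commute[of "indicator {-1..0}"])
    also have "\<dots> = P g" by (simp add: a_def matop_matop Em del: matop_nth)
    finally show ?thesis .
  qed
  finally show ?thesis by (simp add: w_def)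
qed

text \<open>For negative \<open>t\<close> the interval is empty and only the zero control remains,
  so the family is monotone over all real times.\<close>

definition Rs :: "real \<Rightarrow> ((complex^'n) \<times> (L2^'n)) set" where
  "Rs t = {st (N (colV b u)) | u. vanish (- {-t..0}) u}"

lemma Rs_mono: "t \<le> t' \<Longrightarrow> Rs t \<subseteq> Rs t'"
  unfolding Rs_def by (auto intro!: vanish_mono[of "- {-t..0}" _ "- {-t'..0}"])

text \<open>If all states were reached, \<open>I - Kc\<close> would be onto and hence injective. The
  state with first component 1 and zero derivative on the window would then require
  \<open>P g = 0\<close>, that is, the zero control, whose state is zero.\<close>

theorem Rs_n_proper: "\<exists>\<zeta> y. P y = y \<and> (\<zeta>, y) \<notin> Rs (real CARD('n))"
proof (rule ccontr)
  assume "\<not> ?thesis"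
  then have all: "\<And>\<zeta> y. P y = y \<Longrightarrow> (\<zeta>, y) \<in> Rs (real CARD('n))" by blast
  have ex: "\<exists>g. cst (N (colV b (G g))) = \<zeta> \<and> P g - Kc g = y" if yP: "P y = y" for \<zeta> y
  proof -
    obtain u where u: "(\<zeta>, y) = st (N (colV b u))" "vanish (- {- real CARD('n)..0}) u"
      using all[OF yP] unfolding Rs_def by blast
    obtain g where "u = G g" using G_surj[OF u(2)] by blast
    then show ?thesis using u(1) window_response[of g] by (auto simp: st_def)
  qed
  have surj: "\<exists>x. x - Kc x = y" for y
  proof -
    obtain g where g: "P g - Kc g = P y" using ex[where y="P y" and \<zeta>=0] P_P by blast
    \<comment> \<open>Outside the window \<open>Kc\<close> does nothing, so there the right hand
      side itself is the solution.\<close>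
    define x where "x = P g + (y - P y)"
    have "P x = P g" by (simp add: x_def linear_add[OF linear_P] linear_diff[OF linear_P] P_P)
    then have "Kc x = Kc g" using Kc_P by metis
    then have "x - Kc x = y" using g by (simp add: x_def algebra_simps)
    then show ?thesis by blast
  qed
  obtain g where g: "cst (N (colV b (G g))) = (1 :: complex^'n)" "P g - Kc g = 0"
    using ex[where y=0 and \<zeta>=1] linear_0[OF linear_P] by auto
  have "P g = 0"
    by (rule fredholm_surj_imp_inj[OF approximable_Kc surj]) (use g(2) Kc_P[of g] in simp)
  then have "G g = 0" using G_P[of g] linear_0[OF bounded_linear.linear[OF bounded_linear_G]] by simp
  then have "cst (N (colV b (G g))) = 0"
    using linear_0[OF linear_st] by (simp add: linear_0[OF linear_colV] linear_0[OF linear_N] st_def zero_prod_def)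
  then show False using g(1) by (simp add: vec_eq_iff)
qed

lemma bounded_linear_scE: "bounded_linear (scE c :: (complex^'n) \<times> (L2^'n) \<Rightarrow> _)"
proof -
  have "bounded_linear (\<lambda>x :: complex^'n. c *s x)" by (rule bounded_linear_vecI) (auto intro: bounded_linear_const_mult bounded_linear_vec_nth)
  then show ?thesis unfolding scE_def[abs_def] scV_mV
    by (intro bounded_linear_Pair bounded_linear_compose[OF _ bounded_linear_fst] bounded_linear_compose[OF bounded_linear_mV bounded_linear_snd])
qed

sublocale X: complex_space "scE :: complex \<Rightarrow> (complex^'n) \<times> (L2^'n) \<Rightarrow> _"
proof
  fix c d and x y :: "(complex^'n) \<times> (L2^'n)"
  show "scE c (x + y) = scE c x + scE c y" by (rule scE_add)
  show "scE (c + d) x = scE c x + scE d x" by (simp add: scE_def vec_eq_iff mulL_plus distrib_right)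
  show "scE c (scE d x) = scE (c * d) x" by (simp add: scE_def vec_eq_iff mulL_mulL mult.assoc)
  show "scE 1 x = x" by (rule scE_one)
qed

text \<open>The junk outside \<open>[-1, 0]\<close> is left arbitrary, so that \<open>Rhat t\<close> is a subspace of the whole product space.\<close>

definition Rhat :: "real \<Rightarrow> ((complex^'n) \<times> (L2^'n)) set" where
  "Rhat t = {x. (fst x, P (snd x)) \<in> Rs t}"

lemma st_scV: "st (scV c w) = scE c (st w)"
  by (simp add: st_def scE_def cst_def conv_const vec_eq_iff mulL_mulL_commute[of "indicator {-1..0}"])

lemma colV_const: "colV v (mulL (\<lambda>_. c) u) = scV c (colV v u)" by (simp add: colV_mulL scV_mV)

lemma csub_Rhat: "X.csub (Rhat t)"
  unfolding X.csub_def
proof (intro conjI ballI allI)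
  have "st (N (colV b 0)) = 0" by (simp add: linear_0[OF linear_colV] linear_0[OF linear_N] linear_0[OF linear_st])
  then have "0 \<in> Rs t" unfolding Rs_def by (auto intro!: exI[of _ 0])
  then show "0 \<in> Rhat t" by (simp add: Rhat_def linear_0[OF linear_P] zero_prod_def)
  fix x assume "x \<in> Rhat t"
  then obtain u where u: "(fst x, P (snd x)) = st (N (colV b u))" "vanish (- {-t..0}) u" by (auto simp: Rhat_def Rs_def)
  show "scE c x \<in> Rhat t" for c
  proof -
    have "(fst (scE c x), P (snd (scE c x))) = scE c (fst x, P (snd x))"
      by (simp add: scE_def cutV_def scV_mV_commute)
    also have "\<dots> = st (N (colV b (mulL (\<lambda>_. c) u)))" unfolding u(1) by (simp add: colV_const N_scV st_scV)
    finally show ?thesis using vanish_mulL[OF u(2)] unfolding Rhat_def Rs_def by blast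
  qed
  fix y assume "y \<in> Rhat t"
  then obtain v where v: "(fst y, P (snd y)) = st (N (colV b v))" "vanish (- {-t..0}) v" by (auto simp: Rhat_def Rs_def)
  have "(fst (x + y), P (snd (x + y))) = (fst x, P (snd x)) + (fst y, P (snd y))" by (simp add: linear_add[OF linear_P])
  also have "\<dots> = st (N (colV b (u + v)))" unfolding u(1) v(1) by (simp add: linear_add[OF linear_colV] linear_add[OF linear_N] linear_add[OF linear_st])
  finally show "x + y \<in> Rhat t" using vanish_add[OF u(2) v(2)] unfolding Rhat_def Rs_def by blast
qed

text \<open>The splitting of \<open>Kc\<close> proposes the control
  \<open>G (N0 (P (snd x)))\<close>. It reaches \<open>x\<close> unless one of two finite
  dimensional obstructions intervenes: the defect \<open>F\<close> of the splitting or a mismatch of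
  the first components.\<close>

theorem Rhat_finite_codim: "\<exists>m l. (\<forall>i<m. X.clin (l i)) \<and> X.kers m l \<subseteq> Rhat (real CARD('n))"
proof (rule approximable_finrank_split[OF approximable_Kc])
  fix N0 F :: "L2^'n \<Rightarrow> L2^'n"
  assume N0: "bounded_linear N0" "finrank F" "\<And>y. F y = 0 \<Longrightarrow> y = N0 y - Kc (N0 y)"
  have blP: "bounded_linear P" unfolding cutV_def by (rule bounded_linear_mV)
  have blc: "bounded_linear (\<lambda>g. cst (N (colV b (G g))))"
    using bounded_linear_compose[OF bounded_linear_fst bounded_linear_compose[OF bounded_linear_st bounded_linear_NbG]] by (simp add: st_def)
  \<comment> \<open>The error in the first component made by the proposed control.\<close>
  define f1 where "f1 x = fst x - cst (N (colV b (G (N0 (P (snd x))))))" for x :: "(complex^'n) \<times> (L2^'n)"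
  define \<Lambda> where "\<Lambda> x = (f1 x, 0) + (0 :: complex^'n, F (P (snd x)))" for x
  have "bounded_linear f1" unfolding f1_def[abs_def]
    by (intro bounded_linear_sub bounded_linear_fst bounded_linear_compose[OF blc] bounded_linear_compose[OF N0(1)]
        bounded_linear_compose[OF blP] bounded_linear_snd)
  then have "finrank f1" by (rule finrank_euclidean)
  then have "finrank (\<lambda>x. (f1 x, 0 :: L2^'n))"
    by (rule finrank_compose_left) (intro bounded_linear_Pair bounded_linear_ident bounded_linear_zero)
  moreover have "finrank (\<lambda>x :: (complex^'n) \<times> (L2^'n). (0 :: complex^'n, F (P (snd x))))"
  proof -
    have "finrank (\<lambda>x :: (complex^'n) \<times> (L2^'n). F (P (snd x)))"
      by (rule finrank_compose_right[OF N0(2) bounded_linear_compose[OF blP bounded_linear_snd]])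
    then show ?thesis by (rule finrank_compose_left) (intro bounded_linear_Pair bounded_linear_ident bounded_linear_zero)
  qed
  ultimately have "finrank \<Lambda>" unfolding \<Lambda>_def[abs_def] by (rule finrank_add)
  then obtain m l a where l: "\<And>i. i < (m::nat) \<Longrightarrow> bounded_linear (l i :: _ \<Rightarrow> real)" "\<And>x. \<Lambda> x = (\<Sum>i<m. l i x *\<^sub>R a i)"
    unfolding finrank_def by blast
  have "\<exists>l'. (\<forall>i<m. X.clin (l' i)) \<and> X.kers m l' \<subseteq> Rhat (real CARD('n))"
  proof (rule X.complexify_functionals[OF bounded_linear_scE scE_of_real l(1)])
    fix x assume "\<And>i. i < m \<Longrightarrow> l i x = 0"
    then have "\<Lambda> x = 0" by (simp add: l(2))
    then have f: "f1 x = 0" "F (P (snd x)) = 0" by (auto simp: \<Lambda>_def zero_prod_def)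
    define g where "g = N0 (P (snd x))"
    have g: "P (snd x) = g - Kc g" using N0(3)[OF f(2)] by (simp add: g_def)
    then have g': "g = P (snd x) + Kc g" by (simp add: algebra_simps)
    have "P g = P (P (snd x) + Kc g)" by (rule arg_cong[OF g'])
    also have "\<dots> = P (snd x) + Kc g" by (simp only: linear_add[OF linear_P] P_P P_Kc)
    also have "\<dots> = g" by (rule g'[symmetric])
    finally have "P g = g" .
    then have "P (N (colV b (G g))) = P (snd x)" using window_response[of g] by (simp only: g)
    moreover have "cst (N (colV b (G g))) = fst x" using f(1) by (simp add: f1_def g_def)
    ultimately have "(fst x, P (snd x)) = st (N (colV b (G g)))" by (simp only: st_def)
    then show "x \<in> Rhat (real CARD('n))" unfolding Rhat_def Rs_def mem_Collect_eq by (intro exI[of _ "G g"] conjI G_vanish)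
  qed
  then show ?thesis by blast
qed

end

subsection \<open>Eigenfunctionals and exponential trajectories\<close>

text \<open>Integrating the functional equation over an interval on which the integral is not zero
  expresses \<open>\<mu>\<close> through its own primitive. Hence \<open>\<mu>\<close> is
  differentiable and satisfies a linear differential equation.\<close>

lemma multiplicative_continuous_exp:
  fixes \<mu> :: "real \<Rightarrow> complex"
  assumes cont: "continuous_on {0..} \<mu>" and mult: "\<And>s t. s \<ge> 0 \<Longrightarrow> t \<ge> 0 \<Longrightarrow> \<mu> (s + t) = \<mu> s * \<mu> t" and one: "\<mu> 0 = 1"
  shows "\<exists>l. \<forall>t\<ge>0. \<mu> t = exp (l * of_real t)"
proof -
  have c: "continuous_on {a..b} \<mu>" if "a \<ge> 0" for a b using that by (intro continuous_on_subset[OF cont]) auto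
  have int: "\<mu> integrable_on {a..b}" if "a \<ge> 0" for a b by (rule integrable_continuous_real[OF c[OF that]])
  obtain d where d: "d > 0" "\<And>s. s \<ge> 0 \<Longrightarrow> s < d \<Longrightarrow> norm (\<mu> s - 1) < 1/2"
    using cont[unfolded continuous_on_iff, rule_format, of 0 "1/2"] one by (auto simp: dist_norm)
  define \<delta> where "\<delta> = d / 2"
  have \<delta>: "\<delta> > 0" "\<And>s. s \<in> {0..\<delta>} \<Longrightarrow> norm (\<mu> s - 1) \<le> 1/2" using d by (auto simp: \<delta>_def intro!: less_imp_le)
  define J where "J t = integral {0..t} \<mu>" for t
  have "norm (integral {0..\<delta>} (\<lambda>s. \<mu> s - 1)) \<le> (1/2) * (\<delta> - 0)"
    by (rule integral_bound) (use \<delta> c in \<open>auto intro!: continuous_intros\<close>)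
  also have "integral {0..\<delta>} (\<lambda>s. \<mu> s - 1) = J \<delta> - of_real \<delta>"
  proof -
    have "integral {0..\<delta>} (\<lambda>s. \<mu> s - 1) = integral {0..\<delta>} \<mu> - integral {0..\<delta>} (\<lambda>s. 1)"
      by (rule Henstock_Kurzweil_Integration.integral_diff) (use int in auto)
    then show ?thesis using \<delta>(1) by (simp add: J_def scaleR_conv_of_real)
  qed
  finally have "J \<delta> \<noteq> 0" using \<delta>(1) by auto
  have sh: "integral {a..a + t} \<mu> = \<mu> a * J t" if "a \<ge> 0" "t \<ge> 0" for a t
  proof -
    have "integral {a..a + t} \<mu> = integral {0..t} (\<mu> \<circ> (\<lambda>x. x + a))"
      using integral_shift[of 0 a t \<mu>] c[of a] that by (simp add: add.commute)
    also have "\<dots> = integral {0..t} (\<lambda>s. \<mu> a * \<mu> s)"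
      by (rule Henstock_Kurzweil_Integration.integral_cong) (use mult that in \<open>auto simp: mult.commute\<close>)
    finally show ?thesis by (simp add: J_def)
  qed
  define k where "k = (\<mu> \<delta> - 1) / J \<delta>"
  have \<mu>J: "\<mu> t = 1 + k * J t" if "t \<ge> 0" for t
  proof -
    \<comment> \<open>The integral over \<open>{0..t + \<delta>}\<close> is split once at
      \<open>t\<close> and once at \<open>\<delta>\<close>; comparing the two gives
      \<open>\<mu> t\<close> in terms of \<open>J t\<close>.\<close>
    have "J t + \<mu> t * J \<delta> = integral {0..t + \<delta>} \<mu>"
      using Henstock_Kurzweil_Integration.integral_combine[of 0 t "t + \<delta>" \<mu>] int[of 0] sh[of t \<delta>] that \<delta>(1) by (simp add: J_def)
    also have "\<dots> = J \<delta> + \<mu> \<delta> * J t"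
      using Henstock_Kurzweil_Integration.integral_combine[of 0 \<delta> "t + \<delta>" \<mu>] int[of 0] sh[of \<delta> t] that \<delta>(1) by (simp add: J_def add.commute)
    finally show ?thesis using \<open>J \<delta> \<noteq> 0\<close> by (simp add: k_def field_simps)
  qed
  have "\<mu> T = exp (k * of_real T)" if T: "T \<ge> 0" for T
  proof -
    define g where "g t = (1 + k * J t) * exp (- (k * of_real t))" for t
    have "(g has_vector_derivative 0) (at t within {0..T})" if t: "t \<in> {0..T}" for t
    proof -
      have J: "(J has_vector_derivative \<mu> t) (at t within {0..T})"
        unfolding J_def[abs_def] by (rule integral_has_vector_derivative[OF c t]) simp
      have e: "((\<lambda>t. exp (- (k * of_real t))) has_vector_derivative (- k) * exp (- (k * of_real t))) (at t within {0..T})"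
      proof -
        have "((\<lambda>z. exp (- (k * z))) has_field_derivative (- k) * exp (- (k * of_real t))) (at (of_real t))"
          by (auto intro!: derivative_eq_intros)
        from has_vector_derivative_real_field[OF this] show ?thesis by (rule has_vector_derivative_at_within)
      qed
      have "((\<lambda>t. 1 + k * J t) has_vector_derivative k * \<mu> t) (at t within {0..T})"
        using J by (auto intro!: derivative_eq_intros)
      from has_vector_derivative_mult[OF this e] show ?thesis
        using \<mu>J[of t] t unfolding g_def[abs_def] by (simp add: algebra_simps)
    qed
    then obtain a where "\<And>t. t \<in> {0..T} \<Longrightarrow> g t = a"
      using has_vector_derivative_zero_constant[of "{0..T}" g] by auto
    then have "g T = g 0" using T by auto
    then have "\<mu> T * exp (- (k * of_real T)) = 1" using \<mu>J[OF T] by (simp add: g_def J_def)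
    then show ?thesis by (simp add: exp_minus field_simps)
  qed
  then show ?thesis by blast
qed

definition wexp :: "complex \<Rightarrow> real \<Rightarrow> real \<Rightarrow> real \<Rightarrow> complex" where
  "wexp \<mu> a b t = indicator {a..b} t * exp (\<mu> * of_real t)"

definition ew :: "complex \<Rightarrow> real \<Rightarrow> real \<Rightarrow> L2" where "ew \<mu> a b = abs_L2 (wexp \<mu> a b)"

lemma bmeas_wexp: "bmeas (wexp \<mu> a b)"
  unfolding wexp_def[abs_def] by (rule bmeas_window) (auto intro!: continuous_intros)

lemma sqi_wexp: "sqi (wexp \<mu> a b)"
proof -
  have "sqi (indicator {a..b})" by (rule sqi_indicator_bounded) auto
  from sqi_bmult[OF bmeas_wexp this] have "sqi (\<lambda>t. wexp \<mu> a b t * indicator {a..b} t)" .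
  moreover have "(\<lambda>t. wexp \<mu> a b t * indicator {a..b} t) = wexp \<mu> a b" by (auto simp: wexp_def indicator_def)
  ultimately show ?thesis by simp
qed

lemma rep_ew: "AE t in lborel. rep_L2 (ew \<mu> a b) t = wexp \<mu> a b t"
  unfolding ew_def by (rule rep_abs_L2[OF sqi_wexp])

lemma shiftL_ew: "shiftL h (ew \<mu> a b) = mulL (\<lambda>_. exp (\<mu> * of_real h)) (ew \<mu> (a - h) (b - h))"
  unfolding ew_def by (simp add: shiftL_abs mulL_abs sqi_wexp)
    (rule arg_cong[where f=abs_L2], auto simp: wexp_def indicator_def fun_eq_iff exp_add[symmetric] algebra_simps)

lemma ew_vanish: "A \<inter> {a..b} = {} \<Longrightarrow> vanish A (ew \<mu> a b)"
  using rep_ew[of \<mu> a b] unfolding vanish_def by (auto simp: wexp_def indicator_def elim!: eventually_mono)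

lemma ew_cong: "(\<And>t. t \<in> A \<Longrightarrow> t \<in> {a..b} \<longleftrightarrow> t \<in> {a'..b'}) \<Longrightarrow> vanish A (ew \<mu> a b - ew \<mu> a' b')"
  using rep_ew[of \<mu> a b] rep_ew[of \<mu> a' b'] rep_diff[of "ew \<mu> a b" "ew \<mu> a' b'"] unfolding vanish_def
  by eventually_elim (auto simp: wexp_def indicator_def)

lemma ew_split: "a \<le> b \<Longrightarrow> b \<le> c \<Longrightarrow> ew \<mu> a c = ew \<mu> a b + ew \<mu> b c"
proof (rule L2_eqI)
  assume *: "a \<le> b" "b \<le> c"
  show "AE t in lborel. rep_L2 (ew \<mu> a c) t = rep_L2 (ew \<mu> a b + ew \<mu> b c) t"
    using rep_ew[of \<mu> a b] rep_ew[of \<mu> b c] rep_ew[of \<mu> a c] rep_add[of "ew \<mu> a b" "ew \<mu> b c"] AE_lborel_singleton[of b]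
    by eventually_elim (use * in \<open>auto simp: wexp_def indicator_def\<close>)
qed

lemma mulL_wexp_indL: "mulL (wexp \<mu> a b) (indL {c..d}) = ew \<mu> (max a c) (min b d)"
proof -
  have "sqi (indicator {c..d})" by (rule sqi_indicator_bounded) auto
  then show ?thesis unfolding indL_def ew_def by (simp add: mulL_abs bmeas_wexp)
    (rule arg_cong[where f=abs_L2], auto simp: wexp_def indicator_def fun_eq_iff)
qed

text \<open>A kernel supported in [0, 1] sees \<open>x\<close> only on \<open>{t-1..t}\<close>. On
  an exponential it therefore acts as multiplication by its Laplace transform.\<close>

lemma conv_exp:
  assumes k: "sqi k" "\<And>s. s < 0 \<or> s > 1 \<Longrightarrow> k s = 0" and ab: "a \<le> t - 1" "t \<le> b"
    and x: "vanish {t-1..t} (x - mulL (\<lambda>_. c) (ew \<mu> a b))"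
  shows "conv k x t = c * exp (\<mu> * of_real t) * (LINT s|lborel. k s * exp (- \<mu> * of_real s))"
proof -
  have km: "k \<in> borel_measurable borel" using k(1) by (simp add: sqi_def)
  have "conv k x t = conv k (mulL (\<lambda>_. c) (ew \<mu> a b)) t"
    by (rule conv_cong[OF k(1) x]) (auto intro!: k(2))
  also have "\<dots> = c * conv k (ew \<mu> a b) t" by (rule conv_const)
  also have "conv k (ew \<mu> a b) t = (LINT s|lborel. k (t - s) * rep_L2 (ew \<mu> a b) s)" by (rule conv_eq[OF k(1)])
  also have "\<dots> = (LINT s|lborel. k (t - s) * exp (\<mu> * of_real s))"
  proof (rule integral_cong_AE)
    show "AE s in lborel. k (t - s) * rep_L2 (ew \<mu> a b) s = k (t - s) * exp (\<mu> * of_real s)"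
      using rep_ew[of \<mu> a b]
    proof eventually_elim
      case (elim s)
      then show ?case using k(2)[of "t - s"] ab by (cases "t - 1 \<le> s \<and> s \<le> t") (auto simp: wexp_def)
    qed
  qed (use km in measurable)
  also have "\<dots> = (LINT s|lborel. k s * exp (\<mu> * of_real (t - s)))"
    using lborel_integral_real_affine[of "-1" "\<lambda>s. k (t - s) * exp (\<mu> * of_real s)" t] by simp
  also have "\<dots> = (LINT s|lborel. exp (\<mu> * of_real t) * (k s * exp (- \<mu> * of_real s)))"
    by (intro Bochner_Integration.integral_cong refl) (simp add: exp_add[symmetric] algebra_simps)
  finally show ?thesis by simp
qed

section \<open>The free evolution of states\<close>

locale neutral_hautus = neutral_kalman A1 b A2 A3 \<gamma> q
  for A1 :: "complex^'n::finite^'n" and b :: "complex^'n" and A2 A3 :: "real \<Rightarrow> complex^'n^'n" and \<gamma> q :: real +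
  assumes hautus: "\<And>lam. rank (augment (DeltaA A1 A2 A3 lam) b) = CARD('n)"
begin

text \<open>The unweighted derivative is the constant \<open>exp (- \<gamma>)\<close> on
  \<open>{-2..-1}\<close>. It raises the primitive to \<open>exp (- \<gamma>)\<close> at -1, that is
  to 1 after weighting, and leaves the window untouched.\<close>

definition v0 :: L2 where "v0 = mulL (\<lambda>_. of_real (exp (- \<gamma>))) (ew (- of_real \<gamma>) (-2) (-1))"

lemma conv_v0: "conv h0 v0 (-1) = 1"
proof -
  have "conv h0 v0 (-1) = of_real (exp (- \<gamma>)) * (LINT s|lborel. h0 (-1 - s) * rep_L2 (ew (- of_real \<gamma>) (-2) (-1)) s)"
    unfolding v0_def conv_const by (simp add: conv_eq[OF sqi_h])
  also have "(LINT s|lborel. h0 (-1 - s) * rep_L2 (ew (- of_real \<gamma>) (-2) (-1)) s) = (LINT s::real|lborel. of_real (exp \<gamma>) * indicator {-2..-1} s)"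
  proof (rule integral_cong_AE)
    have [measurable]: "h0 \<in> borel_measurable borel" using sqi_h by (simp add: sqi_def)
    show "(\<lambda>s. h0 (-1 - s) * rep_L2 (ew (- of_real \<gamma>) (-2) (-1)) s) \<in> borel_measurable lborel" by measurable
    show "AE s in lborel. h0 (-1 - s) * rep_L2 (ew (- of_real \<gamma>) (-2) (-1)) s = of_real (exp \<gamma>) * indicator {-2..-1} s"
      using rep_ew[of "- of_real \<gamma>" "-2" "-1"]
    proof eventually_elim
      case (elim s)
      show ?case
      proof (cases "s \<in> {-2..-1}")
        case True
        then have "h0 (-1 - s) * rep_L2 (ew (- of_real \<gamma>) (-2) (-1)) s = of_real (exp (- (\<gamma> * (-1 - s)))) * exp (of_real (- \<gamma> * s))"
          using elim by (simp add: wexp_def hker_def)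
        also have "\<dots> = of_real (exp (- (\<gamma> * (-1 - s)) + - \<gamma> * s))" by (simp only: exp_of_real of_real_mult[symmetric] exp_add)
        also have "- (\<gamma> * (-1 - s)) + - \<gamma> * s = \<gamma>" by (simp add: algebra_simps)
        finally show ?thesis using True by simp
      next
        case False then show ?thesis using elim by (simp add: wexp_def)
      qed
    qed
  qed simp
  also have "\<dots> = of_real (exp \<gamma>) * of_real (measure lborel {-2..-1::real})"
    by (simp add: integral_indicator_complex(2) emeasure_lborel_Icc_eq)
  finally show ?thesis by (simp add: exp_minus of_real_mult[symmetric] del: of_real_mult)
qed

lemma v0_vanish: "A \<inter> {-2..-1} = {} \<Longrightarrow> vanish A v0"
  unfolding v0_def by (intro vanish_mulL ew_vanish)

text \<open>\<open>Th\<close> is a right inverse of \<open>st\<close>, \<open>Wx x\<close> is the trajectory through the state \<open>x\<close> that is uncontrolled for positive times,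
  and \<open>Sf\<close> is the free evolution of states.\<close>

definition Th :: "(complex^'n) \<times> (L2^'n) \<Rightarrow> L2^'n" where "Th x = colV (fst x) v0 + P (snd x)"
definition rx :: "(complex^'n) \<times> (L2^'n) \<Rightarrow> L2^'n" where "rx x = cutV {..0} (Th x - K (Th x))"
definition Wx :: "(complex^'n) \<times> (L2^'n) \<Rightarrow> L2^'n" where "Wx x = N (rx x)"
definition Sf :: "real \<Rightarrow> (complex^'n) \<times> (L2^'n) \<Rightarrow> (complex^'n) \<times> (L2^'n)" where "Sf h x = st (shV h (Wx x))"

lemma st_vanish: assumes "vanV {..<0} w" shows "st w = 0"
proof -
  have v: "vanish {..<0} (w $ i)" for i using assms by (simp add: vanV_def)
  have "vanish {-1..0} (w $ i)" for i by (rule vanish_null[OF v, of _ 0]) auto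
  then have "P w = 0" by (subst vanV_cutV[symmetric]) (auto simp: vanV_def)
  moreover have "conv h0 (w $ i) (-1) = 0" for i by (rule conv_vanish[OF sqi_h v]) (auto intro: h0_zero)
  ultimately show ?thesis by (simp add: st_def cst_def zero_prod_def vec_eq_iff)
qed

lemma st_N_cong: assumes "vanV {..<0} (y - y')" shows "st (N y) = st (N y')"
proof -
  have "st (N (y - y')) = 0" by (rule st_vanish[OF N_causal[OF assms]])
  then show ?thesis by (simp add: linear_diff[OF linear_N] linear_diff[OF linear_st])
qed

lemma st_Th: "st (Th x) = (fst x, P (snd x))"
proof -
  have "P (colV (fst x) v0) = 0"
  proof -
    have "vanish {-1<..} v0" by (rule v0_vanish) auto
    then have "vanish {-1..0} v0" by (rule vanish_null[of _ _ _ "-1"]) auto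
    then show ?thesis by (subst vanV_cutV[symmetric]) (auto intro: vanV_colV)
  qed
  moreover have "conv h0 (Th x $ i) (-1) = fst x $ i" for i
  proof -
    have "vanish (- {-1..0}) (mulL (indicator {-1..0}) (snd x $ i))" by (rule vanish_cut) auto
    then have v: "vanish {..<-1} (mulL (indicator {-1..0}) (snd x $ i))" by (rule vanish_mono) auto
    have "vanish {..-1} (mulL (indicator {-1..0}) (snd x $ i))" by (rule vanish_null[OF v, of _ "-1"]) auto
    then have "conv h0 (mulL (indicator {-1..0}) (snd x $ i)) (-1) = 0"
      by (rule conv_vanish[OF sqi_h]) (auto intro: h0_zero)
    then show ?thesis by (simp add: Th_def conv_add conv_const conv_v0)
  qed
  ultimately show ?thesis by (simp add: st_def cst_def vec_eq_iff Th_def linear_add[OF linear_P] P_P)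
qed

lemma N_id_minus_K: "N y - K (N y) = y" using N_eq[of y] by (simp add: diff_eq_eq)

text \<open>Switching the forcing of \<open>Th x\<close> off after time 0 does not change the state
  at 0, by causality.\<close>

lemma st_Wx: "st (Wx x) = (fst x, P (snd x))"
proof -
  have "vanV {..<0} (rx x - (Th x - K (Th x)))"
  proof -
    have "Th x - K (Th x) = rx x + cutV (- {..0}) (Th x - K (Th x))" unfolding rx_def by (rule cutV_compl) simp
    then have "rx x - (Th x - K (Th x)) = rx x - (rx x + cutV (- {..0}) (Th x - K (Th x)))" by (rule arg_cong)
    then have e: "rx x - (Th x - K (Th x)) = 0 - cutV (- {..0}) (Th x - K (Th x))" by (rule trans) simp
    have "vanV {..<0} (cutV (- {..0}) (Th x - K (Th x)))" by (rule vanV_cut) auto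
    moreover have "vanV {..<0} (0::L2^'n)" by (simp add: vanV_def)
    ultimately show ?thesis unfolding e by (rule vanV_diff[rotated])
  qed
  then have "st (Wx x) = st (N (Th x - K (Th x)))" unfolding Wx_def by (rule st_N_cong)
  then show ?thesis by (simp add: N_diffK st_Th)
qed

lemma vanV_rx: "vanV {0<..} (rx x)" unfolding rx_def by (rule vanV_cut) auto

text \<open>The difference of two trajectories with the same state at 0 and no forcing afterwards
  has state zero for all later times. So the choice of the trajectory \<open>Wx x\<close> is
  immaterial.\<close>

lemma Sf_eq:
  assumes "st w = (fst x, P (snd x))" "vanV {0<..} (w - K w)" "h \<ge> 0"
  shows "Sf h x = st (shV h w)"
proof -
  have "st (Wx x - w) = 0" using assms(1) by (simp add: linear_diff[OF linear_st] st_Wx)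
  moreover have "vanV {0<..} ((Wx x - w) - K (Wx x - w))"
  proof -
    have "(Wx x - w) - K (Wx x - w) = (Wx x - K (Wx x)) - (w - K w)" by (simp add: linear_diff[OF linear_K])
    also have "Wx x - K (Wx x) = rx x" unfolding Wx_def by (rule N_id_minus_K)
    finally have e: "(Wx x - w) - K (Wx x - w) = rx x - (w - K w)" .
    show ?thesis unfolding e by (rule vanV_diff[OF vanV_rx assms(2)])
  qed
  ultimately have "st (shV h (Wx x - w)) = 0" using st_zero_future(2) assms(3) by blast
  then show ?thesis by (simp add: Sf_def linear_diff[OF linear_shV] linear_diff[OF linear_st])
qed

lemma Sf_Sf: assumes "h \<ge> 0" "k \<ge> 0" shows "Sf h (Sf k x) = Sf (h + k) x"
proof -
  have "Sf h (Sf k x) = st (shV h (shV k (Wx x)))"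
  proof (rule Sf_eq[OF _ _ assms(1)])
    show "st (shV k (Wx x)) = (fst (Sf k x), P (snd (Sf k x)))"
      by (simp add: Sf_def st_def P_P)
    have "shV k (Wx x) - K (shV k (Wx x)) = shV k (rx x)"
      using N_id_minus_K[of "rx x"] by (simp add: K_shV Wx_def linear_diff[OF linear_shV, symmetric])
    then show "vanV {0<..} (shV k (Wx x) - K (shV k (Wx x)))"
      using vanV_shV[OF vanV_rx, of "{0<..}" k x] assms(2) by auto
  qed
  then show ?thesis by (simp add: Sf_def shV_shV)
qed

text \<open>During a free evolution by \<open>h\<close> the control recedes to
  \<open>[-t - h, -h]\<close>, which is an admissible control interval for time
  \<open>t + h\<close>.\<close>

lemma Sf_Rhat: assumes "x \<in> Rhat t" "h \<ge> 0" "t \<ge> 0" shows "Sf h x \<in> Rhat (t + h)"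
proof -
  obtain u where u: "(fst x, P (snd x)) = st (N (colV b u))" "vanish (- {-t..0}) u"
    using assms(1) unfolding Rhat_def Rs_def by auto
  have "Sf h x = st (shV h (N (colV b u)))"
  proof (rule Sf_eq[OF u(1)[symmetric] _ assms(2)])
    have "vanish {0<..} u" by (rule vanish_mono[OF u(2)]) auto
    then show "vanV {0<..} (N (colV b u) - K (N (colV b u)))" unfolding N_id_minus_K by (rule vanV_colV)
  qed
  also have "\<dots> = st (N (colV b (shiftL h u)))" by (simp add: N_shV colV_shiftL)
  finally have e: "Sf h x = st (N (colV b (shiftL h u)))" .
  have "vanish (- {-(t + h)..0}) (shiftL h u)" by (rule vanish_shiftL[OF u(2)]) (use assms in auto)
  then have "Sf h x \<in> Rs (t + h)" unfolding e Rs_def by blast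
  moreover have "(fst (Sf h x), P (snd (Sf h x))) = Sf h x" by (simp add: Sf_def st_def P_P)
  ultimately show ?thesis by (simp add: Rhat_def)
qed

lemma linear_Th: "linear Th"
  unfolding Th_def
proof (rule linearI)
  fix x y :: "(complex^'n) \<times> (L2^'n)" and r :: real
  show "colV (fst (x + y)) v0 + P (snd (x + y)) = colV (fst x) v0 + P (snd x) + (colV (fst y) v0 + P (snd y))"
    by (simp add: vec_eq_iff mulL_add mulL_plus)
  have "mulL (\<lambda>_. r *\<^sub>R c) v0 = r *\<^sub>R mulL (\<lambda>_. c) v0" for c
    using mulL_mulL[of "\<lambda>_. of_real r" "\<lambda>_. c" v0] by (simp add: mulL_of_real scaleR_conv_of_real)
  then show "colV (fst (r *\<^sub>R x)) v0 + P (snd (r *\<^sub>R x)) = r *\<^sub>R (colV (fst x) v0 + P (snd x))"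
    by (simp add: vec_eq_iff mulL_scaleR scaleR_add_right)
qed

lemma Th_sc: "Th (scE c x) = scV c (Th x)"
  by (simp add: Th_def scE_def vec_eq_iff mulL_add mulL_mulL mulL_mulL_commute[of "indicator {-1..0}"])

lemma Sf_clinop: "X.clinop (Sf h)"
  unfolding X.clinop_def
proof (intro conjI allI)
  have lin: "linear (cutV {..0})" unfolding cutV_def by (rule linear_mV)
  fix x y c
  show "Sf h (x + y) = Sf h x + Sf h y"
    by (simp add: Sf_def Wx_def rx_def linear_add[OF linear_Th] linear_add[OF linear_K] add_diff_add linear_add[OF lin]
        linear_add[OF linear_N] linear_add[OF linear_shV] linear_add[OF linear_st])
  have sd: "scV c (u - v) = scV c u - scV c v" for u v by (simp add: scV_mV linear_diff[OF linear_mV])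
  have "rx (scE c x) = scV c (rx x)"
    by (simp add: rx_def Th_sc K_scV sd[symmetric] cutV_def scV_mV_commute)
  then show "Sf h (scE c x) = scE c (Sf h x)"
    by (simp add: Sf_def Wx_def N_scV shV_scV st_scV)
qed

lemma continuous_shV: "continuous_on S (\<lambda>h. shV h w)"
proof -
  have "continuous_on S (\<lambda>h. \<chi> i. shiftL h (w $ i))"
    by (intro continuous_on_vec_lambda continuous_at_imp_continuous_on ballI shiftL_continuous)
  then show ?thesis by (simp add: shV_def)
qed

text \<open>Derivative, in the weighted variable, of the trajectory \<open>e\<^sup>(\<^sup>\<mu>\<^sup>+\<^sup>\<gamma>\<^sup>)\<^sup>t\<close> on \<open>[-1, h]\<close>; the first summand supplies its value
  at \<open>-1\<close>.\<close>

definition sig :: "complex \<Rightarrow> real \<Rightarrow> L2" where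
  "sig \<mu> h = mulL (\<lambda>_. exp (- \<mu>)) v0 + mulL (\<lambda>_. \<mu> + of_real \<gamma>) (ew \<mu> (-1) h)"

text \<open>The summand with \<open>v0\<close> starts the weighted primitive at
  \<open>exp (- \<mu>)\<close> at time -1; from there \<open>(\<mu> + \<gamma>)\<close> times the
  exponential is the derivative that continues it as \<open>exp (\<mu> * t)\<close>.\<close>

lemma conv_sig:
  assumes t: "-1 \<le> t" "t \<le> h" shows "conv h0 (sig \<mu> h) t = exp (\<mu> * of_real t)"
proof -
  define l where "l = \<mu> + of_real \<gamma>"
  have "conv h0 v0 t = of_real (exp (- (\<gamma> * (t - (-1))))) * conv h0 v0 (-1)"
    by (rule conv_hker_decay[OF \<gamma> t(1)]) (rule v0_vanish, auto)
  then have 1: "conv h0 v0 t = of_real (exp (- (\<gamma> * (t + 1))))" by (simp add: conv_v0)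
  have "conv h0 (ew \<mu> (-1) h) t = (LINT s|lborel. h0 (t - s) * rep_L2 (ew \<mu> (-1) h) s)" by (rule conv_eq[OF sqi_h])
  also have "\<dots> = (LINT s|lborel. of_real (exp (- (\<gamma> * t))) * (indicator {-1..t} s *\<^sub>R exp (l * of_real s)))"
  proof (rule integral_cong_AE)
    have [measurable]: "h0 \<in> borel_measurable borel" using sqi_h by (simp add: sqi_def)
    show "(\<lambda>s. h0 (t - s) * rep_L2 (ew \<mu> (-1) h) s) \<in> borel_measurable lborel" by measurable
    show "AE s in lborel. h0 (t - s) * rep_L2 (ew \<mu> (-1) h) s = of_real (exp (- (\<gamma> * t))) * (indicator {-1..t} s *\<^sub>R exp (l * of_real s))"
      using rep_ew[of \<mu> "-1" h]
    proof eventually_elim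
      case (elim s)
      show ?case
      proof (cases "s \<in> {-1..t}")
        case True
        then have "h0 (t - s) * rep_L2 (ew \<mu> (-1) h) s = of_real (exp (- (\<gamma> * (t - s)))) * exp (\<mu> * of_real s)"
          using elim t by (simp add: wexp_def hker_def)
        also have "\<dots> = exp (of_real (- (\<gamma> * (t - s))) + \<mu> * of_real s)" by (simp only: exp_of_real[symmetric] exp_add)
        also have "of_real (- (\<gamma> * (t - s))) + \<mu> * of_real s = of_real (- (\<gamma> * t)) + l * of_real s" by (simp add: l_def algebra_simps)
        also have "exp \<dots> = of_real (exp (- (\<gamma> * t))) * exp (l * of_real s)" by (simp only: exp_of_real exp_add)
        finally show ?thesis using True by simp
      next
        case False
        then show ?thesis using elim by (cases "s < -1") (auto simp: wexp_def hker_def)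
      qed
    qed
  qed simp
  also have "\<dots> = of_real (exp (- (\<gamma> * t))) * (LINT s|lborel. indicator {-1..t} s *\<^sub>R exp (l * of_real s))"
    by (rule integral_mult_right_zero)
  finally have 2: "conv h0 (ew \<mu> (-1) h) t = of_real (exp (- (\<gamma> * t))) * (LINT s|lborel. indicator {-1..t} s *\<^sub>R exp (l * of_real s))" .
  have 3: "(LINT s|lborel. indicator {-1..t} s *\<^sub>R (l * exp (l * of_real s))) = exp (l * of_real t) - exp (l * of_real (-1))"
  proof (rule integral_FTC_Icc[OF t(1)])
    fix x assume "-1 \<le> x" "x \<le> t"
    have "((\<lambda>z. exp (l * z)) has_field_derivative l * exp (l * of_real x)) (at (of_real x))"
      by (auto intro!: derivative_eq_intros)
    from has_vector_derivative_real_field[OF this]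
    show "((\<lambda>s. exp (l * of_real s)) has_vector_derivative l * exp (l * of_real x)) (at x within {-1..t})"
      by (rule has_vector_derivative_at_within)
  qed (intro continuous_intros)
  have "(LINT s|lborel. indicator {-1..t} s *\<^sub>R (l * exp (l * of_real s))) = l * (LINT s|lborel. indicator {-1..t} s *\<^sub>R exp (l * of_real s))"
    unfolding mult_scaleR_right[symmetric] by (rule integral_mult_right_zero)
  then have 4: "l * (LINT s|lborel. indicator {-1..t} s *\<^sub>R exp (l * of_real s)) = exp (l * of_real t) - exp (- l)" using 3 by simp
  have "conv h0 (sig \<mu> h) t = exp (- \<mu>) * of_real (exp (- (\<gamma> * (t + 1)))) + of_real (exp (- (\<gamma> * t))) * (exp (l * of_real t) - exp (- l))"
    unfolding sig_def conv_add conv_const 1 2 4[symmetric] l_def[symmetric] by (simp add: mult_ac)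
  also have "exp (- \<mu>) * of_real (exp (- (\<gamma> * (t + 1)))) = of_real (exp (- (\<gamma> * t))) * exp (- l)"
  proof -
    have "exp (- \<mu>) * of_real (exp (- (\<gamma> * (t + 1)))) = exp (- \<mu> + of_real (- (\<gamma> * (t + 1))))" by (simp only: exp_add exp_of_real)
    also have "- \<mu> + of_real (- (\<gamma> * (t + 1))) = of_real (- (\<gamma> * t)) + - l" by (simp add: l_def algebra_simps)
    also have "exp \<dots> = of_real (exp (- (\<gamma> * t))) * exp (- l)" by (simp only: exp_add exp_of_real)
    finally show ?thesis .
  qed
  finally have "conv h0 (sig \<mu> h) t = of_real (exp (- (\<gamma> * t))) * exp (l * of_real t)" by (simp add: algebra_simps)
  also have "\<dots> = exp (of_real (- (\<gamma> * t)) + l * of_real t)" by (simp only: exp_add exp_of_real)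
  also have "of_real (- (\<gamma> * t)) + l * of_real t = \<mu> * of_real t" by (simp add: l_def algebra_simps)
  finally show ?thesis .
qed

text \<open>The weight moves the spectral parameter from \<open>\<mu>\<close> to
  \<open>\<mu> + \<gamma>\<close>; the right hand side is an integral from \<open>DeltaA\<close> at
  that point.\<close>

lemma kA_transform:
  "(LINT s|lborel. kA \<gamma> M i j s * exp (- \<mu> * of_real s)) = (LINT s:{-1..0}|lborel. exp ((\<mu> + of_real \<gamma>) * of_real s) * M s $ i $ j)"
proof -
  have "(LINT s|lborel. kA \<gamma> M i j s * exp (- \<mu> * of_real s)) = (LINT s|lborel. kA \<gamma> M i j (- s) * exp (- \<mu> * of_real (- s)))"
    using lborel_integral_real_affine[of "-1" "\<lambda>s. kA \<gamma> M i j s * exp (- \<mu> * of_real s)" 0] by simp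
  also have "\<dots> = (LINT s|lborel. indicator {-1..0} s *\<^sub>R (exp ((\<mu> + of_real \<gamma>) * of_real s) * M s $ i $ j))"
  proof (rule Bochner_Integration.integral_cong[OF refl])
    fix s :: real
    have "of_real (exp (- (\<gamma> * - s))) * exp (- \<mu> * of_real (- s)) = exp ((\<mu> + of_real \<gamma>) * of_real s)"
      by (simp add: exp_of_real[symmetric] exp_add[symmetric] algebra_simps)
    then show "kA \<gamma> M i j (- s) * exp (- \<mu> * of_real (- s)) = indicator {-1..0} s *\<^sub>R (exp ((\<mu> + of_real \<gamma>) * of_real s) * M s $ i $ j)"
      by (cases "s \<in> {-1..0}") (auto simp: kA_def mult_ac)
  qed
  finally show ?thesis by (simp add: set_lebesgue_integral_def)
qed

lemma sig_diff: "vanish {-1<..} (sig \<mu> h - mulL (\<lambda>_. \<mu> + of_real \<gamma>) (ew \<mu> (-1) h))"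
proof -
  have "vanish {-1<..} (mulL (\<lambda>_. exp (- \<mu>)) v0)" by (intro vanish_mulL v0_vanish) auto
  then show ?thesis by (simp add: sig_def)
qed

text \<open>The forcing that sustains an exponential trajectory in direction \<open>\<zeta>\<close>
  is \<open>\<Delta>(\<mu> + \<gamma>) \<zeta>\<close> times the exponential. This holds for times
  in \<open>{0<..<h}\<close>, since the delays then look only at \<open>[-1, h]\<close>, where the
  trajectory is exponential.\<close>

lemma sig_residual:
  assumes h: "h \<ge> 0"
  shows "vanV {0<..<h} ((colV \<zeta> (sig \<mu> h) - K (colV \<zeta> (sig \<mu> h))) - colV (DeltaA A1 A2 A3 (\<mu> + of_real \<gamma>) *v \<zeta>) (ew \<mu> 0 h))"
proof -
  define l where "l = \<mu> + of_real \<gamma>"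
  define I where "I M i j = (LINT s:{-1..0}|lborel. exp (l * of_real s) * M s $ i $ j)" for M :: "real \<Rightarrow> complex^'n^'n" and i j
  let ?s = "sig \<mu> h"
  have sd: "vanish {t-1..t} (?s - mulL (\<lambda>_. l) (ew \<mu> (-1) h))" if "t > 0" for t
    unfolding l_def by (rule vanish_mono[OF sig_diff]) (use that in auto)
  have hd: "vanish {t-1..t} (convL h0 ?s - mulL (\<lambda>_. 1) (ew \<mu> (-1) h))" if "t > 0" "t < h" for t
    unfolding vanish_def using rep_convL[OF kern_h, of ?s] rep_diff[of "convL h0 ?s" "mulL (\<lambda>_. 1) (ew \<mu> (-1) h)"] rep_ew[of \<mu> "-1" h]
  proof eventually_elim
    case (elim s)
    then show ?case using conv_sig[of s h \<mu>] that by (auto simp: wexp_def)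
  qed
  have Tij: "AE t in lborel. t \<in> {0<..<h} \<longrightarrow> rep_L2 (T i j ?s) t = exp (\<mu> * of_real t) * (l * exp (- l) * A1 $ i $ j + l * I A2 i j + I A3 i j)" for i j
  proof -
    \<comment> \<open>One unit earlier the time lies between -1 and \<open>h - 1\<close>, still
      within the exponential part.\<close>
    have s1: "AE t in lborel. t \<in> {0<..<h} \<longrightarrow> rep_L2 (shiftL (-1) ?s) t = l * exp (\<mu> * of_real (t - 1))"
    proof -
      have "vanish {0<..} (shiftL (-1) (?s - mulL (\<lambda>_. l) (ew \<mu> (-1) h)))"
        by (rule vanish_shiftL[OF sig_diff[of \<mu> h, folded l_def]]) auto
      then have v: "vanish {0<..} (shiftL (-1) ?s - mulL (\<lambda>_. l) (shiftL (-1) (ew \<mu> (-1) h)))"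
        by (simp add: linear_diff[OF bounded_linear.linear[OF bounded_linear_shiftL]] shiftL_mulL)
      show ?thesis
        using v[unfolded vanish_def] rep_diff[of "shiftL (-1) ?s" "mulL (\<lambda>_. l) (shiftL (-1) (ew \<mu> (-1) h))"]
          rep_mulL[OF bmeas_const, of l "shiftL (-1) (ew \<mu> (-1) h)"] 
          rep_mulL[OF bmeas_const, of "exp (\<mu> * of_real (-1))" "ew \<mu> 0 (h + 1)"] rep_ew[of \<mu> 0 "h + 1"]
      proof eventually_elim
        case (elim t)
        have e: "shiftL (-1) (ew \<mu> (-1) h) = mulL (\<lambda>_. exp (\<mu> * of_real (-1))) (ew \<mu> 0 (h + 1))" using shiftL_ew[of "-1" \<mu> "-1" h] by simp
        have x: "exp (\<mu> * of_real (t - 1)) = exp (\<mu> * of_real (-1)) * exp (\<mu> * of_real t)" by (simp add: exp_add[symmetric] algebra_simps)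
        show ?case
        proof
          assume t: "t \<in> {0<..<h}"
          then have "rep_L2 (shiftL (-1) ?s) t = l * rep_L2 (shiftL (-1) (ew \<mu> (-1) h)) t" using elim by auto
          also have "rep_L2 (shiftL (-1) (ew \<mu> (-1) h)) t = exp (\<mu> * of_real (-1)) * exp (\<mu> * of_real t)"
            unfolding e using elim t by (simp add: wexp_def)
          finally show "rep_L2 (shiftL (-1) ?s) t = l * exp (\<mu> * of_real (t - 1))" by (simp only: x)
        qed
      qed
    qed
    have kk: "kern (kA \<gamma> A2 i j)" "kern (kA \<gamma> A3 i j)" by (rule kern2 kern3)+
    show ?thesis
      using s1 rep_convL[OF kk(1), of ?s] rep_convL[OF kk(2), of "convL h0 ?s"]
        rep_mulL[OF bmeas_const, of "of_real (exp (- \<gamma>)) * A1 $ i $ j" "shiftL (-1) ?s"]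
        rep_add[of "convL (kA \<gamma> A2 i j) ?s" "convL (kA \<gamma> A3 i j) (convL h0 ?s)"]
        rep_add[of "mulL (\<lambda>_. of_real (exp (- \<gamma>)) * A1 $ i $ j) (shiftL (-1) ?s)" "cop \<gamma> A2 A3 i j ?s"]
    proof eventually_elim
      case (elim t)
      show ?case
      proof
        assume t: "t \<in> {0<..<h}"
        have k2: "sqi (kA \<gamma> A2 i j)" and k3: "sqi (kA \<gamma> A3 i j)" using kk by (auto simp: kern_def)
        have c2: "conv (kA \<gamma> A2 i j) ?s t = l * exp (\<mu> * of_real t) * I A2 i j"
          unfolding I_def l_def kA_transform[symmetric] by (rule conv_exp[OF k2 _ _ _ sd[unfolded l_def]]) (use t in \<open>auto intro: kA_zero\<close>)
        have c3: "conv (kA \<gamma> A3 i j) (convL h0 ?s) t = exp (\<mu> * of_real t) * I A3 i j"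
          using conv_exp[OF k3 _ _ _ hd, of t, OF kA_zero] t unfolding I_def l_def kA_transform[symmetric] mult_1 by auto
        have e: "of_real (exp (- \<gamma>)) * exp (\<mu> * of_real (t - 1)) = exp (\<mu> * of_real t) * exp (- l)"
          by (simp add: exp_of_real[symmetric] exp_add[symmetric] l_def algebra_simps)
        have "rep_L2 (T i j ?s) t = of_real (exp (- \<gamma>)) * A1 $ i $ j * (l * exp (\<mu> * of_real (t - 1))) + (l * exp (\<mu> * of_real t) * I A2 i j + exp (\<mu> * of_real t) * I A3 i j)"
          using elim t c2 c3 by (simp add: nop_def cop_def)
        also have "\<dots> = l * A1 $ i $ j * (of_real (exp (- \<gamma>)) * exp (\<mu> * of_real (t - 1))) + (l * exp (\<mu> * of_real t) * I A2 i j + exp (\<mu> * of_real t) * I A3 i j)"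
          by (simp only: mult_ac)
        also have "\<dots> = exp (\<mu> * of_real t) * (l * exp (- l) * A1 $ i $ j + l * I A2 i j + I A3 i j)"
          unfolding e by (simp add: algebra_simps)
        finally show "rep_L2 (T i j ?s) t = exp (\<mu> * of_real t) * (l * exp (- l) * A1 $ i $ j + l * I A2 i j + I A3 i j)" .
      qed
    qed
  qed
  have Tv: "vanish {0<..<h} (T i j ?s - mulL (\<lambda>_. l * exp (- l) * A1 $ i $ j + l * I A2 i j + I A3 i j) (ew \<mu> 0 h))" (is "vanish _ (_ - mulL (\<lambda>_. ?c i j) _)") for i j
    unfolding vanish_def using Tij[of i j] rep_diff[of "T i j ?s" "mulL (\<lambda>_. ?c i j) (ew \<mu> 0 h)"] rep_mulL[OF bmeas_const, of "?c i j" "ew \<mu> 0 h"] rep_ew[of \<mu> 0 h]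
    by eventually_elim (auto simp: wexp_def mult.commute)
  have sv: "vanish {0<..<h} (?s - mulL (\<lambda>_. l) (ew \<mu> 0 h))"
  proof -
    have 1: "vanish {0<..<h} (?s - mulL (\<lambda>_. l) (ew \<mu> (-1) h))" unfolding l_def by (rule vanish_mono[OF sig_diff]) auto
    have "vanish {0<..<h} (ew \<mu> (-1) h - ew \<mu> 0 h)" by (rule ew_cong) auto
    then have "vanish {0<..<h} (mulL (\<lambda>_. l) (ew \<mu> (-1) h - ew \<mu> 0 h))" by (rule vanish_mulL)
    from vanish_add[OF 1 this] show ?thesis by (simp add: linear_diff[OF bounded_linear.linear[OF bounded_linear_mulL]])
  qed
  have "vanish {0<..<h} (((colV \<zeta> ?s - K (colV \<zeta> ?s)) - colV (DeltaA A1 A2 A3 l *v \<zeta>) (ew \<mu> 0 h)) $ i)" for i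
  proof -
    have Ds: "(DeltaA A1 A2 A3 l *v \<zeta>) $ i = l * \<zeta> $ i - (\<Sum>j\<in>UNIV. ?c i j * \<zeta> $ j)"
    proof -
      have "(DeltaA A1 A2 A3 l *v \<zeta>) $ i = (\<Sum>j\<in>UNIV. (if i = j then l * \<zeta> $ j else 0) - ?c i j * \<zeta> $ j)"
        unfolding matrix_vector_mult_def DeltaA_def I_def by (simp, rule sum.cong) (auto simp: algebra_simps)
      then show ?thesis by (simp add: sum_subtractf)
    qed
    have lin: "linear (mulL m)" for m by (rule bounded_linear.linear[OF bounded_linear_mulL])
    have ms: "mulL (\<lambda>_. c - d) x = mulL (\<lambda>_. c) x - mulL (\<lambda>_. d) x" for c d :: complex and x
      using mulL_plus[of "\<lambda>_. c - d" "\<lambda>_. d" x] by simp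
    have "((colV \<zeta> ?s - K (colV \<zeta> ?s)) - colV (DeltaA A1 A2 A3 l *v \<zeta>) (ew \<mu> 0 h)) $ i
      = mulL (\<lambda>_. \<zeta> $ i) (?s - mulL (\<lambda>_. l) (ew \<mu> 0 h)) - (\<Sum>j\<in>UNIV. mulL (\<lambda>_. \<zeta> $ j) (T i j ?s - mulL (\<lambda>_. ?c i j) (ew \<mu> 0 h)))"
      by (simp add: Ds T_const linear_diff[OF lin] mulL_mulL ms mulL_const_sum sum_subtractf mult.commute)
    then show ?thesis
      by (simp only:) (intro vanish_diff vanish_mulL sv vanish_sum Tv)
  qed
  then show ?thesis by (simp add: vanV_def l_def)
qed

lemma Rhat_mono: "t \<le> t' \<Longrightarrow> Rhat t \<subseteq> Rhat t'"
  using Rs_mono unfolding Rhat_def by blast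

text \<open>The window \<open>[-1, 0]\<close>, moved by \<open>h\<close>, stays inside
  \<open>[-1, h]\<close>. There translating an exponential only multiplies it, so the state at
  \<open>h\<close> is a multiple of the state at 0.\<close>

lemma sig_shift: assumes "h \<ge> 0"
  shows "st (shV h (colV \<zeta> (sig \<mu> h))) = scE (exp (\<mu> * of_real h)) (st (colV \<zeta> (sig \<mu> h)))"
proof -
  define e where "e = exp (\<mu> * of_real h)"
  define l where "l = \<mu> + of_real \<gamma>"
  let ?s = "sig \<mu> h"
  let ?I = "{-1<..<0::real}"
  have lin: "linear (mulL m)" and linh: "linear (shiftL k)" for m k
    by (rule bounded_linear.linear[OF bounded_linear_mulL], rule bounded_linear.linear[OF bounded_linear_shiftL])
  have 1: "vanish {-1<..} (?s - mulL (\<lambda>_. l) (ew \<mu> (-1) h))" unfolding l_def by (rule sig_diff)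
  have "vanish ?I (shiftL h (?s - mulL (\<lambda>_. l) (ew \<mu> (-1) h)))" by (rule vanish_shiftL[OF 1]) (use assms in auto)
  moreover have "shiftL h (?s - mulL (\<lambda>_. l) (ew \<mu> (-1) h)) = shiftL h ?s - mulL (\<lambda>_. l) (mulL (\<lambda>_. e) (ew \<mu> (-1 - h) 0))"
    by (simp add: linear_diff[OF linh] shiftL_mulL shiftL_ew e_def)
  ultimately have a: "vanish ?I (shiftL h ?s - mulL (\<lambda>_. l) (mulL (\<lambda>_. e) (ew \<mu> (-1 - h) 0)))" by simp
  have "vanish ?I (ew \<mu> (-1 - h) 0 - ew \<mu> (-1) h)" by (rule ew_cong) (use assms in auto)
  then have b: "vanish ?I (mulL (\<lambda>_. l) (mulL (\<lambda>_. e) (ew \<mu> (-1 - h) 0 - ew \<mu> (-1) h)))" by (intro vanish_mulL)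
  have c: "vanish ?I (mulL (\<lambda>_. e) (?s - mulL (\<lambda>_. l) (ew \<mu> (-1) h)))"
    by (rule vanish_mulL[OF vanish_mono[OF 1]]) auto
  have "vanish ?I (shiftL h ?s - mulL (\<lambda>_. e) ?s)"
    using vanish_diff[OF vanish_add[OF a b] c]
    by (simp add: linear_diff[OF lin] mulL_mulL_commute[of "\<lambda>_. e" "\<lambda>_. l"])
  then have "vanish {-1..<0} (shiftL h ?s - mulL (\<lambda>_. e) ?s)" by (rule vanish_null[of _ _ _ "-1"]) auto
  then have "vanish {-1..0} (shiftL h ?s - mulL (\<lambda>_. e) ?s)" by (rule vanish_null[of _ _ _ 0]) auto
  then have "mulL (indicator {-1..0}) (shiftL h ?s - mulL (\<lambda>_. e) ?s) = 0" by (simp add: vanish_iff)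
  then have P: "mulL (indicator {-1..0}) (shiftL h ?s) = mulL (indicator {-1..0}) (mulL (\<lambda>_. e) ?s)" by (simp add: linear_diff[OF lin])
  have "conv h0 (shiftL h ?s) (-1) = exp (\<mu> * of_real (-1 + h))" unfolding conv_shiftL by (rule conv_sig) (use assms in auto)
  also have "\<dots> = e * exp (\<mu> * of_real (-1))" by (simp add: e_def exp_add[symmetric] algebra_simps)
  also have "exp (\<mu> * of_real (-1)) = conv h0 ?s (-1)" by (rule conv_sig[symmetric]) (use assms in auto)
  finally have C: "conv h0 (shiftL h ?s) (-1) = e * conv h0 ?s (-1)" .
  have "cst (shV h (colV \<zeta> ?s)) = e *s cst (colV \<zeta> ?s)"
    by (simp add: cst_def vec_eq_iff shiftL_mulL conv_const C)
  moreover have "P (shV h (colV \<zeta> ?s)) = scV e (P (colV \<zeta> ?s))"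
  proof -
    have "mulL (indicator {-1..0}) (shiftL h (mulL (\<lambda>_. \<zeta> $ i) ?s)) = mulL (\<lambda>_. e) (mulL (indicator {-1..0}) (mulL (\<lambda>_. \<zeta> $ i) ?s))" for i
    proof -
      have "mulL (indicator {-1..0}) (shiftL h (mulL (\<lambda>_. \<zeta> $ i) ?s)) = mulL (indicator {-1..0}) (mulL (\<lambda>_. \<zeta> $ i) (shiftL h ?s))"
        by (simp add: shiftL_mulL)
      also have "\<dots> = mulL (\<lambda>_. \<zeta> $ i) (mulL (indicator {-1..0}) (shiftL h ?s))" by (rule mulL_mulL_commute)
      also have "\<dots> = mulL (\<lambda>_. \<zeta> $ i) (mulL (indicator {-1..0}) (mulL (\<lambda>_. e) ?s))" by (simp only: P)
      also have "\<dots> = mulL (\<lambda>_. e) (mulL (indicator {-1..0}) (mulL (\<lambda>_. \<zeta> $ i) ?s))"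
        by (simp add: mulL_mulL bmeas_mult) (simp add: mult_ac)
      finally show ?thesis .
    qed
    then show ?thesis by (simp add: vec_eq_iff)
  qed
  ultimately show ?thesis by (simp add: st_def scE_def e_def)
qed

text \<open>Split the forcing of the exponential trajectory at time 0. The part before 0 evolves
  freely, so \<open>f\<close> gains the factor \<open>exp (\<mu> * h)\<close> on it; the whole
  trajectory gains the same factor by \<open>sig_shift\<close>. The part forced during
  \<open>[0, h]\<close> is therefore annihilated at time \<open>h\<close>, and translating it by
  \<open>h\<close> gives the claim.\<close>

lemma eigenfunctional_sig:
  assumes f: "X.clin f" and eig: "\<And>h x. h \<ge> 0 \<Longrightarrow> f (Sf h x) = exp (\<mu> * of_real h) * f x" and h: "h \<ge> 0"
  shows "f (st (N (colV (DeltaA A1 A2 A3 (\<mu> + of_real \<gamma>) *v \<zeta>) (ew \<mu> (-h) 0)))) = 0"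
proof -
  define w where "w = colV \<zeta> (sig \<mu> h)"
  define r where "r = w - K w"
  define \<xi> where "\<xi> = DeltaA A1 A2 A3 (\<mu> + of_real \<gamma>) *v \<zeta>"
  define w1 where "w1 = N (cutV {..0} r)"
  define w2 where "w2 = N (cutV (- {..0}) r)"
  define e where "e = exp (\<mu> * of_real h)"
  have rs: "r = cutV {..0} r + cutV (- {..0}) r" by (rule cutV_compl) simp
  have "w = N r" unfolding r_def by (rule N_diffK[symmetric])
  also have "\<dots> = w1 + w2" unfolding w1_def w2_def by (subst rs) (rule linear_add[OF linear_N])
  finally have ws: "w = w1 + w2" .
  have "vanV {..<0} (cutV (- {..0}) r)" by (rule vanV_cut) auto
  then have "st w2 = 0" unfolding w2_def by (intro st_vanish N_causal)
  then have st1: "st w1 = st w" by (simp add: ws linear_add[OF linear_st])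
  have "Sf h (st w) = st (shV h w1)"
  proof (rule Sf_eq[OF _ _ h])
    show "st w1 = (fst (st w), P (snd (st w)))" unfolding st1 by (simp add: st_def P_P)
    show "vanV {0<..} (w1 - K w1)" unfolding w1_def N_id_minus_K by (rule vanV_cut) auto
  qed
  then have "f (st (shV h w1)) = e * f (st w)" using eig[OF h, of "st w"] by (simp add: e_def)
  moreover have "f (st (shV h w)) = e * f (st w)" unfolding w_def sig_shift[OF h] e_def by (rule X.clin_sc[OF f])
  moreover have "st (shV h w) = st (shV h w1) + st (shV h w2)" by (simp add: ws linear_add[OF linear_shV] linear_add[OF linear_st])
  ultimately have f2: "f (st (shV h w2)) = 0" by (simp add: X.clin_add[OF f])
  \<comment> \<open>Forcing after time \<open>h\<close> does not matter for the state at
    \<open>h\<close>, so agreement before \<open>h\<close> is enough.\<close>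
  have "vanV {..<h} (cutV (- {..0}) r - colV \<xi> (ew \<mu> 0 h))"
  proof -
    have "vanV {..<0} (cutV (- {..0}) r - colV \<xi> (ew \<mu> 0 h))"
      by (intro vanV_diff vanV_cut vanV_colV ew_vanish) auto
    moreover have "vanV {0<..<h} (cutV (- {..0}) r - colV \<xi> (ew \<mu> 0 h))"
    proof -
      have "vanV {0<..<h} (cutV {..0} r)" by (rule vanV_cut) auto
      moreover have "vanV {0<..<h} (r - colV \<xi> (ew \<mu> 0 h))" unfolding r_def w_def \<xi>_def by (rule sig_residual[OF h])
      ultimately have "vanV {0<..<h} ((r - colV \<xi> (ew \<mu> 0 h)) - cutV {..0} r)" by (rule vanV_diff[rotated])
      moreover have "(r - colV \<xi> (ew \<mu> 0 h)) - cutV {..0} r = (r - cutV {..0} r) - colV \<xi> (ew \<mu> 0 h)" by simp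
      moreover have "r - cutV {..0} r = cutV (- {..0}) r" using rs by (metis add_diff_cancel_left')
      ultimately show ?thesis by simp
    qed
    ultimately have "vanish ({..<0} \<union> {0<..<h}) ((cutV (- {..0}) r - colV \<xi> (ew \<mu> 0 h)) $ i)" for i
      unfolding vanV_def by (intro vanish_Un) auto
    then have "vanish {..<h} ((cutV (- {..0}) r - colV \<xi> (ew \<mu> 0 h)) $ i)" for i
      by (rule vanish_null[of _ _ _ 0]) auto
    then show ?thesis by (simp add: vanV_def)
  qed
  then have "vanV {..<0} (shV h (cutV (- {..0}) r - colV \<xi> (ew \<mu> 0 h)))" by (rule vanV_shV) auto
  moreover have "colV \<xi> (shiftL h (ew \<mu> 0 h)) = scV e (colV \<xi> (ew \<mu> (-h) 0))" by (simp add: shiftL_ew e_def colV_const)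
  ultimately have "vanV {..<0} (shV h (cutV (- {..0}) r) - scV e (colV \<xi> (ew \<mu> (-h) 0)))"
    by (simp only: linear_diff[OF linear_shV] colV_shiftL[symmetric])
  then have "st (N (shV h (cutV (- {..0}) r))) = st (N (scV e (colV \<xi> (ew \<mu> (-h) 0))))" by (rule st_N_cong)
  then have "e * f (st (N (colV \<xi> (ew \<mu> (-h) 0)))) = 0"
    using f2 by (simp add: w2_def N_shV N_scV st_scV X.clin_sc[OF f])
  then show ?thesis by (simp add: e_def \<xi>_def)
qed

theorem Rhat_UNIV: assumes t: "real CARD('n) < t" shows "Rhat t = UNIV"
proof (rule ccontr)
  assume ne: "Rhat t \<noteq> UNIV"
  let ?n = "real CARD('n)"
  obtain m l where l: "\<And>i. i < m \<Longrightarrow> X.clin (l i)" "X.kers m l \<subseteq> Rhat ?n" using Rhat_finite_codim by blast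
  have "m > 0"
  proof (rule ccontr)
    assume "\<not> m > 0"
    then have "UNIV \<subseteq> Rhat ?n" using l(2) by (auto simp: X.kers_def)
    then show False using Rhat_mono[of ?n t] t ne by auto
  qed
  \<comment> \<open>With \<open>m\<close> equal steps from n to \<open>t\<close> there are
    \<open>m + 1\<close> proper spaces, too many for \<open>m\<close> strict inclusions.\<close>
  define \<delta> where "\<delta> = (t - ?n) / real m"
  have \<delta>: "\<delta> > 0" using t \<open>m > 0\<close> by (simp add: \<delta>_def)
  define tk where "tk k = ?n + real k * \<delta>" for k
  have "\<exists>k<m. Rhat (tk k) = Rhat (tk (Suc k))"
  proof (rule X.chain_stationary[of m l])
    show "X.kers m l \<subseteq> Rhat (tk 0)" using l(2) by (simp add: tk_def)
    show "Rhat (tk k) \<subseteq> Rhat (tk (Suc k))" for k by (rule Rhat_mono) (use \<delta> in \<open>simp add: tk_def algebra_simps\<close>)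
    show "Rhat (tk m) \<noteq> UNIV" using ne \<open>m > 0\<close> by (simp add: tk_def \<delta>_def)
  qed (use l csub_Rhat in auto)
  then obtain k where k: "k < m" "Rhat (tk k) = Rhat (tk (Suc k))" by blast
  define R where "R = Rhat (tk k)"
  have tk1: "tk k \<ge> 1" using \<delta> by (simp add: tk_def add_increasing2 Suc_le_eq)
  \<comment> \<open>An evolution by at most \<open>\<delta>\<close> stays within the space at
    \<open>tk (Suc k)\<close>, which is \<open>R\<close> again; longer evolutions are composed of
    such steps.\<close>
  have inv1: "Sf h x \<in> R" if "x \<in> R" "0 \<le> h" "h \<le> \<delta>" for x h
  proof -
    have "Sf h x \<in> Rhat (tk k + h)" using Sf_Rhat[of x "tk k" h] that tk1 by (simp add: R_def)
    also have "\<dots> \<subseteq> Rhat (tk (Suc k))" by (rule Rhat_mono) (use that in \<open>simp add: tk_def algebra_simps\<close>)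
    finally show ?thesis using k(2) by (simp add: R_def)
  qed
  have inv2: "Sf h x \<in> R" if "x \<in> R" "0 \<le> h" "h \<le> real j * \<delta>" for x h j
    using that
  proof (induction j arbitrary: x h)
    case 0
    then show ?case using inv1[of x h] \<delta> by simp
  next
    case (Suc j)
    show ?case
    proof (cases "h \<le> \<delta>")
      case True then show ?thesis using inv1 Suc.prems by blast
    next
      case False
      have "Sf (h - \<delta>) (Sf \<delta> x) \<in> R"
        by (rule Suc.IH) (use Suc.prems False \<delta> inv1[of x \<delta>] in \<open>auto simp: algebra_simps\<close>)
      then show ?thesis using Sf_Sf[of "h - \<delta>" \<delta> x] False \<delta> by simp
    qed
  qed
  have inv: "Sf h x \<in> R" if "x \<in> R" "0 \<le> h" for x h
  proof -
    obtain j where "h \<le> real j * \<delta>" using reals_Archimedean3[OF \<delta>] by (metis less_imp_le)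
    then show ?thesis using inv2 that by blast
  qed
  have R: "X.csub R" "R \<noteq> UNIV" "X.kers m l \<subseteq> R"
  proof -
    show "X.csub R" by (simp add: R_def csub_Rhat)
    have "real k * \<delta> \<le> real m * \<delta>" using k(1) \<delta> by simp
    then have "tk k \<le> t" using \<open>m > 0\<close> by (simp add: tk_def \<delta>_def)
    then show "R \<noteq> UNIV" using Rhat_mono[of "tk k" t] ne by (auto simp: R_def)
    have "?n \<le> tk k" using \<delta> by (simp add: tk_def)
    then show "X.kers m l \<subseteq> R" using l(2) Rhat_mono[of ?n "tk k"] by (auto simp: R_def)
  qed
  obtain f x0 where f: "X.clin f" "f x0 \<noteq> 0" "\<And>x. x \<in> R \<Longrightarrow> f x = 0" and fe: "\<And>h. h \<in> {0..} \<Longrightarrow> \<exists>\<mu>. \<forall>x. f (Sf h x) = \<mu> * f x"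
  proof (rule X.common_eigenfunctional[of "{0..}" Sf R m l])
    show "Sf h (Sf k x) = Sf k (Sf h x)" if "h \<in> {0..}" "k \<in> {0..}" for h k x using that by (simp add: Sf_Sf add.commute)
  qed (use Sf_clinop R inv l in auto)
  define \<mu> where "\<mu> h = f (Sf h x0) / f x0" for h
  have eig: "f (Sf h x) = \<mu> h * f x" if "h \<ge> 0" for h x
  proof -
    have "h \<in> {0..}" using that by simp
    from fe[OF this] obtain a where a: "\<forall>x. f (Sf h x) = a * f x" by blast
    have "f (Sf h x) = a * f x" "f (Sf h x0) = a * f x0" using a by blast+
    then show ?thesis using f(2) by (simp add: \<mu>_def)
  qed
  \<comment> \<open>Elements that are zero apart from what lies outside the window belong to
    \<open>R\<close>, because \<open>Rhat\<close> ignores that part; hence \<open>f\<close> does not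
    see it.\<close>
  have Pf: "f (fst x, P (snd x)) = f x" for x
  proof -
    have "x - (fst x, P (snd x)) = (0, snd x - P (snd x))" by (simp add: prod_eq_iff)
    moreover have "(0, snd x - P (snd x)) \<in> R"
      using X.csub_def[of R] R(1) by (simp add: R_def Rhat_def linear_diff[OF linear_P] linear_0[OF linear_P] P_P)
    ultimately have "f (x - (fst x, P (snd x))) = 0" using f(3) by simp
    then show ?thesis by (simp add: X.clin_diff[OF f(1)])
  qed
  have blf: "bounded_linear (\<lambda>w. f (st w))"
    using bounded_linear_compose[OF _ bounded_linear_st] f(1) by (auto simp: X.clin_def)
  have "\<exists>p. \<forall>h\<ge>0. \<mu> h = exp (p * of_real h)"
  proof (rule multiplicative_continuous_exp)
    have "continuous_on {0..} (\<lambda>h. f (st (shV h (Wx x0))))"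
      by (rule bounded_linear.continuous_on[OF blf continuous_shV])
    then show "continuous_on {0..} \<mu>" unfolding \<mu>_def[abs_def] Sf_def using f(2) by (intro continuous_on_divide continuous_on_const) auto
    show "\<mu> (s + t) = \<mu> s * \<mu> t" if "s \<ge> 0" "t \<ge> 0" for s t
    proof -
      have "\<mu> (s + t) = f (Sf s (Sf t x0)) / f x0" by (simp only: \<mu>_def Sf_Sf[OF that])
      also have "\<dots> = \<mu> s * (\<mu> t * f x0) / f x0" by (simp only: eig[OF that(1)] eig[OF that(2)])
      also have "\<dots> = \<mu> s * \<mu> t" using f(2) by simp
      finally show ?thesis .
    qed
    show "\<mu> 0 = 1" using Pf[of x0] f(2) by (simp add: \<mu>_def Sf_def st_Wx)
  qed
  then obtain p where p: "\<And>h. h \<ge> 0 \<Longrightarrow> \<mu> h = exp (p * of_real h)" by blast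
  define F where "F y = f (st (N y))" for y
  have blF: "bounded_linear F" unfolding F_def[abs_def] by (rule bounded_linear_compose[OF blf bounded_linear_N])
  note linF = bounded_linear.linear[OF blF]
  have Fsc: "F (scV c y) = c * F y" for c y by (simp add: F_def N_scV st_scV X.clin_sc[OF f(1)])
  \<comment> \<open>A control along \<open>b\<close> on an interval of length at most 1, and
    \<open>tk k \<ge> 1\<close>: the state reached lies in \<open>R\<close>.\<close>
  have Fb: "F (colV b (ew p (-h) 0)) = 0" if "0 \<le> h" "h \<le> 1" for h
  proof -
    have "vanish (- {-h..0}) (ew p (-h) 0)" by (rule ew_vanish) auto
    then have "st (N (colV b (ew p (-h) 0))) \<in> Rs h" unfolding Rs_def by blast
    then have "st (N (colV b (ew p (-h) 0))) \<in> Rs (tk k)" using Rs_mono[of h "tk k"] that tk1 by auto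
    then have "st (N (colV b (ew p (-h) 0))) \<in> R" by (simp add: R_def Rhat_def st_def P_P)
    then show ?thesis using f(3) by (simp add: F_def)
  qed
  have F1: "F (colV \<xi> (ew p (-h) 0)) = 0" if h: "0 \<le> h" "h \<le> 1" for \<xi> h
  proof -
    obtain \<zeta> c where \<xi>: "\<xi> = DeltaA A1 A2 A3 (p + of_real \<gamma>) *v \<zeta> + c *s b" using augment_surj[OF hautus] by blast
    have "colV \<xi> u = colV (DeltaA A1 A2 A3 (p + of_real \<gamma>) *v \<zeta>) u + scV c (colV b u)" for u
      by (simp add: \<xi> vec_eq_iff mulL_plus mulL_mulL)
    moreover have "F (colV (DeltaA A1 A2 A3 (p + of_real \<gamma>) *v \<zeta>) (ew p (-h) 0)) = 0"
      unfolding F_def by (rule eigenfunctional_sig[OF f(1) _ h(1)]) (simp add: eig p)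
    ultimately show ?thesis using Fb[OF h] by (simp add: linear_add[OF linF] Fsc)
  qed
  \<comment> \<open>Longer exponential controls are cut at -1. The earlier part is a multiple of a
    translate of a shorter one, and the free evolution by 1 only multiplies the value of the
    eigenfunctional.\<close>
  have Fj: "F (colV \<xi> (ew p (-h) 0)) = 0" if "0 \<le> h" "h \<le> real j" for \<xi> h j
    using that
  proof (induction j arbitrary: h)
    case 0 then show ?case using F1[of h] by simp
  next
    case (Suc j)
    show ?case
    proof (cases "h \<le> 1")
      case True then show ?thesis using F1 Suc.prems by blast
    next
      case False
      define u where "u = ew p (-(h - 1)) 0"
      have u0: "F (colV \<xi> u) = 0" unfolding u_def by (rule Suc.IH) (use Suc.prems False in auto)
      have "Sf 1 (st (N (colV \<xi> u))) = st (shV 1 (N (colV \<xi> u)))"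
      proof (rule Sf_eq)
        show "st (N (colV \<xi> u)) = (fst (st (N (colV \<xi> u))), P (snd (st (N (colV \<xi> u)))))" by (simp add: st_def P_P)
        show "vanV {0<..} (N (colV \<xi> u) - K (N (colV \<xi> u)))" unfolding N_id_minus_K u_def by (intro vanV_colV ew_vanish) auto
      qed simp
      then have "F (shV 1 (colV \<xi> u)) = 0" using eig[of 1 "st (N (colV \<xi> u))"] u0 by (simp add: F_def N_shV)
      moreover have "shiftL 1 u = mulL (\<lambda>_. exp p) (ew p (-h) (-1))" unfolding u_def by (subst shiftL_ew) (simp add: algebra_simps)
      then have "shV 1 (colV \<xi> u) = scV (exp p) (colV \<xi> (ew p (-h) (-1)))" by (simp add: colV_shiftL[symmetric] colV_const)
      ultimately have "F (colV \<xi> (ew p (-h) (-1))) = 0" by (simp add: Fsc)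
      moreover have "ew p (-h) 0 = ew p (-h) (-1) + ew p (-1) 0" by (rule ew_split) (use False in auto)
      ultimately show ?thesis using F1[of 1 \<xi>] by (simp add: linear_add[OF linear_colV] linear_add[OF linF])
    qed
  qed
  \<comment> \<open>Differences of the previous controls are exponentials on arbitrary subintervals
    of \<open>[-2, 0]\<close>, and their combinations are dense among all forcings there, the
    exponential having no zeros. The forcing of \<open>Wx\<close> reaches back to -2.\<close>
  have Fw: "F (colV \<xi> (mulL (wexp p (-2) 0) g)) = 0" for \<xi> g
  proof -
    define M where "M = {g. F (colV \<xi> (mulL (wexp p (-2) 0) g)) = 0}"
    have bl: "bounded_linear (\<lambda>g. F (colV \<xi> (mulL (wexp p (-2) 0) g)))"
      by (rule bounded_linear_compose[OF blF bounded_linear_compose[OF bounded_linear_colV bounded_linear_mulL]])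
    have "g \<in> M"
    proof (rule L2_dense_intervals)
      show "closed M" unfolding M_def
        by (intro closed_Collect_eq bounded_linear.continuous_on[OF bl] continuous_intros)
      show "x + y \<in> M" if "x \<in> M" "y \<in> M" for x y using that linear_add[OF bounded_linear.linear[OF bl]] by (simp add: M_def)
      show "mulL (\<lambda>_. c) x \<in> M" if "x \<in> M" for c x
        using that by (simp add: M_def mulL_mulL_commute[of "wexp p (-2) 0"] colV_const Fsc)
      fix a c :: real
      define \<alpha> \<beta> where "\<alpha> = max (-2) a" and "\<beta> = min 0 c"
      have "F (colV \<xi> (ew p \<alpha> \<beta>)) = 0"
      proof (cases "\<alpha> \<le> \<beta>")
        case False
        then have "vanish UNIV (ew p \<alpha> \<beta>)" by (intro ew_vanish) auto
        then show ?thesis by (simp add: vanish_UNIV linear_0[OF linear_colV] linear_0[OF linF])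
      next
        case True
        have "ew p \<alpha> 0 = ew p \<alpha> \<beta> + ew p \<beta> 0" by (rule ew_split) (use True in \<open>auto simp: \<beta>_def\<close>)
        moreover have "F (colV \<xi> (ew p \<alpha> 0)) = 0" "F (colV \<xi> (ew p \<beta> 0)) = 0"
          using Fj[of "- \<alpha>" 2 \<xi>] Fj[of "- \<beta>" 2 \<xi>] True by (auto simp: \<alpha>_def \<beta>_def)
        ultimately show ?thesis by (simp add: linear_add[OF linear_colV] linear_add[OF linF])
      qed
      then show "indL {a..c} \<in> M" by (simp add: M_def mulL_wexp_indL \<alpha>_def \<beta>_def)
    qed
    then show ?thesis by (simp add: M_def)
  qed
  have "f x0 = 0"
  proof -
    define y where "y = rx x0"
    \<comment> \<open>\<open>v0\<close> begins at -2, \<open>K\<close> is causal, and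
      \<open>rx\<close> cuts off after 0.\<close>
    have yv: "vanish (- {-2..0}) (y $ i)" for i
    proof -
      have "vanV {..<-2} (Th x0)" unfolding Th_def
        by (intro vanV_add vanV_colV v0_vanish vanV_cut) auto
      then have "vanV {..<-2} (Th x0 - K (Th x0))" by (intro vanV_diff K_causal)
      then have "vanV {..<-2} y" unfolding y_def rx_def by (auto simp: vanV_def intro!: vanish_mulL)
      moreover have "vanV {0<..} y" unfolding y_def by (rule vanV_rx)
      ultimately have "vanish ({..<-2} \<union> {0<..}) (y $ i)" by (intro vanish_Un) (auto simp: vanV_def)
      then show ?thesis by (rule vanish_mono) auto
    qed
    have yi: "y $ i = mulL (wexp p (-2) 0) (mulL (wexp (- p) (-2) 0) (y $ i))" for i
    proof -
      have "mulL (wexp p (-2) 0) (mulL (wexp (- p) (-2) 0) (y $ i)) = mulL (indicator {-2..0}) (y $ i)"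
        by (subst mulL_mulL[OF bmeas_wexp bmeas_wexp], rule arg_cong[where f="\<lambda>m. mulL m (y $ i)"])
          (auto simp: wexp_def indicator_def fun_eq_iff exp_add[symmetric])
      also have "\<dots> = y $ i" by (rule cut_eq_self[OF _ yv]) simp
      finally show ?thesis by simp
    qed
    have "y = (\<Sum>i\<in>UNIV. colV (axis i 1) (y $ i))"
    proof -
      have "(\<Sum>i\<in>UNIV. mulL (\<lambda>_. axis i 1 $ j) (y $ i)) = (\<Sum>i\<in>UNIV. if i = j then y $ i else 0)" for j
        by (rule sum.cong) (auto simp: axis_def)
      then show ?thesis by (simp add: vec_eq_iff)
    qed
    then have "F y = (\<Sum>i\<in>UNIV. F (colV (axis i 1) (y $ i)))" using linear_sum[OF linF] by metis
    also have "\<dots> = 0" by (rule sum.neutral) (use Fw yi in metis)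
    finally have "f (st (Wx x0)) = 0" by (simp add: F_def Wx_def y_def)
    then show ?thesis using Pf[of x0] by (simp add: st_Wx)
  qed
  with f(2) show False by simp
qed

end

subsection \<open>The state space M2 as a Banach space\<close>

definition cls :: "(real \<Rightarrow> complex^'n) \<Rightarrow> L2^'n::finite" where
  "cls f = (\<chi> i. abs_L2 (\<lambda>t. indicator {-1..0} t *\<^sub>R f t $ i))"

text \<open>Turns representatives into points of a product of Banach spaces, the function being
  extended by zero; \<open>eqM2\<close> becomes equality.\<close>

definition enc :: "'n::finite m2rep \<Rightarrow> (complex^'n) \<times> (L2^'n)" where
  "enc x = (fst x, cls (snd x))"

definition dec :: "(complex^'n) \<times> (L2^'n::finite) \<Rightarrow> 'n m2rep" where
  "dec e = (fst e, \<lambda>t. \<chi> i. rep_L2 (snd e $ i) t)"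

text \<open>The projection onto the image of \<open>enc\<close>.\<close>

definition restr :: "(complex^'n) \<times> (L2^'n::finite) \<Rightarrow> (complex^'n) \<times> (L2^'n)" where
  "restr e = (fst e, cutV {-1..0} (snd e))"

lemma norm_vec_sq: "(norm (x :: complex^'n::finite))\<^sup>2 = (\<Sum>i\<in>UNIV. (norm (x $ i))\<^sup>2)"
  by (simp add: norm_vec_def L2_set_def sum_nonneg)

lemma L2on_vec_iff: "L2on {-1..0} (f :: real \<Rightarrow> complex^'n::finite) \<longleftrightarrow> (\<forall>i. sqi (\<lambda>t. indicator {-1..0} t *\<^sub>R f t $ i))"
proof
  assume f: "L2on {-1..0} f"
  show "\<forall>i. sqi (\<lambda>t. indicator {-1..0} t *\<^sub>R f t $ i)"
  proof
    fix i
    have m: "(\<lambda>t. indicator {-1..0} t *\<^sub>R f t) \<in> borel_measurable borel" using f by (simp add: L2on_def)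
    have "(\<lambda>t. (indicator {-1..0} t *\<^sub>R f t) $ i) \<in> borel_measurable borel"
      by (rule borel_measurable_continuous_on[OF _ m, where f="\<lambda>x. x $ i"]) (intro continuous_intros)
    then have m': "(\<lambda>t. indicator {-1..0} t *\<^sub>R f t $ i) \<in> borel_measurable lborel" by simp
    moreover have "integrable lborel (\<lambda>t. (norm (indicator {-1..0} t *\<^sub>R f t $ i))\<^sup>2)"
    proof (rule Bochner_Integration.integrable_bound)
      show "integrable lborel (\<lambda>t. indicator {-1..0} t * (norm (f t))\<^sup>2)" using f by (simp add: L2on_def)
      show "(\<lambda>t. (norm (indicator {-1..0} t *\<^sub>R f t $ i))\<^sup>2) \<in> borel_measurable lborel" using m' by measurable
      show "AE t in lborel. norm ((norm (indicator {-1..0} t *\<^sub>R f t $ i))\<^sup>2) \<le> norm (indicator {-1..0} t * (norm (f t))\<^sup>2)"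
        by (rule AE_I2) (auto simp: indicator_def intro!: power_mono Finite_Cartesian_Product.norm_nth_le)
    qed
    ultimately show "sqi (\<lambda>t. indicator {-1..0} t *\<^sub>R f t $ i)" by (simp add: sqi_def)
  qed
next
  assume f: "\<forall>i. sqi (\<lambda>t. indicator {-1..0} t *\<^sub>R f t $ i)"
  have "(\<lambda>t. indicator {-1..0} t *\<^sub>R f t) \<in> borel_measurable borel"
  proof (rule borel_measurable_euclidean_space[THEN iffD2], rule ballI)
    fix b :: "complex^'n" assume "b \<in> Basis"
    have "(\<lambda>t. (indicator {-1..0} t *\<^sub>R f t) \<bullet> b) = (\<lambda>t. \<Sum>i\<in>UNIV. (indicator {-1..0} t *\<^sub>R f t $ i) \<bullet> (b $ i))"
      by (simp add: inner_vec_def fun_eq_iff)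
    moreover have "(\<lambda>t. \<Sum>i\<in>UNIV. (indicator {-1..0} t *\<^sub>R f t $ i) \<bullet> (b $ i)) \<in> borel_measurable borel"
      using f by (intro borel_measurable_sum borel_measurable_inner borel_measurable_const) (simp add: sqi_def)
    ultimately show "(\<lambda>t. (indicator {-1..0} t *\<^sub>R f t) \<bullet> b) \<in> borel_measurable borel" by (simp only:)
  qed
  moreover have "integrable lborel (\<lambda>t. indicator {-1..0} t * (norm (f t))\<^sup>2)"
  proof -
    have "integrable lborel (\<lambda>t. \<Sum>i\<in>UNIV. (norm (indicator {-1..0} t *\<^sub>R f t $ i))\<^sup>2)"
      using f by (auto simp: sqi_def)
    moreover have "(\<lambda>t. \<Sum>i\<in>UNIV. (norm (indicator {-1..0} t *\<^sub>R f t $ i))\<^sup>2) = (\<lambda>t. indicator {-1..0} t * (norm (f t))\<^sup>2)"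
      by (auto simp: fun_eq_iff norm_vec_sq indicator_def)
    ultimately show ?thesis by simp
  qed
  ultimately show "L2on {-1..0} f" by (simp add: L2on_def)
qed

lemma sqi_window: "sqi f \<Longrightarrow> sqi (\<lambda>t. indicator {-1..0} t *\<^sub>R f t)"
  by (simp add: scaleR_conv_of_real of_real_indicator sqi_bmult)

lemma cls_nth: "cls f $ i = abs_L2 (\<lambda>t. indicator {-1..0} t *\<^sub>R f t $ i)" by (simp add: cls_def)

lemma inM2_sqi: "inM2 x \<Longrightarrow> sqi (\<lambda>t. indicator {-1..0} t *\<^sub>R snd x t $ i)"
  by (simp add: inM2_def L2on_vec_iff)

lemma inM2_dec [simp]: "inM2 (dec e)"
  by (simp add: inM2_def L2on_vec_iff dec_def sqi_window)

lemma enc_dec: "enc (dec e) = restr e"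
proof -
  have "abs_L2 (\<lambda>t. indicator {-1..0} t *\<^sub>R rep_L2 (snd e $ i) t) = mulL (indicator {-1..0}) (snd e $ i)" for i
    using mulL_abs[of "indicator {-1..0}" "rep_L2 (snd e $ i)"]
    by (simp add: scaleR_conv_of_real of_real_indicator)
  then show ?thesis by (simp add: enc_def dec_def restr_def cls_def vec_eq_iff)
qed

lemma restr_restr [simp]: "restr (restr e) = restr e" by (simp add: restr_def cutV_cutV)

lemma restr_enc: assumes "inM2 x" shows "restr (enc x) = enc x"
proof -
  have "mulL (indicator {-1..0}) (abs_L2 (\<lambda>t. indicator {-1..0} t *\<^sub>R snd x t $ i)) = abs_L2 (\<lambda>t. indicator {-1..0} t *\<^sub>R snd x t $ i)" for i
    by (subst mulL_abs) (use inM2_sqi[OF assms] in \<open>auto intro!: arg_cong[where f=abs_L2] simp: indicator_def fun_eq_iff\<close>)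
  then show ?thesis by (simp add: restr_def enc_def cls_def vec_eq_iff)
qed

lemma inM2_add: "inM2 x \<Longrightarrow> inM2 y \<Longrightarrow> inM2 (addM2 x y)"
  unfolding inM2_def L2on_vec_iff by (auto simp: addM2_def scaleR_add_right)

lemma inM2_diff: "inM2 x \<Longrightarrow> inM2 y \<Longrightarrow> inM2 (diffM2 x y)"
  unfolding inM2_def L2on_vec_iff by (auto simp: diffM2_def scaleR_diff_right)

lemma inM2_scale: assumes "inM2 x" shows "inM2 (scaleM2 c x)"
proof -
  have "sqi (\<lambda>t. c * (indicator {-1..0} t *\<^sub>R snd x t $ i))" for i by (rule sqi_cmult[OF inM2_sqi[OF assms]])
  then show ?thesis by (simp add: inM2_def L2on_vec_iff scaleM2_def)
qed

lemma enc_add: "inM2 x \<Longrightarrow> inM2 y \<Longrightarrow> enc (addM2 x y) = enc x + enc y"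
  by (simp add: enc_def addM2_def vec_eq_iff cls_def scaleR_add_right abs_L2_add inM2_sqi)

lemma enc_diff: "inM2 x \<Longrightarrow> inM2 y \<Longrightarrow> enc (diffM2 x y) = enc x - enc y"
  by (simp add: enc_def diffM2_def vec_eq_iff cls_def scaleR_diff_right abs_L2_diff inM2_sqi)

lemma enc_scale: assumes "inM2 x" shows "enc (scaleM2 c x) = scE c (enc x)"
  using mulL_abs[OF _ inM2_sqi[OF assms], of "\<lambda>_. c"]
  by (simp add: enc_def scaleM2_def scE_def vec_eq_iff cls_def)

lemma norm_enc: assumes "inM2 x" shows "normM2 x = norm (enc x)"
proof -
  have "(norm (cls (snd x)))\<^sup>2 = (\<Sum>i\<in>UNIV. (norm (cls (snd x) $ i))\<^sup>2)"
    by (simp add: norm_vec_def L2_set_def sum_nonneg)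
  also have "\<dots> = (\<Sum>i\<in>UNIV. (LINT t|lborel. (norm (indicator {-1..0} t *\<^sub>R snd x t $ i))\<^sup>2))"
    by (simp only: cls_nth norm_abs_L2_sq[OF inM2_sqi[OF assms]])
  also have "\<dots> = (LINT t|lborel. (\<Sum>i\<in>UNIV. (norm (indicator {-1..0} t *\<^sub>R snd x t $ i))\<^sup>2))"
    by (rule Bochner_Integration.integral_sum[symmetric]) (use inM2_sqi[OF assms] in \<open>auto simp: sqi_def\<close>)
  also have "\<dots> = (LINT t:{-1..0}|lborel. (norm (snd x t))\<^sup>2)"
    unfolding set_lebesgue_integral_def by (intro Bochner_Integration.integral_cong) (auto simp: norm_vec_sq indicator_def)
  finally show ?thesis by (simp add: normM2_def enc_def norm_prod_def)
qed

lemma eqM2_iff: assumes "inM2 x" "inM2 y" shows "eqM2 x y \<longleftrightarrow> enc x = enc y"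
proof -
  have "cls (snd x) = cls (snd y) \<longleftrightarrow> (\<forall>i. AE t in lborel. indicator {-1..0} t *\<^sub>R snd x t $ i = indicator {-1..0} t *\<^sub>R snd y t $ i)"
    by (simp add: vec_eq_iff cls_def abs_L2_eq_iff inM2_sqi assms del: scaleR_cancel_left)
  also have "\<dots> \<longleftrightarrow> (AE t in lborel. \<forall>i\<in>UNIV. indicator {-1..0} t *\<^sub>R snd x t $ i = indicator {-1..0} t *\<^sub>R snd y t $ i)"
    by (subst AE_finite_all) (auto simp del: scaleR_cancel_left)
  also have "\<dots> \<longleftrightarrow> (AE t in lborel. t \<in> {-1..0} \<longrightarrow> snd x t = snd y t)"
    by (rule AE_cong) (auto simp: vec_eq_iff indicator_def)
  finally show ?thesis by (simp add: eqM2_def enc_def)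
qed

text \<open>The inner product with \<open>w\<close> as a complex linear functional; conjugating
  \<open>w\<close> beforehand lets the bilinear \<open>pairL\<close> serve.\<close>

definition wfun :: "'n::finite m2rep \<Rightarrow> (complex^'n) \<times> (L2^'n) \<Rightarrow> complex" where
  "wfun w e = (\<Sum>i\<in>UNIV. fst e $ i * cnj (fst w $ i))
     + (\<Sum>i\<in>UNIV. pairL (snd e $ i) (abs_L2 (\<lambda>t. cnj (indicator {-1..0} t *\<^sub>R snd w t $ i))))"

lemma innerM2_wfun: assumes "inM2 x" "inM2 w" shows "innerM2 x w = wfun w (enc x)"
proof -
  note s = inM2_sqi[OF assms(1)] sqi_cnj[OF inM2_sqi[OF assms(2)]]
  have "(\<Sum>i\<in>UNIV. pairL (cls (snd x) $ i) (abs_L2 (\<lambda>t. cnj (indicator {-1..0} t *\<^sub>R snd w t $ i))))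
     = (\<Sum>i\<in>UNIV. (LINT t|lborel. (indicator {-1..0} t *\<^sub>R snd x t $ i) * cnj (indicator {-1..0} t *\<^sub>R snd w t $ i)))"
    by (simp only: cls_nth pairL_abs[OF s])
  also have "\<dots> = (LINT t|lborel. (\<Sum>i\<in>UNIV. (indicator {-1..0} t *\<^sub>R snd x t $ i) * cnj (indicator {-1..0} t *\<^sub>R snd w t $ i)))"
    by (rule Bochner_Integration.integral_sum[symmetric]) (rule integrable_sqi_mult[OF s])
  also have "\<dots> = (LINT t:{-1..0}|lborel. (\<Sum>i\<in>UNIV. snd x t $ i * cnj (snd w t $ i)))"
    unfolding set_lebesgue_integral_def by (intro Bochner_Integration.integral_cong) (auto simp: indicator_def)
  finally show ?thesis by (simp add: innerM2_def wfun_def enc_def)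
qed

lemma bounded_linear_wfun: "bounded_linear (wfun w)"
  unfolding wfun_def[abs_def]
  by (intro bounded_linear_add bounded_linear_sum bounded_linear_mult_const
     bounded_linear_compose[OF bounded_linear_vec_nth bounded_linear_fst]
     bounded_linear_compose[OF bounded_bilinear.bounded_linear_left[OF bounded_bilinear_pairL]]
     bounded_linear_compose[OF bounded_linear_vec_nth bounded_linear_snd])

lemma wfun_scE: "wfun w (scE c e) = c * wfun w e"
proof -
  have "pairL (mulL (\<lambda>_. c) x) y = c * pairL x y" for x y by (metis pairL_commute pairL_const)
  then show ?thesis by (simp add: wfun_def scE_def distrib_left sum_distrib_left mult.assoc)
qed

text \<open>Testing with the difference of the two elements yields its squared norm.\<close>

lemma weak_eq:
  assumes x: "inM2 x" and y: "inM2 y" and e: "\<And>w. inM2 w \<Longrightarrow> wfun w (enc x) = wfun w (enc y)"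
  shows "enc x = enc y"
proof -
  define d where "d = diffM2 x y"
  have d: "inM2 d" "enc d = enc x - enc y" using x y by (auto simp: d_def inM2_diff enc_diff)
  have z: "wfun d (enc d) = 0"
    using e[OF d(1)] by (simp add: d(2) linear_diff[OF bounded_linear.linear[OF bounded_linear_wfun]])
  have "innerM2 d d = of_real ((norm (fst d))\<^sup>2 + (LINT \<theta>:{-1..0}|lborel. (norm (snd d \<theta>))\<^sup>2))"
    by (simp add: innerM2_def norm_vec_sq complex_norm_square[symmetric] set_integral_complex_of_real[symmetric] del: of_real_power)
  then have "(norm (fst d))\<^sup>2 + (LINT \<theta>:{-1..0}|lborel. (norm (snd d \<theta>))\<^sup>2) = 0"
    using z innerM2_wfun[OF d(1) d(1)] by (simp del: of_real_add)
  then have "normM2 d = 0" by (simp add: normM2_def)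
  then show ?thesis using norm_enc[OF d(1)] d(2) by simp
qed

lemma restr_add: "restr (x + y) = restr x + restr y"
  by (simp add: restr_def prod_eq_iff vec_eq_iff mulL_add)

lemma restr_scE: "restr (scE c x) = scE c (restr x)"
  by (simp add: restr_def scE_def cutV_def scV_mV_commute)

lemma bounded_linear_restr: "bounded_linear restr"
  unfolding restr_def[abs_def] cutV_def
  by (intro bounded_linear_Pair bounded_linear_fst bounded_linear_compose[OF bounded_linear_mV bounded_linear_snd])

lemma norm_restr_le: "norm (restr e) \<le> norm e"
proof -
  have "norm (cutV {-1..0} (snd e)) \<le> norm (snd e)" unfolding cutV_def by (rule norm_mV_le) (simp add: indicator_def)
  then show ?thesis unfolding restr_def norm_prod_def by (auto intro!: add_mono power_mono)
qed

section \<open>The given semigroup acting on classes\<close>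

locale delay_semigroup =
  fixes A1 :: "complex^'n::finite^'n" and A2 A3 :: "real \<Rightarrow> complex^'n^'n" and S :: "real \<Rightarrow> 'n m2rep \<Rightarrow> 'n m2rep"
  assumes gen_S: "generates_C0 A1 A2 A3 S"
begin

lemmas S_clauses = gen_S[unfolded generates_C0_def]
lemmas S_bound = S_clauses[THEN conjunct2, THEN conjunct2, THEN conjunct2, THEN conjunct1, rule_format]
lemmas S_zero = S_clauses[THEN conjunct2, THEN conjunct2, THEN conjunct2, THEN conjunct2, THEN conjunct1, rule_format]
lemmas S_add = S_clauses[THEN conjunct2, THEN conjunct2, THEN conjunct2, THEN conjunct2, THEN conjunct2, THEN conjunct1, rule_format]
lemmas S_strong = S_clauses[THEN conjunct2, THEN conjunct2, THEN conjunct2, THEN conjunct2, THEN conjunct2, THEN conjunct2, THEN conjunct1, rule_format]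
lemmas S_gen = S_clauses[THEN conjunct2, THEN conjunct2, THEN conjunct2, THEN conjunct2, THEN conjunct2, THEN conjunct2, THEN conjunct2, rule_format]

lemma S_inM2: "t \<ge> 0 \<Longrightarrow> inM2 x \<Longrightarrow> inM2 (S t x)"
  using gen_S unfolding generates_C0_def by (elim conjE) blast

lemma S_cong: assumes t: "t \<ge> 0" and x: "inM2 x" and y: "inM2 y" and e: "enc x = enc y" shows "enc (S t x) = enc (S t y)"
proof -
  have "\<forall>t\<ge>0. \<forall>x x'. inM2 x \<and> eqM2 x x' \<longrightarrow> eqM2 (S t x) (S t x')"
    using gen_S unfolding generates_C0_def by (elim conjE)
  moreover have "eqM2 x y" using e eqM2_iff[OF x y] by simp
  ultimately have "eqM2 (S t x) (S t y)" using t x by blast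
  then show ?thesis using eqM2_iff[OF S_inM2[OF t x] S_inM2[OF t y]] by simp
qed

lemma S_lin: assumes t: "t \<ge> 0" and x: "inM2 x" and y: "inM2 y"
  shows "enc (S t (addM2 (scaleM2 c x) y)) = scE c (enc (S t x)) + enc (S t y)"
proof -
  have "\<forall>t\<ge>0. \<forall>x y c. inM2 x \<and> inM2 y \<longrightarrow> eqM2 (S t (addM2 (scaleM2 c x) y)) (addM2 (scaleM2 c (S t x)) (S t y))"
    using gen_S unfolding generates_C0_def by (elim conjE)
  then have "eqM2 (S t (addM2 (scaleM2 c x) y)) (addM2 (scaleM2 c (S t x)) (S t y))" using t x y by blast
  then have "enc (S t (addM2 (scaleM2 c x) y)) = enc (addM2 (scaleM2 c (S t x)) (S t y))"
    using eqM2_iff S_inM2 inM2_add inM2_scale t x y by metis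
  then show ?thesis by (simp add: enc_add enc_scale inM2_scale S_inM2 t x y)
qed

text \<open>The semigroup acts on the part supported in \<open>[-1, 0]\<close>, the remainder is kept fixed; this makes it a semigroup on
  the full product space.\<close>

definition Sl :: "real \<Rightarrow> (complex^'n) \<times> (L2^'n) \<Rightarrow> (complex^'n) \<times> (L2^'n)" where
  "Sl t e = enc (S t (dec e)) + (e - restr e)"

lemma Sl_enc: assumes "t \<ge> 0" "inM2 x" shows "Sl t (enc x) = enc (S t x)"
proof -
  have "enc (S t (dec (enc x))) = enc (S t x)"
    by (rule S_cong) (use assms in \<open>auto simp: enc_dec restr_enc\<close>)
  then show ?thesis by (simp add: Sl_def restr_enc[OF assms(2)])
qed

lemma Sl_lin: assumes t: "t \<ge> 0" shows "Sl t (scE c x + y) = scE c (Sl t x) + Sl t y"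
proof -
  have "enc (S t (dec (scE c x + y))) = enc (S t (addM2 (scaleM2 c (dec x)) (dec y)))"
    by (rule S_cong[OF t]) (simp_all add: enc_dec enc_add enc_scale inM2_add inM2_scale restr_add restr_scE)
  also have "\<dots> = scE c (enc (S t (dec x))) + enc (S t (dec y))" by (rule S_lin[OF t]) auto
  finally have 1: "enc (S t (dec (scE c x + y))) = scE c (enc (S t (dec x))) + enc (S t (dec y))" .
  have "scE c (x - restr x) + scE c (restr x) = scE c x" by (simp only: scE_add[symmetric] diff_add_cancel)
  then have neg: "scE c x - scE c (restr x) = scE c (x - restr x)" by (metis add_diff_cancel_right')
  have "(scE c x + y) - restr (scE c x + y) = scE c (x - restr x) + (y - restr y)"
    by (simp only: restr_add restr_scE neg[symmetric] add_diff_add)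
  then show ?thesis by (simp only: Sl_def 1 scE_add) (simp only: ac_simps)
qed

lemma Sl_scE: assumes t: "t \<ge> 0" shows "Sl t (scE c x) = scE c (Sl t x)"
proof -
  have "Sl t 0 = 0" using Sl_lin[OF t, of 1 0 0] by (simp add: scE_one)
  then show ?thesis using Sl_lin[OF t, of c x 0] by simp
qed

lemma bounded_linear_Sl: assumes t: "t \<ge> 0" shows "bounded_linear (Sl t)"
proof -
  obtain C where C: "\<And>x. inM2 x \<Longrightarrow> normM2 (S t x) \<le> C * normM2 x"
    using S_bound[OF t] by blast
  show ?thesis
  proof (rule bounded_linear_intro)
    show "Sl t (x + y) = Sl t x + Sl t y" for x y using Sl_lin[OF t, of 1 x y] by (simp add: scE_one)
    show "Sl t (r *\<^sub>R x) = r *\<^sub>R Sl t x" for r x using Sl_scE[OF t, of "of_real r" x] by (simp add: scE_of_real)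
    show "norm (Sl t x) \<le> norm x * (\<bar>C\<bar> + 2)" for x
    proof -
      have "norm (enc (S t (dec x))) \<le> C * norm (restr x)"
        using C[of "dec x"] norm_enc[of "dec x"] norm_enc[OF S_inM2[OF t, of "dec x"]] by (simp add: enc_dec)
      also have "\<dots> \<le> \<bar>C\<bar> * norm x" by (intro mult_mono norm_restr_le) auto
      finally have "norm (enc (S t (dec x))) \<le> \<bar>C\<bar> * norm x" .
      moreover have "norm (x - restr x) \<le> norm x + norm x" using norm_triangle_ineq4[of x "restr x"] norm_restr_le[of x] by simp
      moreover have "norm (Sl t x) \<le> norm (enc (S t (dec x))) + norm (x - restr x)" unfolding Sl_def by (rule norm_triangle_ineq)
      moreover have "norm x * (\<bar>C\<bar> + 2) = \<bar>C\<bar> * norm x + (norm x + norm x)" by (simp add: algebra_simps)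
      ultimately show ?thesis by linarith
    qed
  qed
qed

sublocale sg: c0_semigroup Sl
proof (rule c0_semigroup.intro)
  fix t s :: real and x :: "(complex^'n) \<times> (L2^'n)"
  show "bounded_linear (Sl t)" if "t \<ge> 0" for t by (rule bounded_linear_Sl[OF that])
  have "enc (S 0 (dec x)) = restr x"
    using S_zero[of "dec x"] eqM2_iff[OF S_inM2[of 0 "dec x"], of "dec x"] by (simp add: enc_dec)
  then show "Sl 0 x = x" by (simp add: Sl_def)
  show "Sl (t + s) x = Sl t (Sl s x)" if "t \<ge> 0" "s \<ge> 0"
  proof -
    have "enc (S (t + s) (dec x)) = enc (S t (S s (dec x)))"
      using S_add[of t s "dec x"] eqM2_iff[of "S (t + s) (dec x)" "S t (S s (dec x))"] that by (simp add: S_inM2)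
    also have "\<dots> = Sl t (enc (S s (dec x)))" using that by (simp add: Sl_enc S_inM2)
    finally have 1: "Sl (t + s) x = Sl t (enc (S s (dec x))) + (x - restr x)" by (simp add: Sl_def)
    have r0: "restr (x - restr x) = 0" by (simp add: linear_diff[OF bounded_linear.linear[OF bounded_linear_restr]])
    have "enc (S t (dec (x - restr x))) = enc (S t (dec 0))"
      by (rule S_cong[OF that(1)]) (simp_all add: enc_dec r0 linear_0[OF bounded_linear.linear[OF bounded_linear_restr]])
    moreover have "enc (S t (dec 0)) = 0"
      using linear_0[OF bounded_linear.linear[OF bounded_linear_Sl[OF that(1)]]]
      by (simp add: Sl_def linear_0[OF bounded_linear.linear[OF bounded_linear_restr]])
    ultimately have "Sl t (x - restr x) = x - restr x" by (simp add: Sl_def r0)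
    then show ?thesis using 1 linear_add[OF bounded_linear.linear[OF bounded_linear_Sl[OF that(1)]], of "enc (S s (dec x))" "x - restr x"]
      by (simp add: Sl_def[of s])
  qed
  show "((\<lambda>t. Sl t x) \<longlongrightarrow> x) (at_right 0)"
  proof -
    have "((\<lambda>t. norm (Sl t x - x)) \<longlongrightarrow> 0) (at_right 0)"
    proof (rule Lim_transform_eventually[OF S_strong[of "dec x", OF inM2_dec]])
      show "\<forall>\<^sub>F t in at_right 0. normM2 (diffM2 (S t (dec x)) (dec x)) = norm (Sl t x - x)"
        using eventually_at_right_less[of 0]
        by eventually_elim (simp add: norm_enc inM2_diff S_inM2 enc_diff enc_dec Sl_def)
    qed
    then show ?thesis using Lim_null[of "\<lambda>t. Sl t x" x] tendsto_norm_zero_iff by blast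
  qed
qed

lemma gen_opA: assumes "opA A1 A2 A3 x w" shows "sg.gen (enc x) (enc w)"
proof -
  have xw: "inM2 x" "inM2 w" using assms by (auto simp: opA_def)
  have "((\<lambda>h. normM2 (diffM2 (scaleM2 (complex_of_real (1 / h)) (diffM2 (S h x) x)) w)) \<longlongrightarrow> 0) (at_right 0)"
    using S_gen[of x w] xw assms by blast
  then have "((\<lambda>h. norm ((Sl h (enc x) - enc x) /\<^sub>R h - enc w)) \<longlongrightarrow> 0) (at_right 0)"
  proof (rule Lim_transform_eventually)
    show "\<forall>\<^sub>F h in at_right 0. normM2 (diffM2 (scaleM2 (complex_of_real (1 / h)) (diffM2 (S h x) x)) w) = norm ((Sl h (enc x) - enc x) /\<^sub>R h - enc w)"
      using eventually_at_right_less[of 0]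
    proof eventually_elim
      case (elim h)
      have d: "inM2 (diffM2 (S h x) x)" using elim by (intro inM2_diff S_inM2 xw) auto
      then have "enc (scaleM2 (complex_of_real (1 / h)) (diffM2 (S h x) x)) = (1/h) *\<^sub>R (Sl h (enc x) - enc x)"
        using elim by (simp only: enc_scale scE_of_real) (simp add: enc_diff S_inM2 xw Sl_enc)
      then show ?case using elim d xw by (simp add: norm_enc inM2_diff inM2_scale enc_diff inverse_eq_divide)
    qed
  qed
  then show ?thesis unfolding sg.gen_def using Lim_null tendsto_norm_zero_iff by blast
qed

text \<open>Complex linearity pulls the control value out, so that the single orbit of
  \<open>(b, 0)\<close> governs all controls.\<close>

lemma innerM2_Bop:
  assumes t: "t \<ge> 0" and w: "inM2 w"
  shows "innerM2 (S t (Bop b c)) w = c * wfun w (Sl t (b, 0))"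
proof -
  have B: "inM2 (Bop b c)" by (simp add: inM2_def L2on_vec_iff Bop_def)
  have e: "enc (Bop b c) = scE c (b, 0)"
    by (simp add: enc_def Bop_def scE_def cls_def vec_eq_iff linear_0[OF bounded_linear.linear[OF bounded_linear_mulL]])
       (simp add: zero_L2_def)
  show ?thesis
    by (simp only: innerM2_wfun[OF S_inM2[OF t B] w] Sl_enc[OF t B, symmetric] e Sl_scE[OF t] wfun_scE)
qed

end

subsection \<open>Histories and the control-to-state map\<close>

lemma vec_integral:
  fixes f :: "'a \<Rightarrow> complex^'n::finite"
  assumes "\<And>i. integrable M (\<lambda>s. f s $ i)"
  shows "integrable M f" "integral\<^sup>L M f $ i = (LINT s|M. f s $ i)"
proof -
  have f: "f = (\<lambda>s. \<Sum>i\<in>UNIV. axis i (f s $ i))"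
    by (simp add: fun_eq_iff vec_eq_iff axis_def)
  have "integrable M (\<lambda>s. \<Sum>i\<in>UNIV. axis i (f s $ i))"
    by (intro Bochner_Integration.integrable_sum integrable_bounded_linear[OF bounded_linear_axis] assms)
  then show i: "integrable M f" using f by simp
  show "integral\<^sup>L M f $ i = (LINT s|M. f s $ i)"
    using integral_bounded_linear[OF bounded_linear_vec_nth[of i] i] by simp
qed

lemma average_tendsto_at: "((\<lambda>h. convL (avk h) x) \<longlongrightarrow> x) (at 0)"
  unfolding tendsto_at_iff_sequentially
proof (intro allI impI)
  fix X :: "nat \<Rightarrow> real" assume X: "\<forall>i. X i \<in> UNIV - {0}" "X \<longlonglongrightarrow> 0"
  have "\<forall>\<^sub>F n in sequentially. \<bar>X n\<bar> < 1"
    using order_tendstoD(2)[OF tendsto_rabs[OF X(2)], of 1] by simp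
  then obtain n0 where n0: "\<And>n. n \<ge> n0 \<Longrightarrow> \<bar>X n\<bar> < 1" by (auto simp: eventually_sequentially)
  have "(\<lambda>n. convL (avk (X (n + n0))) x) \<longlonglongrightarrow> x"
    by (rule average_tendsto) (use X n0 in \<open>auto intro!: LIMSEQ_ignore_initial_segment less_imp_le\<close>)
  then show "((\<lambda>h. convL (avk h) x) \<circ> X) \<longlonglongrightarrow> x"
    unfolding o_def by (rule LIMSEQ_offset)
qed

lemma has_vector_derivative_quotientD:
  fixes f :: "real \<Rightarrow> 'a::real_normed_vector"
  assumes "(f has_vector_derivative d) (at t within A)"
  shows "((\<lambda>y. (f y - f t) /\<^sub>R (y - t)) \<longlongrightarrow> d) (at t within A)"
proof -
  have "((\<lambda>y. norm ((1 / norm (y - t)) *\<^sub>R (f y - (f t + (y - t) *\<^sub>R d)))) \<longlongrightarrow> 0) (at t within A)"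
    using assms unfolding has_vector_derivative_def has_derivative_within by (intro tendsto_norm_zero) simp
  then have "((\<lambda>y. norm ((f y - f t) /\<^sub>R (y - t) - d)) \<longlongrightarrow> 0) (at t within A)"
  proof (rule Lim_transform_eventually)
    show "\<forall>\<^sub>F y in at t within A. norm ((1 / norm (y - t)) *\<^sub>R (f y - (f t + (y - t) *\<^sub>R d))) = norm ((f y - f t) /\<^sub>R (y - t) - d)"
      unfolding eventually_at_filter
    proof (rule always_eventually, intro allI impI)
      fix y :: real assume y: "y \<noteq> t"
      have "(f y - f t) /\<^sub>R (y - t) - d = (f y - (f t + (y - t) *\<^sub>R d)) /\<^sub>R (y - t)"
        using y by (simp add: scaleR_diff_right scaleR_add_right)
      then show "norm ((1 / norm (y - t)) *\<^sub>R (f y - (f t + (y - t) *\<^sub>R d))) = norm ((f y - f t) /\<^sub>R (y - t) - d)"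
        by (simp add: divide_inverse)
    qed
  qed
  then show ?thesis using Lim_null[of "\<lambda>y. (f y - f t) /\<^sub>R (y - t)" d] tendsto_norm_zero_iff by blast
qed

context neutral_kalman
begin

abbreviation ex :: "real \<Rightarrow> complex" where "ex t \<equiv> of_real (exp (\<gamma> * t))"

text \<open>Multiplication by \<open>ex\<close> undoes the weight: \<open>ex t * conv h0 x t\<close>
  is the primitive of \<open>ex s * rep_L2 x s\<close> that starts at minus infinity.\<close>

lemma conv_primitive:
  assumes AB: "a \<le> d"
  shows "integrable lborel (\<lambda>s. indicator {a..d} s *\<^sub>R (ex s * rep_L2 x s))"
    "ex d * conv h0 x d = ex a * conv h0 x a + (LINT s:{a..d}|lborel. ex s * rep_L2 x s)"
proof -
  have i: "integrable lborel (\<lambda>s. ex t * (h0 (t - s) * rep_L2 x s))" for t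
  proof -
    have "sqi (\<lambda>s. h0 (t - s))" using sqi_reflect[OF sqi_shift[OF sqi_h, of t]] by simp
    then show ?thesis by (intro integrable_mult_right integrable_sqi_mult) auto
  qed
  have e: "ex t * conv h0 x t = (LINT s|lborel. ex t * (h0 (t - s) * rep_L2 x s))" for t
    by (simp add: conv_eq[OF sqi_h])
  have h: "ex t * (h0 (t - s) * z) = (if s \<le> t then ex s * z else 0)" for t s z
    by (simp add: hker_def exp_diff exp_minus field_simps exp_add[symmetric])
  have p: "ex d * (h0 (d - s) * rep_L2 x s) - ex a * (h0 (a - s) * rep_L2 x s) = indicator {a<..d} s *\<^sub>R (ex s * rep_L2 x s)" for s
    using AB by (simp only: h) (auto simp: indicator_def)
  have ae: "AE s in lborel. indicator {a<..d} s *\<^sub>R (ex s * rep_L2 x s) = indicator {a..d} s *\<^sub>R (ex s * rep_L2 x s)"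
    using AE_lborel_singleton[of a] by eventually_elim (auto simp: indicator_def)
  have i2: "integrable lborel (\<lambda>s. indicator {a<..d} s *\<^sub>R (ex s * rep_L2 x s))"
    using Bochner_Integration.integrable_diff[OF i[of d] i[of a]] by (simp only: p)
  show i3: "integrable lborel (\<lambda>s. indicator {a..d} s *\<^sub>R (ex s * rep_L2 x s))"
    by (rule iffD1[OF integrable_cong_AE i2]) (use ae in auto)
  have "ex d * conv h0 x d - ex a * conv h0 x a = (LINT s|lborel. indicator {a<..d} s *\<^sub>R (ex s * rep_L2 x s))"
    unfolding e by (subst Bochner_Integration.integral_diff[OF i i, symmetric]) (simp only: p)
  also have "\<dots> = (LINT s:{a..d}|lborel. ex s * rep_L2 x s)"
    unfolding set_lebesgue_integral_def by (rule integral_cong_AE) (use ae i2 i3 in auto)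
  finally show "ex d * conv h0 x d = ex a * conv h0 x a + (LINT s:{a..d}|lborel. ex s * rep_L2 x s)"
    by (simp add: algebra_simps)
qed

text \<open>With \<open>gf\<close> below, the unweighted trajectory \<open>z\<close> and its
  derivative belonging to \<open>w\<close>.\<close>

definition zf :: "L2^'n \<Rightarrow> real \<Rightarrow> complex^'n" where "zf w t = (\<chi> i. ex t * conv h0 (w $ i) t)"
definition gf :: "L2^'n \<Rightarrow> real \<Rightarrow> complex^'n" where "gf w t = (\<chi> i. ex t * rep_L2 (w $ i) t)"
definition m0 :: "real \<Rightarrow> complex" where "m0 t = indicator {-1..0} t * ex t"

lemma bmeas_m0: "bmeas m0" unfolding m0_def[abs_def] by (rule bmeas_window) (auto intro!: continuous_intros)

text \<open>\<open>Y w\<close> is the class of \<open>(z(0) - A\<^sub>-\<^sub>1 z(-1), z)\<close>, and \<open>Lam w\<close> the value of the operator \<open>L\<close> on the history.\<close>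

definition Y :: "L2^'n \<Rightarrow> (complex^'n) \<times> (L2^'n)" where
  "Y w = ((\<chi> i. conv h0 (w $ i) 0 - (\<Sum>j\<in>UNIV. Ag $ i $ j * conv h0 (w $ j) (-1))), (\<chi> i. mulL m0 (convL h0 (w $ i))))"

definition Lam :: "L2^'n \<Rightarrow> complex^'n" where
  "Lam w = (\<chi> i. \<Sum>j\<in>UNIV. conv (kA \<gamma> A2 i j) (w $ j) 0 + conv (kA \<gamma> A3 i j) (convL h0 (w $ j)) 0)"

lemma bounded_linear_Y: "bounded_linear Y"
  unfolding Y_def[abs_def]
  by (intro bounded_linear_Pair bounded_linear_vecI)
    (auto intro!: bounded_linear_sub bounded_linear_sum bounded_linear_const_mult bounded_linear_compose[OF bounded_linear_conv bounded_linear_vec_nth]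
     bounded_linear_compose[OF bounded_linear_mulL] bounded_linear_compose[OF bounded_linear_convL[OF kern_h] bounded_linear_vec_nth])

lemma bounded_linear_Lam: "bounded_linear Lam"
  unfolding Lam_def[abs_def]
  by (intro bounded_linear_vecI)
    (auto intro!: bounded_linear_add bounded_linear_sum bounded_linear_compose[OF bounded_linear_conv bounded_linear_vec_nth]
     bounded_linear_compose[OF bounded_linear_conv] bounded_linear_compose[OF bounded_linear_convL[OF kern_h] bounded_linear_vec_nth])

lemmas linear_Y = bounded_linear.linear[OF bounded_linear_Y]
lemmas linear_Lam = bounded_linear.linear[OF bounded_linear_Lam]

lemma window_m0: "indicator {-1..0} t *\<^sub>R (ex t * z) = m0 t * z" by (simp add: m0_def indicator_def)

lemma inM2_zf: "inM2 (y, zf w)" and inM2_gf: "inM2 (y, gf w)"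
  by (auto simp: inM2_def L2on_vec_iff zf_def gf_def window_m0 intro!: sqi_bmult[OF bmeas_m0] sqi_conv[OF kern_h])

lemma enc_zf: "enc (zf w 0 - A1 *v zf w (-1), zf w) = Y w"
proof -
  have "fst (enc (zf w 0 - A1 *v zf w (-1), zf w)) = fst (Y w)"
    by (simp add: enc_def Y_def zf_def vec_eq_iff matrix_vector_mult_def Ag_def mult_ac)
  moreover have "cls (zf w) = snd (Y w)"
    by (simp add: cls_def Y_def zf_def vec_eq_iff window_m0 convL_def mulL_abs[OF bmeas_m0 sqi_conv[OF kern_h]])
  ultimately show ?thesis by (simp add: enc_def prod_eq_iff)
qed

lemma enc_gf: "enc (y, gf w) = (y, mV m0 w)"
  using mulL_abs[OF bmeas_m0 sqi_rep]
  by (simp add: enc_def cls_def gf_def vec_eq_iff window_m0)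

lemma H1_zf: "H1_deriv (zf w) (gf w)"
  unfolding H1_deriv_def
proof (intro conjI ballI)
  show "L2on {-1..0} (gf w)" using inM2_gf[of 0 w] by (simp add: inM2_def)
  fix t :: real assume t: "t \<in> {-1..0}"
  have "(LINT s:{-1..t}|lborel. gf w s) $ i = (LINT s:{-1..t}|lborel. ex s * rep_L2 (w $ i) s)" for i
    unfolding set_lebesgue_integral_def
    by (subst vec_integral) (use conv_primitive(1)[of "-1" t] t in \<open>auto simp: gf_def\<close>)
  then show "zf w t = zf w (-1) + (LINT s:{-1..t}|lborel. gf w s)"
    using conv_primitive(2)[of "-1" t] t by (simp add: vec_eq_iff zf_def)
qed

lemma conv_kA_0:
  assumes k: "kern (kA \<gamma> M i j)"
  shows "integrable lborel (\<lambda>s. indicator {-1..0} s *\<^sub>R (M s $ i $ j * (ex s * rep_L2 x s)))"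
    "conv (kA \<gamma> M i j) x 0 = (LINT s|lborel. indicator {-1..0} s *\<^sub>R (M s $ i $ j * (ex s * rep_L2 x s)))"
proof -
  have s: "sqi (kA \<gamma> M i j)" using k by (simp add: kern_def)
  have e: "kA \<gamma> M i j (- s) * z = indicator {-1..0} s *\<^sub>R (M s $ i $ j * (ex s * z))" for s z
    by (auto simp: kA_def indicator_def)
  show "integrable lborel (\<lambda>s. indicator {-1..0} s *\<^sub>R (M s $ i $ j * (ex s * rep_L2 x s)))"
    using integrable_sqi_mult[OF sqi_reflect[OF s] sqi_rep[of x]] by (simp only: e)
  show "conv (kA \<gamma> M i j) x 0 = (LINT s|lborel. indicator {-1..0} s *\<^sub>R (M s $ i $ j * (ex s * rep_L2 x s)))"
    by (simp only: conv_eq[OF s] diff_0 e)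
qed

text \<open>Rewrites a weighted convolution at time 0 as an integral over the history. The values of
  \<open>g\<close> are prescribed only almost everywhere, whence the separate measurability
  assumption.\<close>

lemma Lop_part:
  assumes k: "\<And>i j. kern (kA \<gamma> M i j)" and g: "\<And>j. AE s in lborel. g s $ j = ex s * rep_L2 (w $ j) s" "\<And>j. (\<lambda>s. g s $ j) \<in> borel_measurable borel"
    and M: "\<And>i j. L2on {-1..0} (\<lambda>\<theta>. M \<theta> $ i $ j)"
  shows "(LINT \<theta>:{-1..0}|lborel. M \<theta> *v g \<theta>) $ i = (\<Sum>j\<in>UNIV. conv (kA \<gamma> M i j) (w $ j) 0)"
proof -
  have m: "(\<lambda>s. indicator {-1..0} s *\<^sub>R (M s $ i $ j * (g s $ j))) \<in> borel_measurable borel" for i j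
  proof -
    have "(\<lambda>s. (indicator {-1..0} s *\<^sub>R M s $ i $ j) * (g s $ j)) \<in> borel_measurable borel"
      using M[of i j] g(2)[of j] by (intro borel_measurable_times) (auto simp: L2on_def)
    then show ?thesis by simp
  qed
  have m': "(\<lambda>s. indicator {-1..0} s *\<^sub>R (M s $ i $ j * (ex s * rep_L2 (w $ j) s))) \<in> borel_measurable borel" for i j
    using borel_measurable_integrable[OF conv_kA_0(1)[OF k, of i j "w $ j"]] by simp
  have ae: "AE s in lborel. indicator {-1..0} s *\<^sub>R (M s $ i $ j * (ex s * rep_L2 (w $ j) s)) = indicator {-1..0} s *\<^sub>R (M s $ i $ j * (g s $ j))" for i j
    using g(1)[of j] by eventually_elim simp
  have int: "integrable lborel (\<lambda>s. indicator {-1..0} s *\<^sub>R (M s $ i $ j * (g s $ j)))" for i j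
    by (rule iffD1[OF integrable_cong_AE conv_kA_0(1)[OF k, of i j "w $ j"]]) (use ae m m' in \<open>auto simp del: scaleR_cancel_left\<close>)
  have eq: "conv (kA \<gamma> M i j) (w $ j) 0 = (LINT s|lborel. indicator {-1..0} s *\<^sub>R (M s $ i $ j * (g s $ j)))" for i j
    unfolding conv_kA_0(2)[OF k]
    by (rule integral_cong_AE) (use ae m m' in \<open>auto simp del: scaleR_cancel_left\<close>)
  have c: "(indicator {-1..0} s *\<^sub>R (M s *v g s)) $ i = (\<Sum>j\<in>UNIV. indicator {-1..0} s *\<^sub>R (M s $ i $ j * (g s $ j)))" for s i
    by (simp add: matrix_vector_mult_def scaleR_sum_right)
  have "(LINT \<theta>:{-1..0}|lborel. M \<theta> *v g \<theta>) $ i = (LINT s|lborel. (\<Sum>j\<in>UNIV. indicator {-1..0} s *\<^sub>R (M s $ i $ j * (g s $ j))))"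
    unfolding set_lebesgue_integral_def
    by (subst vec_integral(2)) (simp_all only: c Bochner_Integration.integrable_sum[OF int])
  also have "\<dots> = (\<Sum>j\<in>UNIV. (LINT s|lborel. indicator {-1..0} s *\<^sub>R (M s $ i $ j * (g s $ j))))"
    by (rule Bochner_Integration.integral_sum[OF int])
  finally show ?thesis by (simp only: eq)
qed

lemma Lop_Lam: "Lop A2 A3 (zf w) (gf w) = Lam w"
proof -
  have "(LINT \<theta>:{-1..0}|lborel. A2 \<theta> *v gf w \<theta>) $ i = (\<Sum>j\<in>UNIV. conv (kA \<gamma> A2 i j) (w $ j) 0)" for i
    by (rule Lop_part[OF kern2 _ _ A2]) (auto simp: gf_def)
  moreover have "(LINT \<theta>:{-1..0}|lborel. A3 \<theta> *v zf w \<theta>) $ i = (\<Sum>j\<in>UNIV. conv (kA \<gamma> A3 i j) ((\<chi> j. convL h0 (w $ j)) $ j) 0)" for i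
  proof (rule Lop_part[OF kern3 _ _ A3])
    show "AE s in lborel. zf w s $ j = ex s * rep_L2 ((\<chi> j. convL h0 (w $ j)) $ j) s" for j
      using rep_convL[OF kern_h, of "w $ j"] by eventually_elim (simp add: zf_def)
    show "(\<lambda>s. zf w s $ j) \<in> borel_measurable borel" for j by (simp add: zf_def)
  qed
  ultimately show ?thesis by (simp add: Lop_def Lam_def vec_eq_iff sum.distrib)
qed

lemma opA_zf: "opA A1 A2 A3 (zf w 0 - A1 *v zf w (-1), zf w) (Lam w, gf w)"
  unfolding opA_def using H1_zf[of w]
  by (intro conjI inM2_zf inM2_gf exI[of _ "zf w"] exI[of _ "gf w"]) (simp_all add: Lop_Lam eqM2_def)

text \<open>A difference quotient of \<open>z\<close> is an average of \<open>z'\<close>, for either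
  sign of the step. The cut to \<open>{-1..\<tau>}\<close> makes the unweighting factor bounded and
  is not felt by the interval of averaging.\<close>

lemma avk_quotient:
  assumes h: "h \<noteq> 0" and t: "-1 \<le> t" "t \<le> \<tau>" "-1 \<le> t + h" "t + h \<le> \<tau>"
  shows "conv (avk h) (mulL (\<lambda>r. indicator {-1..\<tau>} r * ex r) x) t = (ex (t + h) * conv h0 x (t + h) - ex t * conv h0 x t) / of_real h"
proof -
  define p q where "p = min t (t + h)" and "q = max t (t + h)"
  have pq: "p \<le> q" by (simp add: p_def q_def)
  have bm: "bmeas (\<lambda>r. indicator {-1..\<tau>} r * ex r)" by (rule bmeas_window) (auto intro!: continuous_intros)
  have "conv (avk h) (mulL (\<lambda>r. indicator {-1..\<tau>} r * ex r) x) t = (LINT s|lborel. avk h (t - s) * rep_L2 (mulL (\<lambda>r. indicator {-1..\<tau>} r * ex r) x) s)"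
    using kern_avk[OF h] by (intro conv_eq) (simp add: kern_def)
  also have "\<dots> = (LINT s|lborel. (1 / of_real \<bar>h\<bar>) * (indicator {p..q} s *\<^sub>R (ex s * rep_L2 x s)))"
  proof (rule integral_cong_AE)
    have "sqi (avk h)" using kern_avk[OF h] by (simp add: kern_def)
    then have "sqi (\<lambda>s. avk h (t - s))" using sqi_reflect[OF sqi_shift, of "avk h" t] by simp
    then show "(\<lambda>s. avk h (t - s) * rep_L2 (mulL (\<lambda>r. indicator {-1..\<tau>} r * ex r) x) s) \<in> borel_measurable lborel"
      by (rule borel_measurable_integrable[OF integrable_sqi_mult[OF _ sqi_rep]])
    show "(\<lambda>s. (1 / of_real \<bar>h\<bar>) * (indicator {p..q} s *\<^sub>R (ex s * rep_L2 x s))) \<in> borel_measurable lborel"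
      by measurable
    show "AE s in lborel. avk h (t - s) * rep_L2 (mulL (\<lambda>r. indicator {-1..\<tau>} r * ex r) x) s = (1 / of_real \<bar>h\<bar>) * (indicator {p..q} s *\<^sub>R (ex s * rep_L2 x s))"
      using rep_mulL[OF bm, of x]
    proof eventually_elim
      case (elim s)
      have "min 0 (-h) \<le> t - s \<and> t - s \<le> max 0 (-h) \<longleftrightarrow> p \<le> s \<and> s \<le> q" by (auto simp: p_def q_def)
      moreover have "p \<le> s \<and> s \<le> q \<longrightarrow> -1 \<le> s \<and> s \<le> \<tau>" using t by (auto simp: p_def q_def)
      ultimately show ?case unfolding elim by (cases "p \<le> s \<and> s \<le> q") (auto simp: avk_def)
    qed
  qed
  also have "\<dots> = (1 / of_real \<bar>h\<bar>) * (LINT s:{p..q}|lborel. ex s * rep_L2 x s)"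
    unfolding set_lebesgue_integral_def by (rule integral_mult_right_zero)
  also have "\<dots> = (ex q * conv h0 x q - ex p * conv h0 x p) / of_real \<bar>h\<bar>"
    using conv_primitive(2)[OF pq, of x] by simp
  also have "\<dots> = (ex (t + h) * conv h0 x (t + h) - ex t * conv h0 x t) / of_real h"
  proof (cases "h > 0")
    case True
    then have "p = t" "q = t + h" "\<bar>h\<bar> = h" by (auto simp: p_def q_def)
    then show ?thesis by simp
  next
    case False
    then have "p = t + h" "q = t" "\<bar>h\<bar> = - h" by (auto simp: p_def q_def)
    then have "(ex q * conv h0 x q - ex p * conv h0 x p) / of_real \<bar>h\<bar> = (ex t * conv h0 x t - ex (t + h) * conv h0 x (t + h)) / (- of_real h)" by (simp only: of_real_minus)
    also have "\<dots> = (ex (t + h) * conv h0 x (t + h) - ex t * conv h0 x t) / of_real h"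
      by (simp only: divide_minus_right minus_divide_left minus_diff_eq)
    finally show ?thesis .
  qed
  finally show ?thesis .
qed

text \<open>The difference quotient of the unweighted history is the history of an average of
  \<open>z'\<close>. Averages converge in norm, although \<open>z'\<close> has no pointwise
  regularity.\<close>

lemma history_derivative:
  assumes s: "s \<in> {0..\<tau>}"
  shows "((\<lambda>y. (exp (\<gamma> * y) *\<^sub>R mulL m0 (convL h0 (shiftL y x)) - exp (\<gamma> * s) *\<^sub>R mulL m0 (convL h0 (shiftL s x))) /\<^sub>R (y - s))
     \<longlongrightarrow> exp (\<gamma> * s) *\<^sub>R mulL m0 (shiftL s x)) (at s within {0..\<tau>})"
proof -
  define v where "v = mulL (\<lambda>r. indicator {-1..\<tau>} r * ex r) x"
  have bm: "bmeas (\<lambda>r. indicator {-1..\<tau>} r * ex r)" by (rule bmeas_window) (auto intro!: continuous_intros)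
  define J where "J z = mulL (indicator {-1..0}) (shiftL s z)" for z
  have blJ: "bounded_linear J" unfolding J_def[abs_def] by (rule bounded_linear_compose[OF bounded_linear_mulL bounded_linear_shiftL])
  have f: "filterlim (\<lambda>y. y - s) (at 0) (at s within {0..\<tau>})"
    unfolding filterlim_at by (auto simp: eventually_at_filter intro!: tendsto_eq_intros)
  have lim: "((\<lambda>y. J (convL (avk (y - s)) v)) \<longlongrightarrow> J v) (at s within {0..\<tau>})"
    by (rule bounded_linear.tendsto[OF blJ filterlim_compose[OF average_tendsto_at f]])
  have Jv: "J v = exp (\<gamma> * s) *\<^sub>R mulL m0 (shiftL s x)"
  proof -
    have "J v = mulL (\<lambda>t. indicator {-1..0} t * (indicator {-1..\<tau>} (t + s) * ex (t + s))) (shiftL s x)"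
      unfolding J_def v_def by (subst shiftL_mulL[OF bm], subst mulL_mulL) (auto intro: bmeas_shift[OF bm])
    also have "(\<lambda>t. indicator {-1..0} t * (indicator {-1..\<tau>} (t + s) * ex (t + s))) = (\<lambda>t. ex s * m0 t)"
      using s by (auto simp: fun_eq_iff m0_def indicator_def distrib_left exp_add)
    also have "mulL (\<lambda>t. ex s * m0 t) (shiftL s x) = exp (\<gamma> * s) *\<^sub>R mulL m0 (shiftL s x)"
      using mulL_mulL[OF bmeas_const bmeas_m0, of "ex s" "shiftL s x"] by (simp only: mulL_of_real)
    finally show ?thesis .
  qed
  have sq: "sqi (\<lambda>t. m0 t * conv h0 x (t + y))" for y
    using sqi_bmult[OF bmeas_m0 sqi_conv[OF kern_h, of "shiftL y x"]] by (simp add: conv_shiftL)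
  have H: "exp (\<gamma> * y) *\<^sub>R mulL m0 (convL h0 (shiftL y x)) = abs_L2 (\<lambda>t. ex y * (m0 t * conv h0 x (t + y)))" for y
  proof -
    have "convL h0 (shiftL y x) = abs_L2 (conv h0 (shiftL y x))" by (simp add: convL_def)
    then have "mulL m0 (convL h0 (shiftL y x)) = abs_L2 (\<lambda>t. m0 t * conv h0 x (t + y))"
      by (simp add: mulL_abs[OF bmeas_m0 sqi_conv[OF kern_h]] conv_shiftL)
    then show ?thesis by (simp only: mulL_of_real[symmetric] mulL_abs[OF bmeas_const sq])
  qed
  have "J (convL (avk (y - s)) v) = (exp (\<gamma> * y) *\<^sub>R mulL m0 (convL h0 (shiftL y x)) - exp (\<gamma> * s) *\<^sub>R mulL m0 (convL h0 (shiftL s x))) /\<^sub>R (y - s)"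
    if y: "y \<noteq> s" "y \<in> {0..\<tau>}" for y
  proof -
    have h: "y - s \<noteq> 0" using y by simp
    have sa: "sqi (conv (avk (y - s)) v)" by (rule sqi_conv[OF kern_avk[OF h]])
    have "J (convL (avk (y - s)) v) = abs_L2 (\<lambda>t. indicator {-1..0} t * conv (avk (y - s)) v (t + s))"
      unfolding J_def convL_def by (subst shiftL_abs[OF sa], subst mulL_abs) (auto intro: sqi_shift[OF sa])
    also have "(\<lambda>t. indicator {-1..0} t * conv (avk (y - s)) v (t + s)) = (\<lambda>t. of_real (inverse (y - s)) * (ex y * (m0 t * conv h0 x (t + y)) - ex s * (m0 t * conv h0 x (t + s))))"
    proof
      fix t :: real
      show "indicator {-1..0} t * conv (avk (y - s)) v (t + s) = of_real (inverse (y - s)) * (ex y * (m0 t * conv h0 x (t + y)) - ex s * (m0 t * conv h0 x (t + s)))"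
      proof (cases "t \<in> {-1..0}")
        case True
        have "conv (avk (y - s)) v (t + s) = (ex (t + s + (y - s)) * conv h0 x (t + s + (y - s)) - ex (t + s) * conv h0 x (t + s)) / of_real (y - s)"
          unfolding v_def by (rule avk_quotient[OF h]) (use True s y in auto)
        then show ?thesis using True by (simp add: m0_def divide_inverse distrib_left exp_add mult_ac)
      qed (simp add: m0_def)
    qed
    also have "abs_L2 \<dots> = mulL (\<lambda>_. of_real (inverse (y - s))) (abs_L2 (\<lambda>t. ex y * (m0 t * conv h0 x (t + y)) - ex s * (m0 t * conv h0 x (t + s))))"
      by (rule mulL_abs[symmetric]) (auto intro!: sqi_diff sqi_cmult sq)
    also have "abs_L2 (\<lambda>t. ex y * (m0 t * conv h0 x (t + y)) - ex s * (m0 t * conv h0 x (t + s))) = abs_L2 (\<lambda>t. ex y * (m0 t * conv h0 x (t + y))) - abs_L2 (\<lambda>t. ex s * (m0 t * conv h0 x (t + s)))"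
      by (rule abs_L2_diff) (auto intro!: sqi_cmult sq)
    finally show ?thesis by (simp only: H mulL_of_real)
  qed
  then have "\<forall>\<^sub>F y in at s within {0..\<tau>}. J (convL (avk (y - s)) v) = (exp (\<gamma> * y) *\<^sub>R mulL m0 (convL h0 (shiftL y x)) - exp (\<gamma> * s) *\<^sub>R mulL m0 (convL h0 (shiftL s x))) /\<^sub>R (y - s)"
    unfolding eventually_at_filter by simp
  from Lim_transform_eventually[OF lim this] show ?thesis by (simp only: Jv)
qed

text \<open>Where the derivative has a continuous representative, the primitive is classically
  differentiable, at the end points from one side. The first state component needs this
  form.\<close>

lemma primitive_derivative:
  assumes s: "s \<in> {0..\<tau>}" and c: "continuous_on {0..\<tau>} c"
    and ae: "AE r in lborel. r \<in> {0..\<tau>} \<longrightarrow> ex r * rep_L2 x r = c r"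
  shows "((\<lambda>y. (ex y * conv h0 x y - ex s * conv h0 x s) /\<^sub>R (y - s)) \<longlongrightarrow> c s) (at s within {0..\<tau>})"
proof -
  define F where "F y = ex 0 * conv h0 x 0 + integral {0..y} c" for y
  have F: "ex y * conv h0 x y = F y" if y: "y \<in> {0..\<tau>}" for y
  proof -
    have si: "set_integrable lborel {0..y} c"
      unfolding set_integrable_def by (rule borel_integrable_compact) (use y c in \<open>auto intro: continuous_on_subset\<close>)
    have "(LINT r:{0..y}|lborel. ex r * rep_L2 x r) = (LINT r:{0..y}|lborel. c r)"
      unfolding set_lebesgue_integral_def
    proof (rule integral_cong_AE)
      show "(\<lambda>r. indicator {0..y} r *\<^sub>R (ex r * rep_L2 x r)) \<in> borel_measurable lborel" by measurable
      show "(\<lambda>r. indicator {0..y} r *\<^sub>R c r) \<in> borel_measurable lborel" using si by (auto simp: set_integrable_def)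
      show "AE r in lborel. indicator {0..y} r *\<^sub>R (ex r * rep_L2 x r) = indicator {0..y} r *\<^sub>R c r"
        using ae by eventually_elim (use y in \<open>auto simp: indicator_def\<close>)
    qed
    also have "\<dots> = integral {0..y} c" by (rule set_borel_integral_eq_integral(2)[OF si])
    finally show ?thesis using conv_primitive(2)[of 0 y x] y by (simp add: F_def)
  qed
  have "((\<lambda>y. integral {0..y} c) has_vector_derivative c s) (at s within {0..\<tau>})"
    by (rule integral_has_vector_derivative[OF c s])
  then have "(F has_vector_derivative c s) (at s within {0..\<tau>})" unfolding F_def[abs_def]
    by (auto intro!: derivative_eq_intros)
  then have "((\<lambda>y. (F y - F s) /\<^sub>R (y - s)) \<longlongrightarrow> c s) (at s within {0..\<tau>})"
    by (rule has_vector_derivative_quotientD)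
  then show ?thesis
  proof (rule Lim_transform_eventually)
    show "\<forall>\<^sub>F y in at s within {0..\<tau>}. (F y - F s) /\<^sub>R (y - s) = (ex y * conv h0 x y - ex s * conv h0 x s) /\<^sub>R (y - s)"
      unfolding eventually_at_filter using F s by simp
  qed
qed

text \<open>\<open>Lam\<close> is the distributed delay at time 0; translation invariance yields its
  values at all other times.\<close>

lemma C_rep: "AE r in lborel. rep_L2 (C w $ i) r = Lam (shV r w) $ i"
proof -
  have s: "sqi (\<lambda>r. conv (kA \<gamma> A2 i j) (w $ j) r + conv (kA \<gamma> A3 i j) (convL h0 (w $ j)) r)" for j
    by (intro sqi_add sqi_conv kern2 kern3)
  have "C w $ i = (\<Sum>j\<in>UNIV. abs_L2 (\<lambda>r. conv (kA \<gamma> A2 i j) (w $ j) r + conv (kA \<gamma> A3 i j) (convL h0 (w $ j)) r))"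
    by (simp add: C_def cop_def convL_def abs_L2_add sqi_conv kern2 kern3)
  also have "\<dots> = abs_L2 (\<lambda>r. \<Sum>j\<in>UNIV. conv (kA \<gamma> A2 i j) (w $ j) r + conv (kA \<gamma> A3 i j) (convL h0 (w $ j)) r)"
    using abs_L2_sum[of "UNIV :: 'n set", OF _ s] by simp
  finally have e: "C w $ i = abs_L2 (\<lambda>r. \<Sum>j\<in>UNIV. conv (kA \<gamma> A2 i j) (w $ j) r + conv (kA \<gamma> A3 i j) (convL h0 (w $ j)) r)" .
  have "sqi (\<lambda>r. \<Sum>j\<in>UNIV. conv (kA \<gamma> A2 i j) (w $ j) r + conv (kA \<gamma> A3 i j) (convL h0 (w $ j)) r)"
    using abs_L2_sum[of "UNIV :: 'n set", OF _ s] by simp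
  from rep_abs_L2[OF this] show ?thesis unfolding e
    by eventually_elim (simp add: Lam_def conv_shiftL convL_shiftL kern_h)
qed

text \<open>In \<open>z(t) - A\<^sub>-\<^sub>1 z(t - 1)\<close> the pointwise delay cancels, so only
  the control and the distributed delays are integrated. This makes the first component smoother
  than \<open>z\<close> itself.\<close>

lemma fst_Y_response:
  assumes w: "w = colV b u + K w"
  shows "fst (Y (shV t w)) $ i = conv h0 (mulL (\<lambda>_. b $ i) u + C w $ i) t"
proof -
  have "w $ i = mulL (\<lambda>_. b $ i) u + C w $ i + (\<Sum>j\<in>UNIV. mulL (\<lambda>_. Ag $ i $ j) (shiftL (-1) (w $ j)))"
    using arg_cong[OF w, of "\<lambda>w. w $ i"] by (simp add: K_split algebra_simps)
  then have "conv h0 (w $ i) t = conv h0 (mulL (\<lambda>_. b $ i) u + C w $ i + (\<Sum>j\<in>UNIV. mulL (\<lambda>_. Ag $ i $ j) (shiftL (-1) (w $ j)))) t" by (rule arg_cong)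
  also have "\<dots> = conv h0 (mulL (\<lambda>_. b $ i) u + C w $ i) t + (\<Sum>j\<in>UNIV. Ag $ i $ j * conv h0 (w $ j) (t - 1))"
    by (simp only: conv_add[of h0 "_ + _"] linear_sum[OF bounded_linear.linear[OF bounded_linear_conv]] conv_const conv_shiftL) simp
  finally show ?thesis by (simp add: Y_def conv_shiftL add.commute[of _ "-1"])
qed

end

section \<open>States, histories and the domain of the generator\<close>

lemma continuous_AE_zero:
  fixes f :: "real \<Rightarrow> complex"
  assumes ae: "AE t in lborel. t \<in> {p..q} \<longrightarrow> f t = 0" and f: "continuous_on UNIV f" and pq: "p < q" and t: "t \<in> {p..q}"
  shows "f t = 0"
proof -
  define U where "U = {p<..<q} \<inter> {t. f t \<noteq> 0}"
  have op: "open U" unfolding U_def by (intro open_Int open_greaterThanLessThan open_Collect_neq f continuous_on_const)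
  have "AE t in lborel. t \<notin> U" using ae by eventually_elim (auto simp: U_def)
  from AE_E3[OF this] obtain M where M: "M \<in> null_sets lborel" and "\<And>t. t \<in> space lborel - M \<Longrightarrow> t \<notin> U" by metis
  then have UM: "U \<subseteq> M" by auto
  have "negligible M" using null_sets_completionI[OF M] by (simp add: negligible_iff_null_sets)
  then have "negligible U" by (rule negligible_subset[OF _ UM])
  then have "U = {}" using open_not_negligible[OF op] by blast
  then have z: "f t = 0" if "t \<in> {p<..<q}" for t using that by (auto simp: U_def)
  show ?thesis
    by (rule continuous_constant_on_closure[of "{p<..<q}" f]) (use z pq t in \<open>auto intro: continuous_on_subset[OF f]\<close>)
qed

lemma sqi_continuous_window:
  assumes f: "continuous_on {p..q} f" shows "sqi (\<lambda>t. indicator {p..q} t *\<^sub>R (f t :: complex))"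
proof -
  have "integrable lborel (\<lambda>t. indicator {p..q} t *\<^sub>R (norm (f t))\<^sup>2)"
    by (rule borel_integrable_compact) (auto intro!: continuous_intros f)
  moreover have "(norm (indicator {p..q} t *\<^sub>R f t))\<^sup>2 = indicator {p..q} t *\<^sub>R (norm (f t))\<^sup>2" for t by (simp add: indicator_def)
  ultimately show ?thesis
    using borel_measurable_integrable[OF borel_integrable_compact[OF compact_Icc f]] unfolding sqi_def by simp
qed

lemma pairL_nondegenerate: assumes "\<And>x. pairL x y = 0" shows "y = 0"
proof -
  have sq: "cnj z * z = of_real ((norm z)\<^sup>2)" for z by (subst mult.commute) (rule complex_norm_square[symmetric])
  have "0 = pairL (abs_L2 (\<lambda>t. cnj (rep_L2 y t))) y" using assms by simp
  also have "\<dots> = (LINT t|lborel. cnj (rep_L2 y t) * rep_L2 y t)" by (rule pairL_abs_left[OF sqi_cnj[OF sqi_rep]])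
  also have "\<dots> = (LINT t|lborel. of_real ((norm (rep_L2 y t))\<^sup>2))"
    by (simp only: sq)
  also have "\<dots> = of_real ((norm y)\<^sup>2)" by (simp only: norm_L2_sq integral_complex_of_real)
  finally have "(norm y)\<^sup>2 = 0" by simp
  then show ?thesis by simp
qed

context neutral_hautus
begin

text \<open>\<open>z(-1)\<close> is zero and \<open>z'\<close> vanishes on the window, hence so does
  \<open>z\<close>.\<close>

lemma Y_zero_of_st: assumes "st d = 0" shows "Y d = 0"
proof -
  have "cst d = 0" "P d = 0" using assms by (simp_all add: st_def zero_prod_def)
  then have c: "conv h0 (d $ i) (-1) = 0" and v: "vanish {-1..0} (d $ i)" for i
    using vanV_cutV[of "{-1..0}" d] by (simp_all add: cst_def vec_eq_iff vanV_def)
  have z: "conv h0 (d $ i) t = 0" if "t \<in> {-1..0}" for i t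
  proof -
    have "{-1<..t} \<subseteq> {-1..0}" using that by auto
    then show ?thesis using conv_hker_decay[OF \<gamma>, of "-1" t "d $ i"] vanish_mono[OF v, of "{-1<..t}" i] c[of i] that by auto
  qed
  have m: "(\<lambda>t. m0 t * conv h0 (d $ i) t) = (\<lambda>_. 0)" for i
  proof
    show "m0 t * conv h0 (d $ i) t = 0" for t by (cases "t \<in> {-1..0}") (simp_all add: z m0_def)
  qed
  have "mulL m0 (convL h0 (d $ i)) = 0" for i
    unfolding convL_def mulL_abs[OF bmeas_m0 sqi_conv[OF kern_h, of "d $ i"]] m by (simp add: zero_L2_def)
  moreover have "conv h0 (d $ i) 0 = 0" for i using z[of 0 i] by simp
  ultimately show ?thesis by (simp add: Y_def vec_eq_iff zero_prod_def c)
qed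

text \<open>By continuity \<open>z\<close> vanishes at every point of the window, end points
  included. So \<open>z'\<close> integrates to 0 over every subinterval and is zero by density of
  interval indicators.\<close>

lemma st_zero_of_Y: assumes "Y d = 0" shows "st d = 0"
proof -
  have z: "conv h0 (d $ i) t = 0" if t: "t \<in> {-1..0}" for i t
  proof (rule continuous_AE_zero[OF _ conv_continuous _ t])
    have "mulL m0 (convL h0 (d $ i)) = 0" using assms by (simp add: Y_def vec_eq_iff zero_prod_def)
    then have "abs_L2 (\<lambda>t. m0 t * conv h0 (d $ i) t) = abs_L2 (\<lambda>_. 0)"
      using mulL_abs[OF bmeas_m0 sqi_conv[OF kern_h, of "d $ i"]] by (simp add: convL_def zero_L2_def)
    then have "AE t in lborel. m0 t * conv h0 (d $ i) t = 0"
      using abs_L2_eq_iff[OF sqi_bmult[OF bmeas_m0 sqi_conv[OF kern_h]] sqi_zero] by simp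
    then show "AE t in lborel. t \<in> {-1..0} \<longrightarrow> conv h0 (d $ i) t = 0"
      by eventually_elim (auto simp: m0_def)
  qed simp
  have "mulL m0 (d $ i) = 0" for i
  proof (rule pairL_nondegenerate)
    fix x
    define M where "M = {x. pairL x (mulL m0 (d $ i)) = 0}"
    note blp = bounded_bilinear.bounded_linear_left[OF bounded_bilinear_pairL]
    have "x \<in> M"
    proof (rule L2_dense_intervals)
      show "closed M" unfolding M_def
        by (intro closed_Collect_eq bounded_linear.continuous_on[OF blp] continuous_intros)
      show "x + y \<in> M" if "x \<in> M" "y \<in> M" for x y using that by (simp add: M_def pairL_add_left)
      show "mulL (\<lambda>_. c) x \<in> M" if "x \<in> M" for c x
        using that by (simp add: M_def pairL_commute[of "mulL (\<lambda>_. c) x"] pairL_const) (simp add: pairL_commute)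
      fix p q :: real assume pq: "p \<le> q"
      have ind: "sqi (indicator {p..q})" by (rule sqi_indicator_bounded) auto
      define p' q' where "p' = max p (-1)" and "q' = min q 0"
      have "pairL (indL {p..q}) (mulL m0 (d $ i)) = pairL (mulL m0 (indL {p..q})) (d $ i)" by (rule pairL_mulL[symmetric])
      also have "\<dots> = (LINT s|lborel. (m0 s * indicator {p..q} s) * rep_L2 (d $ i) s)"
        unfolding indL_def mulL_abs[OF bmeas_m0 ind] by (rule pairL_abs_left[OF sqi_bmult[OF bmeas_m0 ind]])
      also have "\<dots> = (LINT s:{p'..q'}|lborel. ex s * rep_L2 (d $ i) s)"
        unfolding set_lebesgue_integral_def
        by (rule Bochner_Integration.integral_cong) (auto simp: m0_def indicator_def p'_def q'_def)
      also have "\<dots> = 0"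
      proof (cases "p' \<le> q'")
        case True
        then show ?thesis using conv_primitive(2)[OF True, of "d $ i"] z[of p' i] z[of q' i] by (auto simp: p'_def q'_def)
      qed (simp add: set_lebesgue_integral_def)
      finally show "indL {p..q} \<in> M" by (simp add: M_def)
    qed
    then show "pairL x (mulL m0 (d $ i)) = 0" by (simp add: M_def)
  qed
  then have "mulL (wexp (- of_real \<gamma>) (-1) 0) (mulL m0 (d $ i)) = 0" for i
    by (simp add: linear_0[OF bounded_linear.linear[OF bounded_linear_mulL]])
  moreover have "(\<lambda>t. wexp (- of_real \<gamma>) (-1) 0 t * m0 t) = indicator {-1..0}"
    by (auto simp: fun_eq_iff wexp_def m0_def indicator_def exp_minus exp_of_real[symmetric])
  ultimately have "mulL (indicator {-1..0}) (d $ i) = 0" for i by (simp add: mulL_mulL bmeas_m0 bmeas_wexp)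
  then show ?thesis using z[of "-1"] by (simp add: st_def cst_def vec_eq_iff zero_prod_def)
qed

lemma Y_eq_iff: "Y w = Y w' \<longleftrightarrow> st w = st w'"
  using Y_zero_of_st[of "w - w'"] st_zero_of_Y[of "w - w'"]
  by (auto simp: linear_diff[OF linear_Y] linear_diff[OF linear_st])

lemma restr_Y: "restr (Y w) = Y w"
proof -
  have "(\<lambda>t. indicator {-1..0} t * m0 t) = m0" by (auto simp: m0_def indicator_def)
  then show ?thesis by (simp add: restr_def Y_def vec_eq_iff mulL_mulL bmeas_m0)
qed

text \<open>Every \<open>H\<^sup>1\<close> history is the history of a trajectory on the whole line:
  weight its value at -1 and its derivative, and let \<open>Th\<close> extend this state to the
  past.\<close>

lemma domA_iff: "x \<in> domA A1 \<longleftrightarrow> inM2 x \<and> (\<exists>w. enc x = Y w)"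
proof
  assume "x \<in> domA A1"
  then obtain z g where x: "inM2 x" and H: "H1_deriv z g" and ae: "AE \<theta> in lborel. \<theta> \<in> {-1..0} \<longrightarrow> snd x \<theta> = z \<theta>"
    and f: "fst x = z 0 - A1 *v z (-1)" by (auto simp: domA_def)
  have gs: "sqi (\<lambda>t. indicator {-1..0} t *\<^sub>R g t $ i)" for i using H by (simp add: H1_deriv_def L2on_vec_iff)
  \<comment> \<open>The weighted derivative. The factor \<open>exp \<gamma>\<close> in the next
    definition is the weight at time -1.\<close>
  define y :: "L2^'n" where "y = (\<chi> i. mulL (wexp (- of_real \<gamma>) (-1) 0) (abs_L2 (\<lambda>t. indicator {-1..0} t *\<^sub>R g t $ i)))"
  define w where "w = Th ((\<chi> i. of_real (exp \<gamma>) * z (-1) $ i), y)"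
  have st: "st w = ((\<chi> i. of_real (exp \<gamma>) * z (-1) $ i), P y)" by (simp add: w_def st_Th)
  then have c: "conv h0 (w $ i) (-1) = of_real (exp \<gamma>) * z (-1) $ i" and p: "mulL (indicator {-1..0}) (w $ i) = mulL (indicator {-1..0}) (y $ i)" for i
    by (auto simp: st_def cst_def vec_eq_iff)
  have wg: "AE s in lborel. s \<in> {-1..0} \<longrightarrow> ex s * rep_L2 (w $ i) s = g s $ i" for i
  proof -
    have bi: "bmeas (indicator {-1..0::real})" by simp
    have r1: "AE s in lborel. rep_L2 (mulL (indicator {-1..0}) (y $ i)) s = indicator {-1..0} s * rep_L2 (w $ i) s"
      using rep_mulL[OF bi, of "w $ i"] by (simp only: p)
    have r2: "AE s in lborel. rep_L2 (y $ i) s = wexp (- of_real \<gamma>) (-1) 0 s * rep_L2 (abs_L2 (\<lambda>t. indicator {-1..0} t *\<^sub>R g t $ i)) s"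
      using rep_mulL[OF bmeas_wexp, of "- of_real \<gamma>" "-1" 0 "abs_L2 (\<lambda>t. indicator {-1..0} t *\<^sub>R g t $ i)"] by (simp add: y_def)
    show ?thesis using r1 r2 rep_mulL[OF bi, of "y $ i"] rep_abs_L2[OF gs[of i]]
    proof eventually_elim
      case (elim s)
      show ?case
      proof
        assume s: "s \<in> {-1..0}"
        then have "rep_L2 (w $ i) s = exp (- of_real \<gamma> * of_real s) * g s $ i"
          using elim by (simp add: wexp_def)
        then show "ex s * rep_L2 (w $ i) s = g s $ i"
          by (simp add: exp_minus exp_of_real[symmetric])
      qed
    qed
  qed
  have zeq: "zf w t = z t" if t: "t \<in> {-1..0}" for t
  proof -
    have m: "(\<lambda>s. indicator {-1..t} s *\<^sub>R g s $ i) \<in> borel_measurable lborel" for i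
    proof -
      have "(\<lambda>s. indicator {-1..t} s *\<^sub>R (indicator {-1..0} s *\<^sub>R g s $ i)) \<in> borel_measurable lborel"
        by (rule borel_measurable_scaleR[OF _ gs[of i, unfolded sqi_def, THEN conjunct1]]) simp
      moreover have "(\<lambda>s. indicator {-1..t} s *\<^sub>R (indicator {-1..0} s *\<^sub>R g s $ i)) = (\<lambda>s. indicator {-1..t} s *\<^sub>R g s $ i)"
        using t by (auto simp: indicator_def fun_eq_iff)
      ultimately show ?thesis by simp
    qed
    have ae: "AE s in lborel. indicator {-1..t} s *\<^sub>R (ex s * rep_L2 (w $ i) s) = indicator {-1..t} s *\<^sub>R g s $ i" for i
      using wg[of i] by eventually_elim (use t in \<open>auto simp: indicator_def\<close>)
    have t': "-1 \<le> t" using t by simp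
    note i0 = conv_primitive(1)[OF t']
    have i: "integrable lborel (\<lambda>s. indicator {-1..t} s *\<^sub>R g s $ i)" for i
      by (rule iffD1[OF integrable_cong_AE[OF borel_measurable_integrable[OF i0] m ae] i0])
    have "(LINT s:{-1..t}|lborel. g s) $ i = (LINT s|lborel. indicator {-1..t} s *\<^sub>R g s $ i)" for i
      unfolding set_lebesgue_integral_def by (subst vec_integral(2)) (use i in auto)
    also have "\<dots> i = (LINT s:{-1..t}|lborel. ex s * rep_L2 (w $ i) s)" for i
      unfolding set_lebesgue_integral_def by (rule integral_cong_AE[OF borel_measurable_integrable[OF i0] m ae, symmetric])
    finally have e: "(LINT s:{-1..t}|lborel. g s) $ i = (LINT s:{-1..t}|lborel. ex s * rep_L2 (w $ i) s)" for i .
    have "zf w t $ i = z (-1) $ i + (LINT s:{-1..t}|lborel. g s) $ i" for i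
    proof -
      have "ex (-1) * (of_real (exp \<gamma>) * z (-1) $ i) = of_real (exp (\<gamma> * (-1)) * exp \<gamma>) * z (-1) $ i" by (simp only: of_real_mult mult.assoc)
      also have "exp (\<gamma> * (-1)) * exp \<gamma> = 1" by (simp only: exp_add[symmetric]) simp
      finally have "ex (-1) * (of_real (exp \<gamma>) * z (-1) $ i) = z (-1) $ i" by simp
      moreover have "zf w t $ i = ex t * conv h0 (w $ i) t" by (simp add: zf_def)
      ultimately show ?thesis by (simp only: conv_primitive(2)[OF t', of "w $ i"] c e)
    qed
    moreover have "z t = z (-1) + (LINT s:{-1..t}|lborel. g s)" using H t unfolding H1_deriv_def by blast
    ultimately show ?thesis by (simp only: vec_eq_iff vector_add_component) simp
  qed
  have "eqM2 x (zf w 0 - A1 *v zf w (-1), zf w)"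
    unfolding eqM2_def fst_conv snd_conv
  proof
    show "fst x = zf w 0 - A1 *v zf w (-1)" using zeq[of 0] zeq[of "-1"] by (simp add: f)
    show "AE \<theta> in lborel. \<theta> \<in> {-1..0} \<longrightarrow> snd x \<theta> = zf w \<theta>" using ae by eventually_elim (simp add: zeq)
  qed
  then have "enc x = Y w" using eqM2_iff[OF x inM2_zf] by (simp only: enc_zf)
  with x show "inM2 x \<and> (\<exists>w. enc x = Y w)" by blast
next
  assume "inM2 x \<and> (\<exists>w. enc x = Y w)"
  then obtain w where x: "inM2 x" and "enc x = Y w" by blast
  then have e: "eqM2 x (zf w 0 - A1 *v zf w (-1), zf w)" using eqM2_iff[OF x inM2_zf] by (simp only: enc_zf)
  have e': "AE \<theta> in lborel. \<theta> \<in> {-1..0} \<longrightarrow> snd x \<theta> = zf w \<theta>" "fst x = zf w 0 - A1 *v zf w (-1)"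
    using e unfolding eqM2_def by (simp_all only: fst_conv snd_conv)
  show "x \<in> domA A1" unfolding domA_def
    by (rule CollectI, rule conjI[OF x], rule exI[of _ "zf w"], rule exI[of _ "gf w"]) (intro conjI H1_zf e')
qed

end

subsection \<open>The reachable set\<close>

lemma set_integral_reflect:
  fixes f :: "real \<Rightarrow> complex"
  shows "(LINT t:{0..\<tau>}|lborel. f t) = (LINT s|lborel. indicator {0..\<tau>} (- s) *\<^sub>R f (- s))"
  unfolding set_lebesgue_integral_def
  using lborel_integral_real_affine[of "-1" "\<lambda>t. indicator {0..\<tau>} t *\<^sub>R f t" 0] by simp

locale neutral_semigroup = neutral_hautus A1 b A2 A3 \<gamma> q + delay_semigroup A1 A2 A3 S
  for A1 :: "complex^'n::finite^'n" and b :: "complex^'n" and A2 A3 :: "real \<Rightarrow> complex^'n^'n" and \<gamma> q :: real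
    and S :: "real \<Rightarrow> 'n m2rep \<Rightarrow> 'n m2rep"
begin

abbreviation "wg \<equiv> - complex_of_real \<gamma>"

definition resp :: "L2 \<Rightarrow> (complex^'n) \<times> (L2^'n)" where "resp u = Y (N (colV b u))"

lemma bounded_linear_resp: "bounded_linear resp"
  unfolding resp_def[abs_def]
  by (rule bounded_linear_compose[OF bounded_linear_Y bounded_linear_compose[OF bounded_linear_N bounded_linear_colV]])

lemmas linear_resp = bounded_linear.linear[OF bounded_linear_resp]

lemma Y_scV: "Y (scV c w) = scE c (Y w)"
  by (simp add: Y_def scE_def vec_eq_iff conv_const convL_const[OF kern_h] mulL_mulL_commute[of m0] right_diff_distrib sum_distrib_left mult_ac)

lemma resp_const: "resp (mulL (\<lambda>_. c) u) = scE c (resp u)"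
  by (simp add: resp_def colV_const N_scV Y_scV)

lemma gen_Y: "sg.gen (Y w) (Lam w, mV m0 w)"
  using gen_opA[OF opA_zf[of w]] by (simp only: enc_zf enc_gf)

text \<open>The exponential \<open>ew\<close> with exponent \<open>- \<gamma>\<close> is the
  constant control 1 in weighted form, and \<open>W\<close> is the unweighted state along its
  response. Thus \<open>W\<close> solves the inhomogeneous equation with the constant term
  \<open>(b, 0)\<close>, to which Duhamel's formula applies.\<close>

lemma duhamel_response:
  assumes t: "\<tau> \<ge> 0"
  shows "((\<lambda>s. Sl (\<tau> - s) (b, 0)) has_integral resp (ew wg (-\<tau>) 0)) {0..\<tau>}"
proof -
  define u where "u = ew wg 0 \<tau>"
  define w where "w = N (colV b u)"
  define W where "W s = exp (\<gamma> * s) *\<^sub>R Y (shV s w)" for s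
  define v where "v s = exp (\<gamma> * s) *\<^sub>R shV s w" for s
  have W1: "fst (W s) $ i = ex s * conv h0 (mulL (\<lambda>_. b $ i) u + C w $ i) s" for s i
    using fst_Y_response[OF N_eq[of "colV b u", folded w_def], of s i] by (simp add: W_def scaleR_conv_of_real[where 'a=complex])
  have W2: "snd (W s) $ i = exp (\<gamma> * s) *\<^sub>R mulL m0 (convL h0 (shiftL s (w $ i)))" for s i
    by (simp add: W_def Y_def)
  have "((\<lambda>s. Sl (\<tau> - s) (b, 0)) has_integral W \<tau>) {0..\<tau>}"
  proof (rule sg.duhamel[OF t])
    fix s assume s: "s \<in> {0..\<tau>}"
    have Wv: "W s = Y (v s)" by (simp add: W_def v_def linear_scale[OF linear_Y])
    show "sg.gen (W s) (Lam (v s), mV m0 (v s))" unfolding Wv by (rule gen_Y)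
    have "((\<lambda>y. ((\<chi> i. (fst (W y) $ i - fst (W s) $ i) /\<^sub>R (y - s)), (\<chi> i. (snd (W y) $ i - snd (W s) $ i) /\<^sub>R (y - s))))
        \<longlongrightarrow> (Lam (v s) + b, mV m0 (v s))) (at s within {0..\<tau>})"
    proof (intro tendsto_Pair vec_tendstoI)
      fix i
      \<comment> \<open>\<open>ex r\<close> cancels the decay of \<open>u\<close>, which leaves the
        control value 1 and a continuous derivative up to the ends of the interval.\<close>
      define c where "c r = b $ i + ex r * Lam (shV r w) $ i" for r
      have cont: "continuous_on {0..\<tau>} c" unfolding c_def
        by (intro continuous_intros bounded_linear.continuous_on[OF bounded_linear_vec_nth] bounded_linear.continuous_on[OF bounded_linear_Lam continuous_shV])
      have "AE r in lborel. r \<in> {0..\<tau>} \<longrightarrow> ex r * rep_L2 (mulL (\<lambda>_. b $ i) u + C w $ i) r = c r"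
        using rep_add[of "mulL (\<lambda>_. b $ i) u" "C w $ i"] rep_mulL[OF bmeas_const, of "b $ i" u] rep_ew[of wg 0 \<tau>, folded u_def] C_rep[of w i]
      proof eventually_elim
        case (elim r)
        have "ex r * exp (wg * of_real r) = 1"
          by (simp add: exp_minus exp_of_real[symmetric])
        then have "ex r * (b $ i * exp (wg * of_real r)) = b $ i" by (metis mult.left_commute mult.right_neutral)
        then show ?case by (simp add: elim wexp_def c_def distrib_left)
      qed
      from primitive_derivative[OF s cont this]
      have "((\<lambda>y. (fst (W y) $ i - fst (W s) $ i) /\<^sub>R (y - s)) \<longlongrightarrow> c s) (at s within {0..\<tau>})" by (simp only: W1)
      moreover have "c s = (Lam (v s) + b) $ i"
        by (simp add: c_def v_def linear_scale[OF linear_Lam] scaleR_conv_of_real[where 'a=complex])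
      ultimately show "((\<lambda>y. (\<chi> i. (fst (W y) $ i - fst (W s) $ i) /\<^sub>R (y - s)) $ i) \<longlongrightarrow> (Lam (v s) + b) $ i) (at s within {0..\<tau>})"
        by simp
    next
      fix i
      have "((\<lambda>y. (snd (W y) $ i - snd (W s) $ i) /\<^sub>R (y - s)) \<longlongrightarrow> exp (\<gamma> * s) *\<^sub>R mulL m0 (shiftL s (w $ i))) (at s within {0..\<tau>})"
        using history_derivative[OF s, of "w $ i"] by (simp only: W2)
      then show "((\<lambda>y. (\<chi> i. (snd (W y) $ i - snd (W s) $ i) /\<^sub>R (y - s)) $ i) \<longlongrightarrow> mV m0 (v s) $ i) (at s within {0..\<tau>})"
        by (simp add: v_def mulL_scaleR)
    qed
    moreover have "((\<chi> i. (fst (W y) $ i - fst (W s) $ i) /\<^sub>R (y - s)), (\<chi> i. (snd (W y) $ i - snd (W s) $ i) /\<^sub>R (y - s))) = (W y - W s) /\<^sub>R (y - s)" for y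
      by (simp add: prod_eq_iff vec_eq_iff)
    ultimately show "((\<lambda>y. (W y - W s) /\<^sub>R (y - s)) \<longlongrightarrow> (Lam (v s), mV m0 (v s)) + (b, 0)) (at s within {0..\<tau>})"
      by (simp only:) simp
  next
    have "vanish {..<0} u" unfolding u_def by (rule ew_vanish) auto
    then have "vanV {..<0} w" unfolding w_def by (intro N_causal vanV_colV)
    then have "Y w = 0" by (intro Y_zero_of_st st_vanish)
    then show "W 0 = 0" by (simp add: W_def)
  qed
  moreover have "W \<tau> = resp (ew wg (-\<tau>) 0)"
  proof -
    \<comment> \<open>Moving the end of the control interval to time 0 costs a constant, which the
      factor in \<open>W\<close> compensates.\<close>
    have "shiftL \<tau> u = exp (- (\<gamma> * \<tau>)) *\<^sub>R ew wg (-\<tau>) 0"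
    proof -
      have "exp (wg * of_real \<tau>) = of_real (exp (- (\<gamma> * \<tau>)))" by (simp add: exp_of_real[symmetric])
      then show ?thesis unfolding u_def by (simp only: shiftL_ew mulL_of_real) simp
    qed
    then have "exp (\<gamma> * \<tau>) *\<^sub>R shiftL \<tau> u = ew wg (-\<tau>) 0" by (simp add: exp_minus)
    then have "resp (ew wg (-\<tau>) 0) = exp (\<gamma> * \<tau>) *\<^sub>R resp (shiftL \<tau> u)" by (metis linear_scale[OF linear_resp])
    then show ?thesis by (simp add: W_def w_def resp_def colV_shiftL N_shV)
  qed
  ultimately show ?thesis by simp
qed

text \<open>Time is reflected so that \<open>- s\<close> is the time left until 0. Subtracting two
  intervals that end at 0 gives every subinterval.\<close>

lemma reflected_response:
  assumes "p \<le> d" "d \<le> 0"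
  shows "(\<lambda>s. Sl (- s) (b, 0)) integrable_on {p..d}" "integral {p..d} (\<lambda>s. Sl (- s) (b, 0)) = resp (ew wg p d)"
proof -
  have I: "((\<lambda>s. Sl (- s) (b, 0)) has_integral resp (ew wg p 0)) {p..0}" if "p \<le> 0" for p
  proof -
    have "((\<lambda>s. Sl (- p - s) (b, 0)) has_integral resp (ew wg p 0)) (cbox 0 (- p))"
      using duhamel_response[of "- p"] that by simp
    from has_integral_affinity'[OF this, of 1 "- p"] show ?thesis by simp
  qed
  have p0: "p \<le> 0" using assms by simp
  have ip: "(\<lambda>s. Sl (- s) (b, 0)) integrable_on {p..0}" using I[OF p0] by blast
  then show "(\<lambda>s. Sl (- s) (b, 0)) integrable_on {p..d}" by (rule integrable_on_subinterval) (use assms in auto)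
  have "integral {p..d} (\<lambda>s. Sl (- s) (b, 0)) + integral {d..0} (\<lambda>s. Sl (- s) (b, 0)) = integral {p..0} (\<lambda>s. Sl (- s) (b, 0))"
    by (rule Henstock_Kurzweil_Integration.integral_combine[OF assms ip])
  moreover have "integral {d..0} (\<lambda>s. Sl (- s) (b, 0)) = resp (ew wg d 0)" "integral {p..0} (\<lambda>s. Sl (- s) (b, 0)) = resp (ew wg p 0)"
    using I[OF assms(2)] I[OF p0] by (blast intro: integral_unique)+
  moreover have "resp (ew wg p 0) = resp (ew wg p d) + resp (ew wg d 0)"
    using ew_split[OF assms, of wg] linear_add[OF linear_resp] by metis
  ultimately show "integral {p..d} (\<lambda>s. Sl (- s) (b, 0)) = resp (ew wg p d)" by simp
qed

lemma continuous_reflected: "continuous_on {p..0} (\<lambda>s. wfun w (Sl (- s) (b, 0)))"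
proof (rule bounded_linear.continuous_on[OF bounded_linear_wfun])
  show "continuous_on {p..0} (\<lambda>s. Sl (- s) (b, 0))"
    by (rule continuous_on_compose2[OF sg.continuous_orbit[of "(b, 0)"]]) (auto intro!: continuous_intros)
qed

text \<open>Both sides are continuous and linear in \<open>u\<close>, so interval indicators
  suffice, and for these the claim is \<open>reflected_response\<close>. The factor
  \<open>wexp\<close> converts a control into its weighted form.\<close>

lemma pairing_response:
  "pairL u (abs_L2 (\<lambda>s. indicator {-\<tau>..0} s *\<^sub>R wfun w (Sl (- s) (b, 0)))) = wfun w (resp (mulL (wexp wg (-\<tau>) 0) u))"
proof -
  define k where "k s = indicator {-\<tau>..0} s *\<^sub>R wfun w (Sl (- s) (b, 0))" for s
  have sk: "sqi k" unfolding k_def[abs_def] by (rule sqi_continuous_window[OF continuous_reflected])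
  define F where "F u = wfun w (resp (mulL (wexp wg (-\<tau>) 0) u))" for u
  have blF: "bounded_linear F" unfolding F_def[abs_def]
    by (rule bounded_linear_compose[OF bounded_linear_wfun bounded_linear_compose[OF bounded_linear_resp bounded_linear_mulL]])
  have blp: "bounded_linear (\<lambda>u. pairL u (abs_L2 k))" by (rule bounded_bilinear.bounded_linear_left[OF bounded_bilinear_pairL])
  define M where "M = {u. pairL u (abs_L2 k) = F u}"
  have "u \<in> M"
  proof (rule L2_dense_intervals)
    show "closed M" unfolding M_def
      by (intro closed_Collect_eq bounded_linear.continuous_on[OF blp] bounded_linear.continuous_on[OF blF] continuous_intros)
    show "x + y \<in> M" if "x \<in> M" "y \<in> M" for x y
      using that by (simp add: M_def pairL_add_left linear_add[OF bounded_linear.linear[OF blF]])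
    show "mulL (\<lambda>_. c) x \<in> M" if "x \<in> M" for c x
    proof -
      have "pairL (mulL (\<lambda>_. c) x) (abs_L2 k) = c * pairL x (abs_L2 k)" by (metis pairL_commute pairL_const)
      moreover have "mulL (wexp wg (-\<tau>) 0) (mulL (\<lambda>_. c) x) = mulL (\<lambda>_. c) (mulL (wexp wg (-\<tau>) 0) x)" by (rule mulL_mulL_commute)
      then have "F (mulL (\<lambda>_. c) x) = c * F x" by (simp only: F_def resp_const wfun_scE)
      ultimately show ?thesis using that by (simp add: M_def)
    qed
    fix p d :: real assume "p \<le> d"
    define p' d' where "p' = max (-\<tau>) p" and "d' = min 0 d"
    have ind: "sqi (indicator {p..d})" by (rule sqi_indicator_bounded) auto
    have "pairL (indL {p..d}) (abs_L2 k) = (LINT s|lborel. indicator {p..d} s * k s)"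
      unfolding indL_def by (rule pairL_abs[OF ind sk])
    also have "\<dots> = (LINT s:{p'..d'}|lborel. wfun w (Sl (- s) (b, 0)))"
      unfolding set_lebesgue_integral_def
      by (rule Bochner_Integration.integral_cong) (auto simp: k_def indicator_def p'_def d'_def)
    also have "\<dots> = wfun w (resp (ew wg p' d'))"
    proof (cases "p' \<le> d'")
      case True
      have d0: "d' \<le> 0" by (simp add: d'_def)
      have si: "set_integrable lborel {p'..d'} (\<lambda>s. wfun w (Sl (- s) (b, 0)))"
        unfolding set_integrable_def
        by (rule borel_integrable_compact[OF compact_Icc continuous_on_subset[OF continuous_reflected[of p']]]) (use d0 in auto)
      have "(LINT s:{p'..d'}|lborel. wfun w (Sl (- s) (b, 0))) = integral {p'..d'} (\<lambda>s. wfun w (Sl (- s) (b, 0)))"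
        by (rule set_borel_integral_eq_integral(2)[OF si])
      also have "\<dots> = wfun w (integral {p'..d'} (\<lambda>s. Sl (- s) (b, 0)))"
        using integral_linear[OF reflected_response(1)[OF True d0] bounded_linear_wfun[of w]] by (simp add: o_def)
      finally show ?thesis by (simp only: reflected_response(2)[OF True d0])
    next
      case False
      then have "vanish UNIV (ew wg p' d')" by (intro ew_vanish) auto
      then have "ew wg p' d' = 0" by (simp only: vanish_UNIV)
      then show ?thesis using False
        by (simp add: linear_0[OF linear_resp] linear_0[OF bounded_linear.linear[OF bounded_linear_wfun]] set_lebesgue_integral_def)
    qed
    finally show "indL {p..d} \<in> M" by (simp add: M_def F_def mulL_wexp_indL p'_def d'_def)
  qed
  then show ?thesis by (simp add: M_def F_def k_def[abs_def])
qed

text \<open>In the integral defining the reachable set, \<open>u t\<close> meets the semigroup at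
  \<open>t\<close>, which is the time left until the end. In the present coordinates it therefore
  acts at time \<open>- t\<close>.\<close>

lemma control_integral:
  assumes u: "L2on {0..\<tau>} u" and w: "inM2 w"
  shows "(LINT t:{0..\<tau>}|lborel. innerM2 (S t (Bop b (u t))) w)
    = wfun w (resp (mulL (wexp wg (-\<tau>) 0) (abs_L2 (\<lambda>s. indicator {0..\<tau>} (- s) *\<^sub>R u (- s)))))"
proof -
  have su: "sqi (\<lambda>s. indicator {0..\<tau>} (- s) *\<^sub>R u (- s))"
    using u sqi_reflect[of "\<lambda>t. indicator {0..\<tau>} t *\<^sub>R u t"] by (simp add: L2on_complex_iff)
  have sk: "sqi (\<lambda>s. indicator {-\<tau>..0} s *\<^sub>R wfun w (Sl (- s) (b, 0)))" by (rule sqi_continuous_window[OF continuous_reflected])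
  have "(LINT t:{0..\<tau>}|lborel. innerM2 (S t (Bop b (u t))) w) = (LINT t:{0..\<tau>}|lborel. u t * wfun w (Sl t (b, 0)))"
    unfolding set_lebesgue_integral_def
    by (rule Bochner_Integration.integral_cong) (auto simp: indicator_def innerM2_Bop w)
  also have "\<dots> = (LINT s|lborel. indicator {0..\<tau>} (- s) *\<^sub>R (u (- s) * wfun w (Sl (- s) (b, 0))))"
    by (rule set_integral_reflect)
  also have "\<dots> = (LINT s|lborel. (indicator {0..\<tau>} (- s) *\<^sub>R u (- s)) * (indicator {-\<tau>..0} s *\<^sub>R wfun w (Sl (- s) (b, 0))))"
    by (rule Bochner_Integration.integral_cong) (auto simp: indicator_def)
  also have "\<dots> = pairL (abs_L2 (\<lambda>s. indicator {0..\<tau>} (- s) *\<^sub>R u (- s))) (abs_L2 (\<lambda>s. indicator {-\<tau>..0} s *\<^sub>R wfun w (Sl (- s) (b, 0))))"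
    by (rule pairL_abs[OF su sk, symmetric])
  finally show ?thesis by (simp only: pairing_response)
qed

text \<open>Testing against all of M2 determines an element, and on a bounded interval the weight is
  invertible, so weighted and unweighted controls reach the same states.\<close>

lemma reach_iff: "x \<in> reach S b \<tau> \<longleftrightarrow> inM2 x \<and> (\<exists>u. vanish (- {-\<tau>..0}) u \<and> enc x = resp u)"
proof
  assume "x \<in> reach S b \<tau>"
  then obtain u where x: "inM2 x" and u: "L2on {0..\<tau>} u"
    and e: "\<And>w. inM2 w \<Longrightarrow> innerM2 x w = (LINT t:{0..\<tau>}|lborel. innerM2 (S t (Bop b (u t))) w)"
    unfolding reach_def by blast
  define U where "U = mulL (wexp wg (-\<tau>) 0) (abs_L2 (\<lambda>s. indicator {0..\<tau>} (- s) *\<^sub>R u (- s)))"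
  have R: "enc (dec (resp U)) = resp U" by (simp only: enc_dec resp_def restr_Y)
  have "enc x = enc (dec (resp U))"
  proof (rule weak_eq[OF x inM2_dec])
    fix w :: "'n m2rep" assume w: "inM2 w"
    show "wfun w (enc x) = wfun w (enc (dec (resp U)))"
      unfolding R unfolding innerM2_wfun[OF x w, symmetric] e[OF w] U_def by (rule control_integral[OF u w])
  qed
  moreover have "vanish (- {-\<tau>..0}) U" unfolding U_def by (rule vanish_mulL_zero[OF bmeas_wexp]) (auto simp: wexp_def)
  ultimately show "inM2 x \<and> (\<exists>u. vanish (- {-\<tau>..0}) u \<and> enc x = resp u)" using x R by metis
next
  assume "inM2 x \<and> (\<exists>u. vanish (- {-\<tau>..0}) u \<and> enc x = resp u)"
  then obtain U where x: "inM2 x" and U: "vanish (- {-\<tau>..0}) U" "enc x = resp U" by blast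
  \<comment> \<open>The inverse weight, so that weighting in \<open>control_integral\<close> returns
    \<open>U\<close>.\<close>
  define V where "V = mulL (wexp (of_real \<gamma>) (-\<tau>) 0) U"
  define u where "u t = rep_L2 V (- t)" for t
  have V1: "mulL (indicator {-\<tau>..0}) V = V"
    by (rule cut_eq_self) (auto simp: V_def intro: vanish_mulL[OF U(1)])
  have V2: "mulL (wexp wg (-\<tau>) 0) V = U"
  proof -
    have "(\<lambda>t. wexp wg (-\<tau>) 0 t * wexp (of_real \<gamma>) (-\<tau>) 0 t) = indicator {-\<tau>..0}"
      by (auto simp: fun_eq_iff wexp_def indicator_def exp_minus)
    then have "mulL (wexp wg (-\<tau>) 0) V = mulL (indicator {-\<tau>..0}) U"
      unfolding V_def by (simp only: mulL_mulL[OF bmeas_wexp bmeas_wexp])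
    also have "\<dots> = U" by (rule cut_eq_self[OF _ U(1)]) simp
    finally show ?thesis .
  qed
  have i: "indicator {0..\<tau>} (- s) *\<^sub>R u (- s) = indicator {-\<tau>..0} s * rep_L2 V s" for s
    by (auto simp: u_def indicator_def)
  have sv: "sqi (\<lambda>s. indicator {-\<tau>..0} s * rep_L2 V s)" by (rule sqi_bmult) auto
  have a: "abs_L2 (\<lambda>s. indicator {0..\<tau>} (- s) *\<^sub>R u (- s)) = V"
    unfolding i using mulL_abs[of "indicator {-\<tau>..0}" "rep_L2 V"] V1 by simp
  have "sqi (\<lambda>t. indicator {0..\<tau>} t *\<^sub>R u t)" using sqi_reflect[OF sv] i[of "- _"] by (simp only: i[symmetric] minus_minus)
  then have u: "L2on {0..\<tau>} u" by (simp only: L2on_complex_iff)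
  have "innerM2 x w = (LINT t:{0..\<tau>}|lborel. innerM2 (S t (Bop b (u t))) w)" if w: "inM2 w" for w
    by (simp only: innerM2_wfun[OF x w] control_integral[OF u w] a V2 U(2))
  then show "x \<in> reach S b \<tau>" unfolding reach_def using x u by blast
qed

theorem reach_eq_domA: assumes "real CARD('n) < \<tau>" shows "reach S b \<tau> = domA A1"
proof (rule set_eqI)
  fix x
  have "\<exists>u. vanish (- {-\<tau>..0}) u \<and> Y w = resp u" for w
  proof -
    have "st w \<in> Rhat \<tau>" using Rhat_UNIV[OF assms] by simp
    then have "st w \<in> Rs \<tau>" by (simp add: Rhat_def st_def P_P)
    then show ?thesis unfolding Rs_def resp_def by (auto simp: Y_eq_iff)
  qed
  then show "x \<in> reach S b \<tau> \<longleftrightarrow> x \<in> domA A1" unfolding reach_iff domA_iff resp_def by metis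
qed

text \<open>The state missed at time n belongs to a trajectory, whose history lies in the domain. A
  smaller \<open>\<tau>\<close>, negative ones included, only shrinks the set of reachable
  states.\<close>

theorem reach_neq_domA: assumes "\<tau> \<le> real CARD('n)" shows "reach S b \<tau> \<noteq> domA A1"
proof
  assume eq: "reach S b \<tau> = domA A1"
  obtain \<zeta> y where y: "P y = y" "(\<zeta>, y) \<notin> Rs (real CARD('n))" using Rs_n_proper by blast
  define w where "w = Th (\<zeta>, y)"
  have st: "st w = (\<zeta>, y)" by (simp add: w_def st_Th y)
  have "dec (Y w) \<in> domA A1" unfolding domA_iff by (auto simp: enc_dec restr_Y)
  then have "dec (Y w) \<in> reach S b \<tau>" by (simp only: eq)
  then obtain u where "vanish (- {-\<tau>..0}) u" "Y w = resp u" unfolding reach_iff by (auto simp: enc_dec restr_Y)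
  then have "st w \<in> Rs \<tau>" unfolding Rs_def resp_def Y_eq_iff by blast
  then show False using Rs_mono[OF assms] y(2) st by auto
qed

end

theorem theorem5:
  fixes A1 :: "complex^'n::finite^'n" and b :: "complex^'n"
    and A2 A3 :: "real \<Rightarrow> complex^'n^'n"
    and S :: "real \<Rightarrow> 'n m2rep \<Rightarrow> 'n m2rep"
  assumes "\<forall>i j. A1 $ i $ j \<in> \<real>"
    and "\<forall>i. b $ i \<in> \<real>"
    and "\<forall>i j. L2on {-1..0} (\<lambda>\<theta>. A2 \<theta> $ i $ j)"
    and "\<forall>i j. L2on {-1..0} (\<lambda>\<theta>. A3 \<theta> $ i $ j)"
    and "\<forall>lam. rank (augment (DeltaA A1 A2 A3 lam) b) = CARD('n)"
    and "rank (ctrb A1 b) = CARD('n)"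
    and "generates_C0 A1 A2 A3 S"
  shows "(\<forall>T. T > real CARD('n) \<longrightarrow> reach S b T = domA A1)
       \<and> (\<forall>T. T \<le> real CARD('n) \<longrightarrow> reach S b T \<noteq> domA A1)"
proof -
  obtain \<gamma> q where w: "\<gamma> > 0" "q < 1" "\<And>x. norm (mop (nop \<gamma> A1 A2 A3) x) \<le> q * norm (x :: L2^'n)"
    using exists_weight[OF assms(3,4), of A1] by blast
  interpret neutral_semigroup A1 b A2 A3 \<gamma> q S
    using w assms by unfold_locales auto
  show ?thesis using reach_eq_domA reach_neq_domA by blast
qed

end
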